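(* Let $\boldsymbol{a}=(a_1,\ldots,a_n)\in\mathbb{Z}^n$ be the weight vector of an effective linear action of $\mathbb{C}^\times$ on $\mathbb{C}^n$, i.e. $\gcd(a_1,\ldots,a_n)=1$. Assume that there is an integer $k$ with $0<k<n$ such that $a_i<0$ for $i\leq k$ and $a_i>0$ for $i>k$. Then \begin{align*} \gamma_3(\boldsymbol{a})={}&\frac{-6S_{n-2}(\boldsymbol{a})+8E_1(\boldsymbol{a})S_{n-3}(\boldsymbol{a})-\big(3E_2(\boldsymbol{a})+2E_1(\boldsymbol{a})^2\big)S_{n-4}(\boldsymbol{a})+E_1(\boldsymbol{a})E_2(\boldsymbol{a})S_{n-5}(\boldsymbol{a})}{24\,D(\boldsymbol{a})}\\ &+\sum_{j=1}^n\frac{1-g_j}{24}\cdot\frac{4S_{n-3}(\boldsymbol{a}_j)-5E_1(\boldsymbol{a}_j)S_{n-4}(\boldsymbol{a}_j)+\big(E_2(\boldsymbol{a}_j)+E_1(\boldsymbol{a}_j)^2\big)S_{n-5}(\boldsymbol{a}_j)}{D(\boldsymbol{a}_j)}\\ &+\sum_{j=1}^n\frac{g_j^2-1}{24}\cdot\frac{-2S_{n-3}(\boldsymbol{a}_j)+\big(2a_j+E_1(\boldsymbol{a}_j)\big)S_{n-4}(\boldsymbol{a}_j)-a_jE_1(\boldsymbol{a}_j)S_{n-5}(\boldsymbol{a}_j)}{D(\boldsymbol{a}_j)}\\ &+\sum_{1\leq j<\ell\leq n}\ \sum_{\substack{\zeta^{g_{j,\ell}}=1\\ \zeta^{g_j}\neq1,\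 \zeta^{g_\ell}\neq1}}\frac{1}{(1-\zeta^{a_j})(1-\zeta^{a_\ell})}\cdot\frac{E_1(\boldsymbol{a}_{j,\ell})S_{n-5}(\boldsymbol{a}_{j,\ell})-S_{n-4}(\boldsymbol{a}_{j,\ell})}{2\,D(\boldsymbol{a}_{j,\ell})}\\ &+\sum_{1\leq j<\ell\leq n}\ \sum_{\substack{\zeta^{g_{j,\ell}}=1\\ \zeta^{g_j}\neq1,\ \zeta^{g_\ell}\neq1}}\Bigg(\frac{\zeta^{a_j}}{(1-\zeta^{a_j})^2(1-\zeta^{a_\ell})}\cdot\frac{S_{n-4}(\boldsymbol{a}_{j,\ell})-a_jS_{n-5}(\boldsymbol{a}_{j,\ell})}{D(\boldsymbol{a}_{j,\ell})}\\ &\qquad\qquad+\frac{\zeta^{a_\ell}}{(1-\zeta^{a_j})(1-\zeta^{a_\ell})^2}\cdot\frac{S_{n-4}(\boldsymbol{a}_{j,\ell})-a_\ell S_{n-5}(\boldsymbol{a}_{j,\ell})}{D(\boldsymbol{a}_{j,\ell})}\Bigg)\\ &+\sum_{1\leq j<\ell<p\leq n}\frac{-S_{n-5}(\boldsymbol{a}_{j,\ell,p})}{D(\boldsymbol{a}_{j,\ell,p})}\sum_{\substack{\zeta^{g_{j,\ell,p}}=1\\ \zeta^{g_{j,\ell}}\neq1,\ \zeta^{g_{j,p}}\neq1,\ \zeta^{g_{\ell,p}}\neq1}}\frac{1}{(1-\zeta^{a_j})(1-\zeta^{a_\ell})(1-\zeta^{a_p})}. \end{align*} When moreover $a_i\neq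 a_j$ for all $i\neq j$ with $i,j\leq k$, \begin{align*} \gamma_3(\boldsymbol{a})={}&\sum_{i=1}^k\frac{a_i^{n-5}\Big(\sum\limits_{\substack{1\leq j<\ell<p\leq n\\ j,\ell,p\neq i}}3a_ja_\ell a_p+\sum\limits_{\substack{j=1\\ j\neq i}}^n\sum\limits_{\substack{\ell=1\\ \ell\neq i,j}}^na_ja_\ell(a_\ell-2a_i)+\sum\limits_{\substack{j=1\\ j\neq i}}^na_ia_j(2a_i-a_j)\Big)}{24\prod\limits_{\substack{q=1\\ q\neq i}}^n(a_i-a_q)}\\ &+\sum_{i=1}^k\sum_{\substack{j=1\\ j\neq i}}^n\Bigg(\frac{g_j-1}{2}\Bigg(\sum_{\substack{1\leq\ell<p\leq n\\ \ell,p\neq i,j}}\frac{-a_i^{n-5}a_\ell a_p}{4\prod\limits_{\substack{q=1\\ q\neq i,j}}^n(a_i-a_q)}+\sum_{\substack{\ell=1\\ \ell\neq i,j}}^n\frac{-a_i^{n-5}a_\ell(a_\ell-2a_i)}{12\prod\limits_{\substack{p=1\\ p\neq i,j}}^n(a_i-a_p)}\Bigg)\\ &\qquad\qquad+\frac{g_j^2-1}{24}\cdot\frac{a_i^{n-5}(a_i-a_j)\Big(-a_i+\sum\limits_{\substack{\ell=1\\ \ell\neq i,j}}^na_\ell\Big)}{\prod\limits_{\substack{\ell=1\\ \ell\neq i,j}}^n(a_i-a_\ell)}\Bigg)\\ &+\sum_{i=1}^k\sum_{\substack{1\leq j<\ell\leq n\\ j,\ell\neq i}}\Bigg(\sum_{\substack{\zeta^{g_{j,\ell}}=1\\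 \zeta^{g_j}\neq1,\ \zeta^{g_\ell}\neq1}}\frac{1}{(1-\zeta^{a_j})(1-\zeta^{a_\ell})}\sum_{\substack{p=1\\ p\neq i,j,\ell}}^n\frac{a_i^{n-5}a_p}{2\prod\limits_{\substack{q=1\\ q\neq i,j,\ell}}^n(a_i-a_q)}\\ &\qquad\qquad+\frac{a_i^{n-5}}{\prod\limits_{\substack{p=1\\ p\neq i,j,\ell}}^n(a_i-a_p)}\sum_{\substack{\zeta^{g_{j,\ell}}=1\\ \zeta^{g_j}\neq1,\ \zeta^{g_\ell}\neq1}}\Bigg(\frac{\zeta^{a_j}(a_i-a_j)}{(1-\zeta^{a_j})^2(1-\zeta^{a_\ell})}+\frac{\zeta^{a_\ell}(a_i-a_\ell)}{(1-\zeta^{a_j})(1-\zeta^{a_\ell})^2}\Bigg)\Bigg)\\ &+\sum_{i=1}^k\sum_{\substack{1\leq j<\ell<p\leq n\\ j,\ell,p\neq i}}\ \sum_{\substack{\zeta^{g_{j,\ell,p}}=1\\ \zeta^{g_{j,\ell}}\neq1,\ \zeta^{g_{j,p}}\neq1,\ \zeta^{g_{\ell,p}}\neq1}}\frac{-a_i^{n-5}}{(1-\zeta^{a_j})(1-\zeta^{a_\ell})(1-\zeta^{a_p})\prod\limits_{\substack{q=1\\ q\neq i,j,\ell,p}}^n(a_i-a_q)}. \end{align*}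
   Context: The action with weight vector $\boldsymbol{a}$ is $w\cdot(z_1,\ldots,z_n)=(w^{a_1}z_1,\ldots,w^{a_n}z_n)$. $R=\mathbb{C}[\mathbb{C}^n]^{\mathbb{C}^\times_{\boldsymbol{a}}}$ is the algebra of invariant polynomials graded by polynomial degree, of Krull dimension $\dim R=n-1$; $\operatorname{Hilb}_{\boldsymbol{a}}(t)=\sum_{d\geq0}\dim_{\mathbb{C}}(R_d)t^d$ is its Hilbert series (a rational function), and $\gamma_m(\boldsymbol{a})$ are the coefficients of its Laurent expansion at $t=1$: $\operatorname{Hilb}_{\boldsymbol{a}}(t)=\sum_{m\geq 0}\gamma_m(\boldsymbol{a})(1-t)^{m-\dim R}$. $\boldsymbol{a}_j$, $\boldsymbol{a}_{j,\ell}$, $\boldsymbol{a}_{j,\ell,p}$ denote $\boldsymbol{a}$ with the entries with the indicated (distinct) indices removed; $g_j=\gcd\{a_i:i\neq j\}$, $g_{j,\ell}=\gcd\{a_i:i\neq j,\ell\}$, $g_{j,\ell,p}=\gcd\{a_i:i\neq j,\ell,p\}$ (positive). $E_1,E_2$ are the elementary symmetric polynomials of degree $1,2$ in the entries of the vector. For a vector $\boldsymbol{b}$ of nonzero integers, $D(\boldsymbol{b})=\prod_{b_p<0,\ b_q>0}(b_p-b_q)$, the product over all pairs of a negative entry and a positive entry of $\boldsymbol{b}$ (empty product $=1$). Sums over $\zeta$ run over complex numbers satisfying the stated conditions. For integers $k,m\geq0$ with $N=k+m\geq1$, variables $\boldsymbol{x}=(x_1,\ldots,x_k)$, $\boldsymbol{y}=(y_1,\ldots,y_m)$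 and an integer $u\leq N-2$, $S_u(\boldsymbol{x},\boldsymbol{y})=\det M/(\operatorname{V}(\boldsymbol{x})\operatorname{V}(\boldsymbol{y}))$, where $\operatorname{V}(x_1,\ldots,x_k)=\prod_{1\leq i<j\leq k}(x_i-x_j)$ and $M$ is the $N\times N$ matrix with first row $(x_1^u,\ldots,x_k^u,0,\ldots,0)$ and $r$-th row $(x_1^{N-r},\ldots,x_k^{N-r},y_1^{N-r},\ldots,y_m^{N-r})$ for $r=2,\ldots,N$. This is a polynomial in $\boldsymbol{y}$ and the $x_i^{\pm1}$, so it may be evaluated also when some variables coincide. $S_u(\boldsymbol{b})$ means $S_u$ evaluated with $\boldsymbol{x}=$ the negative entries and $\boldsymbol{y}=$ the positive entries of $\boldsymbol{b}$; $S_u(\boldsymbol{b})=0$ if $\boldsymbol{b}$ has no negative entries, and any summand involving such a vector (in particular the empty vector) is $0$. *)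

theory Defs
  imports
    "HOL-Complex_Analysis.Complex_Analysis"
    "HOL-Library.Poly_Mapping"
    "Jordan_Normal_Form.Determinant"
begin

section \<open>Invariants of a linear torus action and their Hilbert series\<close>

text \<open>A polynomial in variables indexed by natural numbers is a finitely supported map from
  monomials (finitely supported exponent vectors) to coefficients.\<close>

type_synonym cpoly = "(nat \<Rightarrow>\<^sub>0 nat) \<Rightarrow>\<^sub>0 complex"

definition cpoly_scale :: "complex \<Rightarrow> cpoly \<Rightarrow> cpoly" where
  "cpoly_scale c f = Poly_Mapping.map (\<lambda>x. c * x) f"

lemma lookup_cpoly_scale: "Poly_Mapping.lookup (cpoly_scale c f) m = c * Poly_Mapping.lookup f m"
  unfolding cpoly_scale_def by (simp add: Poly_Mapping.map.rep_eq when_def)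

interpretation cpoly: vector_space cpoly_scale
  by unfold_locales
    (auto intro!: poly_mapping_eqI simp: lookup_cpoly_scale lookup_add algebra_simps)

definition cpoly_eval :: "cpoly \<Rightarrow> (nat \<Rightarrow> complex) \<Rightarrow> complex" where
  "cpoly_eval f z = (\<Sum>m\<in>Poly_Mapping.keys f. Poly_Mapping.lookup f m *
     (\<Prod>i\<in>Poly_Mapping.keys m. z i ^ Poly_Mapping.lookup m i))"

text \<open>The coordinate ring of complex \<open>n\<close>-space; the coordinates are numbered \<open>1, \<dots>, n\<close>.\<close>

definition cpolys :: "nat \<Rightarrow> cpoly set" where
  "cpolys n = {f. \<forall>m\<in>Poly_Mapping.keys f. Poly_Mapping.keys m \<subseteq> {1..n}}"

definition homogeneous :: "nat \<Rightarrow> cpoly \<Rightarrow> bool" where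
  "homogeneous d f \<longleftrightarrow>
     (\<forall>m\<in>Poly_Mapping.keys f. (\<Sum>i\<in>Poly_Mapping.keys m. Poly_Mapping.lookup m i) = d)"

definition act :: "(nat \<Rightarrow> int) \<Rightarrow> complex \<Rightarrow> (nat \<Rightarrow> complex) \<Rightarrow> (nat \<Rightarrow> complex)" where
  "act a w z = (\<lambda>i. w powi a i * z i)"

definition invariant_ring :: "nat \<Rightarrow> (nat \<Rightarrow> int) \<Rightarrow> cpoly set" where
  "invariant_ring n a =
     {f \<in> cpolys n. \<forall>w z. w \<noteq> 0 \<longrightarrow> cpoly_eval f (act a w z) = cpoly_eval f z}"

definition invariant_ring_deg :: "nat \<Rightarrow> (nat \<Rightarrow> int) \<Rightarrow> nat \<Rightarrow> cpoly set" where
  "invariant_ring_deg n a d = {f \<in> invariant_ring n a. homogeneous d f}"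

definition hilbert_series :: "nat \<Rightarrow> (nat \<Rightarrow> int) \<Rightarrow> complex fps" where
  "hilbert_series n a = Abs_fps (\<lambda>d. of_nat (cpoly.dim (invariant_ring_deg n a d)))"

text \<open>The Hilbert series is (the power series at \<open>0\<close> of) a rational function \<open>P / Q\<close>.
  Its Laurent expansion at \<open>t = 1\<close> is taken in the variable \<open>s = 1 - t\<close>, so that no signs occur.\<close>

definition hilbert_laurent :: "nat \<Rightarrow> (nat \<Rightarrow> int) \<Rightarrow> complex fls" where
  "hilbert_laurent n a = (THE L. \<exists>P Q :: complex poly. Q \<noteq> 0 \<and>
     fps_of_poly Q * hilbert_series n a = fps_of_poly P \<and>
     (\<lambda>s. poly P (1 - s) / poly Q (1 - s)) has_laurent_expansion L)"

text \<open>\<open>n - 1\<close> is the Krull dimension of the ring of invariants.\<close>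

definition gamma_coeff :: "nat \<Rightarrow> nat \<Rightarrow> (nat \<Rightarrow> int) \<Rightarrow> complex" where
  "gamma_coeff m n a = fls_nth (hilbert_laurent n a) (int m - (int n - 1))"


section \<open>The functions \<open>S\<^sub>u\<close>\<close>

text \<open>Laurent polynomials: the exponents are integers.  In \<open>S_laurent k m u\<close> the variables
  \<open>x\<^sub>1, \<dots>, x\<^sub>k\<close> are numbered \<open>0, \<dots>, k - 1\<close> and \<open>y\<^sub>1, \<dots>, y\<^sub>m\<close> are numbered \<open>k, \<dots>, k + m - 1\<close>.\<close>

type_synonym laurent = "(nat \<Rightarrow>\<^sub>0 int) \<Rightarrow>\<^sub>0 complex"

definition lvar_pow :: "nat \<Rightarrow> int \<Rightarrow> laurent" where
  "lvar_pow i e = Poly_Mapping.single (Poly_Mapping.single i e) 1"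

definition laurent_eval :: "laurent \<Rightarrow> (nat \<Rightarrow> complex) \<Rightarrow> complex" where
  "laurent_eval f z = (\<Sum>m\<in>Poly_Mapping.keys f. Poly_Mapping.lookup f m *
     (\<Prod>i\<in>Poly_Mapping.keys m. z i powi Poly_Mapping.lookup m i))"

definition index_pairs :: "nat set \<Rightarrow> (nat \<times> nat) set" where
  "index_pairs I = {(j, l). j \<in> I \<and> l \<in> I \<and> j < l}"

definition index_triples :: "nat set \<Rightarrow> (nat \<times> nat \<times> nat) set" where
  "index_triples I = {(j, l, p). j \<in> I \<and> l \<in> I \<and> p \<in> I \<and> j < l \<and> l < p}"

definition vandermonde :: "nat set \<Rightarrow> laurent" where
  "vandermonde I = (\<Prod>(i, j)\<in>index_pairs I. lvar_pow i 1 - lvar_pow j 1)"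

text \<open>Rows and columns are numbered from \<open>0\<close>, hence the exponent \<open>N - 1 - r\<close> with \<open>N = k + m\<close>.\<close>

definition S_matrix :: "nat \<Rightarrow> nat \<Rightarrow> int \<Rightarrow> laurent mat" where
  "S_matrix k m u = Matrix.mat (k + m) (k + m) (\<lambda>(r, c).
     if r = 0 then (if c < k then lvar_pow c u else 0)
     else lvar_pow c (int (k + m) - 1 - int r))"

text \<open>The exact quotient, which exists for \<open>k + m \<ge> 1\<close> and \<open>u \<le> k + m - 2\<close>; forming it before
  substituting numbers gives meaning to the values at coinciding arguments.\<close>

definition S_laurent :: "nat \<Rightarrow> nat \<Rightarrow> int \<Rightarrow> laurent" where
  "S_laurent k m u = (THE q.
     q * (vandermonde {0..<k} * vandermonde {k..<k + m}) = Determinant.det (S_matrix k m u))"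

definition neg_entries :: "int list \<Rightarrow> int list" where
  "neg_entries b = filter (\<lambda>x. x < 0) b"

definition pos_entries :: "int list \<Rightarrow> int list" where
  "pos_entries b = filter (\<lambda>x. x > 0) b"

definition S_val :: "int \<Rightarrow> int list \<Rightarrow> complex" where
  "S_val u b = (if neg_entries b = [] then 0 else
     laurent_eval (S_laurent (length (neg_entries b)) (length (pos_entries b)) u)
       (\<lambda>i. of_int ((neg_entries b @ pos_entries b) ! i)))"


section \<open>Weight vectors\<close>

definition D_val :: "int list \<Rightarrow> complex" where
  "D_val b = (\<Prod>p\<leftarrow>neg_entries b. \<Prod>q\<leftarrow>pos_entries b. of_int (p - q))"

definition E1 :: "int list \<Rightarrow> complex" where
  "E1 b = (\<Sum>x\<leftarrow>b. of_int x)"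

definition E2 :: "int list \<Rightarrow> complex" where
  "E2 b = (\<Sum>(i, j)\<in>index_pairs {0..<length b}. of_int (b ! i * b ! j))"

text \<open>The vector \<open>(a\<^sub>1, \<dots>, a\<^sub>n)\<close> with the entries with index in \<open>J\<close> removed, and the gcd of the
  remaining entries.\<close>

definition remove_entries :: "nat \<Rightarrow> (nat \<Rightarrow> int) \<Rightarrow> nat set \<Rightarrow> int list" where
  "remove_entries n a J = map a (filter (\<lambda>i. i \<notin> J) [1..<Suc n])"

definition gcd_without :: "nat \<Rightarrow> (nat \<Rightarrow> int) \<Rightarrow> nat set \<Rightarrow> int" where
  "gcd_without n a J = Gcd (a ` ({1..n} - J))"

text \<open>If \<open>{j, l}\<close> (resp. \<open>{j, l, p}\<close>) is the whole index set, then the gcd is \<open>0\<close> and the following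
  sets are infinite; they then only occur in summands with a factor \<open>S_val u [] = 0\<close>.\<close>

definition zetas2 :: "nat \<Rightarrow> (nat \<Rightarrow> int) \<Rightarrow> nat \<Rightarrow> nat \<Rightarrow> complex set" where
  "zetas2 n a j l = {\<zeta>. \<zeta> powi gcd_without n a {j, l} = 1 \<and>
     \<zeta> powi gcd_without n a {j} \<noteq> 1 \<and> \<zeta> powi gcd_without n a {l} \<noteq> 1}"

definition zetas3 :: "nat \<Rightarrow> (nat \<Rightarrow> int) \<Rightarrow> nat \<Rightarrow> nat \<Rightarrow> nat \<Rightarrow> complex set" where
  "zetas3 n a j l p = {\<zeta>. \<zeta> powi gcd_without n a {j, l, p} = 1 \<and>
     \<zeta> powi gcd_without n a {j, l} \<noteq> 1 \<and> \<zeta> powi gcd_without n a {j, p} \<noteq> 1 \<and>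
     \<zeta> powi gcd_without n a {l, p} \<noteq> 1}"

end

(*
  By Molien's formula the Hilbert series at t = exp (-s) is the integral of
  prod_i 1 / (1 - exp (a_i x - s)) over a period of x, divided by 2 pi i. Only the poles with a_i < 0
  lie to the left of the path, and as s -> 0 they gather in clusters of diameter O(s) around the
  points 2 pi i m / L, where L is a common multiple of the weights; so the Hilbert series is a sum of
  contributions of the roots of unity zeta = exp (2 pi i m / L). After scaling x = log zeta + s y every
  contribution is an integral over one fixed circle, and its integrand has a uniform expansion in
  1 - t. If r of the numbers zeta^a_i differ from 1, the contribution vanishes to order r relative to
  the leading pole; hence for gamma_3 only r <= 3 matters, with coefficients that are combinations of
  the integrals of y^e / prod (1 - a_i y) over the indices i with zeta^a_i = 1. By Lagrange
  interpolation these integrals are, up to sign, the quotients S_u / D; if the negative weights are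
  distinct, they are sums of residues at simple poles.
*)

theory Submission
  imports Defs "HOL-Real_Asymp.Real_Asymp"
begin

subsection \<open>The ring of invariants\<close>

text \<open>\<open>hilbert_laurent\<close> presupposes that the series is a fraction, and an
  expansion along real t < 1 determines Laurent coefficients only for a function known to have a
  Laurent expansion at t = 1. Rationality is therefore proved separately, by counting monomials. The
  main obstacle is that weights may coincide: the poles then have higher order, and S_u is the value
  of a quotient whose numerator and denominator both vanish. So for general weights no residue is
  computed: everything is expressed by circle integrals, which are compared with S_u for perturbed,
  distinct entries before passing to the limit. The denominator 24 comes from the Todd series v / (1
  - exp (-v)), which governs the factors with \<zeta>^a_i = 1, and from the expansion of s = - ln t
  in powers of 1 - t. If just one \<zeta>^a_j differs from 1, effectiveness makes a_j prime to g_j;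
  then \<zeta>^a_j runs over all g_j-th roots of unity other than 1 and the sums have closed forms,
  which yield the terms with g_j - 1 and g_j^2 - 1. For two or three such indices the sums over
  \<zeta> stay in the formula.\<close>

lemma characters_independent:
  fixes ch :: "'m \<Rightarrow> 'g \<Rightarrow> complex" and mul :: "'g \<Rightarrow> 'g \<Rightarrow> 'g"
  assumes "finite M"
    and closed: "\<And>x y. x \<in> G \<Longrightarrow> y \<in> G \<Longrightarrow> mul x y \<in> G"
    and unit: "e \<in> G" "\<And>m. ch m e = 1"
    and mult: "\<And>m x y. x \<in> G \<Longrightarrow> y \<in> G \<Longrightarrow> ch m (mul x y) = ch m x * ch m y"
    and distinct: "\<And>m m'. m \<noteq> m' \<Longrightarrow> \<exists>x\<in>G. ch m x \<noteq> ch m' x"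
    and zero: "\<And>x. x \<in> G \<Longrightarrow> (\<Sum>m\<in>M. c m * ch m x) = 0"
    and "m \<in> M"
  shows "c m = 0"
  using assms(1) zero \<open>m \<in> M\<close>
proof (induction M arbitrary: c m rule: finite_induct)
  case (insert m0 M c m)
  \<comment> \<open>Artin's argument: the relation at \<open>mul x y\<close> minus
    \<open>ch m0 y\<close> times the relation at x has no \<open>m0\<close> term, which leaves a
    relation over the smaller set M for the induction hypothesis.\<close>
  have "c m * (ch m y - ch m0 y) = 0" if y: "y \<in> G" and m: "m \<in> M" for m y
  proof (rule insert.IH[where c = "\<lambda>m. c m * (ch m y - ch m0 y)", OF _ m])
    fix x assume x: "x \<in> G"
    have "(\<Sum>m\<in>M. c m * (ch m y - ch m0 y) * ch m x)
        = (\<Sum>m\<in>insert m0 M. c m * (ch m y - ch m0 y) * ch m x)"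
      using insert.hyps by simp
    also have "\<dots> = (\<Sum>m\<in>insert m0 M. c m * ch m (mul x y)) - ch m0 y * (\<Sum>m\<in>insert m0 M. c m * ch m x)"
      unfolding sum_distrib_left sum_subtractf[symmetric]
      by (intro sum.cong) (simp_all add: mult x y algebra_simps)
    also have "\<dots> = 0" using insert.prems(1) x y closed by simp
    finally show "(\<Sum>m\<in>M. c m * (ch m y - ch m0 y) * ch m x) = 0" .
  qed
  hence *: "c m = 0" if "m \<in> M" for m
    using that distinct[of m m0] insert.hyps by (metis mult_eq_0_iff right_minus_eq)
  moreover have "c m0 = 0"
    using insert.prems(1)[OF unit(1)] insert.hyps * unit(2) by simp
  ultimately show ?case using insert.prems(2) by auto
qed simp

text \<open>Exponents are integers so that one independence result serves both the monomials of
  invariant polynomials (through \<open>Poly_Mapping.map int\<close>) and the Laurent monomials of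
  \<open>S_laurent\<close>.\<close>

definition monomial_at :: "(nat \<Rightarrow> complex) \<Rightarrow> (nat \<Rightarrow>\<^sub>0 int) \<Rightarrow> complex" where
  "monomial_at z m = (\<Prod>i\<in>Poly_Mapping.keys m. z i powi Poly_Mapping.lookup m i)"

lemma monomial_at_superset:
  assumes "finite A" "Poly_Mapping.keys m \<subseteq> A"
  shows "monomial_at z m = (\<Prod>i\<in>A. z i powi Poly_Mapping.lookup m i)"
  unfolding monomial_at_def
  by (rule prod.mono_neutral_left) (use assms in \<open>auto simp: in_keys_iff\<close>)

lemma monomial_at_mult: "monomial_at (\<lambda>i. x i * y i) m = monomial_at x m * monomial_at y m"
  unfolding monomial_at_def by (simp add: power_int_mult_distrib prod.distrib)

lemma monomial_at_distinct:
  assumes "m \<noteq> m'"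
  shows "\<exists>z\<in>{z. \<forall>i. z i \<noteq> 0}. monomial_at z m \<noteq> monomial_at z m'"
proof -
  obtain i where i: "Poly_Mapping.lookup m i \<noteq> Poly_Mapping.lookup m' i"
    using assms by (meson poly_mapping_eqI)
  \<comment> \<open>At a coordinate i where the exponents differ, the value 2 is not a root of
    unity, so its powers separate the two monomials.\<close>
  define z :: "nat \<Rightarrow> complex" where "z = (\<lambda>j. if j = i then 2 else 1)"
  have "monomial_at z m = 2 powi Poly_Mapping.lookup m i" for m
  proof -
    have "monomial_at z m = (\<Prod>j\<in>insert i (Poly_Mapping.keys m). z j powi Poly_Mapping.lookup m j)"
      by (rule monomial_at_superset) auto
    also have "\<dots> = (\<Prod>j\<in>{i}. z j powi Poly_Mapping.lookup m j)"
      by (rule prod.mono_neutral_right) (auto simp: z_def)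
    finally show ?thesis by (simp add: z_def)
  qed
  moreover have "(2::complex) powi a \<noteq> 2 powi b" if "a \<noteq> b" for a b
  proof
    assume "(2::complex) powi a = 2 powi b"
    hence "norm ((2::complex) powi a) = norm ((2::complex) powi b)" by simp
    hence "(2::real) powi a = 2 powi b" by (simp add: norm_power_int)
    thus False using that by (smt (verit) power_int_strict_increasing)
  qed
  ultimately show ?thesis using i by (intro bexI[of _ z]) (auto simp: z_def)
qed

text \<open>Monomials are pairwise distinct characters of the group of points without zero
  coordinates under coordinatewise multiplication, so Dedekind independence applies.\<close>

lemma monomials_independent:
  assumes "finite M" "\<And>z. (\<And>i. z i \<noteq> 0) \<Longrightarrow> (\<Sum>m\<in>M. c m * monomial_at z m) = 0" "m \<in> M"
  shows "c m = 0"
proof (rule characters_independent[where ch = "\<lambda>m z. monomial_at z m" and G = "{z. \<forall>i. z i \<noteq> 0}"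
      and mul = "\<lambda>x y i. x i * y i" and e = "\<lambda>_. 1" and M = M and c = c])
  show "\<And>m. monomial_at (\<lambda>_. 1) m = 1" by (simp add: monomial_at_def)
qed (use assms monomial_at_mult monomial_at_distinct in auto)

section \<open>Invariant polynomials and monomials of weight zero\<close>

definition weight :: "(nat \<Rightarrow> int) \<Rightarrow> (nat \<Rightarrow>\<^sub>0 nat) \<Rightarrow> int" where
  "weight a m = (\<Sum>i\<in>Poly_Mapping.keys m. a i * int (Poly_Mapping.lookup m i))"

definition exponents :: "nat set \<Rightarrow> nat \<Rightarrow> (nat \<Rightarrow>\<^sub>0 nat) set" where
  "exponents I d = {m. Poly_Mapping.keys m \<subseteq> I \<and> (\<Sum>i\<in>Poly_Mapping.keys m. Poly_Mapping.lookup m i) = d}"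

lemma power_int_sum:
  fixes w :: complex
  assumes "w \<noteq> 0"
  shows "(\<Prod>i\<in>A. w powi f i) = w powi (\<Sum>i\<in>A. f i)"
  by (induction A rule: infinite_finite_induct) (simp_all add: assms power_int_add)

lemma cpoly_eval_act:
  assumes "w \<noteq> 0"
  shows "cpoly_eval f (act a w z) = (\<Sum>m\<in>Poly_Mapping.keys f.
    (Poly_Mapping.lookup f m * w powi weight a m) * (\<Prod>i\<in>Poly_Mapping.keys m. z i ^ Poly_Mapping.lookup m i))"
proof -
  have *: "(w powi x * y) ^ k = w powi (x * int k) * y ^ k" for x y k
    by (simp add: power_mult_distrib power_int_mult power_int_power)
  show ?thesis unfolding cpoly_eval_def act_def weight_def
    by (intro sum.cong refl) (simp add: * prod.distrib power_int_sum assms)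
qed

lemma int_exponents_inj: "inj (Poly_Mapping.map int :: (nat \<Rightarrow>\<^sub>0 nat) \<Rightarrow> (nat \<Rightarrow>\<^sub>0 int))"
proof (rule injI)
  fix x y :: "nat \<Rightarrow>\<^sub>0 nat"
  assume *: "Poly_Mapping.map int x = Poly_Mapping.map int y"
  show "x = y"
  proof (rule poly_mapping_eqI)
    fix k show "Poly_Mapping.lookup x k = Poly_Mapping.lookup y k"
      using arg_cong[OF *, of "\<lambda>m. Poly_Mapping.lookup m k"]
      by (simp add: Poly_Mapping.map.rep_eq when_def split: if_splits)
  qed
qed

text \<open>Acting by w multiplies a monomial by the power of w given by its weight. The single
  group element w = 2 already detects invariance: by independence every monomial m of f satisfies 2
  powi \<open>weight a m\<close> = 1, hence has weight 0.\<close>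

lemma invariant_ring_iff:
  "f \<in> invariant_ring n a \<longleftrightarrow> f \<in> cpolys n \<and> (\<forall>m\<in>Poly_Mapping.keys f. weight a m = 0)"
proof (cases "f \<in> cpolys n")
  case True
  have "weight a m = 0" if inv: "\<And>w z. w \<noteq> 0 \<Longrightarrow> cpoly_eval f (act a w z) = cpoly_eval f z"
    and m: "m \<in> Poly_Mapping.keys f" for m
  proof -
    let ?h = "Poly_Mapping.map int :: (nat \<Rightarrow>\<^sub>0 nat) \<Rightarrow> (nat \<Rightarrow>\<^sub>0 int)"
    \<comment> \<open>These are the coefficients of the difference between f at the point moved by w
      = 2 and f at z, as a combination of monomials in z.\<close>
    define c where "c m = Poly_Mapping.lookup f m * (2 powi weight a m - 1)" for m
    have inj: "inj_on ?h (Poly_Mapping.keys f)" using int_exponents_inj inj_on_subset by blast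
    have keys: "Poly_Mapping.keys (?h m) = Poly_Mapping.keys m" for m
      by (auto simp: in_keys_iff Poly_Mapping.map.rep_eq when_def split: if_splits)
    have mono: "monomial_at z (?h m) = (\<Prod>i\<in>Poly_Mapping.keys m. z i ^ Poly_Mapping.lookup m i)" for z m
      unfolding monomial_at_def keys by (intro prod.cong refl) (simp add: Poly_Mapping.map.rep_eq when_def)
    have "(c \<circ> inv_into (Poly_Mapping.keys f) ?h) (?h m) = 0"
    proof (rule monomials_independent[where M = "?h ` Poly_Mapping.keys f"])
      fix z :: "nat \<Rightarrow> complex"
      have "(\<Sum>m\<in>?h ` Poly_Mapping.keys f. (c \<circ> inv_into (Poly_Mapping.keys f) ?h) m * monomial_at z m)
        = (\<Sum>m\<in>Poly_Mapping.keys f. c m * monomial_at z (?h m))"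
        using inj by (subst sum.reindex) (auto intro!: sum.cong)
      also have "\<dots> = cpoly_eval f (act a 2 z) - cpoly_eval f z"
        unfolding mono c_def by (subst cpoly_eval_act, simp, unfold cpoly_eval_def)
          (simp add: algebra_simps sum_subtractf)
      also have "\<dots> = 0" using inv[of 2] by simp
      finally show "(\<Sum>m\<in>?h ` Poly_Mapping.keys f.
         (c \<circ> inv_into (Poly_Mapping.keys f) ?h) m * monomial_at z m) = 0" .
    qed (use m in auto)
    hence "c m = 0" using m inj by simp
    hence "(2::complex) powi weight a m = 1" using m by (simp add: c_def in_keys_iff)
    hence "norm ((2::complex) powi weight a m) = 1" by simp
    hence "(2::real) powi weight a m = 2 powi 0" by (simp add: norm_power_int)
    thus ?thesis by (smt (verit) power_int_strict_increasing)
  qed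
  moreover have "cpoly_eval f (act a w z) = cpoly_eval f z"
    if "\<forall>m\<in>Poly_Mapping.keys f. weight a m = 0" "w \<noteq> 0" for w z
    unfolding cpoly_eval_act[OF that(2)] unfolding cpoly_eval_def
    by (intro sum.cong refl) (use that in simp)
  ultimately show ?thesis using True by (auto simp: invariant_ring_def)
qed (simp add: invariant_ring_def)

text \<open>The weight-zero monomials of degree d form a basis, which turns the dimension into a
  count of exponent vectors.\<close>

lemma dim_invariant_ring_deg:
  assumes "finite (exponents {1..n} d)"
  shows "cpoly.dim (invariant_ring_deg n a d) = card {m \<in> exponents {1..n} d. weight a m = 0}"
proof -
  define M where "M = {m \<in> exponents {1..n} d. weight a m = 0}"
  define B where "B = (\<lambda>m. Poly_Mapping.single m (1::complex)) ` M"
  have finM: "finite M" using assms by (simp add: M_def)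
  have inj: "inj_on (\<lambda>m. Poly_Mapping.single m (1::complex)) M"
    by (rule inj_onI) (drule arg_cong[where f = Poly_Mapping.keys], simp)
  have V: "f \<in> invariant_ring_deg n a d \<longleftrightarrow> Poly_Mapping.keys f \<subseteq> M" for f
    unfolding invariant_ring_deg_def invariant_ring_iff homogeneous_def cpolys_def M_def exponents_def
    by auto
  have sum: "f = (\<Sum>m\<in>Poly_Mapping.keys f. cpoly_scale (Poly_Mapping.lookup f m) (Poly_Mapping.single m 1))" for f
  proof (rule poly_mapping_eqI)
    fix k
    have "(\<Sum>m\<in>Poly_Mapping.keys f. Poly_Mapping.lookup f m * (1 when m = k)) = Poly_Mapping.lookup f k"
      by (cases "k \<in> Poly_Mapping.keys f") (auto simp: when_def in_keys_iff if_distrib[of "(*) _"] cong: if_cong)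
    thus "Poly_Mapping.lookup f k = Poly_Mapping.lookup (\<Sum>m\<in>Poly_Mapping.keys f. cpoly_scale (Poly_Mapping.lookup f m) (Poly_Mapping.single m 1)) k"
      by (simp add: lookup_sum lookup_cpoly_scale lookup_single)
  qed
  have "invariant_ring_deg n a d = cpoly.span B"
  proof (intro equalityI subsetI)
    fix f assume "f \<in> invariant_ring_deg n a d"
    hence "Poly_Mapping.keys f \<subseteq> M" by (simp add: V)
    thus "f \<in> cpoly.span B"
      by (subst sum) (intro cpoly.span_sum cpoly.span_scale cpoly.span_base, auto simp: B_def)
  next
    have "cpoly.subspace (invariant_ring_deg n a d)"
      unfolding cpoly.subspace_def
    proof (intro conjI ballI allI)
      show "0 \<in> invariant_ring_deg n a d" by (simp add: V)
      show "x + y \<in> invariant_ring_deg n a d"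
        if "x \<in> invariant_ring_deg n a d" "y \<in> invariant_ring_deg n a d" for x y
        using that Poly_Mapping.keys_add[of x y] unfolding V by blast
      show "cpoly_scale c x \<in> invariant_ring_deg n a d" if "x \<in> invariant_ring_deg n a d" for c x
        using that unfolding V by (auto simp: in_keys_iff lookup_cpoly_scale)
    qed
    moreover have "B \<subseteq> invariant_ring_deg n a d" by (auto simp: V B_def)
    ultimately show "f \<in> invariant_ring_deg n a d" if "f \<in> cpoly.span B" for f
      using that cpoly.span_minimal by blast
  qed
  moreover have "cpoly.independent B"
  proof -
    have "u v = 0" if "(\<Sum>v\<in>B. cpoly_scale (u v) v) = 0" and v: "v \<in> B" for u v
    proof -
      obtain m where m: "m \<in> M" "v = Poly_Mapping.single m 1" using v by (auto simp: B_def)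
      have "0 = Poly_Mapping.lookup (\<Sum>v\<in>B. cpoly_scale (u v) v) m" using that by simp
      also have "\<dots> = (\<Sum>m'\<in>M. u (Poly_Mapping.single m' 1) * (1 when m' = m))"
        unfolding B_def by (subst sum.reindex[OF inj]) (simp add: lookup_sum lookup_cpoly_scale lookup_single)
      also have "\<dots> = u v" using m finM by (simp add: when_def if_distrib[of "(*) _"] cong: if_cong)
      finally show ?thesis by simp
    qed
    thus ?thesis using finM by (subst cpoly.independent_if_scalars_zero) (auto simp: B_def)
  qed
  ultimately have "cpoly.dim (invariant_ring_deg n a d) = card B"
    using cpoly.dim_span_eq_card_independent by simp
  thus ?thesis using card_image[OF inj] by (simp add: B_def M_def)
qed

subsection \<open>Rationality of the Hilbert series\<close>

lemma weight_add_single: "weight a (m + Poly_Mapping.single i 1) = weight a m + a i"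
proof -
  have *: "weight a m' = (\<Sum>j\<in>insert i (Poly_Mapping.keys m). a j * int (Poly_Mapping.lookup m' j))"
    if "Poly_Mapping.keys m' \<subseteq> insert i (Poly_Mapping.keys m)" for m'
    unfolding weight_def by (rule sum.mono_neutral_left) (use that in \<open>auto simp: in_keys_iff\<close>)
  have "Poly_Mapping.keys (m + Poly_Mapping.single i 1) \<subseteq> insert i (Poly_Mapping.keys m)"
    using Poly_Mapping.keys_add[of m "Poly_Mapping.single i 1"] by auto
  hence "weight a (m + Poly_Mapping.single i 1) - weight a m =
     (\<Sum>j\<in>insert i (Poly_Mapping.keys m). a j * int (Poly_Mapping.lookup (Poly_Mapping.single i 1) j))"
    by (subst (1 2) *) (auto simp: lookup_add algebra_simps sum.distrib sum_subtractf[symmetric])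
  also have "\<dots> = (\<Sum>j\<in>{i}. a j * int (Poly_Mapping.lookup (Poly_Mapping.single i 1) j))"
    by (rule sum.mono_neutral_right) (auto simp: lookup_single when_def)
  finally show ?thesis by (simp add: lookup_single)
qed

abbreviation deg :: "(nat \<Rightarrow>\<^sub>0 nat) \<Rightarrow> nat" where
  "deg m \<equiv> (\<Sum>i\<in>Poly_Mapping.keys m. Poly_Mapping.lookup m i)"

lemma deg_add_single: "deg (m + Poly_Mapping.single i 1) = Suc (deg m)"
proof -
  have *: "int (deg m) = weight (\<lambda>_. 1) m" for m by (simp add: weight_def)
  have "int (deg (m + Poly_Mapping.single i 1)) = int (deg m) + 1" unfolding * by (rule weight_add_single)
  thus ?thesis by linarith
qed

lemma exponents_0: "exponents I 0 = {0}"
  by (auto simp: exponents_def in_keys_iff intro!: poly_mapping_eqI)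

lemma keys_add_nat: "Poly_Mapping.keys (m + m' :: 'a \<Rightarrow>\<^sub>0 nat) = Poly_Mapping.keys m \<union> Poly_Mapping.keys m'"
  by (auto simp: in_keys_iff lookup_add)

lemma single_diff_add:
  assumes "i \<in> Poly_Mapping.keys (m :: nat \<Rightarrow>\<^sub>0 nat)"
  shows "m - Poly_Mapping.single i 1 + Poly_Mapping.single i 1 = m"
  by (rule poly_mapping_eqI)
    (use assms in \<open>auto simp: lookup_add lookup_minus lookup_single in_keys_iff when_def\<close>)

lemma exponents_Suc:
  assumes "i \<in> I"
  shows "exponents I (Suc d) = exponents (I - {i}) (Suc d) \<union> (\<lambda>m. m + Poly_Mapping.single i 1) ` exponents I d"
    (is "?L = ?R")
proof (intro equalityI subsetI)
  fix m assume m: "m \<in> ?L"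
  show "m \<in> ?R"
  proof (cases "i \<in> Poly_Mapping.keys m")
    case True
    define m' where "m' = m - Poly_Mapping.single i 1"
    have mm: "m = m' + Poly_Mapping.single i 1" using single_diff_add[OF True] by (simp add: m'_def)
    have "deg m = Suc (deg m')" unfolding mm by (rule deg_add_single)
    moreover have "Poly_Mapping.keys m' \<subseteq> Poly_Mapping.keys m" unfolding mm by (auto simp: keys_add_nat)
    ultimately have "m' \<in> exponents I d" using m by (auto simp: exponents_def)
    thus ?thesis using mm by blast
  qed (use m in \<open>auto simp: exponents_def\<close>)
next
  fix m assume "m \<in> ?R"
  thus "m \<in> ?L" using assms
    by (auto simp: exponents_def deg_add_single simp del: One_nat_def) (auto simp: keys_add_nat)
qed

lemma finite_exponents: "finite I \<Longrightarrow> finite (exponents I d)"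
proof (induction d)
  case (Suc d)
  have "exponents I (Suc d) \<subseteq> (\<Union>i\<in>I. (\<lambda>m. m + Poly_Mapping.single i 1) ` exponents I d)"
  proof
    fix m assume m: "m \<in> exponents I (Suc d)"
    hence "Poly_Mapping.keys m \<noteq> {}" by (auto simp: exponents_def)
    then obtain i where i: "i \<in> Poly_Mapping.keys m" by blast
    with m have "i \<in> I" by (auto simp: exponents_def)
    moreover have "m \<notin> exponents (I - {i}) (Suc d)" using i by (auto simp: exponents_def)
    ultimately show "m \<in> (\<Union>i\<in>I. (\<lambda>m. m + Poly_Mapping.single i 1) ` exponents I d)"
      using m exponents_Suc[of i I d] by blast
  qed
  thus ?case using Suc by (meson finite_UN_I finite_imageI finite_subset)
qed (simp add: exponents_0)

text \<open>This recursion, which separates the monomials without the variable i from the multiples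
  of it, is behind all three counts below: the recursion of \<open>weight_count\<close>, the growth
  bound \<open>summable_card_exponents\<close> and the geometric product
  \<open>sums_exponents\<close>.\<close>

lemma sum_exponents_Suc:
  fixes F :: "_ \<Rightarrow> 'b :: comm_monoid_add"
  assumes "finite I" "i \<in> I"
  shows "(\<Sum>m\<in>exponents I (Suc d). F m) =
    (\<Sum>m\<in>exponents (I - {i}) (Suc d). F m) + (\<Sum>m\<in>exponents I d. F (m + Poly_Mapping.single i 1))"
proof -
  have "exponents (I - {i}) (Suc d) \<inter> (\<lambda>m. m + Poly_Mapping.single i 1) ` exponents I d = {}"
    by (auto simp: exponents_def keys_add_nat)
  moreover have "inj_on (\<lambda>m. m + Poly_Mapping.single i 1) (exponents I d)" by (auto intro: inj_onI)
  ultimately show ?thesis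
    unfolding exponents_Suc[OF assms(2)]
    using assms by (subst sum.union_disjoint) (auto simp: finite_exponents sum.reindex)
qed

text \<open>All weights w are kept, not only 0, because splitting off the variable i shifts the
  weight by \<open>a i\<close>.\<close>

definition weight_count :: "(nat \<Rightarrow> int) \<Rightarrow> nat set \<Rightarrow> int \<Rightarrow> complex fps" where
  "weight_count a I w = Abs_fps (\<lambda>d. of_nat (card {m \<in> exponents I d. weight a m = w}))"

lemma weight_count_nth:
  assumes "finite I"
  shows "fps_nth (weight_count a I w) d = (\<Sum>m\<in>exponents I d. if weight a m = w then 1 else 0)"
  using finite_exponents[OF assms] by (simp add: weight_count_def sum.If_cases Int_def)

lemma weight_count_rec:
  assumes "finite I" "i \<in> I"
  shows "weight_count a I w = weight_count a (I - {i}) w + fps_X * weight_count a I (w - a i)"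
proof (rule fps_ext)
  fix d
  show "fps_nth (weight_count a I w) d = fps_nth (weight_count a (I - {i}) w + fps_X * weight_count a I (w - a i)) d"
  proof (cases d)
    case 0
    thus ?thesis using assms by (simp add: weight_count_nth exponents_0)
  next
    case (Suc d')
    show ?thesis unfolding Suc fps_add_nth fps_X_mult_nth weight_count_nth[OF assms(1)]
        weight_count_nth[OF finite_Diff[OF assms(1)]] sum_exponents_Suc[OF assms]
      using assms by (simp add: weight_count_nth weight_add_single eq_diff_eq del: One_nat_def)
  qed
qed

definition rational_fps :: "complex fps \<Rightarrow> bool" where
  "rational_fps F \<longleftrightarrow> (\<exists>P Q. Q \<noteq> 0 \<and> fps_of_poly Q * F = fps_of_poly P)"

lemma rational_fps_0: "rational_fps 0"
  unfolding rational_fps_def by (intro exI[of _ 0] exI[of _ 1]) simp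

lemma rational_fps_1: "rational_fps 1"
  unfolding rational_fps_def by (intro exI[of _ 1]) simp

lemma rational_fps_add:
  assumes "rational_fps F" "rational_fps G" shows "rational_fps (F + G)"
proof -
  obtain P Q P' Q' where "Q \<noteq> 0" "fps_of_poly Q * F = fps_of_poly P"
    "Q' \<noteq> 0" "fps_of_poly Q' * G = fps_of_poly P'" using assms unfolding rational_fps_def by blast
  moreover from this have "fps_of_poly (Q * Q') * (F + G) = fps_of_poly (Q' * P + Q * P')"
    by (simp add: fps_of_poly_mult fps_of_poly_add algebra_simps)
  ultimately show ?thesis unfolding rational_fps_def by (metis mult_eq_0_iff)
qed

lemma rational_fps_X_power_mult:
  assumes "rational_fps F" shows "rational_fps (fps_X ^ k * F)"
proof -
  obtain P Q where "Q \<noteq> 0" "fps_of_poly Q * F = fps_of_poly P" using assms unfolding rational_fps_def by blast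
  moreover from this have "fps_of_poly Q * (fps_X ^ k * F) = fps_of_poly (monom 1 k * P)"
    by (simp add: fps_of_poly_mult fps_of_poly_monom')
  ultimately show ?thesis unfolding rational_fps_def by blast
qed

lemma rational_fps_sum:
  "(\<And>x. x \<in> A \<Longrightarrow> rational_fps (F x)) \<Longrightarrow> rational_fps (\<Sum>x\<in>A. F x)"
  by (induction A rule: infinite_finite_induct) (auto intro: rational_fps_add rational_fps_0)

lemma rational_fps_div:
  assumes "rational_fps (F - fps_X ^ r * F)" "r > 0" shows "rational_fps F"
proof -
  obtain P Q where PQ: "Q \<noteq> 0" "fps_of_poly Q * (F - fps_X ^ r * F) = fps_of_poly P"
    using assms unfolding rational_fps_def by blast
  have "coeff (1 - monom 1 r :: complex poly) 0 = 1" using assms(2) by simp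
  hence "(1 - monom 1 r :: complex poly) \<noteq> 0" by (metis coeff_0 zero_neq_one)
  moreover have "fps_of_poly (Q * (1 - monom 1 r)) * F = fps_of_poly P"
    using PQ(2) by (simp add: fps_of_poly_mult fps_of_poly_diff fps_of_poly_monom' algebra_simps)
  ultimately show ?thesis using PQ(1) unfolding rational_fps_def by (metis mult_eq_0_iff)
qed

text \<open>On a finite window the map \<open>\<tau>\<close> is eventually periodic, so the recursion closes up.\<close>

lemma rational_fps_recursion:
  fixes X Y :: "'w \<Rightarrow> complex fps" and \<tau> :: "'w \<Rightarrow> 'w"
  assumes fin: "finite W" and closed: "\<And>w. w \<in> W \<Longrightarrow> \<tau> w \<in> W"
    and rec: "\<And>w. w \<in> W \<Longrightarrow> X w = Y w + fps_X * X (\<tau> w)"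
    and Y: "\<And>w. w \<in> W \<Longrightarrow> rational_fps (Y w)"
    and w: "w \<in> W"
  shows "rational_fps (X w)"
proof -
  have W: "(\<tau> ^^ k) w \<in> W" if "w \<in> W" for k w by (induction k) (use that closed in auto)
  have iter: "X w = (\<Sum>i<k. fps_X ^ i * Y ((\<tau> ^^ i) w)) + fps_X ^ k * X ((\<tau> ^^ k) w)"
    if "w \<in> W" for k w
  proof (induction k)
    case (Suc k)
    show ?case using Suc rec[OF W[OF that, of k]] by (simp add: algebra_simps)
  qed simp
  have "\<not> inj (\<lambda>k. (\<tau> ^^ k) w)"
    using W[OF w] fin by (metis finite_subset image_subsetI infinite_UNIV_nat finite_imageD)
  then obtain i j where ij: "i < j" "(\<tau> ^^ i) w = (\<tau> ^^ j) w"
    unfolding inj_def by (metis linorder_neqE_nat)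
  define v where "v = (\<tau> ^^ i) w"
  have v: "v \<in> W" "(\<tau> ^^ (j - i)) v = v"
  proof -
    have "(\<tau> ^^ (j - i)) v = (\<tau> ^^ (j - i + i)) w" by (simp only: v_def funpow_add o_apply)
    thus "(\<tau> ^^ (j - i)) v = v" using ij by (simp add: v_def)
  qed (use W[OF w] in \<open>simp add: v_def\<close>)
  have "X v - fps_X ^ (j - i) * X v = (\<Sum>l<j - i. fps_X ^ l * Y ((\<tau> ^^ l) v))"
    using iter[OF v(1), of "j - i"] unfolding v(2) by (metis add_diff_cancel_right')
  moreover have "rational_fps (\<Sum>l<j - i. fps_X ^ l * Y ((\<tau> ^^ l) v))"
    using v W Y by (intro rational_fps_sum rational_fps_X_power_mult) auto
  ultimately have "rational_fps (X v)" using ij by (intro rational_fps_div[of "X v" "j - i"]) auto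
  thus ?thesis using W[OF w] Y
    by (subst iter[OF w, of i])
      (auto simp: v_def[symmetric] intro!: rational_fps_add rational_fps_sum rational_fps_X_power_mult)
qed

lemma weight_bounds:
  assumes "m \<in> exponents I d"
  shows "(\<And>i. i \<in> I \<Longrightarrow> a i < 0) \<Longrightarrow> weight a m \<le> 0" "(\<And>i. i \<in> I \<Longrightarrow> a i > 0) \<Longrightarrow> weight a m \<ge> 0"
     "(\<And>i. i \<in> I \<Longrightarrow> a i > 0) \<Longrightarrow> weight a m = 0 \<Longrightarrow> d = 0"
proof -
  have sub: "Poly_Mapping.keys m \<subseteq> I" using assms by (auto simp: exponents_def)
  show "(\<And>i. i \<in> I \<Longrightarrow> a i < 0) \<Longrightarrow> weight a m \<le> 0" unfolding weight_def
    by (rule sum_nonpos) (use sub in \<open>auto simp: mult_le_0_iff dest!: subsetD less_imp_le\<close>)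
  show "(\<And>i. i \<in> I \<Longrightarrow> a i > 0) \<Longrightarrow> weight a m \<ge> 0" unfolding weight_def
    by (rule sum_nonneg) (use sub in \<open>force intro: mult_nonneg_nonneg less_imp_le\<close>)
  show "d = 0" if pos: "\<And>i. i \<in> I \<Longrightarrow> a i > 0" and z: "weight a m = 0"
  proof -
    have "\<forall>i\<in>Poly_Mapping.keys m. a i * int (Poly_Mapping.lookup m i) = 0"
      using z unfolding weight_def
      by (subst (asm) sum_nonneg_eq_0_iff) (use sub pos in \<open>auto dest!: subsetD simp: less_imp_le\<close>)
    moreover have "a i * int (Poly_Mapping.lookup m i) \<noteq> 0" if "i \<in> Poly_Mapping.keys m" for i
      using pos[of i] sub that in_keys_iff[of i m] by auto
    ultimately have "Poly_Mapping.keys m = {}" by blast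
    thus ?thesis using assms by (auto simp: exponents_def)
  qed
qed

text \<open>States whose series is already known to be rational need no recursion. If
  \<open>X w\<close> is not rational, then neither is \<open>X (\<tau> w)\<close>; so the
  non-rational states are closed under \<tau>, and the preceding lemma applied to them gives a
  contradiction.\<close>

lemma rational_fps_recursion':
  fixes X Y :: "'w \<Rightarrow> complex fps" and \<tau> :: "'w \<Rightarrow> 'w"
  assumes fin: "finite W"
    and rec: "\<And>w. w \<in> W \<Longrightarrow> rational_fps (X w) \<or>
      (\<tau> w \<in> W \<and> rational_fps (Y w) \<and> X w = Y w + fps_X * X (\<tau> w))"
    and w: "w \<in> W"
  shows "rational_fps (X w)"
proof (rule ccontr)
  assume nonrat: "\<not> rational_fps (X w)"
  have "rational_fps (X w)"
  proof (rule rational_fps_recursion[where W = "{w \<in> W. \<not> rational_fps (X w)}" and Y = Y and \<tau> = \<tau>])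
    fix w assume "w \<in> {w \<in> W. \<not> rational_fps (X w)}"
    thus "\<tau> w \<in> {w \<in> W. \<not> rational_fps (X w)}"
      using rec[of w] rational_fps_add rational_fps_X_power_mult[of "X (\<tau> w)" 1] by auto
  qed (use fin rec w nonrat in auto)
  thus False using nonrat by simp
qed

text \<open>Monomials are built letter by letter, taking a positive letter while the remaining weight is
  positive and a negative one otherwise; then the remaining weight stays in a bounded window.\<close>

lemma rational_weight_count:
  assumes "finite I" "\<And>i. i \<in> I \<Longrightarrow> a i \<noteq> 0 \<and> \<bar>a i\<bar> \<le> A" "w \<in> {-A<..A}"
  shows "rational_fps (weight_count a I w)"
  using assms
proof (induction "card I" arbitrary: I w rule: less_induct)
  case (less I w)
  have IH: "rational_fps (weight_count a (I - {i}) w)" if "i \<in> I" "w \<in> {-A<..A}" for i w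
    by (rule less.hyps) (use less.prems that card_Diff1_less[of I i] in auto)
  define p where "p = (SOME i. i \<in> I \<and> a i > 0)"
  define q where "q = (SOME i. i \<in> I \<and> a i < 0)"
  have p: "p \<in> I" "a p > 0" if "\<exists>i\<in>I. a i > 0"
    using someI_ex[of "\<lambda>i. i \<in> I \<and> a i > 0"] that by (auto simp: p_def)
  have q: "q \<in> I" "a q < 0" if "\<exists>i\<in>I. a i < 0"
    using someI_ex[of "\<lambda>i. i \<in> I \<and> a i < 0"] that by (auto simp: q_def)
  show ?case
  \<comment> \<open>The window is half-open: subtracting a positive letter from w > 0 gives more
    than -A, and subtracting a negative letter from w \<le> 0 gives at most A.\<close>
  proof (rule rational_fps_recursion'[where W = "{-A<..A}" and \<tau> = "\<lambda>w. if w > 0 then w - a p else w - a q"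
          and X = "weight_count a I" and Y = "\<lambda>w. weight_count a (I - {if w > 0 then p else q}) w"])
    fix w assume w: "w \<in> {-A<..A}"
    \<comment> \<open>If no letter of the required sign exists, all letters have the opposite sign.
      Then a nonzero weight w cannot be attained and the series is 0, while for w = 0 only the
      constant monomial remains and the series is 1.\<close>
    consider "w > 0" "\<exists>i\<in>I. a i > 0" | "w > 0" "\<not> (\<exists>i\<in>I. a i > 0)" | "w \<le> 0" "\<exists>i\<in>I. a i < 0"
      | "w < 0" "\<not> (\<exists>i\<in>I. a i < 0)" | "w = 0" "\<not> (\<exists>i\<in>I. a i < 0)" by linarith
    thus "rational_fps (weight_count a I w) \<or>
      ((if w > 0 then w - a p else w - a q) \<in> {-A<..A} \<and> rational_fps (weight_count a (I - {if w > 0 then p else q}) w) \<and>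
       weight_count a I w = weight_count a (I - {if w > 0 then p else q}) w
         + fps_X * weight_count a I (if w > 0 then w - a p else w - a q))"
    proof cases
      case 1
      with p w less.prems(2)[of p] IH[of p w] weight_count_rec[OF less.prems(1), of p a w] show ?thesis by auto
    next
      case 2
      hence "\<And>i. i \<in> I \<Longrightarrow> a i < 0" using less.prems(2) by (meson linorder_neqE)
      hence "weight_count a I w = 0"
        unfolding weight_count_def using weight_bounds(1)[of _ I _ a] 2
        by (intro fps_ext) (fastforce simp: card_eq_0_iff)
      thus ?thesis by (simp add: rational_fps_0)
    next
      case 3
      with q w less.prems(2)[of q] IH[of q w] weight_count_rec[OF less.prems(1), of q a w] show ?thesis by auto
    next
      case 4
      hence "\<And>i. i \<in> I \<Longrightarrow> a i > 0" using less.prems(2) by (meson linorder_neqE)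
      hence "weight_count a I w = 0"
        unfolding weight_count_def using weight_bounds(2)[of _ I _ a] 4
        by (intro fps_ext) (fastforce simp: card_eq_0_iff)
      thus ?thesis by (simp add: rational_fps_0)
    next
      case 5
      hence pos: "\<And>i. i \<in> I \<Longrightarrow> a i > 0" using less.prems(2) by (meson linorder_neqE)
      have "weight_count a I 0 = 1"
      proof (rule fps_ext)
        fix d
        have "{m \<in> exponents I d. weight a m = 0} = (if d = 0 then {0} else {})"
          using weight_bounds(3)[of _ I d a] pos by (auto simp: exponents_0 weight_def)
        thus "fps_nth (weight_count a I 0) d = fps_nth 1 d" by (simp add: weight_count_def)
      qed
      thus ?thesis using 5 by (simp add: rational_fps_1)
    qed
  qed (use less.prems in auto)
qed

subsection \<open>Molien's integral\<close>

text \<open>A new variable replaces the counts by their partial sums, that is, it multiplies the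
  series by a geometric series; Cauchy products preserve absolute summability.\<close>

lemma summable_card_exponents:
  fixes t :: real
  assumes "finite I" "0 \<le> t" "t < 1"
  shows "summable (\<lambda>d. real (card (exponents I d)) * t ^ d)"
  using assms(1)
proof (induction I rule: finite_induct)
  case empty
  have "exponents {} d = {}" if "d \<noteq> 0" for d using that by (auto simp: exponents_def)
  thus ?case by (intro summable_finite[of "{0}"]) auto
next
  case (insert i I)
  have fin: "finite (insert i I)" using insert by simp
  have rec: "card (exponents (insert i I) (Suc d)) = card (exponents I (Suc d)) + card (exponents (insert i I) d)" for d
    using sum_exponents_Suc[OF fin, of i "\<lambda>_. 1::nat" d] insert by simp
  have eq: "real (card (exponents (insert i I) d)) = (\<Sum>e\<le>d. real (card (exponents I e)))" for d
    by (induction d) (simp_all add: exponents_0 rec)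
  have "summable (\<lambda>d. \<Sum>e\<le>d. (real (card (exponents I e)) * t ^ e) * t ^ (d - e))"
    using insert assms by (intro summable_Cauchy_product) (auto simp: abs_mult)
  moreover have "(\<Sum>e\<le>d. (real (card (exponents I e)) * t ^ e) * t ^ (d - e)) = real (card (exponents (insert i I) d)) * t ^ d" for d
    unfolding eq sum_distrib_right by (intro sum.cong) (auto simp: power_add[symmetric] mult.assoc)
  ultimately show ?case by simp
qed

text \<open>For |z| = 1 the number of monomials is a majorant, so the series with the additional
  variable i converges to some S. The recursion then gives \<open>S * (1 - t * z powi a i)\<close>
  as the product for the smaller set, and this factor is invertible because |t| < 1.\<close>

lemma sums_exponents:
  fixes t z :: complex
  assumes "finite I" "norm t < 1" "norm z = 1"
  shows "(\<lambda>d. (\<Sum>m\<in>exponents I d. z powi weight a m) * t ^ d) sums (\<Prod>i\<in>I. 1 / (1 - t * z powi a i))"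
  using assms(1)
proof (induction I rule: finite_induct)
  case empty
  have "exponents {} d = (if d = 0 then {0} else {})" for d by (auto simp: exponents_def)
  hence "(\<Sum>m\<in>exponents {} d. z powi weight a m) * t ^ d = (if d = 0 then 1 else 0)" for d
    by (simp add: weight_def)
  thus ?case using sums_single[of 0 "\<lambda>_. 1::complex"] by (simp add: eq_commute)
next
  case (insert i I)
  define p where "p I d = (\<Sum>m\<in>exponents I d. z powi weight a m)" for I d
  have z0: "z \<noteq> 0" using assms(3) by auto
  have fin: "finite (insert i I)" using insert by simp
  have bound: "norm (p (insert i I) d * t ^ d) \<le> real (card (exponents (insert i I) d)) * norm t ^ d" for d
  proof -
    have "norm (p (insert i I) d) \<le> (\<Sum>m\<in>exponents (insert i I) d. 1)"
      unfolding p_def by (rule sum_norm_le) (simp add: norm_power_int assms(3))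
    thus ?thesis by (simp add: norm_mult norm_power mult_right_mono)
  qed
  have "summable (\<lambda>d. real (card (exponents (insert i I) d)) * norm t ^ d)"
    by (rule summable_card_exponents[OF fin]) (use assms(2) in auto)
  hence "summable (\<lambda>d. p (insert i I) d * t ^ d)"
    by (rule summable_comparison_test'[where N = 0]) (rule bound)
  then obtain S where S: "(\<lambda>d. p (insert i I) d * t ^ d) sums S" by (auto simp: summable_def)
  have rec: "p (insert i I) (Suc d) = p I (Suc d) + z powi a i * p (insert i I) d" for d
    using sum_exponents_Suc[OF fin, of i "\<lambda>m. z powi weight a m" d] insert.hyps z0
    by (simp add: p_def weight_add_single power_int_add sum_distrib_left mult.commute del: One_nat_def)
  have "(\<lambda>d. p (insert i I) (Suc d) * t ^ Suc d) sums (S - p (insert i I) 0)"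
    using S by (subst sums_Suc_iff) simp
  moreover have "(\<lambda>d. p I (Suc d) * t ^ Suc d) sums ((\<Prod>i\<in>I. 1 / (1 - t * z powi a i)) - p I 0)"
    using insert.IH by (subst sums_Suc_iff) (simp add: p_def)
  ultimately have "(\<lambda>d. p (insert i I) (Suc d) * t ^ Suc d - p I (Suc d) * t ^ Suc d) sums
     (S - p (insert i I) 0 - ((\<Prod>i\<in>I. 1 / (1 - t * z powi a i)) - p I 0))" by (rule sums_diff)
  moreover have "p (insert i I) 0 = p I 0" by (simp add: p_def exponents_0)
  moreover have "p (insert i I) (Suc d) * t ^ Suc d - p I (Suc d) * t ^ Suc d
      = (t * z powi a i) * (p (insert i I) d * t ^ d)" for d by (simp add: rec algebra_simps)
  ultimately have "(\<lambda>d. (t * z powi a i) * (p (insert i I) d * t ^ d)) sums (S - (\<Prod>i\<in>I. 1 / (1 - t * z powi a i)))"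
    by simp
  from sums_unique2[OF this sums_mult[OF S]] have "S * (1 - t * z powi a i) = (\<Prod>i\<in>I. 1 / (1 - t * z powi a i))"
    by (simp add: algebra_simps)
  moreover have "norm (t * z powi a i) \<noteq> 1" using assms by (simp add: norm_mult norm_power_int)
  hence "1 - t * z powi a i \<noteq> 0" by (metis norm_one right_minus_eq)
  ultimately have "S = (\<Prod>i\<in>insert i I. 1 / (1 - t * z powi a i))"
    using insert.hyps by (simp add: field_simps)
  thus ?case using S by (simp add: p_def)
qed

lemma hilbert_series_nth:
  "fps_nth (hilbert_series n a) d = of_nat (card {m \<in> exponents {1..n} d. weight a m = 0})"
  by (simp add: hilbert_series_def dim_invariant_ring_deg finite_exponents)

lemma contour_integral_exp_period:
  fixes k :: int and p :: complex
  shows "(\<lambda>x. exp x powi k) contour_integrable_on linepath p (p + 2 * of_real pi * \<i>)"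
    and "contour_integral (linepath p (p + 2 * of_real pi * \<i>)) (\<lambda>x. exp x powi k)
      = (if k = 0 then 2 * of_real pi * \<i> else 0)"
proof -
  let ?\<gamma> = "linepath p (p + 2 * of_real pi * \<i>)"
  have *: "((\<lambda>x. exp x powi k) has_contour_integral (if k = 0 then 2 * of_real pi * \<i> else 0)) ?\<gamma>"
  proof (cases "k = 0")
    case True
    thus ?thesis using has_contour_integral_const_linepath[of 1 "p + 2 * of_real pi * \<i>" p] by simp
  next
    case False
    have eq: "exp x powi k = exp (of_int k * x)" for x :: complex by (simp add: exp_power_int)
    have "((\<lambda>x. exp (of_int k * x)) has_contour_integral
       exp (of_int k * pathfinish ?\<gamma>) / of_int k - exp (of_int k * pathstart ?\<gamma>) / of_int k) ?\<gamma>"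
      by (rule contour_integral_primitive[where S = UNIV])
        (use False in \<open>auto intro!: derivative_eq_intros\<close>)
    moreover have "exp (of_int k * (p + 2 * of_real pi * \<i>)) = exp (of_int k * p)"
      unfolding exp_eq by (rule exI[of _ k]) (simp add: algebra_simps)
    ultimately show ?thesis unfolding eq using False by simp
  qed
  show "(\<lambda>x. exp x powi k) contour_integrable_on ?\<gamma>" using * by (auto simp: contour_integrable_on_def)
  show "contour_integral ?\<gamma> (\<lambda>x. exp x powi k) = (if k = 0 then 2 * of_real pi * \<i> else 0)"
    using * by (rule contour_integral_unique)
qed

text \<open>Integration over one period removes every monomial of nonzero weight; it may be done
  term by term by the M-test, with the number of monomials as majorant. The base point p is left
  free on the imaginary axis so that the period can later be cut between two clusters of
  poles.\<close>

lemma hilbert_series_sums: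
  fixes p t :: complex
  assumes t: "norm t < 1" and p: "Re p = 0"
  shows "(\<lambda>d. fps_nth (hilbert_series n a) d * t ^ d) sums
    (contour_integral (linepath p (p + 2 * of_real pi * \<i>)) (\<lambda>x. \<Prod>i\<in>{1..n}. 1 / (1 - t * exp x powi a i))
      / (2 * of_real pi * \<i>))"
proof -
  let ?\<gamma> = "linepath p (p + 2 * of_real pi * \<i>)"
  define f where "f d x = (\<Sum>m\<in>exponents {1..n} d. exp x powi weight a m) * t ^ d" for d x
  have img: "norm (exp x) = 1" if "x \<in> path_image ?\<gamma>" for x
  proof -
    have "Re x = 0" using that p by (auto simp: closed_segment_def)
    thus ?thesis by simp
  qed
  have f_eq: "f d = (\<lambda>x. \<Sum>m\<in>exponents {1..n} d. t ^ d * exp x powi weight a m)" for d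
    unfolding f_def sum_distrib_right by (auto simp: mult.commute)
  have fint: "f d contour_integrable_on ?\<gamma>" for d
    unfolding f_eq
    by (intro contour_integrable_sum contour_integrable_lmul contour_integral_exp_period finite_exponents) auto
  have fval: "contour_integral ?\<gamma> (f d) = fps_nth (hilbert_series n a) d * t ^ d * (2 * of_real pi * \<i>)" for d
  proof -
    have "contour_integral ?\<gamma> (f d) = (\<Sum>m\<in>exponents {1..n} d. t ^ d * (if weight a m = 0 then 2 * of_real pi * \<i> else 0))"
      unfolding f_eq
      by (subst contour_integral_sum)
         (auto intro!: contour_integrable_lmul contour_integral_exp_period finite_exponents sum.cong
           simp: contour_integral_exp_period contour_integral_lmul)
    also have "\<dots> = (\<Sum>m\<in>{m \<in> exponents {1..n} d. weight a m = 0}. t ^ d * (2 * of_real pi * \<i>))"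
      by (rule sum.mono_neutral_cong_right) (auto simp: finite_exponents)
    finally show ?thesis by (simp add: hilbert_series_nth)
  qed
  have unif: "uniform_limit (path_image ?\<gamma>) (\<lambda>N x. \<Sum>d<N. f d x) (\<lambda>x. suminf (\<lambda>d. f d x)) sequentially"
  proof (rule Weierstrass_m_test)
    fix d x assume x: "x \<in> path_image ?\<gamma>"
    have "norm (\<Sum>m\<in>exponents {1..n} d. exp x powi weight a m) \<le> (\<Sum>m\<in>exponents {1..n} d. 1)"
      by (rule sum_norm_le) (simp only: norm_power_int img[OF x], simp)
    thus "norm (f d x) \<le> real (card (exponents {1..n} d)) * norm t ^ d"
      by (simp add: f_def norm_mult norm_power mult_right_mono)
  qed (rule summable_card_exponents, use t in auto)
  have "(\<lambda>N. contour_integral ?\<gamma> (\<lambda>x. \<Sum>d<N. f d x)) \<longlonglongrightarrow> contour_integral ?\<gamma> (\<lambda>x. suminf (\<lambda>d. f d x))"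
    by (rule contour_integral_uniform_limit(2)[OF _ unif, where B = "norm (2 * of_real pi * \<i>)"])
      (auto intro!: always_eventually contour_integrable_sum fint)
  hence "(\<lambda>N. (\<Sum>d<N. fps_nth (hilbert_series n a) d * t ^ d * (2 * of_real pi * \<i>)))
      \<longlonglongrightarrow> contour_integral ?\<gamma> (\<lambda>x. suminf (\<lambda>d. f d x))"
    by (subst (asm) contour_integral_sum) (auto simp: fint fval)
  hence "(\<lambda>d. fps_nth (hilbert_series n a) d * t ^ d * (2 * of_real pi * \<i>)) sums contour_integral ?\<gamma> (\<lambda>x. suminf (\<lambda>d. f d x))"
    by (simp add: sums_def)
  from sums_divide[OF this, of "2 * of_real pi * \<i>"]
  have "(\<lambda>d. fps_nth (hilbert_series n a) d * t ^ d) sums (contour_integral ?\<gamma> (\<lambda>x. suminf (\<lambda>d. f d x)) / (2 * of_real pi * \<i>))"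
    by simp
  also have "contour_integral ?\<gamma> (\<lambda>x. suminf (\<lambda>d. f d x)) =
     contour_integral ?\<gamma> (\<lambda>x. \<Prod>i\<in>{1..n}. 1 / (1 - t * exp x powi a i))"
    by (rule contour_integral_eq) (use sums_exponents[OF _ t img, THEN sums_unique] in \<open>auto simp: f_def\<close>)
  finally show ?thesis .
qed

subsection \<open>Clusters of residues\<close>

lemma contour_integral_circlepath_scale:
  fixes s :: real
  assumes "s > 0"
  shows "contour_integral (circlepath (c + of_real s * z) (s * r)) g =
     of_real s * contour_integral (circlepath z r) (\<lambda>y. g (c + of_real s * y))"
proof -
  have "circlepath (c + of_real s * z) (s * r) x = c + of_real s * circlepath z r x" for x
    by (simp add: circlepath algebra_simps)
  thus ?thesis unfolding contour_integral_integral vector_derivative_circlepath integral_mult_right[symmetric]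
    by (simp add: mult_ac)
qed

lemma contour_integral_linepath_translate:
  "contour_integral (linepath (a + c) (b + c)) f = contour_integral (linepath a b) (\<lambda>x. f (x + c))"
proof -
  have "linepath (a + c) (b + c) t = linepath a b t + c" for t
    by (simp add: linepath_def algebra_simps)
  thus ?thesis unfolding contour_integral_integral by simp
qed

text \<open>In the rescaled variable y the relevant poles are the points 1 / a_i. Those with a_i < 0
  lie in [-1, -1/A], hence within 1 - 1/A of -1, while those with a_i > 0 are farther than 1 from
  -1. The radius lies strictly between these two distances, so one circle about -1 separates them,
  whatever \<zeta> and s are.\<close>

definition cluster_radius :: "real \<Rightarrow> real" where "cluster_radius A = 1 - 1 / (2 * A)"

lemma cluster_radius_bounds:
  assumes "A \<ge> 1"
  shows "0 < cluster_radius A" "cluster_radius A < 1"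
  using assms by (auto simp: cluster_radius_def field_simps)

lemma cluster_radius_separates:
  fixes k :: int and A :: real
  assumes "k \<noteq> 0" "\<bar>k\<bar> \<le> A"
  shows "\<bar>1 / k + 1\<bar> < cluster_radius A \<longleftrightarrow> k < 0" "\<bar>1 / k + 1\<bar> \<noteq> cluster_radius A"
proof -
  have A: "A \<ge> 1" using assms by linarith
  have "\<bar>1 / k + 1\<bar> < cluster_radius A" if "k < 0"
  proof -
    have "1 \<le> - real_of_int k" "- real_of_int k \<le> A" using that assms(2) by linarith+
    hence "1 / A \<le> 1 / (- real_of_int k)" "1 / (- real_of_int k) \<le> 1" by (auto simp: field_simps)
    moreover have "1 / (2 * A) < 1 / A" using A by (simp add: field_simps)
    ultimately show ?thesis unfolding cluster_radius_def by (simp add: abs_if)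
  qed
  moreover have "\<bar>1 / k + 1\<bar> > cluster_radius A" if "k > 0"
  proof -
    have "1 / real_of_int k > 0" using that by simp
    thus ?thesis using cluster_radius_bounds[OF A] by linarith
  qed
  ultimately show "\<bar>1 / k + 1\<bar> < cluster_radius A \<longleftrightarrow> k < 0" "\<bar>1 / k + 1\<bar> \<noteq> cluster_radius A"
    using assms(1) by (cases "k < 0"; force)+
qed

text \<open>A common multiple L of the weights puts all poles on the levels Im x = 2 pi k / L. For s
  < pi / L the discs of radius less than s about the points \<open>cluster_center m\<close> are
  disjoint, because the centres are at least 2 pi / L apart.\<close>

context
  fixes a :: "nat \<Rightarrow> int" and I :: "nat set" and s :: real and A :: real and L :: nat
  assumes I: "finite I" and nz: "\<And>i. i \<in> I \<Longrightarrow> a i \<noteq> 0" and A: "\<And>i. i \<in> I \<Longrightarrow> \<bar>a i\<bar> \<le> A" "A \<ge> 1"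
    and neg: "\<exists>i\<in>I. a i < 0" and L: "L > 0" "\<And>i. i \<in> I \<Longrightarrow> a i dvd int L"
    and s: "0 < s" "s < pi / L"
begin

abbreviation (input) molien_integrand :: "complex \<Rightarrow> complex" where
  "molien_integrand x \<equiv> \<Prod>i\<in>I. 1 / (1 - exp (of_int (a i) * x - of_real s))"

abbreviation (input) molien_poles :: "complex set" where
  "molien_poles \<equiv> {x. \<exists>i\<in>I. exp (of_int (a i) * x - of_real s) = 1}"

lemma molien_poles_iff:
  "x \<in> molien_poles \<longleftrightarrow> (\<exists>i\<in>I. \<exists>k::int. of_int (a i) * x = of_real s + 2 * of_int k * of_real pi * \<i>)"
  unfolding mem_Collect_eq exp_eq_1 by (auto simp: complex_eq_iff algebra_simps)

lemma molien_polesD: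
  assumes "x \<in> molien_poles"
  shows "\<exists>i\<in>I. Re x = s / a i" "\<exists>k::int. Im x = 2 * pi * k / L"
proof -
  obtain i k where ik: "i \<in> I" "of_int (a i) * x = of_real s + 2 * of_int k * of_real pi * \<i>"
    using assms molien_poles_iff by auto
  have "a i * Re x = s" "a i * Im x = 2 * k * pi"
    using arg_cong[OF ik(2), of Re] arg_cong[OF ik(2), of Im] by auto
  moreover obtain l where l: "int L = a i * l" using L(2)[OF ik(1)] by (elim dvdE)
  moreover from this have "real L = a i * l" by (metis of_int_mult of_int_of_nat_eq)
  ultimately show "\<exists>i\<in>I. Re x = s / a i" "\<exists>k::int. Im x = 2 * pi * k / L"
    using ik(1) nz[OF ik(1)] L(1)
    by (auto intro!: bexI[of _ i] exI[of _ "k * l"] simp: field_simps)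
qed

lemma finite_molien_poles:
  assumes "bounded B"
  shows "finite (molien_poles \<inter> B)"
proof -
  obtain M where M: "\<And>x. x \<in> B \<Longrightarrow> norm x \<le> M" using assms unfolding bounded_iff by auto
  define N where "N = \<lceil>M * L\<rceil>"
  have "molien_poles \<inter> B \<subseteq> (\<lambda>(i, k). Complex (s / a i) (2 * pi * of_int k / L)) ` (I \<times> {-N..N})"
  proof
    fix x assume x: "x \<in> molien_poles \<inter> B"
    then obtain i k where ik: "i \<in> I" "Re x = s / a i" "Im x = 2 * pi * of_int k / L"
      using molien_polesD by blast
    have "\<bar>Im x\<bar> \<le> M" using M[of x] x abs_Im_le_cmod[of x] by auto
    hence "2 * pi * \<bar>real_of_int k\<bar> \<le> M * L" using L(1) ik(3) by (simp add: abs_mult field_simps)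
    moreover have "\<bar>real_of_int k\<bar> * 1 \<le> \<bar>real_of_int k\<bar> * (2 * pi)"
      by (rule mult_left_mono) (use pi_ge_two in linarith, simp)
    ultimately have "\<bar>real_of_int k\<bar> \<le> M * L" by (simp add: mult.commute)
    hence "k \<in> {-N..N}" unfolding N_def by (simp add: abs_le_iff) linarith
    moreover have "x = Complex (s / a i) (2 * pi * of_int k / L)" using ik by (simp add: complex_eq_iff)
    ultimately show "x \<in> (\<lambda>(i, k). Complex (s / a i) (2 * pi * of_int k / L)) ` (I \<times> {-N..N})"
      using ik(1) by auto
  qed
  thus ?thesis using I by (meson finite_SigmaI finite_atLeastAtMost_int finite_imageI finite_subset)
qed

lemma molien_integrand_holomorphic: "molien_integrand holomorphic_on (S - (molien_poles \<inter> S))"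
  by (intro holomorphic_intros) auto

lemma pole_distance:
  assumes "i \<in> I"
  shows "\<bar>s / a i + s\<bar> < s * cluster_radius A \<longleftrightarrow> a i < 0" "\<bar>s / a i + s\<bar> \<noteq> s * cluster_radius A"
proof -
  have "s / a i + s = s * (1 / a i + 1)" by (simp add: algebra_simps)
  hence *: "\<bar>s / a i + s\<bar> = s * \<bar>1 / a i + 1\<bar>" using s by (simp add: abs_mult)
  show "\<bar>s / a i + s\<bar> < s * cluster_radius A \<longleftrightarrow> a i < 0" "\<bar>s / a i + s\<bar> \<noteq> s * cluster_radius A"
    using cluster_radius_separates[OF nz[OF assms] A(1)[OF assms]] s unfolding * by auto
qed

text \<open>The summand is written \<open>of_real s * (- 1)\<close> so that
  \<open>contour_integral_circlepath_scale\<close> applies as it stands and produces the fixed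
  centre -1.\<close>

abbreviation (input) cluster_center :: "nat \<Rightarrow> complex" where
  "cluster_center m \<equiv> 2 * of_real pi * \<i> * of_nat m / of_nat L + of_real s * (- 1)"

lemma cluster_center_Re_Im: "Re (cluster_center m) = - s" "Im (cluster_center m) = 2 * pi * m / L"
  by auto

text \<open>The disc has radius below pi / L, half the distance between two levels of poles, so a
  pole in it lies on the level of the centre. The difference to the centre is then the real number s
  / a_i + s, to which the choice of the radius applies.\<close>

lemma pole_near_cluster:
  assumes "x \<in> molien_poles" "norm (x - cluster_center m) \<le> s * cluster_radius A"
  shows "Im x = 2 * pi * m / L" "Re x < 0" "norm (x - cluster_center m) < s * cluster_radius A"
proof -
  obtain i k where ik: "i \<in> I" "Re x = s / a i" "Im x = 2 * pi * of_int k / L"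
    using assms molien_polesD by blast
  have "s * cluster_radius A < s * 1" by (rule mult_strict_left_mono) (use s cluster_radius_bounds[OF A(2)] in auto)
  hence "\<bar>Im (x - cluster_center m)\<bar> < pi / L"
    using abs_Im_le_cmod[of "x - cluster_center m"] assms(2) s by linarith
  hence "\<bar>2 * pi * (of_int k - m) / L\<bar> < pi / L" using ik(3)
    by (simp add: cluster_center_Re_Im diff_divide_distrib right_diff_distrib)
  moreover have "2 * pi * (of_int k - m) / L = pi / L * (2 * (of_int k - real m))" by simp
  hence "\<bar>2 * pi * (of_int k - m) / L\<bar> = \<bar>pi / L\<bar> * \<bar>2 * (of_int k - real m)\<bar>" by (simp only: abs_mult)
  ultimately have "pi / L * \<bar>2 * (of_int k - real m)\<bar> < pi / L * 1" using L(1) by simp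
  hence "\<bar>2 * (of_int k - real m)\<bar> < 1" using L(1) by (subst (asm) mult_less_cancel_left_pos) auto
  hence "real_of_int \<bar>2 * (k - int m)\<bar> < 1" by simp
  hence "\<bar>2 * (k - int m)\<bar> < 1" by linarith
  hence "k = int m" by arith
  thus im: "Im x = 2 * pi * m / L" using ik by simp
  have "x - cluster_center m = of_real (s / a i + s)"
    using ik(2) im by (simp add: complex_eq_iff cluster_center_Re_Im)
  hence nrm: "norm (x - cluster_center m) = \<bar>s / a i + s\<bar>" by (metis norm_of_real)
  thus lt: "norm (x - cluster_center m) < s * cluster_radius A"
    using assms(2) pole_distance(2)[OF ik(1)] by linarith
  thus "Re x < 0" using pole_distance(1)[OF ik(1)] nrm s ik(2) by (simp add: divide_less_0_iff)
qed

text \<open>On the line Re x = -K a factor with negative weight has a large exponential and is at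
  most 1 / (K - s), by exp u \<ge> 1 + u. Every other factor is bounded by 1 / (1 - exp (-s)). One
  negative weight is thus enough for decay.\<close>

lemma norm_molien_integrand_left:
  assumes "Re x = - K" "K > s + 1"
  shows "norm (molien_integrand x) \<le> (1 / (1 - exp (- s))) ^ card I / (K - s)"
proof -
  define B where "B = 1 / (1 - exp (- s))"
  have B: "B \<ge> 1" using s by (simp add: B_def field_simps)
  have nrm: "norm (exp (of_int (a i) * x - of_real s)) = exp (- K * a i - s)" for i
    using assms by simp
  obtain j where j: "j \<in> I" "a j < 0" using neg by blast
  have neg_bound: "norm (1 / (1 - exp (of_int (a i) * x - of_real s))) \<le> 1 / (K - s)" if "a i < 0" for i
  proof -
    have "K * 1 \<le> K * (- a i)" using that assms s by (intro mult_left_mono) auto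
    hence "K - s \<le> exp (- K * a i - s) - 1" using exp_ge_add_one_self[of "- K * a i - s"] by linarith
    also have "\<dots> \<le> norm (1 - exp (of_int (a i) * x - of_real s))"
      using nrm[of i] norm_triangle_ineq2[of "exp (of_int (a i) * x - of_real s)" 1] by (simp add: norm_minus_commute)
    finally show ?thesis using assms s unfolding norm_divide norm_one by (intro frac_le) auto
  qed
  have all_bound: "norm (1 / (1 - exp (of_int (a i) * x - of_real s))) \<le> B" if "i \<in> I" for i
  proof (cases "a i < 0")
    case True
    have "1 / (K - s) \<le> 1" using assms by simp
    thus ?thesis using neg_bound[OF True] B by linarith
  next
    case False
    hence "K * a i \<ge> 0" using assms s by simp
    hence "exp (- K * a i - s) \<le> exp (- s)" by simp
    moreover have "1 - exp (- K * a i - s) \<le> norm (1 - exp (of_int (a i) * x - of_real s))"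
      using norm_triangle_ineq2[of 1 "exp (of_int (a i) * x - of_real s)"] unfolding nrm[of i] by simp
    ultimately have "1 - exp (- s) \<le> norm (1 - exp (of_int (a i) * x - of_real s))" by linarith
    moreover have "1 - exp (- s) > 0" using s by simp
    ultimately show ?thesis unfolding B_def by (simp add: norm_divide frac_le)
  qed
  have "norm (molien_integrand x) = norm (1 / (1 - exp (of_int (a j) * x - of_real s))) *
      (\<Prod>i\<in>I - {j}. norm (1 / (1 - exp (of_int (a i) * x - of_real s))))"
    unfolding prod_norm[symmetric] by (rule prod.remove[OF I j(1)])
  also have "\<dots> \<le> (1 / (K - s)) * (\<Prod>i\<in>I - {j}. B)"
    using neg_bound[OF j(2)] all_bound assms by (intro mult_mono prod_mono) (auto intro: prod_nonneg)
  also have "\<dots> \<le> (1 / (K - s)) * B ^ card I"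
    using B assms by (intro mult_left_mono) (auto intro!: power_increasing card_mono I)
  finally show ?thesis by (simp add: B_def)
qed

text \<open>Both sides are residue sums over the same poles. The horizontal sides of the rectangle
  run halfway between two levels of poles, the right side lies on the imaginary axis, and the left
  side is beyond all poles because these satisfy |Re x| \<le> s; so the boundary carries no
  pole.\<close>

lemma sum_residues_clusters:
  assumes "K > 2 * s + 1"
  defines "S \<equiv> box (Complex (- K - 1) (- pi / L - 1)) (Complex 1 (2 * pi))"
  shows "contour_integral (rectpath (Complex (- K) (- pi / L)) (Complex 0 (2 * pi - pi / L))) molien_integrand
     = (\<Sum>m<L. contour_integral (circlepath (cluster_center m) (s * cluster_radius A)) molien_integrand)"
proof -
  define z1 where "z1 = Complex (- K) (- pi / L)"
  define z2 where "z2 = Complex 0 (2 * pi - pi / L)"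
  define pts where "pts = molien_poles \<inter> S"
  define r where "r = s * cluster_radius A"
  have piL: "pi / L > 0" "pi / L \<le> pi" using L(1) by (auto simp: field_simps)
  have r: "0 < r" "r < s" using s cluster_radius_bounds[OF A(2)] by (auto simp: r_def)
  have fin: "finite pts" unfolding pts_def S_def by (intro finite_molien_poles bounded_box)
  have S: "open S" "connected S" "convex S" unfolding S_def by (auto intro: convex_connected)
  have hol: "molien_integrand holomorphic_on (S - pts)" unfolding pts_def by (rule molien_integrand_holomorphic)
  have poles: "\<bar>Re x\<bar> \<le> s" "Re x \<noteq> 0" "Im x \<noteq> - pi / L" "Im x \<noteq> 2 * pi - pi / L" if pole: "x \<in> molien_poles" for x
  proof -
    obtain i k where ik: "i \<in> I" "Re x = s / a i" "Im x = 2 * pi * of_int k / L"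
      using molien_polesD[OF pole] by blast
    have "\<bar>real_of_int (a i)\<bar> \<ge> 1" using nz[OF ik(1)] by linarith
    hence "s / \<bar>real_of_int (a i)\<bar> \<le> s / 1" using s by (intro divide_left_mono) auto
    thus "\<bar>Re x\<bar> \<le> s" using s by (simp add: ik(2) abs_divide)
    show "Re x \<noteq> 0" using ik(2) nz[OF ik(1)] s by simp
    have Imx: "Im x = pi / L * of_int (2 * k)" using ik(3) by simp
    \<comment> \<open>Parity: poles sit at even multiples of pi / L, the horizontal sides at the odd
      multiples -1 and 2 L - 1.\<close>
    have "Im x \<noteq> pi / L * of_int l" if "odd l" for l
    proof
      assume "Im x = pi / L * of_int l"
      hence "real_of_int (2 * k) = of_int l" using Imx piL L(1) by simp
      hence "2 * k = l" by linarith
      thus False using that by (metis dvd_triv_left)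
    qed
    from this[of "-1"] this[of "2 * int L - 1"] show "Im x \<noteq> - pi / L" "Im x \<noteq> 2 * pi - pi / L"
      using L(1) by (auto simp: field_simps)
  qed
  have "contour_integral (rectpath z1 z2) molien_integrand =
      of_real (2 * pi) * \<i> * (\<Sum>p\<in>pts. winding_number (rectpath z1 z2) p * residue molien_integrand p)"
  proof (rule Residue_theorem[OF S(1,2) fin hol])
    have img: "path_image (rectpath z1 z2) \<subseteq> S"
      using path_image_rectpath_subset_cbox[of z1 z2] piL assms(1) s
      by (force simp: z1_def z2_def S_def in_cbox_complex_iff in_box_complex_iff)
    moreover have "path_image (rectpath z1 z2) \<inter> molien_poles = {}"
    proof -
      have "x \<notin> molien_poles" if img: "x \<in> path_image (rectpath z1 z2)" for x
      proof
        assume "x \<in> molien_poles"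
        from poles[OF this] show False
          using img assms(1) s piL unfolding z1_def z2_def by (subst (asm) path_image_rectpath) auto
      qed
      thus ?thesis by blast
    qed
    ultimately show "path_image (rectpath z1 z2) \<subseteq> S - pts" by (auto simp: pts_def)
    show "\<forall>z. z \<notin> S \<longrightarrow> winding_number (rectpath z1 z2) z = 0"
      using img S(3) by (auto intro!: winding_number_zero_outside)
  qed auto
  also have "(\<Sum>p\<in>pts. winding_number (rectpath z1 z2) p * residue molien_integrand p)
      = (\<Sum>p\<in>pts \<inter> box z1 z2. residue molien_integrand p)"
  proof (rule sum.mono_neutral_cong_right[OF fin])
    show "\<forall>p\<in>pts - pts \<inter> box z1 z2. winding_number (rectpath z1 z2) p * residue molien_integrand p = 0"
    proof
      fix p assume p: "p \<in> pts - pts \<inter> box z1 z2"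
      have "p \<notin> cbox z1 z2" using p poles[of p] assms(1) s
        by (auto simp: pts_def in_cbox_complex_iff in_box_complex_iff z1_def z2_def)
      hence "winding_number (rectpath z1 z2) p = 0"
        using path_image_rectpath_subset_cbox[of z1 z2] assms(1) s piL
        by (intro winding_number_zero_outside[of _ "cbox z1 z2"]) (auto simp: z1_def z2_def)
      thus "winding_number (rectpath z1 z2) p * residue molien_integrand p = 0" by simp
    qed
  qed (auto simp: winding_number_rectpath)
  \<comment> \<open>Inside the box Re x < 0, so its poles come from negative weights; its vertical
    range contains exactly the levels of the clusters 0, ..., L - 1.\<close>
  also have "pts \<inter> box z1 z2 = (\<Union>m<L. pts \<inter> ball (cluster_center m) r)"
  proof (intro equalityI subsetI)
    fix x assume x: "x \<in> pts \<inter> box z1 z2"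
    then obtain i k where ik: "i \<in> I" "Re x = s / a i" "Im x = 2 * pi * of_int k / L"
      using molien_polesD by (force simp: pts_def)
    have "- pi / L < Im x" "Im x < 2 * pi - pi / L" "Re x < 0"
      using x by (auto simp: in_box_complex_iff z1_def z2_def)
    hence "pi / L * (-1) < pi / L * of_int (2 * k)" "pi / L * of_int (2 * k) < pi / L * of_int (2 * int L - 1)"
      using L(1) by (auto simp: ik(3) field_simps)
    hence "-1 < real_of_int (2 * k)" "real_of_int (2 * k) < of_int (2 * int L - 1)"
      using piL(1) by (auto simp only: mult_less_cancel_left_pos)
    hence k: "k \<ge> 0" "k < int L" by linarith+
    have "x - cluster_center (nat k) = of_real (s / a i + s)"
      using ik(2,3) k by (simp add: complex_eq_iff)
    hence "norm (x - cluster_center (nat k)) = \<bar>s / a i + s\<bar>" by (metis norm_of_real)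
    also have "\<dots> < r" using pole_distance(1)[OF ik(1)] \<open>Re x < 0\<close> ik(2) s nz[OF ik(1)]
      by (auto simp: r_def divide_less_0_iff)
    finally have "x \<in> ball (cluster_center (nat k)) r" by (simp add: dist_norm norm_minus_commute)
    thus "x \<in> (\<Union>m<L. pts \<inter> ball (cluster_center m) r)" using x k by (intro UN_I[of "nat k"]) auto
  next
    fix x assume "x \<in> (\<Union>m<L. pts \<inter> ball (cluster_center m) r)"
    then obtain m where m: "m < L" "x \<in> pts" "x \<in> ball (cluster_center m) r" by blast
    hence pole: "x \<in> molien_poles" and "norm (x - cluster_center m) \<le> s * cluster_radius A"
      by (auto simp: pts_def r_def dist_norm norm_minus_commute)
    from pole_near_cluster(1,2)[OF this] have im: "Im x = 2 * pi * m / L" "Re x < 0" .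
    have "pi / L * real (2 * m) < pi / L * (2 * L - 1)" "pi / L * (-1) < pi / L * real (2 * m)"
      by (rule mult_strict_left_mono; use m(1) piL in simp)+
    hence "Im x < 2 * pi - pi / L" "- pi / L < Im x"
      using L(1) by (auto simp: im(1) field_simps)
    thus "x \<in> pts \<inter> box z1 z2" using m(2) im poles(1)[OF pole] assms(1) s
      by (auto simp: in_box_complex_iff z1_def z2_def)
  qed
  also have "(\<Sum>p\<in>(\<Union>m<L. pts \<inter> ball (cluster_center m) r). residue molien_integrand p)
     = (\<Sum>m<L. \<Sum>p\<in>pts \<inter> ball (cluster_center m) r. residue molien_integrand p)"
  proof (rule sum.UNION_disjoint)
    show "\<forall>i\<in>{..<L}. \<forall>j\<in>{..<L}. i \<noteq> j \<longrightarrow>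
        pts \<inter> ball (cluster_center i) r \<inter> (pts \<inter> ball (cluster_center j) r) = {}"
    proof (intro ballI impI, rule ccontr)
      fix i j assume "i \<noteq> j" "pts \<inter> ball (cluster_center i) r \<inter> (pts \<inter> ball (cluster_center j) r) \<noteq> {}"
      then obtain x where x: "x \<in> pts" "x \<in> ball (cluster_center i) r" "x \<in> ball (cluster_center j) r"
        by blast
      hence "x \<in> molien_poles" "norm (x - cluster_center i) \<le> s * cluster_radius A"
          "norm (x - cluster_center j) \<le> s * cluster_radius A"
        by (auto simp: pts_def r_def dist_norm norm_minus_commute)
      hence "Im x = 2 * pi * i / L" "Im x = 2 * pi * j / L" using pole_near_cluster(1) by blast+
      thus False using \<open>i \<noteq> j\<close> L(1) by simp
    qed
  qed (use fin in auto)
  also have "of_real (2 * pi) * \<i> * \<dots> = (\<Sum>m<L. contour_integral (circlepath (cluster_center m) r) molien_integrand)"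
  proof (subst sum_distrib_left, rule sum.cong[OF refl])
    fix m assume m: "m \<in> {..<L}"
    have "contour_integral (circlepath (cluster_center m) r) molien_integrand =
       of_real (2 * pi) * \<i> * (\<Sum>p\<in>pts. winding_number (circlepath (cluster_center m) r) p * residue molien_integrand p)"
    proof (rule Residue_theorem[OF S(1,2) fin hol])
      have "cball (cluster_center m) r \<subseteq> S"
      proof
        fix x assume "x \<in> cball (cluster_center m) r"
        hence "norm (x - cluster_center m) \<le> r" by (simp add: dist_norm norm_minus_commute)
        hence "\<bar>Re (x - cluster_center m)\<bar> \<le> r" "\<bar>Im (x - cluster_center m)\<bar> \<le> r"
          using abs_Re_le_cmod[of "x - cluster_center m"] abs_Im_le_cmod[of "x - cluster_center m"] by linarith+
        moreover have "pi / L * real (2 * m) \<le> pi / L * (2 * L - 2)" using m piL by (intro mult_left_mono) auto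
        hence "2 * pi * m / L \<le> 2 * pi - 2 * (pi / L)" "0 \<le> 2 * pi * m / L" using L(1) by (auto simp: field_simps)
        moreover have "Re (x - cluster_center m) = Re x + s" "Im (x - cluster_center m) = Im x - 2 * pi * m / L"
          by (simp_all add: cluster_center_Re_Im)
        ultimately have "\<bar>Re x + s\<bar> \<le> r" "- r \<le> Im x" "Im x \<le> 2 * pi - 2 * (pi / L) + r" by linarith+
        thus "x \<in> S" using r s assms(1) piL unfolding S_def in_box_complex_iff by auto
      qed
      hence img: "path_image (circlepath (cluster_center m) r) \<subseteq> S" using r by (auto simp: sphere_def)
      moreover have "x \<notin> molien_poles" if "x \<in> path_image (circlepath (cluster_center m) r)" for x
        using that r pole_near_cluster(3)[of x m]
        by (auto simp: dist_norm norm_minus_commute r_def)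
      ultimately show "path_image (circlepath (cluster_center m) r) \<subseteq> S - pts" by (auto simp: pts_def)
      show "\<forall>z. z \<notin> S \<longrightarrow> winding_number (circlepath (cluster_center m) r) z = 0"
        using img S(3) by (auto intro!: winding_number_zero_outside)
    qed auto
    also have "(\<Sum>p\<in>pts. winding_number (circlepath (cluster_center m) r) p * residue molien_integrand p)
       = (\<Sum>p\<in>pts \<inter> ball (cluster_center m) r. residue molien_integrand p)"
    proof (rule sum.mono_neutral_cong_right[OF fin])
      show "\<forall>p\<in>pts - pts \<inter> ball (cluster_center m) r.
          winding_number (circlepath (cluster_center m) r) p * residue molien_integrand p = 0"
      proof
        fix p assume p: "p \<in> pts - pts \<inter> ball (cluster_center m) r"
        have "p \<notin> cball (cluster_center m) r"
          using p pole_near_cluster(3)[of p m] by (auto simp: pts_def r_def dist_norm norm_minus_commute)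
        hence "winding_number (circlepath (cluster_center m) r) p = 0"
          using r by (intro winding_number_zero_outside[of _ "cball (cluster_center m) r"]) auto
        thus "winding_number (circlepath (cluster_center m) r) p * residue molien_integrand p = 0" by simp
      qed
      show "winding_number (circlepath (cluster_center m) r) x * residue molien_integrand x = residue molien_integrand x"
        if "x \<in> pts \<inter> ball (cluster_center m) r" for x
        using that by (subst winding_number_circlepath) (auto simp: dist_norm norm_minus_commute)
    qed auto
    finally show "of_real (2 * pi) * \<i> * (\<Sum>p\<in>pts \<inter> ball (cluster_center m) r. residue molien_integrand p)
       = contour_integral (circlepath (cluster_center m) r) molien_integrand" by simp
  qed
  finally show ?thesis unfolding z1_def z2_def r_def .
qed

text \<open>The horizontal sides cancel because the integrand has period 2 pi i, and the left side
  is O(1 / K). The difference of the two sides of the claim does not depend on K, so it is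
  0.\<close>

lemma molien_integral_clusters:
  "contour_integral (linepath (Complex 0 (- pi / L)) (Complex 0 (- pi / L) + 2 * of_real pi * \<i>)) molien_integrand
     = (\<Sum>m<L. contour_integral (circlepath (cluster_center m) (s * cluster_radius A)) molien_integrand)"
    (is "?right = ?clusters")
proof -
  define B where "B = (1 / (1 - exp (- s))) ^ card I"
  define a2 where "a2 = Complex 0 (- pi / L)"
  define z2 where "z2 = Complex 0 (2 * pi - pi / L)"
  have bound: "norm (?right - ?clusters) \<le> B / (K - s) * (2 * pi)" if K: "K > 2 * s + 1" for K
  proof -
    define z1 where "z1 = Complex (- K) (- pi / L)"
    define a4 where "a4 = Complex (- K) (2 * pi - pi / L)"
    have cont: "continuous_on (path_image (rectpath z1 z2)) molien_integrand"
    proof (rule continuous_on_subset)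
      show "continuous_on (UNIV - molien_poles) molien_integrand"
        by (intro continuous_intros) auto
      have "x \<notin> molien_poles" if img: "x \<in> path_image (rectpath z1 z2)" for x
      proof
        assume pole: "x \<in> molien_poles"
        obtain i k where ik: "i \<in> I" "Re x = s / a i" "Im x = 2 * pi * of_int k / L"
          using molien_polesD[OF pole] by blast
        have "\<bar>real_of_int (a i)\<bar> \<ge> 1" using nz[OF ik(1)] by linarith
        hence "s / \<bar>real_of_int (a i)\<bar> \<le> s / 1" using s by (intro divide_left_mono) auto
        hence "\<bar>Re x\<bar> \<le> s" using s by (simp add: ik(2) abs_divide)
        moreover have "Re x \<noteq> 0" using ik(2) nz[OF ik(1)] s by simp
        moreover have "Im x \<noteq> pi / L * of_int l" if "odd l" for l
        proof
          assume "Im x = pi / L * of_int l"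
          hence "real_of_int (2 * k) = of_int l" using ik(3) L(1) by simp
          hence "2 * k = l" by linarith
          thus False using that by (metis dvd_triv_left)
        qed
        from this[of "-1"] this[of "2 * int L - 1"] have "Im x \<noteq> - pi / L" "Im x \<noteq> 2 * pi - pi / L"
          using L(1) by (auto simp: field_simps)
        moreover have "pi / L \<le> pi" using L(1) by (simp add: field_simps)
        ultimately show False
          using img K s unfolding z1_def z2_def by (subst (asm) path_image_rectpath) auto
      qed
      thus "path_image (rectpath z1 z2) \<subseteq> UNIV - molien_poles" by blast
    qed
    have path: "rectpath z1 z2 = linepath z1 a2 +++ linepath a2 z2 +++ linepath z2 a4 +++ linepath a4 z1"
      by (simp add: rectpath_def Let_def z1_def z2_def a2_def a4_def)
    have img: "path_image (rectpath z1 z2) = closed_segment z1 a2 \<union> closed_segment a2 z2 \<union> closed_segment z2 a4 \<union> closed_segment a4 z1"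
      unfolding path by (simp add: path_image_join Un_assoc)
    have int: "molien_integrand contour_integrable_on linepath u v"
      if "closed_segment u v \<subseteq> path_image (rectpath z1 z2)" for u v
      by (rule contour_integrable_continuous_linepath) (rule continuous_on_subset[OF cont that])
    have ints: "molien_integrand contour_integrable_on linepath z1 a2" "molien_integrand contour_integrable_on linepath a2 z2"
      "molien_integrand contour_integrable_on linepath z2 a4" "molien_integrand contour_integrable_on linepath a4 z1"
      by (rule int; use img in blast)+
    have "contour_integral (rectpath z1 z2) molien_integrand = contour_integral (linepath z1 a2) molien_integrand
      + contour_integral (linepath a2 z2) molien_integrand + contour_integral (linepath z2 a4) molien_integrand
      + contour_integral (linepath a4 z1) molien_integrand"
    proof -
      from ints have "(molien_integrand has_contour_integral contour_integral (linepath z1 a2) molien_integrand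
       + (contour_integral (linepath a2 z2) molien_integrand + (contour_integral (linepath z2 a4) molien_integrand
       + contour_integral (linepath a4 z1) molien_integrand))) (rectpath z1 z2)"
        unfolding path by (intro has_contour_integral_join has_contour_integral_integral) auto
      thus ?thesis by (simp add: contour_integral_unique add.assoc)
    qed
    moreover have "contour_integral (linepath z2 a4) molien_integrand = - contour_integral (linepath z1 a2) molien_integrand"
    proof -
      have "contour_integral (linepath a4 z2) molien_integrand
          = contour_integral (linepath (z1 + 2 * of_real pi * \<i>) (a2 + 2 * of_real pi * \<i>)) molien_integrand"
        by (intro arg_cong2[where f = contour_integral] arg_cong2[where f = linepath])
          (auto simp: z1_def z2_def a2_def a4_def complex_eq_iff)
      also have "\<dots> = contour_integral (linepath z1 a2) (\<lambda>x. molien_integrand (x + 2 * of_real pi * \<i>))"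
        by (rule contour_integral_linepath_translate)
      also have "(\<lambda>x. molien_integrand (x + 2 * of_real pi * \<i>)) = molien_integrand"
      proof
        fix x
        have "exp (of_int k * (x + 2 * of_real pi * \<i>) - of_real s) = exp (of_int k * x - of_real s)" for k
          unfolding exp_eq by (rule exI[of _ k]) (simp add: algebra_simps)
        thus "molien_integrand (x + 2 * of_real pi * \<i>) = molien_integrand x" by simp
      qed
      finally show ?thesis
        using contour_integral_reverse_linepath[of z2 a4 molien_integrand] continuous_on_subset[OF cont, of "closed_segment z2 a4"] img
        by auto
    qed
    moreover have "contour_integral (rectpath z1 z2) molien_integrand = ?clusters"
      unfolding z1_def z2_def by (rule sum_residues_clusters[OF K])
    ultimately have eq: "contour_integral (linepath a2 z2) molien_integrand - ?clusters = - contour_integral (linepath a4 z1) molien_integrand"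
      by (simp add: algebra_simps)
    have "norm (contour_integral (linepath a4 z1) molien_integrand) \<le> B / (K - s) * norm (z1 - a4)"
    proof (rule contour_integral_bound_linepath)
      show "molien_integrand contour_integrable_on linepath a4 z1" by (rule ints(4))
      show "0 \<le> B / (K - s)" using K s by (simp add: B_def)
      fix x assume "x \<in> closed_segment a4 z1"
      hence "Re x = - K" by (auto simp: closed_segment_same_Re a4_def z1_def)
      thus "norm (molien_integrand x) \<le> B / (K - s)"
        unfolding B_def using K s by (intro norm_molien_integrand_left) auto
    qed
    also have "norm (z1 - a4) = 2 * pi"
      by (simp add: z1_def a4_def cmod_def real_sqrt_mult)
    finally have "norm (contour_integral (linepath a2 z2) molien_integrand - ?clusters) \<le> B / (K - s) * (2 * pi)"
      unfolding eq by simp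
    also have "z2 = a2 + 2 * of_real pi * \<i>" by (simp add: a2_def z2_def complex_eq_iff)
    finally show ?thesis by (simp add: a2_def)
  qed
  have lim: "((\<lambda>K. B / (K - s) * (2 * pi)) \<longlongrightarrow> 0) at_top"
    by real_asymp
  have "norm (?right - ?clusters) \<le> 0"
  proof (rule tendsto_lowerbound[OF lim])
    show "\<forall>\<^sub>F K in at_top. norm (?right - ?clusters) \<le> B / (K - s) * (2 * pi)"
      using eventually_gt_at_top[of "2 * s + 1"] by (rule eventually_mono) (rule bound)
  qed simp
  thus ?thesis by simp
qed

end

text \<open>An identity rather than an approximation: for every positive s < pi / L the
  contributions are integrals over a circle that depends neither on s nor on \<zeta>. The behaviour
  as s tends to 0 is thereby moved into the integrand.\<close>

theorem hilbert_series_clusters: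
  fixes a :: "nat \<Rightarrow> int" and n L :: nat and s A :: real
  assumes nz: "\<And>i. i \<in> {1..n} \<Longrightarrow> a i \<noteq> 0" and A: "\<And>i. i \<in> {1..n} \<Longrightarrow> \<bar>a i\<bar> \<le> A" "A \<ge> 1"
    and neg: "\<exists>i\<in>{1..n}. a i < 0" and L: "L > 0" "\<And>i. i \<in> {1..n} \<Longrightarrow> a i dvd int L"
    and s: "0 < s" "s < pi / L"
  shows "(\<lambda>d. fps_nth (hilbert_series n a) d * exp (- of_real s) ^ d) sums
    (\<Sum>\<zeta> | \<zeta> ^ L = 1. of_real s / (2 * of_real pi * \<i>) * contour_integral (circlepath (-1) (cluster_radius A))
       (\<lambda>y. \<Prod>i\<in>{1..n}. 1 / (1 - \<zeta> powi a i * exp (- (of_real s * (1 - of_int (a i) * y))))))"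
proof -
  define p where "p = Complex 0 (- pi / L)"
  define R where "R = cluster_radius A"
  define g where "g x = (\<Prod>i\<in>{1..n}. 1 / (1 - exp (of_int (a i) * x - of_real s)))" for x :: complex
  have "(\<Prod>i\<in>{1..n}. 1 / (1 - exp (- of_real s) * exp x powi a i)) = g x" for x
    unfolding g_def by (simp add: exp_power_int exp_diff exp_minus field_simps)
  moreover have "norm (exp (- complex_of_real s)) < 1" using s by simp
  ultimately have sums: "(\<lambda>d. fps_nth (hilbert_series n a) d * exp (- of_real s) ^ d) sums
      (contour_integral (linepath p (p + 2 * of_real pi * \<i>)) g / (2 * of_real pi * \<i>))"
    using hilbert_series_sums[of "exp (- of_real s)" p n a] by (simp add: p_def)
  have "contour_integral (linepath p (p + 2 * of_real pi * \<i>)) g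
     = (\<Sum>m<L. contour_integral (circlepath (2 * of_real pi * \<i> * of_nat m / of_nat L + of_real s * (- 1)) (s * R)) g)"
    unfolding p_def g_def R_def by (rule molien_integral_clusters) (use assms in auto)
  also have "\<dots> = (\<Sum>m<L. of_real s * contour_integral (circlepath (-1) R)
      (\<lambda>y. g (2 * of_real pi * \<i> * of_nat m / of_nat L + of_real s * y)))"
    using s by (simp only: contour_integral_circlepath_scale)
  also have "\<dots> = (\<Sum>m<L. of_real s * contour_integral (circlepath (-1) R)
      (\<lambda>y. \<Prod>i\<in>{1..n}. 1 / (1 - exp (2 * of_real pi * \<i> * of_nat m / of_nat L) powi a i * exp (- (of_real s * (1 - of_int (a i) * y))))))"
  proof -
    have "exp (of_int k * (u + of_real s * y) - of_real s) = exp u powi k * exp (- (of_real s * (1 - of_int k * y)))"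
      for k and u y :: complex
      by (simp add: exp_power_int algebra_simps flip: exp_add)
    thus ?thesis by (simp add: g_def)
  qed
  also have "\<dots> = (\<Sum>\<zeta> | \<zeta> ^ L = 1. of_real s * contour_integral (circlepath (-1) R)
      (\<lambda>y. \<Prod>i\<in>{1..n}. 1 / (1 - \<zeta> powi a i * exp (- (of_real s * (1 - of_int (a i) * y))))))"
  proof (rule sum.reindex_bij_betw)
    have "bij_betw (\<lambda>k. cis (2 * pi * real k / real L)) {..<L} {\<zeta>. \<zeta> ^ L = 1}"
      by (rule Complex.bij_betw_roots_unity[OF L(1)])
    thus "bij_betw (\<lambda>m. exp (2 * of_real pi * \<i> * of_nat m / of_nat L)) {..<L} {\<zeta>. \<zeta> ^ L = 1}"
      by (simp add: cis_conv_exp mult_ac)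
  qed
  finally have "contour_integral (linepath p (p + 2 * of_real pi * \<i>)) g / (2 * of_real pi * \<i>) =
    (\<Sum>\<zeta> | \<zeta> ^ L = 1. of_real s / (2 * of_real pi * \<i>) * contour_integral (circlepath (-1) R)
      (\<lambda>y. \<Prod>i\<in>{1..n}. 1 / (1 - \<zeta> powi a i * exp (- (of_real s * (1 - of_int (a i) * y))))))"
    by (simp add: sum_divide_distrib)
  with sums show ?thesis by (simp add: R_def)
qed

subsection \<open>Uniform asymptotic expansions\<close>

text \<open>A function of \<open>(\<sigma>, y)\<close> is expanded as \<open>\<sigma>\<close> decreases to \<open>0\<close>, uniformly in \<open>y\<close> on a compact set; the
  coefficients of \<open>\<sigma>\<^sup>0, \<dots>, \<sigma>\<^sup>3\<close> are stored in a formal power series whose further coefficients are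
  irrelevant.\<close>

definition unif_filter :: "complex set \<Rightarrow> (real \<times> complex) filter" where
  "unif_filter C = at_right 0 \<times>\<^sub>F principal C"

lemma eventually_unif_filter:
  "eventually P (unif_filter C) \<longleftrightarrow> (\<forall>\<^sub>F \<sigma> in at_right 0. \<forall>y\<in>C. P (\<sigma>, y))"
proof
  assume "eventually P (unif_filter C)"
  then obtain Pf Pg where "eventually Pf (at_right 0)" "\<forall>y\<in>C. Pg y" "\<And>x y. Pf x \<Longrightarrow> Pg y \<Longrightarrow> P (x, y)"
    unfolding unif_filter_def eventually_prod_filter eventually_principal by blast
  thus "\<forall>\<^sub>F \<sigma> in at_right 0. \<forall>y\<in>C. P (\<sigma>, y)" by (auto elim: eventually_mono)
next
  assume "\<forall>\<^sub>F \<sigma> in at_right 0. \<forall>y\<in>C. P (\<sigma>, y)"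
  thus "eventually P (unif_filter C)"
    unfolding unif_filter_def eventually_prod_filter eventually_principal
    by (intro exI[of _ "\<lambda>\<sigma>. \<forall>y\<in>C. P (\<sigma>, y)"] exI[of _ "\<lambda>y. y \<in> C"]) auto
qed

abbreviation sg :: "real \<times> complex \<Rightarrow> complex" where "sg p \<equiv> of_real (fst p)"

text \<open>The first clause makes the coefficients bounded on a compact C and integrable over a
  circle; the second makes f itself integrable for small \<sigma>. Together with the uniform
  remainder they permit integration term by term.\<close>

definition expands :: "complex set \<Rightarrow> (real \<Rightarrow> complex \<Rightarrow> complex) \<Rightarrow> (complex \<Rightarrow> complex fps) \<Rightarrow> bool" where
  "expands C f c \<longleftrightarrow>
     (\<forall>m<4. continuous_on C (\<lambda>y. fps_nth (c y) m)) \<and>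
     (\<forall>\<^sub>F \<sigma> in at_right 0. continuous_on C (f \<sigma>)) \<and>
     (\<lambda>p. f (fst p) (snd p) - (\<Sum>m<4. fps_nth (c (snd p)) m * sg p ^ m)) \<in> O[unif_filter C](\<lambda>p. sg p ^ 4)"

lemma bigo_continuous_on_compact:
  assumes "compact C" "continuous_on C h"
  shows "(\<lambda>p. h (snd p)) \<in> O[unif_filter C](\<lambda>_. 1 :: complex)"
proof -
  have "bounded (h ` C)" using assms by (intro compact_imp_bounded compact_continuous_image)
  then obtain M where "\<And>y. y \<in> C \<Longrightarrow> norm (h y) \<le> M" by (auto simp: bounded_iff)
  thus ?thesis by (intro bigoI[of _ M]) (auto simp: eventually_unif_filter)
qed

lemma bigo_unif_fst:
  fixes f g :: "real \<Rightarrow> complex"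
  assumes "f \<in> O[at_right 0](g)"
  shows "(\<lambda>p. f (fst p)) \<in> O[unif_filter C](\<lambda>p. g (fst p))"
  unfolding unif_filter_def by (rule landau_o.big.compose[OF assms filterlim_fst])

lemma bigo_of_real:
  fixes f g :: "real \<Rightarrow> real"
  assumes "f \<in> O[F](g)"
  shows "(\<lambda>x. complex_of_real (f x)) \<in> O[F](\<lambda>x. complex_of_real (g x))"
  using assms by (auto elim!: landau_o.bigE intro!: landau_o.bigI simp: norm_of_real)

lemma bigo_diff_trans:
  assumes "(\<lambda>x. f x - g x) \<in> O[F](h)" "(\<lambda>x. g x - k x) \<in> O[F](h)"
  shows "(\<lambda>x. f x - k x) \<in> O[F](h)"
  using sum_in_bigo(1)[OF assms] by simp

lemma sg_bigo_1: "sg \<in> O[unif_filter C](\<lambda>_. 1)"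
proof -
  have "(\<lambda>x::real. x) \<in> O[at_right 0](\<lambda>_. 1)" by real_asymp
  from bigo_unif_fst[OF bigo_of_real[OF this]] show ?thesis by simp
qed

text \<open>The error splits as (f - tc) g + tc (g - td) plus the part of order at least 4 of the
  product of the two cubic truncations. All cofactors are bounded, by compactness of C.\<close>

lemma expands_mult:
  assumes C: "compact C" and f: "expands C f c" and g: "expands C g d"
  shows "expands C (\<lambda>\<sigma> y. f \<sigma> y * g \<sigma> y) (\<lambda>y. c y * d y)"
proof -
  let ?F = "unif_filter C"
  define tc where "tc p = (\<Sum>m<4. fps_nth (c (snd p)) m * sg p ^ m)" for p
  define td where "td p = (\<Sum>m<4. fps_nth (d (snd p)) m * sg p ^ m)" for p
  have O1: "(\<lambda>p. fps_nth (c (snd p)) m) \<in> O[?F](\<lambda>_. 1)" "(\<lambda>p. fps_nth (d (snd p)) m) \<in> O[?F](\<lambda>_. 1)" if "m < 4" for m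
    using that f g by (auto simp: expands_def intro!: bigo_continuous_on_compact C)
  have pow: "(\<lambda>p. sg p ^ m) \<in> O[?F](\<lambda>_. 1)" for m
    using landau_o.big_power[OF sg_bigo_1[of C], of m] by simp
  have prod1: "(\<lambda>p. u p * v p) \<in> O[?F](\<lambda>_. 1)" if "u \<in> O[?F](\<lambda>_. 1)" "v \<in> O[?F](\<lambda>_. 1)" for u v :: "_ \<Rightarrow> complex"
    using landau_o.big_mult[OF that] by simp
  have tc: "tc \<in> O[?F](\<lambda>_. 1)" and td: "td \<in> O[?F](\<lambda>_. 1)"
    unfolding tc_def td_def by (intro big_sum_in_bigo prod1 O1 pow; simp)+
  have df: "(\<lambda>p. f (fst p) (snd p) - tc p) \<in> O[?F](\<lambda>p. sg p ^ 4)"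
    and dg: "(\<lambda>p. g (fst p) (snd p) - td p) \<in> O[?F](\<lambda>p. sg p ^ 4)"
    using f g by (auto simp: expands_def tc_def td_def)
  have g1: "(\<lambda>p. g (fst p) (snd p)) \<in> O[?F](\<lambda>_. 1)"
    using sum_in_bigo(1)[OF landau_o.big_trans[OF dg pow[of 4]] td] by simp
  define rest where "rest p = (\<Sum>(m, k)\<in>{(m, k). m < 4 \<and> k < 4 \<and> m + k \<ge> 4}.
      fps_nth (c (snd p)) m * fps_nth (d (snd p)) k * sg p ^ (m + k - 4))" for p
  have rest: "rest \<in> O[?F](\<lambda>_. 1)"
    unfolding rest_def case_prod_unfold by (intro big_sum_in_bigo prod1 O1 pow) auto
  have split: "tc p * td p = (\<Sum>m<4. fps_nth (c (snd p) * d (snd p)) m * sg p ^ m) + sg p ^ 4 * rest p" for p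
  proof -
    have set: "{(m, k). m < (4::nat) \<and> k < (4::nat) \<and> m + k \<ge> 4} = {(1,3),(2,2),(2,3),(3,1),(3,2),(3,3)}"
      by (auto simp: numeral_eq_Suc less_Suc_eq)
    show ?thesis unfolding tc_def td_def rest_def set
      by (simp add: fps_mult_nth numeral_eq_Suc algebra_simps)
  qed
  have "(\<lambda>p. f (fst p) (snd p) * g (fst p) (snd p) - (\<Sum>m<4. fps_nth (c (snd p) * d (snd p)) m * sg p ^ m))
     = (\<lambda>p. (f (fst p) (snd p) - tc p) * g (fst p) (snd p) + tc p * (g (fst p) (snd p) - td p) + sg p ^ 4 * rest p)"
    using split by (auto simp: fun_eq_iff algebra_simps)
  also have "\<dots> \<in> O[?F](\<lambda>p. sg p ^ 4)"
    using landau_o.big_mult[OF df g1] landau_o.big_mult[OF tc dg]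
      landau_o.big_mult[OF landau_o.big_refl[of "\<lambda>p. sg p ^ 4"] rest]
    by (intro sum_in_bigo) simp_all
  finally have "(\<lambda>p. f (fst p) (snd p) * g (fst p) (snd p) - (\<Sum>m<4. fps_nth (c (snd p) * d (snd p)) m * sg p ^ m))
      \<in> O[?F](\<lambda>p. sg p ^ 4)" .
  moreover have "\<forall>\<^sub>F \<sigma> in at_right 0. continuous_on C (\<lambda>y. f \<sigma> y * g \<sigma> y)"
  proof -
    have "\<forall>\<^sub>F \<sigma> in at_right 0. continuous_on C (f \<sigma>)" "\<forall>\<^sub>F \<sigma> in at_right 0. continuous_on C (g \<sigma>)"
      using f g by (auto simp: expands_def)
    thus ?thesis by eventually_elim (rule continuous_on_mult)
  qed
  moreover have "continuous_on C (\<lambda>y. fps_nth (c y * d y) m)" if "m < 4" for m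
    unfolding fps_mult_nth using f g that by (intro continuous_intros) (auto simp: expands_def)
  ultimately show ?thesis by (simp add: expands_def)
qed

lemma expands_cong:
  assumes "expands C f c" "\<And>y m. y \<in> C \<Longrightarrow> m < 4 \<Longrightarrow> fps_nth (c y) m = fps_nth (d y) m"
    and "\<forall>\<^sub>F \<sigma> in at_right 0. \<forall>y\<in>C. f \<sigma> y = g \<sigma> y"
  shows "expands C g d"
proof -
  have "(\<lambda>p. f (fst p) (snd p) - (\<Sum>m<4. fps_nth (c (snd p)) m * sg p ^ m)) \<in> O[unif_filter C](\<lambda>p. sg p ^ 4)
     \<longleftrightarrow> (\<lambda>p. g (fst p) (snd p) - (\<Sum>m<4. fps_nth (d (snd p)) m * sg p ^ m)) \<in> O[unif_filter C](\<lambda>p. sg p ^ 4)"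
  proof (rule landau_o.big.in_cong)
    show "\<forall>\<^sub>F p in unif_filter C. f (fst p) (snd p) - (\<Sum>m<4. fps_nth (c (snd p)) m * sg p ^ m)
       = g (fst p) (snd p) - (\<Sum>m<4. fps_nth (d (snd p)) m * sg p ^ m)"
      unfolding eventually_unif_filter using assms(3) by eventually_elim (use assms(2) in auto)
  qed
  moreover have "continuous_on C (\<lambda>y. fps_nth (d y) m)" if "m < 4" for m
    using assms(1,2) that by (auto simp: expands_def cong: continuous_on_cong)
  moreover have "\<forall>\<^sub>F \<sigma> in at_right 0. continuous_on C (g \<sigma>)"
  proof -
    have "\<forall>\<^sub>F \<sigma> in at_right 0. continuous_on C (f \<sigma>)" using assms(1) by (auto simp: expands_def)
    thus ?thesis using assms(3) by eventually_elim (auto cong: continuous_on_cong)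
  qed
  ultimately show ?thesis using assms(1) by (simp add: expands_def)
qed

lemma expands_const:
  assumes "continuous_on C h"
  shows "expands C (\<lambda>_. h) (\<lambda>y. fps_const (h y))"
proof -
  have "(\<Sum>m<4. fps_nth (fps_const (h y)) m * z ^ m) = h y" for y z
    by (simp add: numeral_eq_Suc)
  moreover have "continuous_on C (\<lambda>y. fps_nth (fps_const (h y)) m)" for m
    by (cases m) (use assms in auto)
  ultimately show ?thesis using assms by (simp add: expands_def)
qed

lemma expands_prod:
  assumes "compact C" "finite I" "\<And>i. i \<in> I \<Longrightarrow> expands C (f i) (c i)"
  shows "expands C (\<lambda>\<sigma> y. \<Prod>i\<in>I. f i \<sigma> y) (\<lambda>y. \<Prod>i\<in>I. c i y)"
  using assms(2,3)
proof (induction I rule: finite_induct)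
  case empty
  show ?case using expands_const[of C "\<lambda>_. 1"] by simp
qed (simp add: expands_mult[OF assms(1)])

section \<open>Expansions of the single factors of the integrand\<close>

definition fps4 :: "complex \<Rightarrow> complex \<Rightarrow> complex \<Rightarrow> complex \<Rightarrow> complex fps" where
  "fps4 a b c d = Abs_fps (\<lambda>m. if m = 0 then a else if m = 1 then b else if m = 2 then c else if m = 3 then d else 0)"

lemma fps4_nth [simp]:
  "fps_nth (fps4 a b c d) 0 = a" "fps_nth (fps4 a b c d) (Suc 0) = b"
  "fps_nth (fps4 a b c d) 2 = c" "fps_nth (fps4 a b c d) 3 = d"
  "fps_nth (fps4 a b c d) (Suc (Suc 0)) = c" "fps_nth (fps4 a b c d) (Suc (Suc (Suc 0))) = d"
  by (auto simp: fps4_def)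

lemma sum_fps4: "(\<Sum>m<4. fps_nth (fps4 a b c d) m * z ^ m) = a + b * z + c * z ^ 2 + d * z ^ 3"
  by (simp add: numeral_eq_Suc algebra_simps)

lemma less_4_cases: "m < (4::nat) \<Longrightarrow> m = 0 \<or> m = 1 \<or> m = 2 \<or> m = 3" by auto

lemma expands_real:
  fixes h :: "real \<Rightarrow> real"
  assumes "(\<lambda>x. h x - (a + b * x + c * x ^ 2 + d * x ^ 3)) \<in> O[at_right 0](\<lambda>x. x ^ 4)"
  shows "expands C (\<lambda>\<sigma> _. of_real (h \<sigma>)) (\<lambda>_. fps4 (of_real a) (of_real b) (of_real c) (of_real d))"
proof -
  from bigo_unif_fst[OF bigo_of_real[OF assms], of C]
  show ?thesis unfolding expands_def sum_fps4 by simp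
qed

lemma has_fps_expansion_bigo:
  fixes f :: "complex \<Rightarrow> complex"
  assumes "f has_fps_expansion F"
  shows "(\<lambda>v. f v - (\<Sum>m<k. fps_nth F m * v ^ m)) \<in> O[nhds 0](\<lambda>v. v ^ k)"
proof -
  define G where "G = fps_shift k F"
  have r: "fps_conv_radius F > 0" "fps_conv_radius G > 0" using assms by (auto simp: has_fps_expansion_def G_def)
  have "\<forall>\<^sub>F z in nhds 0. z \<in> eball 0 (fps_conv_radius F)"
    by (rule eventually_nhds_in_open) (use r in \<open>auto simp: zero_ereal_def\<close>)
  moreover have "\<forall>\<^sub>F z in nhds 0. eval_fps F z = f z" using assms by (auto simp: has_fps_expansion_def)
  ultimately have ev: "\<forall>\<^sub>F v in nhds 0. f v - (\<Sum>m<k. fps_nth F m * v ^ m) = v ^ k * eval_fps G v"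
  proof eventually_elim
    case (elim v)
    have sm: "summable (\<lambda>n. fps_nth F n * v ^ n)" using elim(1) by (intro summable_fps) auto
    have smG: "summable (\<lambda>n. fps_nth G n * v ^ n)" using elim(1) by (intro summable_fps) (auto simp: G_def)
    have "f v = suminf (\<lambda>n. fps_nth F (n + k) * v ^ (n + k)) + (\<Sum>m<k. fps_nth F m * v ^ m)"
      using suminf_split_initial_segment[OF sm, of k] elim(2) by (simp add: eval_fps_def)
    also have "(\<lambda>n. fps_nth F (n + k) * v ^ (n + k)) = (\<lambda>n. v ^ k * (fps_nth G n * v ^ n))"
      by (auto simp: G_def power_add)
    also have "suminf \<dots> = v ^ k * eval_fps G v" using smG by (simp add: eval_fps_def suminf_mult)
    finally show ?case by simp
  qed
  have "(eval_fps G \<longlongrightarrow> fps_nth G 0) (nhds 0)"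
    by (rule has_fps_expansion_imp_tendsto_0[OF eval_fps_has_fps_expansion[OF r(2)]])
  hence "eval_fps G \<in> O[nhds 0](\<lambda>_. 1)" by (intro bigoI_tendsto[where c = "fps_nth G 0"]) auto
  hence "(\<lambda>v. v ^ k * eval_fps G v) \<in> O[nhds 0](\<lambda>v. v ^ k * 1)" by (intro landau_o.big_mult) auto
  thus ?thesis using landau_o.big.in_cong[OF ev, of "\<lambda>v. v ^ k"] by simp
qed

text \<open>The parameter is \<open>\<sigma> = 1 - t\<close>; the logarithmic parameter is \<open>s = - ln t = - ln (1 - \<sigma>)\<close>.\<close>

definition slog :: "real \<Rightarrow> real" where "slog \<sigma> = - ln (1 - \<sigma>)"

text \<open>Modulo \<sigma>^4 one has s = \<sigma> + \<sigma>^2/2 + \<sigma>^3/3, s^2 = \<sigma>^2 +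
  \<sigma>^3 and s^3 = \<sigma>^3 for s = \<open>slog \<sigma>\<close>; substitution into the cubic
  Taylor polynomial of f gives the coefficients. Since b is bounded on C, the argument s * b y tends
  to 0 uniformly.\<close>

lemma expands_slog_compose:
  assumes C: "compact C" and F: "f has_fps_expansion F" and b: "continuous_on C b"
  shows "expands C (\<lambda>\<sigma> y. f (of_real (slog \<sigma>) * b y))
     (\<lambda>y. fps4 (fps_nth F 0) (fps_nth F 1 * b y) (fps_nth F 1 * b y / 2 + fps_nth F 2 * b y ^ 2)
        (fps_nth F 1 * b y / 3 + fps_nth F 2 * b y ^ 2 + fps_nth F 3 * b y ^ 3))"
proof -
  let ?F = "unif_filter C"
  define v where "v p = of_real (slog (fst p)) * b (snd p)" for p
  have s1: "(\<lambda>x. slog x - (x + x\<^sup>2 / 2 + x ^ 3 / 3)) \<in> O[at_right 0](\<lambda>x. x ^ 4)"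
    and s2: "(\<lambda>x. slog x ^ 2 - (x ^ 2 + x ^ 3)) \<in> O[at_right 0](\<lambda>x. x ^ 4)"
    and s3: "(\<lambda>x. slog x ^ 3 - x ^ 3) \<in> O[at_right 0](\<lambda>x. x ^ 4)"
    and s0: "slog \<in> O[at_right 0](\<lambda>x. x)" "(slog \<longlongrightarrow> 0) (at_right 0)"
    unfolding slog_def by real_asymp+
  note sO = s1[THEN bigo_of_real, THEN bigo_unif_fst[where C = C]]
    s2[THEN bigo_of_real, THEN bigo_unif_fst[where C = C]] s3[THEN bigo_of_real, THEN bigo_unif_fst[where C = C]]
    s0(1)[THEN bigo_of_real, THEN bigo_unif_fst[where C = C]]
  have bO: "(\<lambda>p. b (snd p)) \<in> O[?F](\<lambda>_. 1)" by (rule bigo_continuous_on_compact[OF C b])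
  have bk: "(\<lambda>p. k * b (snd p) ^ m) \<in> O[?F](\<lambda>_. 1)" for k m
    using landau_o.big_power[OF bO, of m] by (cases "k = 0") simp_all
  obtain M where M: "\<And>y. y \<in> C \<Longrightarrow> norm (b y) \<le> M" "M > 0"
    using compact_imp_bounded[OF compact_continuous_image[OF b C]] by (auto simp: bounded_pos)
  have vlim: "(v \<longlongrightarrow> 0) ?F"
  proof (rule Lim_null_comparison)
    show "\<forall>\<^sub>F p in ?F. norm (v p) \<le> \<bar>slog (fst p)\<bar> * M"
      unfolding eventually_unif_filter by (rule always_eventually) (auto simp: v_def norm_mult M intro!: mult_left_mono)
    have "((\<lambda>x. \<bar>slog x\<bar> * M) \<longlongrightarrow> 0) (at_right 0)"
      using tendsto_mult_left_zero[OF tendsto_rabs_zero[OF s0(2)]] by simp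
    thus "((\<lambda>p. \<bar>slog (fst p)\<bar> * M) \<longlongrightarrow> 0) ?F"
      unfolding unif_filter_def by (rule filterlim_compose[OF _ filterlim_fst])
  qed
  have vO: "v \<in> O[?F](sg)" unfolding v_def using landau_o.big_mult[OF sO(4) bO] by simp
  have "(\<lambda>p. f (v p) - (\<Sum>m<4. fps_nth F m * v p ^ m)) \<in> O[?F](\<lambda>p. v p ^ 4)"
    by (rule landau_o.big.compose[OF has_fps_expansion_bigo[OF F] vlim])
  hence "(\<lambda>p. f (v p) - (\<Sum>m<4. fps_nth F m * v p ^ m)) \<in> O[?F](\<lambda>p. sg p ^ 4)"
    by (rule landau_o.big_trans) (rule landau_o.big_power[OF vO])
  moreover have "(\<lambda>p. (\<Sum>m<4. fps_nth F m * v p ^ m) - (fps_nth F 0 + fps_nth F 1 * b (snd p) * sg p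
      + (fps_nth F 1 * b (snd p) / 2 + fps_nth F 2 * b (snd p) ^ 2) * sg p ^ 2
      + (fps_nth F 1 * b (snd p) / 3 + fps_nth F 2 * b (snd p) ^ 2 + fps_nth F 3 * b (snd p) ^ 3) * sg p ^ 3))
      \<in> O[?F](\<lambda>p. sg p ^ 4)" (is "?lhs \<in> _")
  proof -
    have "?lhs = (\<lambda>p. (fps_nth F 1 * b (snd p) ^ 1) * of_real (slog (fst p) - (fst p + (fst p)\<^sup>2 / 2 + fst p ^ 3 / 3))
        + (fps_nth F 2 * b (snd p) ^ 2) * of_real (slog (fst p) ^ 2 - ((fst p)\<^sup>2 + fst p ^ 3))
        + (fps_nth F 3 * b (snd p) ^ 3) * of_real (slog (fst p) ^ 3 - fst p ^ 3))"
      by (rule ext) (simp add: v_def numeral_eq_Suc algebra_simps)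
    also have "\<dots> \<in> O[?F](\<lambda>p. sg p ^ 4)"
      using landau_o.big_mult[OF bk[of "fps_nth F 1" 1] sO(1)] landau_o.big_mult[OF bk[of "fps_nth F 2" 2] sO(2)]
        landau_o.big_mult[OF bk[of "fps_nth F 3" 3] sO(3)]
      by (intro sum_in_bigo) simp_all
    finally show ?thesis .
  qed
  ultimately have sum: "(\<lambda>p. f (v p) - (fps_nth F 0 + fps_nth F 1 * b (snd p) * sg p
      + (fps_nth F 1 * b (snd p) / 2 + fps_nth F 2 * b (snd p) ^ 2) * sg p ^ 2
      + (fps_nth F 1 * b (snd p) / 3 + fps_nth F 2 * b (snd p) ^ 2 + fps_nth F 3 * b (snd p) ^ 3) * sg p ^ 3))
      \<in> O[?F](\<lambda>p. sg p ^ 4)"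
    by (rule bigo_diff_trans)
  have "\<forall>\<^sub>F \<sigma> in at_right 0. continuous_on C (\<lambda>y. f (of_real (slog \<sigma>) * b y))"
  proof -
    have "f analytic_on {0}" using F by (rule has_fps_expansion_imp_analytic_0)
    then obtain e where e: "e > 0" "f holomorphic_on ball 0 e" by (auto simp: analytic_on_def)
    have "\<forall>\<^sub>F p in ?F. v p \<in> ball 0 e" using tendstoD[OF vlim e(1)] by (simp add: dist_commute)
    hence "\<forall>\<^sub>F \<sigma> in at_right 0. \<forall>y\<in>C. of_real (slog \<sigma>) * b y \<in> ball 0 e"
      by (simp add: eventually_unif_filter v_def)
    thus ?thesis
    proof eventually_elim
      case (elim \<sigma>)
      have "continuous_on C (f \<circ> (\<lambda>y. of_real (slog \<sigma>) * b y))"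
        by (rule continuous_on_compose) (use elim in \<open>auto intro!: continuous_intros b
            continuous_on_subset[OF holomorphic_on_imp_continuous_on[OF e(2)]]\<close>)
      thus ?case by (simp add: o_def)
    qed
  qed
  moreover have "continuous_on C (\<lambda>y. fps_nth (fps4 (fps_nth F 0) (fps_nth F 1 * b y) (fps_nth F 1 * b y / 2 + fps_nth F 2 * b y ^ 2)
        (fps_nth F 1 * b y / 3 + fps_nth F 2 * b y ^ 2 + fps_nth F 3 * b y ^ 3)) m)" if "m < 4" for m
    using less_4_cases[OF that] by (elim disjE) (auto intro!: continuous_intros b)
  ultimately show ?thesis using sum unfolding expands_def sum_fps4 v_def by simp
qed

lemma fps_mult_nth_small:
  fixes F G :: "complex fps"
  shows "fps_nth (F * G) 0 = fps_nth F 0 * fps_nth G 0"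
    "fps_nth (F * G) 1 = fps_nth F 0 * fps_nth G 1 + fps_nth F 1 * fps_nth G 0"
    "fps_nth (F * G) 2 = fps_nth F 0 * fps_nth G 2 + fps_nth F 1 * fps_nth G 1 + fps_nth F 2 * fps_nth G 0"
    "fps_nth (F * G) 3 = fps_nth F 0 * fps_nth G 3 + fps_nth F 1 * fps_nth G 2 + fps_nth F 2 * fps_nth G 1
      + fps_nth F 3 * fps_nth G 0"
    "fps_nth (F * G) 4 = fps_nth F 0 * fps_nth G 4 + fps_nth F 1 * fps_nth G 3 + fps_nth F 2 * fps_nth G 2
      + fps_nth F 3 * fps_nth G 1 + fps_nth F 4 * fps_nth G 0"
  by (simp_all add: fps_mult_nth numeral_eq_Suc)

text \<open>The Todd function: 1 / (1 - exp (-v)) freed of its simple pole at 0, so that it has a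
  power series there.\<close>

definition todd :: "complex \<Rightarrow> complex" where
  "todd v = (if v = 0 then 1 else v / (1 - exp (- v)))"

lemma todd_expansion:
  obtains F where "todd has_fps_expansion F" "fps_nth F 0 = 1" "fps_nth F 1 = 1 / 2"
    "fps_nth F 2 = 1 / 12" "fps_nth F 3 = 0"
proof
  define G :: "complex fps" where "G = 1 - fps_exp (-1)"
  define F where "F = fps_X / G"
  have G: "fps_nth G 0 = 0" "fps_nth G 1 = 1" "fps_nth G 2 = - 1 / 2" "fps_nth G 3 = 1 / 6" "fps_nth G 4 = - 1 / 24"
    by (simp_all add: G_def fps_exp_def numeral_eq_Suc fact_numeral)
  have G0: "G \<noteq> 0" using G(2) by auto
  have sub: "subdegree G = 1" by (rule subdegreeI) (use G in auto)
  have "(\<lambda>x. 1 - exp (- x)) has_fps_expansion G"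
    unfolding G_def by (intro fps_expansion_intros)
  hence "(\<lambda>x. if x = 0 then 1 else x / (1 - exp (- x))) has_fps_expansion F"
    unfolding F_def by (intro has_fps_expansion_divide fps_expansion_intros) (use G0 sub G in auto)
  thus "todd has_fps_expansion F" by (simp add: todd_def[abs_def])
  have FG: "F * G = fps_X" unfolding F_def using G0 sub by (intro fps_times_divide_eq) auto
  have n1: "fps_nth (F * G) 1 = 1" and n2: "fps_nth (F * G) 2 = 0" and n3: "fps_nth (F * G) 3 = 0" and n4: "fps_nth (F * G) 4 = 0"
    unfolding FG by (simp_all add: fps_X_def)
  show F0: "fps_nth F 0 = 1" using n1 unfolding fps_mult_nth_small G by simp
  show F1: "fps_nth F 1 = 1 / 2" using n2 unfolding fps_mult_nth_small G F0 by (simp add: algebra_simps)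
  show F2: "fps_nth F 2 = 1 / 12" using n3 unfolding fps_mult_nth_small G F0 F1 by (simp add: field_simps)
  show "fps_nth F 3 = 0" using n4 unfolding fps_mult_nth_small G F0 F1 F2 by (simp add: field_simps)
qed

text \<open>The factor is 1 / b y times \<sigma> / s times the Todd function at s * b y. For b y = 1
  it is identically 1, because exp (-s) = 1 - \<sigma>; this explains why all higher coefficients
  contain b y - 1, which becomes - a_i y in the application.\<close>

lemma expands_unit_factor:
  assumes C: "compact C" and b: "continuous_on C b" "\<And>y. y \<in> C \<Longrightarrow> b y \<noteq> 0"
  shows "expands C (\<lambda>\<sigma> y. of_real \<sigma> * (1 / (1 - exp (- (of_real (slog \<sigma>) * b y)))))
    (\<lambda>y. fps_const (1 / b y) * fps4 1 ((b y - 1) / 2) ((b y - 1) * (b y + 1) / 12) ((b y - 1) * (b y + 1) / 24))"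
proof -
  obtain F where F: "todd has_fps_expansion F" "fps_nth F 0 = 1" "fps_nth F 1 = 1 / 2"
    "fps_nth F 2 = 1 / 12" "fps_nth F 3 = 0" using todd_expansion by blast
  have r: "(\<lambda>x. x / slog x - (1 + (- 1 / 2) * x + (- 1 / 12) * x\<^sup>2 + (- 1 / 24) * x ^ 3)) \<in> O[at_right 0](\<lambda>x. x ^ 4)"
    unfolding slog_def by real_asymp
  have "expands C (\<lambda>\<sigma> y. (1 / b y) * (of_real (\<sigma> / slog \<sigma>) * todd (of_real (slog \<sigma>) * b y)))
    (\<lambda>y. fps_const (1 / b y) * (fps4 (of_real 1) (of_real (- 1 / 2)) (of_real (- 1 / 12)) (of_real (- 1 / 24)) *
      fps4 (fps_nth F 0) (fps_nth F 1 * b y) (fps_nth F 1 * b y / 2 + fps_nth F 2 * b y ^ 2)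
        (fps_nth F 1 * b y / 3 + fps_nth F 2 * b y ^ 2 + fps_nth F 3 * b y ^ 3)))"
    by (intro expands_mult C expands_const expands_real[OF r] expands_slog_compose F(1) b(1) continuous_intros) (use b in auto)
  thus ?thesis
  proof (rule expands_cong)
    fix y :: complex and m :: nat assume "m < 4"
    thus "fps_nth (fps_const (1 / b y) * (fps4 (of_real 1) (of_real (- 1 / 2)) (of_real (- 1 / 12)) (of_real (- 1 / 24)) *
      fps4 (fps_nth F 0) (fps_nth F 1 * b y) (fps_nth F 1 * b y / 2 + fps_nth F 2 * b y ^ 2)
        (fps_nth F 1 * b y / 3 + fps_nth F 2 * b y ^ 2 + fps_nth F 3 * b y ^ 3))) m =
      fps_nth (fps_const (1 / b y) * fps4 1 ((b y - 1) / 2) ((b y - 1) * (b y + 1) / 12) ((b y - 1) * (b y + 1) / 24)) m"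
      unfolding fps_mult_left_const_nth F(2-) using less_4_cases[OF \<open>m < 4\<close>]
      by (elim disjE) (simp_all add: fps_mult_nth numeral_eq_Suc field_simps)
  next
    have "\<forall>\<^sub>F \<sigma> in at_right 0. \<sigma> \<in> {0<..<1::real}" by (rule eventually_at_right_real) simp
    thus "\<forall>\<^sub>F \<sigma> in at_right 0. \<forall>y\<in>C. 1 / b y * (of_real (\<sigma> / slog \<sigma>) * todd (of_real (slog \<sigma>) * b y)) =
       of_real \<sigma> * (1 / (1 - exp (- (of_real (slog \<sigma>) * b y))))"
    proof eventually_elim
      case (elim \<sigma>)
      hence "slog \<sigma> > 0" by (simp add: slog_def)
      thus ?case using b(2) by (auto simp: todd_def)
    qed
  qed
qed

text \<open>For w \<noteq> 1 there is no pole at v = 0, and the Taylor coefficients of 1 / (1 - w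
  exp (-v)) follow by comparing coefficients in \<open>F * G = 1\<close>.\<close>

lemma expands_nonunit_factor:
  assumes C: "compact C" and b: "continuous_on C b" and w: "w \<noteq> 1"
  obtains e where "expands C (\<lambda>\<sigma> y. 1 / (1 - w * exp (- (of_real (slog \<sigma>) * b y))))
    (\<lambda>y. fps4 (1 / (1 - w)) (- w * b y / (1 - w) ^ 2)
        (- w * b y / (2 * (1 - w) ^ 2) + w * (1 + w) * b y ^ 2 / (2 * (1 - w) ^ 3)) (e y))"
proof -
  define G where "G = 1 - fps_const w * fps_exp (-1)"
  define F where "F = inverse G"
  have G: "fps_nth G 0 = 1 - w" "fps_nth G 1 = w" "fps_nth G 2 = - w / 2"
    by (simp_all add: G_def fps_exp_def numeral_eq_Suc)
  have "(\<lambda>v. 1 - w * exp (- v)) has_fps_expansion G"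
    unfolding G_def by (intro fps_expansion_intros)
  hence F: "(\<lambda>v. inverse (1 - w * exp (- v))) has_fps_expansion F"
    unfolding F_def by (rule has_fps_expansion_inverse) (use G w in auto)
  have FG: "F * G = 1" unfolding F_def using G(1) w by (intro inverse_mult_eq_1) auto
  have n0: "fps_nth (F * G) 0 = 1" and n1: "fps_nth (F * G) 1 = 0" and n2: "fps_nth (F * G) 2 = 0"
    unfolding FG by simp_all
  have w': "1 - w \<noteq> 0" using w by simp
  have F0: "fps_nth F 0 = 1 / (1 - w)" using n0 w' unfolding fps_mult_nth_small G by (simp add: field_simps)
  have "fps_nth F 1 * (1 - w) = - (w / (1 - w))"
    using n1 unfolding fps_mult_nth_small G F0 by (simp add: algebra_simps eq_neg_iff_add_eq_0)
  hence F1: "fps_nth F 1 = - w / (1 - w) ^ 2" using w' by (simp add: divide_simps power2_eq_square mult.assoc)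
  have "fps_nth F 2 * (1 - w) = - (fps_nth F 1 * w + fps_nth F 0 * (- w / 2))"
    using n2 unfolding fps_mult_nth_small G by (metis add.commute eq_neg_iff_add_eq_0)
  also have "\<dots> = w * (1 + w) / (2 * (1 - w) ^ 2)"
    unfolding F0 F1 using w' by (simp add: divide_simps) (simp add: algebra_simps power2_eq_square)
  finally have "fps_nth F 2 = w * (1 + w) / (2 * (1 - w) ^ 2) / (1 - w)"
    using w' by (simp add: eq_divide_eq mult_ac)
  hence F2: "fps_nth F 2 = w * (1 + w) / (2 * (1 - w) ^ 3)" by (simp add: power2_eq_square power3_eq_cube)
  show thesis
    by (rule that, rule expands_cong[OF expands_slog_compose[OF C F b]])
      (drule less_4_cases, elim disjE, auto simp: F0 F1[unfolded One_nat_def] F2 inverse_eq_divide)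
qed

text \<open>The remainder is O(\<sigma>^4) uniformly on the circle, so integration costs only the
  factor 2 pi r.\<close>

lemma expands_contour_integral:
  assumes r: "r > 0" and f: "expands (sphere z r) f c"
  shows "(\<lambda>\<sigma>. contour_integral (circlepath z r) (f \<sigma>)
     - (\<Sum>m<4. contour_integral (circlepath z r) (\<lambda>y. fps_nth (c y) m) * of_real \<sigma> ^ m))
       \<in> O[at_right 0](\<lambda>\<sigma>. complex_of_real \<sigma> ^ 4)"
proof -
  let ?C = "sphere z r"
  from f obtain M where M: "\<forall>\<^sub>F p in unif_filter ?C.
      norm (f (fst p) (snd p) - (\<Sum>m<4. fps_nth (c (snd p)) m * sg p ^ m)) \<le> M * norm (sg p ^ 4)" "M > 0"
    unfolding expands_def by (auto elim!: landau_o.bigE)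
  have int: "g contour_integrable_on circlepath z r" if "continuous_on ?C g" for g
    by (rule contour_integrable_continuous_circlepath) (use that r in auto)
  have "\<forall>\<^sub>F \<sigma> in at_right 0. continuous_on ?C (f \<sigma>)" using f by (simp add: expands_def)
  moreover have "\<forall>\<^sub>F \<sigma> in at_right 0. \<forall>y\<in>?C. norm (f \<sigma> y - (\<Sum>m<4. fps_nth (c y) m * of_real \<sigma> ^ m)) \<le> M * norm (complex_of_real \<sigma> ^ 4)"
    using M(1) unfolding eventually_unif_filter by simp
  ultimately have "\<forall>\<^sub>F \<sigma> in at_right 0. norm (contour_integral (circlepath z r) (f \<sigma>)
     - (\<Sum>m<4. contour_integral (circlepath z r) (\<lambda>y. fps_nth (c y) m) * of_real \<sigma> ^ m)) \<le> (M * (2 * pi * r)) * norm (complex_of_real \<sigma> ^ 4)"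
  proof eventually_elim
    case (elim \<sigma>)
    have ci: "(\<lambda>y. fps_nth (c y) m) contour_integrable_on circlepath z r" if "m < 4" for m
      using f that by (intro int) (auto simp: expands_def)
    have "((\<lambda>y. f \<sigma> y - (\<Sum>m<4. fps_nth (c y) m * of_real \<sigma> ^ m)) has_contour_integral
       (contour_integral (circlepath z r) (f \<sigma>) - (\<Sum>m<4. contour_integral (circlepath z r) (\<lambda>y. fps_nth (c y) m) * of_real \<sigma> ^ m)))
        (circlepath z r)"
      by (intro has_contour_integral_diff has_contour_integral_sum has_contour_integral_rmul has_contour_integral_integral int elim(1) ci) auto
    hence "norm (contour_integral (circlepath z r) (f \<sigma>) - (\<Sum>m<4. contour_integral (circlepath z r) (\<lambda>y. fps_nth (c y) m) * of_real \<sigma> ^ m))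
      \<le> (M * norm (complex_of_real \<sigma> ^ 4)) * (2 * pi * r)"
      by (rule has_contour_integral_bound_circlepath) (use elim(2) M r in \<open>auto simp: dist_norm norm_minus_commute\<close>)
    thus ?case by (simp add: mult_ac)
  qed
  thus ?thesis by (rule landau_o.bigI[rotated]) (use M r in auto)
qed

subsection \<open>Laurent coefficients from one-sided asymptotics\<close>

text \<open>Subtracting the polynomial leaves a Laurent series that is O(\<sigma>^N) on the positive
  reals. If a coefficient below N were nonzero, the lowest term c \<sigma>^s with s < N would be
  bounded by a multiple M \<sigma>^N, which fails once \<sigma> < |c| / M.\<close>

lemma laurent_coeff_asymptotic:
  fixes f :: "complex \<Rightarrow> complex" and d :: "nat \<Rightarrow> complex"
  assumes f: "f has_laurent_expansion L"
    and asymp: "(\<lambda>\<sigma>. of_real \<sigma> ^ k * f (of_real \<sigma>) - (\<Sum>m<N. d m * of_real \<sigma> ^ m)) \<in> O[at_right 0](\<lambda>\<sigma>. of_real \<sigma> ^ N)"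
    and m: "m < N"
  shows "fls_nth L (int m - int k) = d m"
proof -
  define G where "G = fls_X ^ k * L - (\<Sum>m<N. fls_const (d m) * fls_X ^ m)"
  define g where "g z = z ^ k * f z - (\<Sum>m<N. d m * z ^ m)" for z
  have g: "g has_laurent_expansion G"
    unfolding g_def G_def by (intro laurent_expansion_intros f)
  have g_asymp: "(\<lambda>\<sigma>. g (of_real \<sigma>)) \<in> O[at_right 0](\<lambda>\<sigma>. of_real \<sigma> ^ N)"
    using asymp by (simp add: g_def)
  have "fls_nth G (int m) = 0"
  proof (rule ccontr)
    assume nz: "fls_nth G (int m) \<noteq> 0"
    define s where "s = fls_subdegree G"
    define c where "c = fls_nth G s"
    have "G \<noteq> 0" using nz by auto
    hence c: "c \<noteq> 0" by (simp add: c_def s_def)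
    have s: "s \<le> int m" unfolding s_def using nz by (rule fls_subdegree_leI)
    have lim: "filterlim complex_of_real (at 0) (at_right 0)"
      by (rule filterlim_atI) (auto intro!: tendsto_eq_intros simp: eventually_at_filter)
    have "g \<sim>[at 0] (\<lambda>z. c * z powi s)"
      unfolding c_def s_def by (rule has_laurent_expansion_imp_asymp_equiv_0[OF g])
    hence "(\<lambda>\<sigma>. g (of_real \<sigma>)) \<sim>[at_right 0] (\<lambda>\<sigma>. c * of_real \<sigma> powi s)"
      by (rule asymp_equiv_compose'[OF _ lim])
    hence "(\<lambda>\<sigma>. c * of_real \<sigma> powi s) \<in> O[at_right 0](\<lambda>\<sigma>. g (of_real \<sigma>))"
      by (intro asymp_equiv_imp_bigo) (simp add: asymp_equiv_sym)
    from landau_o.bigE[OF landau_o.big_trans[OF this g_asymp]] obtain M where M: "M > 0"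
      "\<forall>\<^sub>F \<sigma> in at_right 0. norm (c * complex_of_real \<sigma> powi s) \<le> M * norm (complex_of_real \<sigma> ^ N)" .
    have "\<forall>\<^sub>F \<sigma>::real in at_right 0. \<sigma> \<in> {0<..<min 1 (norm c / M)}"
      by (rule eventually_at_right_real) (use M c in auto)
    with M(2) have "\<forall>\<^sub>F \<sigma>::real in at_right 0. False"
    proof eventually_elim
      case (elim \<sigma>)
      have "\<sigma> powi (int N - 1) \<le> \<sigma> powi s"
        by (rule power_int_decreasing) (use elim s m in auto)
      hence "norm c * \<sigma> powi (int N - 1) \<le> norm c * \<sigma> powi s" by (rule mult_left_mono) simp
      also have "\<dots> \<le> M * \<sigma> ^ N" using elim by (simp add: norm_mult norm_power_int norm_power)
      also have "\<sigma> ^ N = \<sigma> * \<sigma> powi (int N - 1)"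
        using m by (cases N) (auto simp: power_int_def)
      finally have "norm c * \<sigma> powi (int N - 1) \<le> (M * \<sigma>) * \<sigma> powi (int N - 1)" by (simp add: mult_ac)
      moreover have "\<sigma> powi (int N - 1) > 0" using elim by (intro zero_less_power_int) auto
      ultimately have "norm c \<le> M * \<sigma>" by simp
      thus False using elim M by (simp add: field_simps)
    qed
    thus False by simp
  qed
  moreover have "fls_nth G (int m) = fls_nth L (int m - int k) - d m"
  proof -
    have "fls_nth (\<Sum>m<N. fls_const (d m) * fls_X ^ m) (int m) = (\<Sum>j<N. if j = m then d j else 0)"
      unfolding fls_nth_sum
      by (intro sum.cong refl) (auto simp: fls_X_power_times_conv_shift mult.commute[of "fls_const _"])
    also have "\<dots> = d m" using m by simp
    finally show ?thesis unfolding G_def by (simp add: fls_X_power_times_conv_shift)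
  qed
  ultimately show ?thesis by simp
qed

lemma sums_fps_of_poly_mult:
  fixes t :: complex
  assumes "(\<lambda>d. fps_nth F d * t ^ d) sums S"
  shows "(\<lambda>d. fps_nth (fps_of_poly Q * F) d * t ^ d) sums (poly Q t * S)"
proof (induction Q)
  case (pCons c Q)
  have "(\<lambda>d. fps_nth (fps_of_poly Q * F) d * t ^ Suc d) sums (t * (poly Q t * S))"
    using sums_mult[OF pCons.IH, of t] by (simp add: mult_ac)
  hence "(\<lambda>d. fps_nth (fps_X * (fps_of_poly Q * F)) (Suc d) * t ^ Suc d) sums (t * (poly Q t * S))" by simp
  hence "(\<lambda>d. fps_nth (fps_X * (fps_of_poly Q * F)) d * t ^ d) sums (t * (poly Q t * S))"
    by (subst (asm) sums_Suc_iff) simp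
  from sums_add[OF sums_mult[OF assms, of c] this] show ?case
    by (simp add: fps_of_poly_pCons algebra_simps)
qed simp

lemma poly_eventually_nonzero:
  fixes Q :: "complex poly"
  assumes "Q \<noteq> 0"
  shows "\<forall>\<^sub>F s in at 0. poly Q (1 - s) \<noteq> 0"
proof -
  have "finite ((\<lambda>z. 1 - z) ` {z. poly Q z = 0})" using poly_roots_finite[OF assms] by simp
  hence "closed ((\<lambda>z. 1 - z) ` {z. poly Q z = 0} - {0})" by (intro finite_imp_closed) simp
  hence "open (- ((\<lambda>z. 1 - z) ` {z. poly Q z = 0} - {0}))" by (rule open_Compl)
  moreover have "poly Q (1 - s) \<noteq> 0" if "s \<in> - ((\<lambda>z. 1 - z) ` {z. poly Q z = 0} - {0})" "s \<noteq> 0" for s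
  proof
    assume "poly Q (1 - s) = 0"
    hence "s \<in> (\<lambda>z. 1 - z) ` {z. poly Q z = 0}" by (intro image_eqI[of _ _ "1 - s"]) auto
    thus False using that by blast
  qed
  ultimately show ?thesis unfolding eventually_at_topological
    by (intro exI[of _ "- ((\<lambda>z. 1 - z) ` {z. poly Q z = 0} - {0})"]) simp
qed

text \<open>Two fractions for the same series satisfy P * Q' = P' * Q, hence agree on a punctured
  neighbourhood of t = 1, and Laurent expansions are unique. This justifies the definite description
  in \<open>hilbert_laurent\<close>.\<close>

lemma hilbert_laurent_expansion:
  assumes Q: "Q \<noteq> 0" and PQ: "fps_of_poly Q * hilbert_series n a = fps_of_poly P"
  shows "(\<lambda>s. poly P (1 - s) / poly Q (1 - s)) has_laurent_expansion hilbert_laurent n a"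
proof -
  have ex: "\<exists>F. (\<lambda>s. poly R (1 - s)) has_laurent_expansion F" for R :: "complex poly"
  proof -
    have "(\<lambda>s. poly R (1 - s)) analytic_on {0}" by (induction R) (auto intro!: analytic_intros)
    thus ?thesis using analytic_at_imp_has_fps_expansion_0 has_laurent_expansion_fps by blast
  qed
  then obtain FP FQ where "(\<lambda>s. poly P (1 - s)) has_laurent_expansion FP" "(\<lambda>s. poly Q (1 - s)) has_laurent_expansion FQ"
    by blast
  hence L: "(\<lambda>s. poly P (1 - s) / poly Q (1 - s)) has_laurent_expansion FP / FQ"
    by (rule has_laurent_expansion_divide)
  have "hilbert_laurent n a = FP / FQ" unfolding hilbert_laurent_def
  proof (rule the_equality)
    show "\<exists>P Q. Q \<noteq> 0 \<and> fps_of_poly Q * hilbert_series n a = fps_of_poly P \<and>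
      (\<lambda>s. poly P (1 - s) / poly Q (1 - s)) has_laurent_expansion FP / FQ" using Q PQ L by blast
  next
    fix M assume "\<exists>P Q. Q \<noteq> 0 \<and> fps_of_poly Q * hilbert_series n a = fps_of_poly P \<and>
      (\<lambda>s. poly P (1 - s) / poly Q (1 - s)) has_laurent_expansion M"
    then obtain P' Q' where Q': "Q' \<noteq> 0" and PQ': "fps_of_poly Q' * hilbert_series n a = fps_of_poly P'"
      and M: "(\<lambda>s. poly P' (1 - s) / poly Q' (1 - s)) has_laurent_expansion M" by blast
    have "fps_of_poly (P * Q') = fps_of_poly (P' * Q)"
      unfolding fps_of_poly_mult PQ[symmetric] PQ'[symmetric] by (simp add: mult_ac)
    hence eq: "P * Q' = P' * Q" by simp
    have "\<forall>\<^sub>F s in at 0. poly P' (1 - s) / poly Q' (1 - s) = poly P (1 - s) / poly Q (1 - s)"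
      using poly_eventually_nonzero[OF Q] poly_eventually_nonzero[OF Q']
    proof eventually_elim
      case (elim s)
      have "poly P (1 - s) * poly Q' (1 - s) = poly P' (1 - s) * poly Q (1 - s)"
        using arg_cong[OF eq, of "\<lambda>p. poly p (1 - s)"] by simp
      thus ?case using elim by (simp add: field_simps)
    qed
    from has_laurent_expansion_cong[OF this refl, of M] M
    have "(\<lambda>s. poly P (1 - s) / poly Q (1 - s)) has_laurent_expansion M" by simp
    thus "M = FP / FQ" by (rule has_laurent_expansion_unique[OF _ L])
  qed
  thus ?thesis using L by simp
qed

lemma hilbert_series_rational:
  assumes "\<And>i. i \<in> {1..n} \<Longrightarrow> a i \<noteq> 0"
  shows "rational_fps (hilbert_series n a)"
proof -
  have "hilbert_series n a = weight_count a {1..n} 0"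
    by (rule fps_ext) (simp add: hilbert_series_nth weight_count_def)
  also have "rational_fps (weight_count a {1..n} 0)"
  proof (rule rational_weight_count[where A = "1 + (\<Sum>i\<in>{1..n}. \<bar>a i\<bar>)"])
    show "a i \<noteq> 0 \<and> \<bar>a i\<bar> \<le> 1 + (\<Sum>i\<in>{1..n}. \<bar>a i\<bar>)" if "i \<in> {1..n}" for i
      using assms[OF that] member_le_sum[OF that, of "\<lambda>i. \<bar>a i\<bar>"] by simp
    show "0 \<in> {- (1 + (\<Sum>i\<in>{1..n}. \<bar>a i\<bar>))<..1 + (\<Sum>i\<in>{1..n}. \<bar>a i\<bar>)}"
    proof -
      have "(\<Sum>i\<in>{1..n}. \<bar>a i\<bar>) \<ge> 0" by (rule sum_nonneg) simp
      thus ?thesis unfolding greaterThanAtMost_iff by linarith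
    qed
  qed simp
  finally show ?thesis .
qed

text \<open>The variable of \<open>hilbert_laurent\<close> is 1 - t, which is \<sigma>. The identity
  between Q times the series and P, evaluated at t = 1 - \<sigma>, identifies the sum H with the
  fraction P / Q there, so that the one-sided expansion of H is one of a function with a Laurent
  expansion.\<close>

lemma gamma_coeff_asymptotic:
  fixes H :: "real \<Rightarrow> complex"
  assumes n: "n \<ge> 1" and nz: "\<And>i. i \<in> {1..n} \<Longrightarrow> a i \<noteq> 0"
    and H: "\<forall>\<^sub>F \<sigma> in at_right 0. (\<lambda>d. fps_nth (hilbert_series n a) d * of_real (1 - \<sigma>) ^ d) sums H \<sigma>"
    and asymp: "(\<lambda>\<sigma>. of_real \<sigma> ^ (n - 1) * H \<sigma> - (\<Sum>m<N. d m * of_real \<sigma> ^ m)) \<in> O[at_right 0](\<lambda>\<sigma>. of_real \<sigma> ^ N)"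
    and m: "m < N"
  shows "gamma_coeff m n a = d m"
proof -
  have "rational_fps (hilbert_series n a)" by (rule hilbert_series_rational) (rule nz)
  then obtain P Q where Q: "Q \<noteq> 0" and PQ: "fps_of_poly Q * hilbert_series n a = fps_of_poly P"
    unfolding rational_fps_def by (elim exE conjE)
  define f where "f s = poly P (1 - s) / poly Q (1 - s)" for s
  have f: "f has_laurent_expansion hilbert_laurent n a"
    unfolding f_def by (rule hilbert_laurent_expansion[OF Q PQ])
  have lim: "filterlim complex_of_real (at 0) (at_right 0)"
    by (rule filterlim_atI) (auto intro!: tendsto_eq_intros simp: eventually_at_filter)
  have "\<forall>\<^sub>F \<sigma> in at_right 0. poly Q (1 - complex_of_real \<sigma>) \<noteq> 0"
    by (rule eventually_compose_filterlim[OF poly_eventually_nonzero[OF Q] lim])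
  with H have ev: "\<forall>\<^sub>F \<sigma> in at_right 0. f (of_real \<sigma>) = H \<sigma>"
  proof eventually_elim
    case (elim \<sigma>)
    have "(\<lambda>d. fps_nth (fps_of_poly P) d * of_real (1 - \<sigma>) ^ d) sums (poly Q (of_real (1 - \<sigma>)) * H \<sigma>)"
      using sums_fps_of_poly_mult[OF elim(1), of Q] by (simp add: PQ)
    moreover have "(\<lambda>d. fps_nth 1 d * complex_of_real (1 - \<sigma>) ^ d) sums 1"
      using sums_single[of 0 "\<lambda>_. 1 :: complex"] by (rule sums_cong[THEN iffD1, rotated]) auto
    from sums_fps_of_poly_mult[OF this, of P]
    have "(\<lambda>d. fps_nth (fps_of_poly P) d * of_real (1 - \<sigma>) ^ d) sums poly P (of_real (1 - \<sigma>))" by simp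
    ultimately have "poly Q (of_real (1 - \<sigma>)) * H \<sigma> = poly P (of_real (1 - \<sigma>))" by (rule sums_unique2)
    thus ?case using elim by (simp add: f_def field_simps)
  qed
  have "(\<lambda>\<sigma>. of_real \<sigma> ^ (n - 1) * f (of_real \<sigma>) - (\<Sum>m<N. d m * of_real \<sigma> ^ m)) \<in> O[at_right 0](\<lambda>\<sigma>. of_real \<sigma> ^ N)"
  proof (rule landau_o.big.in_cong[THEN iffD2, OF _ asymp])
    show "\<forall>\<^sub>F \<sigma> in at_right 0. of_real \<sigma> ^ (n - 1) * f (of_real \<sigma>) - (\<Sum>m<N. d m * of_real \<sigma> ^ m)
       = of_real \<sigma> ^ (n - 1) * H \<sigma> - (\<Sum>m<N. d m * of_real \<sigma> ^ m)"
      using ev by eventually_elim simp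
  qed
  from laurent_coeff_asymptotic[OF f this m] show ?thesis
    using n by (simp add: gamma_coeff_def of_nat_diff)
qed

subsection \<open>The contribution of a cluster\<close>

definition esym1 :: "(nat \<Rightarrow> int) \<Rightarrow> nat set \<Rightarrow> complex" where
  "esym1 a I = (\<Sum>i\<in>I. of_int (a i))"

text \<open>Newton's form of the second elementary symmetric polynomial, convenient because products
  over a set expand in power sums. The agreement with \<open>E2\<close> comes from
  \<open>sum_index_pairs\<close>.\<close>

definition esym2 :: "(nat \<Rightarrow> int) \<Rightarrow> nat set \<Rightarrow> complex" where
  "esym2 a I = ((\<Sum>i\<in>I. of_int (a i)) ^ 2 - (\<Sum>i\<in>I. of_int (a i) ^ 2)) / 2"

definition polar_integral :: "real \<Rightarrow> (nat \<Rightarrow> int) \<Rightarrow> nat set \<Rightarrow> nat \<Rightarrow> complex" where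
  "polar_integral A a I e = contour_integral (circlepath (-1) (cluster_radius A))
     (\<lambda>y. y ^ e / (\<Prod>i\<in>I. 1 - of_int (a i) * y)) / (2 * of_real pi * \<i>)"

text \<open>With e2 = (p1^2 - p2) / 2, the parts of highest degree (p1^2 + e2) / 12 and p1 e2 / 24
  are the second and third Todd polynomials. The third elementary symmetric polynomial cancels from
  the latter, so an induction that carries only p1 and p2 closes.\<close>

lemma unit_prod_nth:
  fixes v :: "nat \<Rightarrow> complex"
  assumes "finite I"
  defines "P \<equiv> (\<Prod>i\<in>I. fps4 1 (v i / 2) (v i * (v i + 2) / 12) (v i * (v i + 2) / 24))"
  defines "p1 \<equiv> \<Sum>i\<in>I. v i" and "p2 \<equiv> \<Sum>i\<in>I. v i ^ 2"
  shows "fps_nth P 0 = 1" "fps_nth P 1 = p1 / 2" "fps_nth P 2 = (p1\<^sup>2 + (p1\<^sup>2 - p2) / 2 + 2 * p1) / 12"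
    "fps_nth P 3 = (p1\<^sup>2 + (p1\<^sup>2 - p2) + 2 * p1 + p1 * ((p1\<^sup>2 - p2) / 2)) / 24"
proof -
  have "fps_nth P 0 = 1 \<and> fps_nth P 1 = p1 / 2 \<and> fps_nth P 2 = (p1\<^sup>2 + (p1\<^sup>2 - p2) / 2 + 2 * p1) / 12
    \<and> fps_nth P 3 = (p1\<^sup>2 + (p1\<^sup>2 - p2) + 2 * p1 + p1 * ((p1\<^sup>2 - p2) / 2)) / 24"
    unfolding P_def p1_def p2_def using assms(1)
  proof (induction I rule: finite_induct)
    case (insert j I)
    define Q where "Q = (\<Prod>i\<in>I. fps4 1 (v i / 2) (v i * (v i + 2) / 12) (v i * (v i + 2) / 24))"
    define p where "p = (\<Sum>i\<in>I. v i)"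
    define q where "q = (\<Sum>i\<in>I. v i ^ 2)"
    have IH: "fps_nth Q 0 = 1" "fps_nth Q 1 = p / 2" "fps_nth Q 2 = (p\<^sup>2 + (p\<^sup>2 - q) / 2 + 2 * p) / 12"
      "fps_nth Q 3 = (p\<^sup>2 + (p\<^sup>2 - q) + 2 * p + p * ((p\<^sup>2 - q) / 2)) / 24"
      using insert.IH by (auto simp: Q_def p_def q_def)
    have u: "fps_nth (fps4 1 (v j / 2) (v j * (v j + 2) / 12) (v j * (v j + 2) / 24)) 1 = v j / 2"
      using fps4_nth(2) by (metis One_nat_def)
    show ?case
      unfolding prod.insert[OF insert.hyps] sum.insert[OF insert.hyps] Q_def[symmetric] p_def[symmetric] q_def[symmetric]
        fps_mult_nth_small IH u fps4_nth
      by (simp add: field_simps power2_eq_square)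
  qed simp
  thus "fps_nth P 0 = 1" "fps_nth P 1 = p1 / 2" "fps_nth P 2 = (p1\<^sup>2 + (p1\<^sup>2 - p2) / 2 + 2 * p1) / 12"
    "fps_nth P 3 = (p1\<^sup>2 + (p1\<^sup>2 - p2) + 2 * p1 + p1 * ((p1\<^sup>2 - p2) / 2)) / 24" by blast+
qed

lemma expands_X_power:
  assumes "compact C"
  shows "expands C (\<lambda>\<sigma> _. of_real \<sigma> ^ k) (\<lambda>_. fps_X ^ k)"
proof -
  have "(\<lambda>x::real. x - (0 + 1 * x + 0 * x\<^sup>2 + 0 * x ^ 3)) \<in> O[at_right 0](\<lambda>x. x ^ 4)" by simp
  from expands_real[OF this, of C]
  have "expands C (\<lambda>\<sigma> _. of_real \<sigma>) (\<lambda>_. fps_X)"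
    by (rule expands_cong) (auto dest!: less_4_cases simp: fps_X_def)
  from expands_prod[OF assms finite_lessThan this, of k] show ?thesis by simp
qed

lemma prod_fps_const: "(\<Prod>i\<in>I. fps_const (f i)) = fps_const (\<Prod>i\<in>I. f i :: complex)"
  by (induction I rule: infinite_finite_induct) auto

locale weights =
  fixes n :: nat and a :: "nat \<Rightarrow> int" and A :: real
  assumes nz: "\<And>i. i \<in> {1..n} \<Longrightarrow> a i \<noteq> 0" and A: "\<And>i. i \<in> {1..n} \<Longrightarrow> \<bar>a i\<bar> \<le> A" "A \<ge> 1"
begin

abbreviation C where "C \<equiv> sphere (- 1 :: complex) (cluster_radius A)"

abbreviation J where "J \<equiv> polar_integral A a"

lemma factor_nonzero:
  assumes "i \<in> {1..n}" "y \<in> C"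
  shows "1 - of_int (a i) * y \<noteq> 0"
proof
  assume "1 - of_int (a i) * y = 0"
  hence y: "y = of_real (1 / a i)" using nz[OF assms(1)] by (auto simp: field_simps)
  have "norm (y - (- 1)) = norm (complex_of_real (1 / a i + 1))" unfolding y by simp
  also have "\<dots> = \<bar>1 / a i + 1\<bar>" by (rule norm_of_real)
  finally show False
    using assms(2) cluster_radius_separates(2)[OF nz[OF assms(1)] A(1)[OF assms(1)]]
    by (simp add: dist_norm norm_minus_commute)
qed

lemma polar_integrable:
  assumes "I \<subseteq> {1..n}"
  shows "(\<lambda>y. y ^ e / (\<Prod>i\<in>I. 1 - of_int (a i) * y)) contour_integrable_on circlepath (-1) (cluster_radius A)"
proof (rule contour_integrable_continuous_circlepath)
  have "path_image (circlepath (-1) (cluster_radius A)) = C"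
    using cluster_radius_bounds[OF A(2)] by simp
  moreover have "finite I" using assms finite_subset by blast
  moreover have "1 - of_int (a i) * y \<noteq> 0" if "i \<in> I" "y \<in> C" for i y
    using factor_nonzero[of i y] assms that by blast
  ultimately show "continuous_on (path_image (circlepath (- 1) (cluster_radius A))) (\<lambda>y. y ^ e / (\<Prod>i\<in>I. 1 - of_int (a i) * y))"
    by (intro continuous_on_divide continuous_on_power continuous_on_id continuous_on_prod
       continuous_on_diff continuous_on_const continuous_on_mult) (auto simp: prod_zero_iff)
qed

lemma polar_integral_cubic:
  assumes I: "I \<subseteq> {1..n}"
    and g: "\<And>y. y \<in> C \<Longrightarrow> g y = (c0 + c1 * y + c2 * y ^ 2 + c3 * y ^ 3) / (\<Prod>i\<in>I. 1 - of_int (a i) * y)"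
  shows "contour_integral (circlepath (-1) (cluster_radius A)) g / (2 * of_real pi * \<i>)
    = c0 * J I 0 + c1 * J I 1 + c2 * J I 2 + c3 * J I 3"
proof -
  let ?h = "\<lambda>e y. y ^ e / (\<Prod>i\<in>I. 1 - of_int (a i) * y)"
  have "path_image (circlepath (-1) (cluster_radius A)) = C"
    using cluster_radius_bounds[OF A(2)] by simp
  hence "contour_integral (circlepath (-1) (cluster_radius A)) g = contour_integral (circlepath (-1) (cluster_radius A))
     (\<lambda>y. c0 * ?h 0 y + c1 * ?h 1 y + c2 * ?h 2 y + c3 * ?h 3 y)"
    by (intro contour_integral_eq) (auto simp: g add_divide_distrib)
  also have "\<dots> = c0 * contour_integral (circlepath (-1) (cluster_radius A)) (?h 0) +
     c1 * contour_integral (circlepath (-1) (cluster_radius A)) (?h 1) +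
     c2 * contour_integral (circlepath (-1) (cluster_radius A)) (?h 2) +
     c3 * contour_integral (circlepath (-1) (cluster_radius A)) (?h 3)"
    using polar_integrable[OF I]
    by (intro contour_integral_unique has_contour_integral_add has_contour_integral_lmul has_contour_integral_integral)
  finally show ?thesis by (simp add: polar_integral_def add_divide_distrib)
qed

definition nontrivial :: "complex \<Rightarrow> nat set" where
  "nontrivial \<zeta> = {i \<in> {1..n}. \<zeta> powi a i \<noteq> 1}"

text \<open>The first factor \<open>fps4\<close> is the expansion of \<open>slog \<sigma> / \<sigma>\<close>. An index \<open>i\<close> with \<open>\<zeta>\<^bsup>a\<^sub>i\<^esup> = 1\<close> contributes a pole of the
  integrand in \<open>\<sigma>\<close>, any other one contributes a power of \<open>\<sigma>\<close> after normalisation. The cubic coefficients \<open>e i y\<close>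
  of the factors of the second kind never enter, because such factors come with at least one power of \<open>\<sigma>\<close>.\<close>

definition cluster_series :: "complex \<Rightarrow> (nat \<Rightarrow> complex \<Rightarrow> complex) \<Rightarrow> complex \<Rightarrow> complex fps" where
  "cluster_series \<zeta> e y = fps_X ^ card (nontrivial \<zeta>) * (fps4 1 (1 / 2) (1 / 3) (1 / 4) *
    ((\<Prod>i\<in>{1..n} - nontrivial \<zeta>. fps_const (1 / (1 - of_int (a i) * y)) *
        fps4 1 (- (of_int (a i) * y) / 2) (- (of_int (a i) * y) * (- (of_int (a i) * y) + 2) / 12)
          (- (of_int (a i) * y) * (- (of_int (a i) * y) + 2) / 24)) *
     (\<Prod>i\<in>nontrivial \<zeta>. fps4 (1 / (1 - \<zeta> powi a i)) (- (\<zeta> powi a i) * (1 - of_int (a i) * y) / (1 - \<zeta> powi a i) ^ 2)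
        (- (\<zeta> powi a i) * (1 - of_int (a i) * y) / (2 * (1 - \<zeta> powi a i) ^ 2)
          + \<zeta> powi a i * (1 + \<zeta> powi a i) * (1 - of_int (a i) * y) ^ 2 / (2 * (1 - \<zeta> powi a i) ^ 3)) (e i y))))"

text \<open>Balance of powers, with T = \<open>nontrivial \<zeta>\<close>: each of the n - card T
  factors with \<zeta>^a_i = 1 takes one \<sigma> to cancel its pole, and
  \<open>slog \<sigma>\<close> is divided by one, so \<sigma>^(n-1) leaves \<sigma>^card T.\<close>

lemma cluster_expands:
  assumes "n \<ge> 1"
  obtains e where "expands C (\<lambda>\<sigma> y. of_real \<sigma> ^ (n - 1) * (of_real (slog \<sigma>) *
      (\<Prod>i\<in>{1..n}. 1 / (1 - \<zeta> powi a i * exp (- (of_real (slog \<sigma>) * (1 - of_int (a i) * y)))))))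
    (cluster_series \<zeta> e)"
proof -
  define T where "T = nontrivial \<zeta>"
  have T: "T \<subseteq> {1..n}" "finite T" by (auto simp: T_def nontrivial_def)
  have C: "compact C" by simp
  have b: "continuous_on C (\<lambda>y. 1 - of_int (a i) * y)" for i by (intro continuous_intros)
  have "\<forall>i\<in>T. \<exists>e. expands C (\<lambda>\<sigma> y. 1 / (1 - \<zeta> powi a i * exp (- (of_real (slog \<sigma>) * (1 - of_int (a i) * y)))))
     (\<lambda>y. fps4 (1 / (1 - \<zeta> powi a i)) (- (\<zeta> powi a i) * (1 - of_int (a i) * y) / (1 - \<zeta> powi a i) ^ 2)
        (- (\<zeta> powi a i) * (1 - of_int (a i) * y) / (2 * (1 - \<zeta> powi a i) ^ 2)
          + \<zeta> powi a i * (1 + \<zeta> powi a i) * (1 - of_int (a i) * y) ^ 2 / (2 * (1 - \<zeta> powi a i) ^ 3)) (e y))"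
  proof
    fix i assume "i \<in> T"
    hence "\<zeta> powi a i \<noteq> 1" by (simp add: T_def nontrivial_def)
    thus "\<exists>e. expands C (\<lambda>\<sigma> y. 1 / (1 - \<zeta> powi a i * exp (- (of_real (slog \<sigma>) * (1 - of_int (a i) * y)))))
     (\<lambda>y. fps4 (1 / (1 - \<zeta> powi a i)) (- (\<zeta> powi a i) * (1 - of_int (a i) * y) / (1 - \<zeta> powi a i) ^ 2)
        (- (\<zeta> powi a i) * (1 - of_int (a i) * y) / (2 * (1 - \<zeta> powi a i) ^ 2)
          + \<zeta> powi a i * (1 + \<zeta> powi a i) * (1 - of_int (a i) * y) ^ 2 / (2 * (1 - \<zeta> powi a i) ^ 3)) (e y))"
      by (rule expands_nonunit_factor[OF C b]) (rule exI)
  qed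
  from bchoice[OF this] obtain e where e: "\<And>i. i \<in> T \<Longrightarrow> expands C (\<lambda>\<sigma> y. 1 / (1 - \<zeta> powi a i * exp (- (of_real (slog \<sigma>) * (1 - of_int (a i) * y)))))
     (\<lambda>y. fps4 (1 / (1 - \<zeta> powi a i)) (- (\<zeta> powi a i) * (1 - of_int (a i) * y) / (1 - \<zeta> powi a i) ^ 2)
        (- (\<zeta> powi a i) * (1 - of_int (a i) * y) / (2 * (1 - \<zeta> powi a i) ^ 2)
          + \<zeta> powi a i * (1 + \<zeta> powi a i) * (1 - of_int (a i) * y) ^ 2 / (2 * (1 - \<zeta> powi a i) ^ 3)) (e i y))"
    by blast
  have unit: "expands C (\<lambda>\<sigma> y. of_real \<sigma> * (1 / (1 - exp (- (of_real (slog \<sigma>) * (1 - of_int (a i) * y))))))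
     (\<lambda>y. fps_const (1 / (1 - of_int (a i) * y)) *
        fps4 1 (- (of_int (a i) * y) / 2) (- (of_int (a i) * y) * (- (of_int (a i) * y) + 2) / 12)
          (- (of_int (a i) * y) * (- (of_int (a i) * y) + 2) / 24))" if "i \<in> {1..n} - T" for i
    using expands_unit_factor[OF C b[of i]] factor_nonzero[of i] that by simp
  have slog: "(\<lambda>x. slog x / x - (1 + (1 / 2) * x + (1 / 3) * x\<^sup>2 + (1 / 4) * x ^ 3)) \<in> O[at_right 0](\<lambda>x. x ^ 4)"
    unfolding slog_def by real_asymp
  have "expands C (\<lambda>\<sigma> y. of_real \<sigma> ^ card T * (of_real (slog \<sigma> / \<sigma>) *
      ((\<Prod>i\<in>{1..n} - T. of_real \<sigma> * (1 / (1 - exp (- (of_real (slog \<sigma>) * (1 - of_int (a i) * y)))))) *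
       (\<Prod>i\<in>T. 1 / (1 - \<zeta> powi a i * exp (- (of_real (slog \<sigma>) * (1 - of_int (a i) * y))))))))
    (\<lambda>y. fps_X ^ card T * (fps4 (of_real 1) (of_real (1 / 2)) (of_real (1 / 3)) (of_real (1 / 4)) *
    ((\<Prod>i\<in>{1..n} - T. fps_const (1 / (1 - of_int (a i) * y)) *
        fps4 1 (- (of_int (a i) * y) / 2) (- (of_int (a i) * y) * (- (of_int (a i) * y) + 2) / 12)
          (- (of_int (a i) * y) * (- (of_int (a i) * y) + 2) / 24)) *
     (\<Prod>i\<in>T. fps4 (1 / (1 - \<zeta> powi a i)) (- (\<zeta> powi a i) * (1 - of_int (a i) * y) / (1 - \<zeta> powi a i) ^ 2)
        (- (\<zeta> powi a i) * (1 - of_int (a i) * y) / (2 * (1 - \<zeta> powi a i) ^ 2)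
          + \<zeta> powi a i * (1 + \<zeta> powi a i) * (1 - of_int (a i) * y) ^ 2 / (2 * (1 - \<zeta> powi a i) ^ 3)) (e i y)))))"
    by (intro expands_mult C expands_X_power expands_real[OF slog] expands_prod unit e) (use T in auto)
  hence "expands C (\<lambda>\<sigma> y. of_real \<sigma> ^ (n - 1) * (of_real (slog \<sigma>) *
      (\<Prod>i\<in>{1..n}. 1 / (1 - \<zeta> powi a i * exp (- (of_real (slog \<sigma>) * (1 - of_int (a i) * y)))))))
    (cluster_series \<zeta> e)"
  proof (rule expands_cong)
    have "\<forall>\<^sub>F \<sigma> in at_right 0. \<sigma> \<in> {0<..<1::real}" by (rule eventually_at_right_real) simp
    thus "\<forall>\<^sub>F \<sigma> in at_right 0. \<forall>y\<in>C. of_real \<sigma> ^ card T * (of_real (slog \<sigma> / \<sigma>) *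
      ((\<Prod>i\<in>{1..n} - T. of_real \<sigma> * (1 / (1 - exp (- (of_real (slog \<sigma>) * (1 - of_int (a i) * y)))))) *
       (\<Prod>i\<in>T. 1 / (1 - \<zeta> powi a i * exp (- (of_real (slog \<sigma>) * (1 - of_int (a i) * y))))))) =
       of_real \<sigma> ^ (n - 1) * (of_real (slog \<sigma>) *
      (\<Prod>i\<in>{1..n}. 1 / (1 - \<zeta> powi a i * exp (- (of_real (slog \<sigma>) * (1 - of_int (a i) * y))))))"
    proof eventually_elim
      case (elim \<sigma>)
      show ?case
      proof
        fix y
        let ?f = "\<lambda>i. 1 / (1 - \<zeta> powi a i * exp (- (of_real (slog \<sigma>) * (1 - of_int (a i) * y))))"
        have "(\<Prod>i\<in>{1..n} - T. of_real \<sigma> * (1 / (1 - exp (- (of_real (slog \<sigma>) * (1 - of_int (a i) * y)))))) =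
            (\<Prod>i\<in>{1..n} - T. of_real \<sigma> * ?f i)"
          by (rule prod.cong) (auto simp: T_def nontrivial_def)
        also have "\<dots> = of_real \<sigma> ^ (n - card T) * (\<Prod>i\<in>{1..n} - T. ?f i)"
          using T by (subst prod.distrib) (simp add: card_Diff_subset)
        finally have 1: "(\<Prod>i\<in>{1..n} - T. of_real \<sigma> * (1 / (1 - exp (- (of_real (slog \<sigma>) * (1 - of_int (a i) * y)))))) =
           of_real \<sigma> ^ (n - card T) * (\<Prod>i\<in>{1..n} - T. ?f i)" .
        have 2: "(\<Prod>i\<in>{1..n}. ?f i) = (\<Prod>i\<in>{1..n} - T. ?f i) * (\<Prod>i\<in>T. ?f i)"
          by (rule prod.subset_diff) (use T in auto)
        have "card T \<le> n" using card_mono[OF _ T(1)] by simp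
        hence "of_real \<sigma> ^ card T * of_real \<sigma> ^ (n - card T) = complex_of_real \<sigma> ^ n" by (simp flip: power_add)
        also have "\<dots> = of_real \<sigma> * of_real \<sigma> ^ (n - 1)" using assms by (cases n) auto
        finally have 3: "of_real \<sigma> ^ card T * of_real \<sigma> ^ (n - card T) = complex_of_real \<sigma> * of_real \<sigma> ^ (n - 1)" .
        have "of_real \<sigma> ^ card T * (of_real (slog \<sigma> / \<sigma>) *
          (of_real \<sigma> ^ (n - card T) * (\<Prod>i\<in>{1..n} - T. ?f i) * (\<Prod>i\<in>T. ?f i)))
          = (of_real \<sigma> ^ card T * of_real \<sigma> ^ (n - card T)) * of_real (slog \<sigma> / \<sigma>) *
            ((\<Prod>i\<in>{1..n} - T. ?f i) * (\<Prod>i\<in>T. ?f i))" by (simp only: mult_ac)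
        also have "\<dots> = of_real \<sigma> ^ (n - 1) * (of_real (slog \<sigma>) * ((\<Prod>i\<in>{1..n} - T. ?f i) * (\<Prod>i\<in>T. ?f i)))"
          unfolding 3 using elim by simp
        finally show "of_real \<sigma> ^ card T * (of_real (slog \<sigma> / \<sigma>) *
          ((\<Prod>i\<in>{1..n} - T. of_real \<sigma> * (1 / (1 - exp (- (of_real (slog \<sigma>) * (1 - of_int (a i) * y)))))) *
          (\<Prod>i\<in>T. ?f i))) = of_real \<sigma> ^ (n - 1) * (of_real (slog \<sigma>) * (\<Prod>i\<in>{1..n}. ?f i))"
          unfolding 1 2 .
      qed
    qed
  qed (simp add: cluster_series_def T_def)
  thus thesis by (rule that)
qed

text \<open>As the series carries \<sigma>^card T, the cases are the coefficients of \<sigma>^3,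
  \<sigma>^2, \<sigma> and 1 of the remaining product, integrated over the circle. For one index the
  three summands belong to the Taylor coefficients of order 0, 1 and 2 of 1 / (1 - w exp (-v)) with
  w = \<zeta>^a_j.\<close>

definition cluster_term :: "complex \<Rightarrow> complex" where
  "cluster_term \<zeta> = (let T = nontrivial \<zeta>; I = {1..n} - T; e1 = esym1 a I; e2 = esym2 a I in
    if T = {} then (6 * J I 0 - 8 * e1 * J I 1 + (3 * e2 + 2 * e1\<^sup>2) * J I 2 - e1 * e2 * J I 3) / 24
    else if card T = 1 then (\<Sum>j\<in>T.
      1 / (1 - \<zeta> powi a j) * ((4 * J I 0 - 5 * e1 * J I 1 + (e2 + e1\<^sup>2) * J I 2) / 12)
      - \<zeta> powi a j / (1 - \<zeta> powi a j) ^ 2 * ((2 * J I 0 - (2 * of_int (a j) + e1) * J I 1 + of_int (a j) * e1 * J I 2) / 2)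
      + \<zeta> powi a j * (1 + \<zeta> powi a j) / (1 - \<zeta> powi a j) ^ 3 *
         ((J I 0 - 2 * of_int (a j) * J I 1 + of_int (a j) ^ 2 * J I 2) / 2))
    else if card T = 2 then (\<Prod>j\<in>T. 1 / (1 - \<zeta> powi a j)) * ((J I 0 - e1 * J I 1) / 2)
      - (\<Sum>j\<in>T. \<zeta> powi a j / (1 - \<zeta> powi a j) ^ 2 * (\<Prod>l\<in>T - {j}. 1 / (1 - \<zeta> powi a l)) * (J I 0 - of_int (a j) * J I 1))
    else if card T = 3 then (\<Prod>j\<in>T. 1 / (1 - \<zeta> powi a j)) * J I 0
    else 0)"

lemma cluster_series_integral:
  "contour_integral (circlepath (-1) (cluster_radius A)) (\<lambda>y. fps_nth (cluster_series \<zeta> e y) 3) / (2 * of_real pi * \<i>)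
     = cluster_term \<zeta>"
proof -
  define T where "T = nontrivial \<zeta>"
  define I where "I = {1..n} - T"
  have T: "T \<subseteq> {1..n}" "finite T" by (auto simp: T_def nontrivial_def)
  have I: "I \<subseteq> {1..n}" "finite I" by (auto simp: I_def)
  define e1 where "e1 = esym1 a I"
  define e2 where "e2 = esym2 a I"
  define P where "P y = (\<Prod>i\<in>I. fps4 1 (- (of_int (a i) * y) / 2) (- (of_int (a i) * y) * (- (of_int (a i) * y) + 2) / 12)
          (- (of_int (a i) * y) * (- (of_int (a i) * y) + 2) / 24))" for y
  define D where "D y = (\<Prod>i\<in>I. 1 - of_int (a i) * y)" for y :: complex
  define w where "w i = \<zeta> powi a i" for i
  define N where "N i y = fps4 (1 / (1 - w i)) (- w i * (1 - of_int (a i) * y) / (1 - w i) ^ 2)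
        (- w i * (1 - of_int (a i) * y) / (2 * (1 - w i) ^ 2)
          + w i * (1 + w i) * (1 - of_int (a i) * y) ^ 2 / (2 * (1 - w i) ^ 3)) (e i y)" for i y
  have N: "fps_nth (N i y) 0 = 1 / (1 - w i)" "fps_nth (N i y) 1 = - w i * (1 - of_int (a i) * y) / (1 - w i) ^ 2"
    "fps_nth (N i y) 2 = - w i * (1 - of_int (a i) * y) / (2 * (1 - w i) ^ 2)
          + w i * (1 + w i) * (1 - of_int (a i) * y) ^ 2 / (2 * (1 - w i) ^ 3)" for i y
    by (simp_all add: N_def)
  define Q where "Q y = fps4 1 (1 / 2) (1 / 3) (1 / 4) * P y" for y
  have "(\<Sum>i\<in>I. of_int (a i) ^ 2) = e1\<^sup>2 - 2 * e2" by (simp add: e1_def e2_def esym1_def esym2_def field_simps)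
  hence p: "(\<Sum>i\<in>I. - (of_int (a i) * y)) = - e1 * y" "(\<Sum>i\<in>I. (- (of_int (a i) * y))\<^sup>2) = (e1\<^sup>2 - 2 * e2) * y\<^sup>2" for y
    by (simp_all add: e1_def esym1_def sum_negf power_mult_distrib flip: sum_distrib_right)
  have P: "fps_nth (P y) 0 = 1" "fps_nth (P y) 1 = - e1 * y / 2" "fps_nth (P y) 2 = (e1\<^sup>2 * y\<^sup>2 + e2 * y\<^sup>2 - 2 * e1 * y) / 12"
    "fps_nth (P y) 3 = (e1\<^sup>2 * y\<^sup>2 + 2 * e2 * y\<^sup>2 - 2 * e1 * y - e1 * e2 * y ^ 3) / 24" for y
    using unit_prod_nth[OF I(2), of "\<lambda>i. - (of_int (a i) * y)"] unfolding P_def p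
    by (simp_all add: field_simps power2_eq_square power3_eq_cube)
  \<comment> \<open>Q unites \<open>slog \<sigma> / \<sigma>\<close> with the factors for which
    \<zeta>^a_i = 1. Up to sign, its cubic coefficient is the numerator of the first line of the
    formula and its quadratic coefficient that of the second, with powers of y in place of the
    S_u.\<close>
  have Q: "fps_nth (Q y) 0 = 1" "fps_nth (Q y) 1 = (1 - e1 * y) / 2" "fps_nth (Q y) 2 = (4 - 5 * e1 * y + (e2 + e1\<^sup>2) * y\<^sup>2) / 12"
    "fps_nth (Q y) 3 = (6 - 8 * e1 * y + (3 * e2 + 2 * e1\<^sup>2) * y\<^sup>2 - e1 * e2 * y ^ 3) / 24" for y
    unfolding Q_def fps_mult_nth_small P by (simp_all add: field_simps)
  have series: "cluster_series \<zeta> e y = fps_X ^ card T * (fps_const (1 / D y) * (Q y * (\<Prod>i\<in>T. N i y)))" for y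
    unfolding cluster_series_def T_def[symmetric] I_def[symmetric] N_def w_def Q_def P_def prod.distrib prod_fps_const D_def
    by (simp add: mult_ac prod_dividef)
  have nth: "fps_nth (cluster_series \<zeta> e y) 3 =
     (if card T > 3 then 0 else fps_nth (Q y * (\<Prod>i\<in>T. N i y)) (3 - card T) / D y)" for y
    unfolding series by (simp add: fps_X_power_mult_nth)
  have cterm: "cluster_term \<zeta> = (
    if T = {} then (6 * J I 0 - 8 * e1 * J I 1 + (3 * e2 + 2 * e1\<^sup>2) * J I 2 - e1 * e2 * J I 3) / 24
    else if card T = 1 then (\<Sum>j\<in>T.
      1 / (1 - w j) * ((4 * J I 0 - 5 * e1 * J I 1 + (e2 + e1\<^sup>2) * J I 2) / 12)
      - w j / (1 - w j) ^ 2 * ((2 * J I 0 - (2 * of_int (a j) + e1) * J I 1 + of_int (a j) * e1 * J I 2) / 2)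
      + w j * (1 + w j) / (1 - w j) ^ 3 *
         ((J I 0 - 2 * of_int (a j) * J I 1 + of_int (a j) ^ 2 * J I 2) / 2))
    else if card T = 2 then (\<Prod>j\<in>T. 1 / (1 - w j)) * ((J I 0 - e1 * J I 1) / 2)
      - (\<Sum>j\<in>T. w j / (1 - w j) ^ 2 * (\<Prod>l\<in>T - {j}. 1 / (1 - w l)) * (J I 0 - of_int (a j) * J I 1))
    else if card T = 3 then (\<Prod>j\<in>T. 1 / (1 - w j)) * J I 0
    else 0)"
    by (simp add: cluster_term_def Let_def T_def I_def e1_def e2_def w_def)
  consider "T = {}" | j where "T = {j}" | j l where "T = {j, l}" "j \<noteq> l"
    | j l m where "T = {j, l, m}" "j \<noteq> l" "j \<noteq> m" "l \<noteq> m" | "card T > 3"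
  proof -
    have "card T = 0 \<or> card T = 1 \<or> card T = 2 \<or> card T = 3 \<or> card T > 3" by linarith
    thus thesis using that T(2) by (auto simp: card_1_singleton_iff card_2_iff card_3_iff)
  qed
  thus ?thesis
  proof cases
    case 1
    have "contour_integral (circlepath (-1) (cluster_radius A)) (\<lambda>y. fps_nth (cluster_series \<zeta> e y) 3) / (2 * of_real pi * \<i>)
       = 6 / 24 * J I 0 + (- 8 * e1 / 24) * J I 1 + ((3 * e2 + 2 * e1\<^sup>2) / 24) * J I 2 + (- e1 * e2 / 24) * J I 3"
    proof (rule polar_integral_cubic[OF I(1)])
      fix y
      have "fps_nth (Q y) 3 = 6 / 24 + (- 8 * e1 / 24) * y + ((3 * e2 + 2 * e1\<^sup>2) / 24) * y ^ 2 + (- e1 * e2 / 24) * y ^ 3"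
        unfolding Q by (simp add: field_simps)
      thus "fps_nth (cluster_series \<zeta> e y) 3 = (6 / 24 + (- 8 * e1 / 24) * y + ((3 * e2 + 2 * e1\<^sup>2) / 24) * y ^ 2
          + (- e1 * e2 / 24) * y ^ 3) / (\<Prod>i\<in>I. 1 - of_int (a i) * y)"
        using 1 by (simp add: nth D_def)
    qed
    also have "\<dots> = cluster_term \<zeta>" unfolding cterm by (simp add: 1 field_simps)
    finally show ?thesis .
  next
    case (2 j)
    define u where "u = 1 / (1 - w j)"
    define v where "v = w j / (1 - w j) ^ 2"
    define x where "x = w j * (1 + w j) / (1 - w j) ^ 3"
    have N': "fps_nth (N j y) 0 = u" "fps_nth (N j y) 1 = - v * (1 - of_int (a j) * y)"
      "fps_nth (N j y) 2 = - v * (1 - of_int (a j) * y) / 2 + x * (1 - of_int (a j) * y) ^ 2 / 2" for y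
      unfolding N u_def v_def x_def by (simp_all add: mult_ac)
    have "contour_integral (circlepath (-1) (cluster_radius A)) (\<lambda>y. fps_nth (cluster_series \<zeta> e y) 3) / (2 * of_real pi * \<i>)
       = (u / 3 - v + x / 2) * J I 0 + (- (5 * u * e1) / 12 + v * (2 * of_int (a j) + e1) / 2 - x * of_int (a j)) * J I 1
        + (u * (e2 + e1\<^sup>2) / 12 - v * of_int (a j) * e1 / 2 + x * of_int (a j) ^ 2 / 2) * J I 2 + 0 * J I 3"
    proof (rule polar_integral_cubic[OF I(1)])
      fix y
      have "fps_nth (Q y * N j y) 2 = u / 3 - v + x / 2 + (- (5 * u * e1) / 12 + v * (2 * of_int (a j) + e1) / 2 - x * of_int (a j)) * y
        + (u * (e2 + e1\<^sup>2) / 12 - v * of_int (a j) * e1 / 2 + x * of_int (a j) ^ 2 / 2) * y ^ 2 + 0 * y ^ 3"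
        unfolding fps_mult_nth_small Q N' by (simp add: field_simps power2_eq_square)
      thus "fps_nth (cluster_series \<zeta> e y) 3 = (u / 3 - v + x / 2 + (- (5 * u * e1) / 12 + v * (2 * of_int (a j) + e1) / 2 - x * of_int (a j)) * y
        + (u * (e2 + e1\<^sup>2) / 12 - v * of_int (a j) * e1 / 2 + x * of_int (a j) ^ 2 / 2) * y ^ 2 + 0 * y ^ 3) / (\<Prod>i\<in>I. 1 - of_int (a i) * y)"
        by (simp add: nth 2 D_def)
    qed
    also have "\<dots> = u * ((4 * J I 0 - 5 * e1 * J I 1 + (e2 + e1\<^sup>2) * J I 2) / 12)
      - v * ((2 * J I 0 - (2 * of_int (a j) + e1) * J I 1 + of_int (a j) * e1 * J I 2) / 2)
      + x * ((J I 0 - 2 * of_int (a j) * J I 1 + of_int (a j) ^ 2 * J I 2) / 2)"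
      by (simp add: field_simps)
    also have "\<dots> = cluster_term \<zeta>" unfolding cterm by (simp add: 2 u_def v_def x_def)
    finally show ?thesis .
  next
    case (3 j l)
    define u where "u j = 1 / (1 - w j)" for j
    define v where "v j = w j / (1 - w j) ^ 2" for j
    have N': "fps_nth (N j y) 0 = u j" "fps_nth (N j y) 1 = - v j * (1 - of_int (a j) * y)" for j y
      unfolding N u_def v_def by (simp_all add: mult_ac)
    have "contour_integral (circlepath (-1) (cluster_radius A)) (\<lambda>y. fps_nth (cluster_series \<zeta> e y) 3) / (2 * of_real pi * \<i>)
       = (u j * u l / 2 - v j * u l - v l * u j) * J I 0 + (- (u j * u l * e1) / 2 + v j * u l * of_int (a j) + v l * u j * of_int (a l)) * J I 1
        + 0 * J I 2 + 0 * J I 3"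
    proof (rule polar_integral_cubic[OF I(1)])
      fix y
      have "fps_nth (Q y * (N j y * N l y)) 1 = u j * u l / 2 - v j * u l - v l * u j
        + (- (u j * u l * e1) / 2 + v j * u l * of_int (a j) + v l * u j * of_int (a l)) * y + 0 * y ^ 2 + 0 * y ^ 3"
        unfolding fps_mult_nth_small Q N' by (simp add: field_simps)
      thus "fps_nth (cluster_series \<zeta> e y) 3 = (u j * u l / 2 - v j * u l - v l * u j
        + (- (u j * u l * e1) / 2 + v j * u l * of_int (a j) + v l * u j * of_int (a l)) * y + 0 * y ^ 2 + 0 * y ^ 3) / (\<Prod>i\<in>I. 1 - of_int (a i) * y)"
        using 3 by (simp add: nth D_def)
    qed
    also have "\<dots> = u j * u l * ((J I 0 - e1 * J I 1) / 2)
      - (v j * u l * (J I 0 - of_int (a j) * J I 1) + v l * u j * (J I 0 - of_int (a l) * J I 1))"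
      by (simp add: field_simps)
    also have "\<dots> = cluster_term \<zeta>"
    proof -
      have "T - {j} = {l}" "T - {l} = {j}" using 3 by auto
      thus ?thesis unfolding cterm using 3 by (simp add: u_def v_def mult.commute)
    qed
    finally show ?thesis .
  next
    case (4 j l m)
    define u where "u j = 1 / (1 - w j)" for j
    have "contour_integral (circlepath (-1) (cluster_radius A)) (\<lambda>y. fps_nth (cluster_series \<zeta> e y) 3) / (2 * of_real pi * \<i>)
       = (u j * u l * u m) * J I 0 + 0 * J I 1 + 0 * J I 2 + 0 * J I 3"
      by (rule polar_integral_cubic[OF I(1)]) (use 4 in \<open>simp add: nth D_def fps_mult_nth_small Q N u_def\<close>)
    also have "\<dots> = cluster_term \<zeta>" unfolding cterm using 4 by (simp add: u_def)
    finally show ?thesis .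
  next
    case 5
    hence "fps_nth (cluster_series \<zeta> e y) 3 = 0" for y by (simp add: nth)
    moreover have "T \<noteq> {}" using 5 by auto
    ultimately show ?thesis unfolding cterm using 5 by simp
  qed
qed

text \<open>For s = \<open>slog \<sigma>\<close> the exact formula gives the Hilbert series at t = 1
  - \<sigma> as a finite sum of integrals. Each of them, multiplied by \<sigma>^(n-1), has an
  expansion up to O(\<sigma>^4), so the coefficient of \<sigma>^3 is the sum of the integrated third
  coefficients.\<close>

theorem gamma3_cluster_sum:
  assumes neg: "\<exists>i\<in>{1..n}. a i < 0" and L: "L > 0" "\<And>i. i \<in> {1..n} \<Longrightarrow> a i dvd int L"
  shows "gamma_coeff 3 n a = (\<Sum>\<zeta> | \<zeta> ^ L = 1. cluster_term \<zeta>)"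
proof -
  define R where "R = cluster_radius A"
  have R: "R > 0" using cluster_radius_bounds[OF A(2)] by (simp add: R_def)
  have n: "n \<ge> 1" using neg by auto
  define K where "K \<zeta> \<sigma> y = of_real \<sigma> ^ (n - 1) * (of_real (slog \<sigma>) *
      (\<Prod>i\<in>{1..n}. 1 / (1 - \<zeta> powi a i * exp (- (of_real (slog \<sigma>) * (1 - of_int (a i) * y))))))" for \<zeta> y :: complex and \<sigma> :: real
  have "\<exists>e. expands C (K \<zeta>) (cluster_series \<zeta> e)" for \<zeta>
    unfolding K_def by (rule cluster_expands[OF n, of \<zeta>]) (rule exI)
  then obtain e where e: "\<And>\<zeta>. expands C (K \<zeta>) (cluster_series \<zeta> (e \<zeta>))" by metis
  define H where "H \<sigma> = (\<Sum>\<zeta> | \<zeta> ^ L = 1. of_real (slog \<sigma>) / (2 * of_real pi * \<i>) * contour_integral (circlepath (-1) R)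
       (\<lambda>y. \<Prod>i\<in>{1..n}. 1 / (1 - \<zeta> powi a i * exp (- (of_real (slog \<sigma>) * (1 - of_int (a i) * y))))))" for \<sigma>
  define d where "d m = (\<Sum>\<zeta> | \<zeta> ^ L = 1. contour_integral (circlepath (-1) R) (\<lambda>y. fps_nth (cluster_series \<zeta> (e \<zeta>) y) m) / (2 * of_real pi * \<i>))" for m
  have "gamma_coeff 3 n a = d 3"
  proof (rule gamma_coeff_asymptotic[OF n nz])
    have "(slog \<longlongrightarrow> 0) (at_right 0)" unfolding slog_def by real_asymp
    hence "\<forall>\<^sub>F \<sigma> in at_right 0. dist (slog \<sigma>) 0 < pi / L" by (rule tendstoD) (use L in simp)
    moreover have "\<forall>\<^sub>F \<sigma> in at_right 0. \<sigma> \<in> {0<..<1::real}" by (rule eventually_at_right_real) simp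
    ultimately show "\<forall>\<^sub>F \<sigma> in at_right 0. (\<lambda>d. fps_nth (hilbert_series n a) d * of_real (1 - \<sigma>) ^ d) sums H \<sigma>"
    proof eventually_elim
      case (elim \<sigma>)
      have s: "slog \<sigma> > 0" using elim by (simp add: slog_def)
      have "exp (- complex_of_real (slog \<sigma>)) = of_real (exp (- slog \<sigma>))" by (simp flip: exp_of_real)
      also have "exp (- slog \<sigma>) = 1 - \<sigma>" using elim by (simp add: slog_def)
      finally show ?case
        using hilbert_series_clusters[OF nz A neg L s] elim unfolding H_def R_def by simp
    qed
    have lim: "(\<lambda>\<sigma>. contour_integral (circlepath (-1) R) (K \<zeta> \<sigma>)
     - (\<Sum>m<4. contour_integral (circlepath (-1) R) (\<lambda>y. fps_nth (cluster_series \<zeta> (e \<zeta>) y) m) * of_real \<sigma> ^ m))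
       \<in> O[at_right 0](\<lambda>\<sigma>. complex_of_real \<sigma> ^ 4)" for \<zeta>
      by (rule expands_contour_integral[OF R]) (use e in \<open>simp add: R_def\<close>)
    have "(\<lambda>\<sigma>. \<Sum>\<zeta> | \<zeta> ^ L = 1. (1 / (2 * of_real pi * \<i>)) * (contour_integral (circlepath (-1) R) (K \<zeta> \<sigma>)
     - (\<Sum>m<4. contour_integral (circlepath (-1) R) (\<lambda>y. fps_nth (cluster_series \<zeta> (e \<zeta>) y) m) * of_real \<sigma> ^ m)))
       \<in> O[at_right 0](\<lambda>\<sigma>. complex_of_real \<sigma> ^ 4)"
      by (rule big_sum_in_bigo) (use lim in simp)
    also have "(\<lambda>\<sigma>. \<Sum>\<zeta> | \<zeta> ^ L = 1. (1 / (2 * of_real pi * \<i>)) * (contour_integral (circlepath (-1) R) (K \<zeta> \<sigma>)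
     - (\<Sum>m<4. contour_integral (circlepath (-1) R) (\<lambda>y. fps_nth (cluster_series \<zeta> (e \<zeta>) y) m) * of_real \<sigma> ^ m)))
       = (\<lambda>\<sigma>. of_real \<sigma> ^ (n - 1) * H \<sigma> - (\<Sum>m<4. d m * of_real \<sigma> ^ m))"
    proof
      fix \<sigma>
      have "contour_integral (circlepath (-1) R) (K \<zeta> \<sigma>) = of_real \<sigma> ^ (n - 1) * (of_real (slog \<sigma>) * contour_integral (circlepath (-1) R)
       (\<lambda>y. \<Prod>i\<in>{1..n}. 1 / (1 - \<zeta> powi a i * exp (- (of_real (slog \<sigma>) * (1 - of_int (a i) * y))))))" for \<zeta>
        unfolding K_def contour_integral_integral mult.assoc integral_mult_right ..
      hence "(\<Sum>\<zeta> | \<zeta> ^ L = 1. (1 / (2 * of_real pi * \<i>)) * contour_integral (circlepath (-1) R) (K \<zeta> \<sigma>)) = of_real \<sigma> ^ (n - 1) * H \<sigma>"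
        unfolding H_def sum_distrib_left by (intro sum.cong) simp_all
      moreover have "(\<Sum>\<zeta> | \<zeta> ^ L = 1. (1 / (2 * of_real pi * \<i>)) *
          (\<Sum>m<4. contour_integral (circlepath (-1) R) (\<lambda>y. fps_nth (cluster_series \<zeta> (e \<zeta>) y) m) * of_real \<sigma> ^ m))
          = (\<Sum>m<4. d m * of_real \<sigma> ^ m)"
        unfolding d_def sum_distrib_left sum_distrib_right by (subst sum.swap) simp
      ultimately show "(\<Sum>\<zeta> | \<zeta> ^ L = 1. (1 / (2 * of_real pi * \<i>)) * (contour_integral (circlepath (-1) R) (K \<zeta> \<sigma>)
     - (\<Sum>m<4. contour_integral (circlepath (-1) R) (\<lambda>y. fps_nth (cluster_series \<zeta> (e \<zeta>) y) m) * of_real \<sigma> ^ m)))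
       = of_real \<sigma> ^ (n - 1) * H \<sigma> - (\<Sum>m<4. d m * of_real \<sigma> ^ m)"
        by (simp only: right_diff_distrib sum_subtractf)
    qed
    finally show "(\<lambda>\<sigma>. of_real \<sigma> ^ (n - 1) * H \<sigma> - (\<Sum>m<4. d m * of_real \<sigma> ^ m)) \<in> O[at_right 0](\<lambda>\<sigma>. of_real \<sigma> ^ 4)" .
  qed simp_all
  thus ?thesis unfolding d_def R_def cluster_series_integral .
qed

end

subsection \<open>The Laurent polynomials \<open>S\<^sub>u\<close>\<close>

text \<open>Exponents may be negative and \<open>0 powi (- 1) = 0\<close>, so evaluation is
  multiplicative only at points without zero coordinates.\<close>

abbreviation nonvanishing :: "(nat \<Rightarrow> complex) \<Rightarrow> bool" where
  "nonvanishing z \<equiv> (\<forall>i. z i \<noteq> 0)"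

lemma laurent_eval_monomial_at:
  "laurent_eval f z = (\<Sum>m\<in>Poly_Mapping.keys f. Poly_Mapping.lookup f m * monomial_at z m)"
  by (simp add: laurent_eval_def monomial_at_def)

lemma laurent_eval_superset:
  assumes "finite M" "Poly_Mapping.keys f \<subseteq> M"
  shows "laurent_eval f z = (\<Sum>m\<in>M. Poly_Mapping.lookup f m * monomial_at z m)"
  unfolding laurent_eval_monomial_at
  by (rule sum.mono_neutral_left) (use assms in \<open>auto simp: in_keys_iff\<close>)

lemma laurent_eval_0 [simp]: "laurent_eval 0 z = 0"
  by (simp add: laurent_eval_def)

lemma laurent_eval_add: "laurent_eval (f + g) z = laurent_eval f z + laurent_eval g z"
proof -
  let ?M = "Poly_Mapping.keys f \<union> Poly_Mapping.keys g"
  have "Poly_Mapping.keys (f + g) \<subseteq> ?M" by (rule Poly_Mapping.keys_add)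
  thus ?thesis
    by (simp add: laurent_eval_superset[of ?M] lookup_add algebra_simps sum.distrib)
qed

lemma laurent_eval_sum: "laurent_eval (\<Sum>x\<in>X. f x) z = (\<Sum>x\<in>X. laurent_eval (f x) z)"
  by (induction X rule: infinite_finite_induct) (auto simp: laurent_eval_add)

lemma laurent_eval_single: "laurent_eval (Poly_Mapping.single m c) z = c * monomial_at z m"
  by (simp add: laurent_eval_monomial_at)

lemma monomial_at_add:
  assumes "nonvanishing z"
  shows "monomial_at z (m + m') = monomial_at z m * monomial_at z m'"
proof -
  let ?M = "Poly_Mapping.keys m \<union> Poly_Mapping.keys m'"
  have "Poly_Mapping.keys (m + m') \<subseteq> ?M" by (rule Poly_Mapping.keys_add)
  thus ?thesis
    using assms by (simp add: monomial_at_superset[of ?M] lookup_add power_int_add prod.distrib)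
qed

lemma laurent_monomial_sum:
  fixes f :: laurent
  shows "f = (\<Sum>m\<in>Poly_Mapping.keys f. Poly_Mapping.single m (Poly_Mapping.lookup f m))"
proof (rule poly_mapping_eqI)
  fix k
  have "(\<Sum>m\<in>Poly_Mapping.keys f. Poly_Mapping.lookup f m when m = k) = Poly_Mapping.lookup f k"
    by (cases "k \<in> Poly_Mapping.keys f") (auto simp: when_def in_keys_iff)
  thus "Poly_Mapping.lookup f k
     = Poly_Mapping.lookup (\<Sum>m\<in>Poly_Mapping.keys f. Poly_Mapping.single m (Poly_Mapping.lookup f m)) k"
    by (simp add: lookup_sum lookup_single)
qed

lemma laurent_eval_mult:
  assumes "nonvanishing z"
  shows "laurent_eval (f * g) z = laurent_eval f z * laurent_eval g z"
proof -
  have "f * g = (\<Sum>m\<in>Poly_Mapping.keys f. \<Sum>m'\<in>Poly_Mapping.keys g.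
      Poly_Mapping.single (m + m') (Poly_Mapping.lookup f m * Poly_Mapping.lookup g m'))"
    by (subst laurent_monomial_sum[of f], subst laurent_monomial_sum[of g])
      (simp add: sum_product Poly_Mapping.mult_single)
  thus ?thesis
    by (simp add: laurent_eval_sum laurent_eval_single monomial_at_add[OF assms] mult_ac
        laurent_eval_monomial_at[of f] laurent_eval_monomial_at[of g] sum_product)
qed

lemma laurent_eval_1: "laurent_eval 1 z = 1"
  using laurent_eval_single[of 0 1 z] by (simp add: monomial_at_def)

text \<open>In this form evaluation commutes with determinants through
  \<open>hom_det\<close>.\<close>

lemma laurent_eval_hom:
  assumes "nonvanishing z"
  shows "comm_ring_hom (\<lambda>f. laurent_eval f z)"
  by unfold_locales (simp_all add: laurent_eval_add laurent_eval_mult assms laurent_eval_1)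

lemma laurent_eval_diff:
  assumes "nonvanishing z"
  shows "laurent_eval (f - g) z = laurent_eval f z - laurent_eval g z"
proof -
  interpret comm_ring_hom "\<lambda>f. laurent_eval f z" by (rule laurent_eval_hom[OF assms])
  show ?thesis by (rule hom_minus)
qed

lemma laurent_eval_prod:
  assumes "nonvanishing z"
  shows "laurent_eval (\<Prod>x\<in>X. f x) z = (\<Prod>x\<in>X. laurent_eval (f x) z)"
  by (induction X rule: infinite_finite_induct) (auto simp: laurent_eval_mult assms laurent_eval_1)

lemma laurent_eval_eq_0_imp:
  assumes "\<And>z. nonvanishing z \<Longrightarrow> laurent_eval f z = 0"
  shows "f = 0"
proof (rule poly_mapping_eqI)
  fix m
  show "Poly_Mapping.lookup f m = Poly_Mapping.lookup 0 m"
  proof (cases "m \<in> Poly_Mapping.keys f")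
    case True
    have "Poly_Mapping.lookup f m = 0"
      by (rule monomials_independent[OF finite_keys _ True]) (use assms in \<open>simp flip: laurent_eval_monomial_at\<close>)
    thus ?thesis by simp
  qed (simp add: in_keys_iff)
qed

lemma laurent_eqI:
  assumes "\<And>z. nonvanishing z \<Longrightarrow> laurent_eval f z = laurent_eval g z"
  shows "f = g"
  using laurent_eval_eq_0_imp[of "f - g"] assms by (simp add: laurent_eval_diff)

lemma monomial_at_single: "monomial_at z (Poly_Mapping.single i e) = z i powi e"
  by (cases "e = 0") (auto simp: monomial_at_def)

lemma laurent_eval_lvar_pow: "laurent_eval (lvar_pow i e) z = z i powi e"
  by (simp add: lvar_pow_def laurent_eval_single monomial_at_single)

section \<open>Divisibility by differences of variables\<close>

lemma lvar_pow_add: "lvar_pow i (d + e) = lvar_pow i d * lvar_pow i e"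
  by (simp add: lvar_pow_def Poly_Mapping.mult_single single_add)

lemma lvar_pow_nat: "lvar_pow i (int k) = lvar_pow i 1 ^ k"
proof (induction k)
  case 0 show ?case by (simp add: lvar_pow_def)
next
  case (Suc k)
  have "lvar_pow i (1 + int k) = lvar_pow i 1 * lvar_pow i (int k)" by (rule lvar_pow_add)
  thus ?case using Suc by simp
qed

text \<open>For a negative exponent, x^(-k) - y^(-k) is x^k - y^k times the unit - x^(-k) y^(-k), so
  the geometric sum for nonnegative exponents suffices.\<close>

lemma lvar_pow_diff_dvd: "(lvar_pow i 1 - lvar_pow j 1) dvd (lvar_pow i e - lvar_pow j e)"
proof -
  have pow: "(lvar_pow i 1 - lvar_pow j 1) dvd (lvar_pow i (int k) - lvar_pow j (int k))" for i j k
    unfolding lvar_pow_nat by (metis dvd_triv_left power_diff_sumr2)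
  show ?thesis
  proof (cases e rule: int_cases2)
    case (nonneg k) thus ?thesis using pow by simp
  next
    case (nonpos k)
    have one: "lvar_pow i (int k) * lvar_pow i (- int k) = 1" for i
      by (simp flip: lvar_pow_add) (simp add: lvar_pow_def)
    have "lvar_pow i e - lvar_pow j e = lvar_pow i (- int k) * (lvar_pow j (int k) * lvar_pow j (- int k))
        - lvar_pow j (- int k) * (lvar_pow i (int k) * lvar_pow i (- int k))"
      unfolding one nonpos by simp
    also have "\<dots> = (lvar_pow i (int k) - lvar_pow j (int k)) * (- (lvar_pow i (- int k) * lvar_pow j (- int k)))"
      by (simp add: algebra_simps)
    finally show ?thesis using pow[of i j k] by (simp add: dvd_mult2)
  qed
qed

text \<open>The substitution of \<open>x\<^sub>j\<close> for \<open>x\<^sub>i\<close>.\<close>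

definition identify :: "nat \<Rightarrow> nat \<Rightarrow> laurent \<Rightarrow> laurent" where
  "identify i j f = (\<Sum>m\<in>Poly_Mapping.keys f.
     Poly_Mapping.single (m + Poly_Mapping.single i (- Poly_Mapping.lookup m i) + Poly_Mapping.single j (Poly_Mapping.lookup m i))
       (Poly_Mapping.lookup f m))"

lemma laurent_eval_identify:
  assumes "nonvanishing z" "i \<noteq> j"
  shows "laurent_eval (identify i j f) z = laurent_eval f (z(i := z j))"
proof -
  have "monomial_at z (m + Poly_Mapping.single i (- Poly_Mapping.lookup m i) + Poly_Mapping.single j (Poly_Mapping.lookup m i))
      = monomial_at (z(i := z j)) m" for m
  proof -
    let ?M = "insert i (Poly_Mapping.keys m)"
    have 1: "monomial_at z m = z i powi Poly_Mapping.lookup m i * (\<Prod>k\<in>?M - {i}. z k powi Poly_Mapping.lookup m k)"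
      by (subst monomial_at_superset[of ?M]) (auto simp: prod.remove[of ?M i])
    have "monomial_at (z(i := z j)) m = z j powi Poly_Mapping.lookup m i * (\<Prod>k\<in>?M - {i}. (z(i := z j)) k powi Poly_Mapping.lookup m k)"
      by (subst monomial_at_superset[of ?M]) (auto simp: prod.remove[of ?M i])
    also have "(\<Prod>k\<in>?M - {i}. (z(i := z j)) k powi Poly_Mapping.lookup m k) = (\<Prod>k\<in>?M - {i}. z k powi Poly_Mapping.lookup m k)"
      by (rule prod.cong) auto
    finally show ?thesis
      using assms by (simp add: monomial_at_add 1 monomial_at_single power_int_minus field_simps fun_upd_def)
  qed
  thus ?thesis
    by (simp add: identify_def laurent_eval_sum laurent_eval_single laurent_eval_monomial_at[of f])
qed

text \<open>The factor theorem for x_i - x_j: on a single monomial the difference is a monomial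
  times x_i^e - x_j^e.\<close>

lemma dvd_diff_identify:
  assumes "i \<noteq> j"
  shows "(lvar_pow i 1 - lvar_pow j 1) dvd (f - identify i j f)"
proof -
  have "f - identify i j f = (\<Sum>m\<in>Poly_Mapping.keys f. Poly_Mapping.single m (Poly_Mapping.lookup f m) -
     Poly_Mapping.single (m + Poly_Mapping.single i (- Poly_Mapping.lookup m i) + Poly_Mapping.single j (Poly_Mapping.lookup m i))
       (Poly_Mapping.lookup f m))"
    by (subst (1) laurent_monomial_sum[of f]) (simp add: identify_def sum_subtractf)
  also have "(lvar_pow i 1 - lvar_pow j 1) dvd \<dots>"
  proof (rule dvd_sum)
    fix m :: "nat \<Rightarrow>\<^sub>0 int"
    define m0 where "m0 = m + Poly_Mapping.single i (- Poly_Mapping.lookup m i)"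
    have m: "m = m0 + Poly_Mapping.single i (Poly_Mapping.lookup m i)"
      by (rule poly_mapping_eqI) (simp add: m0_def lookup_add lookup_single when_def)
    have "Poly_Mapping.single m (Poly_Mapping.lookup f m) -
       Poly_Mapping.single (m0 + Poly_Mapping.single j (Poly_Mapping.lookup m i)) (Poly_Mapping.lookup f m)
      = Poly_Mapping.single m0 (Poly_Mapping.lookup f m) * (lvar_pow i (Poly_Mapping.lookup m i) - lvar_pow j (Poly_Mapping.lookup m i))"
      using m by (simp add: lvar_pow_def right_diff_distrib Poly_Mapping.mult_single)
    thus "(lvar_pow i 1 - lvar_pow j 1) dvd Poly_Mapping.single m (Poly_Mapping.lookup f m) -
       Poly_Mapping.single (m + Poly_Mapping.single i (- Poly_Mapping.lookup m i) + Poly_Mapping.single j (Poly_Mapping.lookup m i)) (Poly_Mapping.lookup f m)"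
      using lvar_pow_diff_dvd by (simp add: m0_def dvd_mult)
  qed
  finally show ?thesis .
qed

text \<open>Unique factorization is avoided. If f = V q for the factors treated so far, then V q
  vanishes under x_i = x_j; the substituted V is nonzero and Laurent polynomials have no zero
  divisors, so the substituted q is 0 and x_i - x_j divides q.\<close>

lemma prod_variable_diffs_dvd:
  fixes f :: laurent
  assumes "finite P" "\<And>i j. (i, j) \<in> P \<Longrightarrow> i < j"
    and "\<And>i j z. (i, j) \<in> P \<Longrightarrow> nonvanishing z \<Longrightarrow> z i = z j \<Longrightarrow> laurent_eval f z = 0"
  shows "(\<Prod>(i, j)\<in>P. lvar_pow i 1 - lvar_pow j 1) dvd f"
  using assms
proof (induction P rule: finite_induct)
  case (insert p P)
  obtain i j where p: "p = (i, j)" by force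
  have ij: "i < j" using insert.prems(1) p by auto
  define V where "V = (\<Prod>(i, j)\<in>P. lvar_pow i 1 - lvar_pow j 1)"
  have "V dvd f" unfolding V_def using insert by blast
  then obtain q where q: "f = V * q" by blast
  have "identify i j V * identify i j q = 0"
  proof (rule laurent_eval_eq_0_imp)
    fix z :: "nat \<Rightarrow> complex" assume z: "nonvanishing z"
    hence z': "nonvanishing (z(i := z j))" by simp
    have "laurent_eval (identify i j V * identify i j q) z = laurent_eval f (z(i := z j))"
      unfolding q laurent_eval_mult[OF z] laurent_eval_mult[OF z'] using z ij by (simp add: laurent_eval_identify)
    also have "\<dots> = 0" using insert.prems(2)[of i j, OF _ z'] p ij by (simp add: fun_upd_def)
    finally show "laurent_eval (identify i j V * identify i j q) z = 0" .
  qed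
  moreover have "identify i j V \<noteq> 0"
  proof
    assume V0: "identify i j V = 0"
    \<comment> \<open>All coordinates are distinct and nonzero, so after the substitution only the
      positions i and j coincide; the pair (i, j) is not in P, hence V does not vanish
      there.\<close>
    define z :: "nat \<Rightarrow> complex" where "z k = of_nat (Suc k)" for k
    have z: "nonvanishing z" "nonvanishing (z(i := z j))" by (auto simp: z_def simp del: of_nat_Suc)
    have "0 = laurent_eval V (z(i := z j))"
      using laurent_eval_identify[OF z(1), of i j V] ij V0 by simp
    also have "\<dots> = (\<Prod>(k, l)\<in>P. (z(i := z j)) k - (z(i := z j)) l)"
      unfolding V_def laurent_eval_prod[OF z(2)]
      by (rule prod.cong) (auto simp: laurent_eval_diff[OF z(2)] laurent_eval_lvar_pow)
    finally obtain k l where kl: "(k, l) \<in> P" "(z(i := z j)) k = (z(i := z j)) l"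
      using insert.hyps(1) by (auto simp: prod_zero_iff eq_commute[of 0])
    moreover have "k < l" using insert.prems(1) kl(1) by auto
    moreover have "(k, l) \<noteq> (i, j)" using kl(1) insert.hyps(2) p by auto
    ultimately show False using ij by (auto simp: z_def split: if_splits simp del: of_nat_Suc)
  qed
  ultimately have "identify i j q = 0" by simp
  hence "(lvar_pow i 1 - lvar_pow j 1) dvd q" using dvd_diff_identify[of i j q] ij by simp
  thus ?case
    unfolding q p using insert.hyps by (simp add: p V_def mult.commute mult_dvd_mono)
qed simp

section \<open>Determinants of Vandermonde type\<close>

lemma sum_coeff_descending:
  fixes p :: "complex poly"
  assumes "degree p < N"
  shows "(\<Sum>s = 0..<N. coeff p (N - 1 - s) * x ^ (N - 1 - s)) = poly p x"
proof -
  have "poly p x = (\<Sum>s\<in>{0..<N}. coeff p s * x ^ s)"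
    unfolding poly_altdef
    by (rule sum.mono_neutral_left) (use assms in \<open>auto simp: coeff_eq_0\<close>)
  also have "\<dots> = (\<Sum>s = 0..<N. coeff p (N - 1 - s) * x ^ (N - 1 - s))"
    by (rule sum.reindex_bij_witness[of _ "\<lambda>s. N - 1 - s" "\<lambda>s. N - 1 - s"]) auto
  finally show ?thesis by simp
qed

lemma degree_prod_linear: "finite I \<Longrightarrow> degree (\<Prod>i\<in>I. [:- z i, 1:] :: complex poly) = card I"
  by (subst degree_prod_eq_sum_degree) auto

lemma lead_coeff_prod_linear: "lead_coeff (\<Prod>i\<in>I. [:- z i, 1:] :: complex poly) = 1"
  by (simp add: lead_coeff_prod)

text \<open>Multiplying by the unitriangular coefficient matrix of the Newton polynomials makes the
  Vandermonde matrix lower triangular.\<close>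

lemma vandermonde_det:
  fixes z :: "nat \<Rightarrow> complex"
  shows "Determinant.det (Matrix.mat N N (\<lambda>(r, c). z c ^ (N - 1 - r))) = (\<Prod>r = 0..<N. \<Prod>i\<in>{r<..<N}. z r - z i)"
proof -
  define W where "W = Matrix.mat N N (\<lambda>(r, c). z c ^ (N - 1 - r))"
  define p where "p r = (\<Prod>i\<in>{r<..<N}. [:- z i, 1:])" for r
  define U where "U = Matrix.mat N N (\<lambda>(r, s). coeff (p r) (N - 1 - s))"
  have deg: "degree (p r) = N - 1 - r" for r by (simp add: p_def degree_prod_linear)
  have carr: "U \<in> carrier_mat N N" "W \<in> carrier_mat N N" "U * W \<in> carrier_mat N N"
    by (auto simp: U_def W_def)
  have UW: "(U * W) $$ (r, c) = poly (p r) (z c)" if "r < N" "c < N" for r c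
  proof -
    have "(U * W) $$ (r, c) = (\<Sum>s = 0..<N. coeff (p r) (N - 1 - s) * z c ^ (N - 1 - s))"
      using that by (simp add: U_def W_def Matrix.scalar_prod_def)
    thus ?thesis using that deg[of r] by (subst (asm) sum_coeff_descending) auto
  qed
  have "Determinant.det U = 1"
  proof -
    have "Determinant.det U = prod_list (diag_mat U)"
    proof (rule det_upper_triangular[OF upper_triangularI carr(1)])
      fix i j assume "j < i" "i < dim_row U"
      thus "U $$ (i, j) = 0" using deg[of i] by (auto simp: U_def intro!: coeff_eq_0)
    qed
    also have "\<dots> = (\<Prod>r = 0..<N. coeff (p r) (degree (p r)))"
      by (simp add: prod_list_diag_prod U_def deg)
    also have "\<dots> = 1" using lead_coeff_prod_linear unfolding p_def by (intro prod.neutral) blast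
    finally show ?thesis .
  qed
  hence "Determinant.det W = Determinant.det (U * W)" using det_mult[OF carr(1,2)] by simp
  also have "\<dots> = prod_list (diag_mat (U * W))"
  proof (rule det_lower_triangular[OF _ carr(3)])
    fix r c assume "r < c" "c < N"
    thus "(U * W) $$ (r, c) = 0" by (simp add: UW p_def poly_prod prod_zero_iff) (auto intro!: bexI[of _ c])
  qed
  also have "\<dots> = (\<Prod>r = 0..<N. \<Prod>i\<in>{r<..<N}. z r - z i)"
  proof -
    have dim: "dim_row (U * W) = N" using carr by simp
    show ?thesis unfolding prod_list_diag_prod dim
      by (intro prod.cong refl, subst UW) (auto simp: p_def poly_prod)
  qed
  finally show ?thesis by (simp add: W_def)
qed

text \<open>Replacing the first row of the Vandermonde matrix by arbitrary values \<open>f\<close> multiplies the determinant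
  by the leading coefficient of the Lagrange interpolation polynomial of \<open>f\<close>.\<close>

lemma vandermonde_det_first_row:
  fixes z f :: "nat \<Rightarrow> complex"
  assumes inj: "inj_on z {0..<N}" and N: "N > 0"
  shows "Determinant.det (Matrix.mat N N (\<lambda>(r, c). if r = 0 then f c else z c ^ (N - 1 - r)))
    = (\<Sum>c = 0..<N. f c / (\<Prod>q\<in>{0..<N} - {c}. z c - z q)) * (\<Prod>r = 0..<N. \<Prod>i\<in>{r<..<N}. z r - z i)"
proof -
  define W where "W = Matrix.mat N N (\<lambda>(r, c). z c ^ (N - 1 - r))"
  define l where "l c = f c / (\<Prod>q\<in>{0..<N} - {c}. z c - z q)" for c
  define G where "G = (\<Sum>c = 0..<N. Polynomial.smult (l c) (\<Prod>q\<in>{0..<N} - {c}. [:- z q, 1:]))"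
  \<comment> \<open>The first row holds the coefficients of the interpolation polynomial G and the
    other rows are those of the identity. So \<open>B * W\<close> has first row f and keeps the
    other rows of W, while B is upper triangular with determinant the coefficient of degree N - 1 of
    G.\<close>
  define B where "B = Matrix.mat N N (\<lambda>(r, s). if r = 0 then coeff G (N - 1 - s) else if r = s then 1 else 0)"
  have deg: "degree (\<Prod>q\<in>{0..<N} - {c}. [:- z q, 1:]) = N - 1" if "c < N" for c
    using that by (subst degree_prod_linear) auto
  have degG: "degree G < N"
  proof -
    have "degree G \<le> N - 1" unfolding G_def
      by (rule degree_sum_le) (use deg in \<open>auto intro: order_trans[OF degree_smult_le]\<close>)
    thus ?thesis using N by linarith
  qed
  have lead: "coeff G (N - 1) = (\<Sum>c = 0..<N. l c)"
    unfolding G_def coeff_sum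
  proof (rule sum.cong[OF refl])
    fix c assume "c \<in> {0..<N}"
    hence "coeff (\<Prod>q\<in>{0..<N} - {c}. [:- z q, 1:]) (N - 1) = 1"
      using lead_coeff_prod_linear[of z "{0..<N} - {c}"] deg[of c] by simp
    thus "coeff (Polynomial.smult (l c) (\<Prod>q\<in>{0..<N} - {c}. [:- z q, 1:])) (N - 1) = l c" by simp
  qed
  have polyG: "poly G (z c) = f c" if c: "c < N" for c
  proof -
    have "poly G (z c) = (\<Sum>d = 0..<N. l d * (\<Prod>q\<in>{0..<N} - {d}. z c - z q))"
      by (simp add: G_def poly_sum poly_prod)
    also have "\<dots> = (\<Sum>d\<in>{c}. l d * (\<Prod>q\<in>{0..<N} - {d}. z c - z q))"
    proof (rule sum.mono_neutral_right)
      show "\<forall>d\<in>{0..<N} - {c}. l d * (\<Prod>q\<in>{0..<N} - {d}. z c - z q) = 0"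
      proof
        fix d assume d: "d \<in> {0..<N} - {c}"
        hence "(\<Prod>q\<in>{0..<N} - {d}. z c - z q) = 0" using c by (intro prod_zero) auto
        thus "l d * (\<Prod>q\<in>{0..<N} - {d}. z c - z q) = 0" by simp
      qed
    qed (use c in auto)
    also have "(\<Prod>q\<in>{0..<N} - {c}. z c - z q) \<noteq> 0"
      using inj c by (auto simp: prod_zero_iff dest: inj_onD)
    hence "(\<Sum>d\<in>{c}. l d * (\<Prod>q\<in>{0..<N} - {d}. z c - z q)) = f c" by (simp add: l_def)
    finally show ?thesis .
  qed
  have carr: "B \<in> carrier_mat N N" "W \<in> carrier_mat N N" by (auto simp: B_def W_def)
  have "Matrix.mat N N (\<lambda>(r, c). if r = 0 then f c else z c ^ (N - 1 - r)) = B * W"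
  proof (rule eq_matI)
    fix r c assume rc: "r < dim_row (B * W)" "c < dim_col (B * W)"
    hence rc: "r < N" "c < N" by (auto simp: B_def W_def)
    have "(B * W) $$ (r, c) = (\<Sum>s = 0..<N. (if r = 0 then coeff G (N - 1 - s) else if r = s then 1 else 0) * z c ^ (N - 1 - s))"
      using rc by (simp add: B_def W_def Matrix.scalar_prod_def)
    also have "\<dots> = (if r = 0 then f c else z c ^ (N - 1 - r))"
    proof (cases "r = 0")
      case True
      thus ?thesis using sum_coeff_descending[OF degG, of "z c"] polyG[OF rc(2)] by simp
    next
      case False
      have "(\<Sum>s = 0..<N. (if r = s then 1 else 0) * z c ^ (N - 1 - s)) = (\<Sum>s\<in>{r}. z c ^ (N - 1 - s))"
        by (rule sum.mono_neutral_cong_right) (use rc in auto)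
      thus ?thesis using False by simp
    qed
    finally show "Matrix.mat N N (\<lambda>(r, c). if r = 0 then f c else z c ^ (N - 1 - r)) $$ (r, c) = (B * W) $$ (r, c)"
      using rc by simp
  qed (auto simp: B_def W_def)
  hence "Determinant.det (Matrix.mat N N (\<lambda>(r, c). if r = 0 then f c else z c ^ (N - 1 - r)))
      = Determinant.det B * Determinant.det W" using det_mult[OF carr] by simp
  also have "Determinant.det B = prod_list (diag_mat B)"
    by (rule det_upper_triangular[OF upper_triangularI carr(1)]) (auto simp: B_def)
  also have "\<dots> = (\<Prod>r = 0..<N. if r = 0 then coeff G (N - 1) else 1)"
  proof -
    have dim: "dim_row B = N" by (simp add: B_def)
    show ?thesis unfolding prod_list_diag_prod dim
      by (intro prod.cong refl) (auto simp: B_def)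
  qed
  also have "\<dots> = coeff G (N - 1)" using N by (simp add: prod.delta)
  finally show ?thesis unfolding lead W_def vandermonde_det l_def .
qed

lemma laurent_eval_det:
  assumes "nonvanishing z"
  shows "laurent_eval (Determinant.det (S_matrix k m u)) z = Determinant.det (Matrix.mat (k + m) (k + m)
     (\<lambda>(r, c). if r = 0 then (if c < k then z c powi u else 0) else z c ^ (k + m - 1 - r)))"
proof -
  interpret comm_ring_hom "\<lambda>f. laurent_eval f z" by (rule laurent_eval_hom[OF assms])
  have "map_mat (\<lambda>f. laurent_eval f z) (S_matrix k m u) = Matrix.mat (k + m) (k + m)
     (\<lambda>(r, c). if r = 0 then (if c < k then z c powi u else 0) else z c ^ (k + m - 1 - r))"
  proof (rule eq_matI)
    fix r c assume "r < dim_row (Matrix.mat (k + m) (k + m)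
     (\<lambda>(r, c). if r = 0 then (if c < k then z c powi u else 0) else z c ^ (k + m - 1 - r)))"
      "c < dim_col (Matrix.mat (k + m) (k + m)
     (\<lambda>(r, c). if r = 0 then (if c < k then z c powi u else 0) else z c ^ (k + m - 1 - r)))"
    hence rc: "r < k + m" "c < k + m" by auto
    hence "int (k + m) - 1 - int r = int (k + m - 1 - r)" by auto
    thus "map_mat (\<lambda>f. laurent_eval f z) (S_matrix k m u) $$ (r, c) = Matrix.mat (k + m) (k + m)
     (\<lambda>(r, c). if r = 0 then (if c < k then z c powi u else 0) else z c ^ (k + m - 1 - r)) $$ (r, c)"
    proof (cases "r = 0")
      case False
      have "map_mat (\<lambda>f. laurent_eval f z) (S_matrix k m u) $$ (r, c) = z c powi (int (k + m) - 1 - int r)"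
        using rc False by (simp add: S_matrix_def laurent_eval_lvar_pow)
      also have "\<dots> = z c ^ (k + m - 1 - r)" unfolding \<open>int (k + m) - 1 - int r = int (k + m - 1 - r)\<close> by simp
      finally show ?thesis using rc False by simp
    qed (use rc in \<open>simp add: S_matrix_def laurent_eval_lvar_pow\<close>)
  qed (auto simp: S_matrix_def)
  thus ?thesis using hom_det[of "S_matrix k m u"] by simp
qed

lemma laurent_eval_vandermonde:
  assumes "nonvanishing z"
  shows "laurent_eval (vandermonde I) z = (\<Prod>(i, j)\<in>index_pairs I. z i - z j)"
  unfolding vandermonde_def laurent_eval_prod[OF assms]
  by (intro prod.cong) (auto simp: laurent_eval_diff[OF assms] laurent_eval_lvar_pow)

lemma finite_index_pairs: "finite I \<Longrightarrow> finite (index_pairs I)"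
  by (rule finite_subset[of _ "I \<times> I"]) (auto simp: index_pairs_def)

lemma vandermonde_nonzero:
  assumes "finite I"
  shows "vandermonde I \<noteq> 0"
proof
  assume "vandermonde I = 0"
  moreover define z :: "nat \<Rightarrow> complex" where "z k = of_nat (Suc k)" for k
  moreover have "nonvanishing z" by (auto simp: z_def simp del: of_nat_Suc)
  ultimately have "(\<Prod>(i, j)\<in>index_pairs I. z i - z j) = 0"
    using laurent_eval_vandermonde[of z I] by simp
  thus False using finite_index_pairs[OF assms]
    by (auto simp: prod_zero_iff index_pairs_def z_def simp del: of_nat_Suc)
qed

text \<open>Two equal variables of the same group give two equal columns. For one x and one y the
  entries of the first row differ, which is why only the two separate Vandermonde products
  divide.\<close>

lemma vandermonde_dvd_det:
  assumes "k + m > 0"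
  shows "vandermonde {0..<k} * vandermonde {k..<k + m} dvd Determinant.det (S_matrix k m u)"
proof -
  let ?P = "index_pairs {0..<k} \<union> index_pairs {k..<k + m}"
  have "vandermonde {0..<k} * vandermonde {k..<k + m} = (\<Prod>(i, j)\<in>?P. lvar_pow i 1 - lvar_pow j 1)"
    unfolding vandermonde_def
    by (rule prod.union_disjoint[symmetric]) (auto simp: finite_index_pairs, auto simp: index_pairs_def)
  also have "\<dots> dvd Determinant.det (S_matrix k m u)"
  proof (rule prod_variable_diffs_dvd)
    show "finite ?P" by (simp add: finite_index_pairs)
    show "i < j" if "(i, j) \<in> ?P" for i j using that by (auto simp: index_pairs_def)
    fix i j z assume ij: "(i, j) \<in> ?P" and z: "nonvanishing z" "z i = z j"
    define M where "M = Matrix.mat (k + m) (k + m)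
      (\<lambda>(r, c). if r = 0 then (if c < k then z c powi u else 0) else z c ^ (k + m - 1 - r))"
    have *: "i \<noteq> j" "i < k + m" "j < k + m" "i < k \<longleftrightarrow> j < k" using ij by (auto simp: index_pairs_def)
    have "Determinant.det M = 0"
    proof (rule det_identical_columns[of M "k + m" i j])
      show "Matrix.col M i = Matrix.col M j" using * z(2) by (intro eq_vecI) (auto simp: M_def)
    qed (use * in \<open>auto simp: M_def\<close>)
    thus "laurent_eval (Determinant.det (S_matrix k m u)) z = 0"
      by (simp add: laurent_eval_det[OF z(1)] M_def)
  qed
  finally show ?thesis .
qed

text \<open>Existence of the quotient is the divisibility just shown, uniqueness holds because the
  ring has no zero divisors. The second claim makes \<open>S_laurent\<close> recognizable from its
  defining equation.\<close>

lemma S_laurent_mult: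
  assumes "k + m > 0"
  shows "S_laurent k m u * (vandermonde {0..<k} * vandermonde {k..<k + m}) = Determinant.det (S_matrix k m u)"
    and "q' * (vandermonde {0..<k} * vandermonde {k..<k + m}) = Determinant.det (S_matrix k m u) \<Longrightarrow> q' = S_laurent k m u"
proof -
  let ?V = "vandermonde {0..<k} * vandermonde {k..<k + m}"
  have V: "?V \<noteq> 0" using vandermonde_nonzero by simp
  obtain q where q: "Determinant.det (S_matrix k m u) = ?V * q"
    using vandermonde_dvd_det[OF assms, of u] by (elim dvdE)
  have uniq: "q' = q" if "q' * ?V = Determinant.det (S_matrix k m u)" for q'
  proof -
    have "q' * ?V = q * ?V" unfolding that q by (rule mult.commute)
    thus ?thesis by (rule iffD1[OF mult_right_cancel[OF V]])
  qed
  have S: "S_laurent k m u = q" unfolding S_laurent_def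
  proof (rule the_equality)
    show "q * ?V = Determinant.det (S_matrix k m u)" unfolding q by (rule mult.commute)
  qed (rule uniq)
  show "S_laurent k m u * ?V = Determinant.det (S_matrix k m u)" unfolding S q by (rule mult.commute)
  show "q' = S_laurent k m u" if "q' * ?V = Determinant.det (S_matrix k m u)" for q'
    unfolding S by (rule uniq[OF that])
qed

text \<open>The substitution of 1 for every variable with index at least N.\<close>

definition truncate_vars :: "nat \<Rightarrow> laurent \<Rightarrow> laurent" where
  "truncate_vars N f = (\<Sum>m\<in>Poly_Mapping.keys f. Poly_Mapping.single
     (\<Sum>i\<in>Poly_Mapping.keys m \<inter> {..<N}. Poly_Mapping.single i (Poly_Mapping.lookup m i)) (Poly_Mapping.lookup f m))"

lemma monomial_at_sum:
  assumes "nonvanishing z"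
  shows "monomial_at z (\<Sum>i\<in>X. f i) = (\<Prod>i\<in>X. monomial_at z (f i))"
proof (induction X rule: infinite_finite_induct)
  case (insert x F) thus ?case by (simp add: monomial_at_add[OF assms])
qed (auto simp: monomial_at_def)

lemma laurent_eval_truncate_vars:
  assumes "nonvanishing z"
  shows "laurent_eval (truncate_vars N f) z = laurent_eval f (\<lambda>i. if i < N then z i else 1)"
proof -
  have "monomial_at z (\<Sum>i\<in>Poly_Mapping.keys m \<inter> {..<N}. Poly_Mapping.single i (Poly_Mapping.lookup m i))
     = monomial_at (\<lambda>i. if i < N then z i else 1) m" for m
  proof -
    have "monomial_at (\<lambda>i. if i < N then z i else 1) m
        = (\<Prod>i\<in>Poly_Mapping.keys m. if i \<in> {..<N} then z i powi Poly_Mapping.lookup m i else 1)"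
      unfolding monomial_at_def by (intro prod.cong) auto
    also have "\<dots> = (\<Prod>i\<in>Poly_Mapping.keys m \<inter> {..<N}. z i powi Poly_Mapping.lookup m i)"
      by (rule prod.inter_restrict[symmetric]) simp
    finally show ?thesis by (simp add: monomial_at_sum[OF assms] monomial_at_single)
  qed
  thus ?thesis by (simp add: truncate_vars_def laurent_eval_sum laurent_eval_single laurent_eval_monomial_at[of f])
qed

lemma keys_truncate_vars:
  assumes "j \<in> Poly_Mapping.keys (truncate_vars N f)"
  shows "Poly_Mapping.keys j \<subseteq> {..<N}"
proof -
  let ?h = "\<lambda>m. \<Sum>i\<in>Poly_Mapping.keys m \<inter> {..<N}. Poly_Mapping.single i (Poly_Mapping.lookup m i)"
  have "j \<in> (\<Union>m\<in>Poly_Mapping.keys f. Poly_Mapping.keys (Poly_Mapping.single (?h m) (Poly_Mapping.lookup f m)))"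
    using assms unfolding truncate_vars_def by (rule subsetD[OF keys_sum])
  then obtain m where "j \<in> Poly_Mapping.keys (Poly_Mapping.single (?h m) (Poly_Mapping.lookup f m))" by blast
  moreover have "Poly_Mapping.keys (Poly_Mapping.single (?h m) (Poly_Mapping.lookup f m)) \<subseteq> {?h m}"
    by simp
  ultimately have j: "j = ?h m" by blast
  have "Poly_Mapping.keys (?h m) \<subseteq>
      (\<Union>i\<in>Poly_Mapping.keys m \<inter> {..<N}. Poly_Mapping.keys (Poly_Mapping.single i (Poly_Mapping.lookup m i)))"
    by (rule keys_sum)
  also have "\<dots> \<subseteq> {..<N}" by auto
  finally show ?thesis unfolding j .
qed

text \<open>\<open>S_val\<close> evaluates at list positions, which carry no information beyond the
  length of the list, so foreign variables must be excluded. Substituting 1 for them changes neither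
  the Vandermonde products nor the determinant, hence by uniqueness it does not change the
  quotient.\<close>

lemma S_laurent_vars:
  assumes "k + m > 0" "j \<in> Poly_Mapping.keys (S_laurent k m u)"
  shows "Poly_Mapping.keys j \<subseteq> {..<k + m}"
proof -
  let ?V = "vandermonde {0..<k} * vandermonde {k..<k + m}"
  have "truncate_vars (k + m) (S_laurent k m u) = S_laurent k m u"
  proof (rule S_laurent_mult(2)[OF assms(1)], rule laurent_eqI)
    fix z :: "nat \<Rightarrow> complex" assume z: "nonvanishing z"
    define z' where "z' = (\<lambda>i. if i < k + m then z i else 1)"
    have z': "nonvanishing z'" using z by (simp add: z'_def)
    have V: "laurent_eval ?V z = laurent_eval ?V z'"
      unfolding laurent_eval_mult[OF z] laurent_eval_mult[OF z'] laurent_eval_vandermonde[OF z] laurent_eval_vandermonde[OF z']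
      by (intro arg_cong2[where f = "(*)"] prod.cong) (auto simp: z'_def index_pairs_def)
    have "laurent_eval (truncate_vars (k + m) (S_laurent k m u) * ?V) z
        = laurent_eval (truncate_vars (k + m) (S_laurent k m u)) z * laurent_eval ?V z"
      by (rule laurent_eval_mult[OF z])
    also have "\<dots> = laurent_eval (S_laurent k m u) z' * laurent_eval ?V z'"
      unfolding V laurent_eval_truncate_vars[OF z] z'_def ..
    also have "\<dots> = laurent_eval (S_laurent k m u * ?V) z'" by (rule laurent_eval_mult[OF z', symmetric])
    also have "\<dots> = laurent_eval (Determinant.det (S_matrix k m u)) z'" unfolding S_laurent_mult(1)[OF assms(1)] ..
    also have "\<dots> = laurent_eval (Determinant.det (S_matrix k m u)) z"
      unfolding laurent_eval_det[OF z] laurent_eval_det[OF z']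
      by (intro arg_cong[where f = Determinant.det] eq_matI) (auto simp: z'_def)
    finally show "laurent_eval (truncate_vars (k + m) (S_laurent k m u) * ?V) z = laurent_eval (Determinant.det (S_matrix k m u)) z" .
  qed
  hence "j \<in> Poly_Mapping.keys (truncate_vars (k + m) (S_laurent k m u))" using assms(2) by simp
  thus ?thesis by (rule keys_truncate_vars)
qed

lemma prod_differences_split:
  fixes z :: "nat \<Rightarrow> complex"
  shows "(\<Prod>r = 0..<k + m. \<Prod>i\<in>{r<..<k + m}. z r - z i) =
     (\<Prod>(i, j)\<in>index_pairs {0..<k}. z i - z j) * (\<Prod>(i, j)\<in>index_pairs {k..<k + m}. z i - z j)
       * (\<Prod>i\<in>{0..<k}. \<Prod>j\<in>{k..<k + m}. z i - z j)"
proof -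
  have "(\<Prod>r = 0..<k + m. \<Prod>i\<in>{r<..<k + m}. z r - z i) = (\<Prod>(i, j)\<in>(SIGMA r:{0..<k + m}. {r<..<k + m}). z i - z j)"
    by (rule prod.Sigma) auto
  also have "(SIGMA r:{0..<k + m}. {r<..<k + m}) = index_pairs {0..<k} \<union> (index_pairs {k..<k + m} \<union> {0..<k} \<times> {k..<k + m})"
    by (auto simp: index_pairs_def)
  also have "(\<Prod>(i, j)\<in>\<dots>. z i - z j) = (\<Prod>(i, j)\<in>index_pairs {0..<k}. z i - z j) * ((\<Prod>(i, j)\<in>index_pairs {k..<k + m}. z i - z j)
       * (\<Prod>(i, j)\<in>{0..<k} \<times> {k..<k + m}. z i - z j))"
    by (subst prod.union_disjoint, simp_all add: finite_index_pairs, force simp: index_pairs_def,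
        subst prod.union_disjoint, simp_all add: finite_index_pairs, force simp: index_pairs_def)
  also have "(\<Prod>(i, j)\<in>{0..<k} \<times> {k..<k + m}. z i - z j) = (\<Prod>i\<in>{0..<k}. \<Prod>j\<in>{k..<k + m}. z i - z j)"
    by (rule prod.Sigma[symmetric]) auto
  finally show ?thesis by (simp add: mult.assoc)
qed

text \<open>The Vandermonde product of all k + m variables is V(x) V(y) times the mixed differences
  x_i - y_j. Cancelling V(x) V(y) leaves the mixed product times the leading coefficient of the
  polynomial that interpolates x^u at the x_i and 0 at the y_j.\<close>

lemma laurent_eval_S_laurent:
  fixes z :: "nat \<Rightarrow> complex"
  assumes km: "k + m > 0" and z: "nonvanishing z" and inj: "inj_on z {0..<k + m}"
  shows "laurent_eval (S_laurent k m u) z = (\<Prod>i\<in>{0..<k}. \<Prod>j\<in>{k..<k + m}. z i - z j) *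
    (\<Sum>c\<in>{0..<k}. z c powi u / (\<Prod>q\<in>{0..<k + m} - {c}. z c - z q))"
proof -
  let ?V = "vandermonde {0..<k} * vandermonde {k..<k + m}"
  let ?D = "\<Prod>i\<in>{0..<k}. \<Prod>j\<in>{k..<k + m}. z i - z j"
  have V: "laurent_eval ?V z = (\<Prod>(i, j)\<in>index_pairs {0..<k}. z i - z j) * (\<Prod>(i, j)\<in>index_pairs {k..<k + m}. z i - z j)"
    by (simp add: laurent_eval_mult[OF z] laurent_eval_vandermonde[OF z])
  have "(\<Prod>(i, j)\<in>index_pairs I. z i - z j) \<noteq> 0" if "I \<subseteq> {0..<k + m}" for I
  proof
    have fin: "finite (index_pairs I)" using that by (intro finite_index_pairs) (rule finite_subset, auto)
    assume "(\<Prod>(i, j)\<in>index_pairs I. z i - z j) = 0"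
    then obtain i j where ij: "(i, j) \<in> index_pairs I" "z i = z j" using fin by (auto simp: prod_zero_iff)
    hence "i \<in> {0..<k + m}" "j \<in> {0..<k + m}" "i < j" using that by (auto simp: index_pairs_def)
    thus False using inj_onD[OF inj ij(2)] by simp
  qed
  from this[of "{0..<k}"] this[of "{k..<k + m}"] have V0: "laurent_eval ?V z \<noteq> 0"
    unfolding V by auto
  have "laurent_eval (S_laurent k m u) z * laurent_eval ?V z = laurent_eval (S_laurent k m u * ?V) z"
    by (rule laurent_eval_mult[OF z, symmetric])
  also have "\<dots> = laurent_eval (Determinant.det (S_matrix k m u)) z"
    unfolding S_laurent_mult(1)[OF km] ..
  also have "\<dots> = (\<Sum>c = 0..<k + m. (if c < k then z c powi u else 0) / (\<Prod>q\<in>{0..<k + m} - {c}. z c - z q))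
      * (laurent_eval ?V z * ?D)"
    unfolding laurent_eval_det[OF z] vandermonde_det_first_row[OF inj km] prod_differences_split V ..
  also have "(\<Sum>c = 0..<k + m. (if c < k then z c powi u else 0) / (\<Prod>q\<in>{0..<k + m} - {c}. z c - z q))
      = (\<Sum>c\<in>{0..<k}. z c powi u / (\<Prod>q\<in>{0..<k + m} - {c}. z c - z q))"
    by (rule sum.mono_neutral_cong_right) auto
  finally show ?thesis using V0 by (simp add: field_simps)
qed

subsection \<open>Sums over roots of unity\<close>

text \<open>Multiplication by the primitive root \<omega> permutes the g-th roots of unity and
  multiplies the sum by \<omega>^m, which is not 1.\<close>

lemma sum_unity_powers:
  fixes g m :: nat
  assumes "0 < m" "m < g"
  shows "(\<Sum>w | w ^ g = 1. w ^ m) = (0 :: complex)"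
proof -
  define \<omega> where "\<omega> = cis (2 * pi / g)"
  have \<omega>: "\<omega> ^ g = 1" using assms by (simp add: \<omega>_def Complex.DeMoivre)
  have \<omega>m: "\<omega> ^ m \<noteq> 1"
  proof
    assume "\<omega> ^ m = 1"
    have inj: "inj_on (\<lambda>k. cis (2 * pi * real k / real g)) {..<g}"
      using Complex.bij_betw_roots_unity[of g] assms by (auto simp: bij_betw_def)
    have "cis (2 * pi * real m / real g) = cis (2 * pi * real 0 / real g)"
      using \<open>\<omega> ^ m = 1\<close> by (simp add: \<omega>_def Complex.DeMoivre mult.commute)
    from inj_onD[OF inj this] have "m = 0" using assms by simp
    thus False using assms by simp
  qed
  have fin: "finite {w :: complex. w ^ g = 1}" using assms by (intro finite_roots_unity) auto
  have "(\<Sum>w | w ^ g = 1. w ^ m) = (\<Sum>w | w ^ g = 1. (\<omega> * w) ^ m)"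
  proof (rule sum.reindex_bij_witness[where i = "\<lambda>w. \<omega> * w" and j = "\<lambda>w. w / \<omega>"])
    have "\<omega> \<noteq> 0" by (simp add: \<omega>_def)
    thus "\<omega> * (w / \<omega>) = w" "\<omega> * w / \<omega> = w" "(\<omega> * (w / \<omega>)) ^ m = w ^ m" for w by auto
  qed (auto simp: power_mult_distrib power_divide \<omega>)
  also have "\<dots> = \<omega> ^ m * (\<Sum>w | w ^ g = 1. w ^ m)" by (simp add: power_mult_distrib sum_distrib_left)
  finally show ?thesis using \<omega>m by simp
qed

abbreviation nontrivial_roots :: "nat \<Rightarrow> complex set" where
  "nontrivial_roots g \<equiv> {w. w ^ g = 1} - {1}"

lemma finite_nontrivial_roots: "g > 0 \<Longrightarrow> finite (nontrivial_roots g)"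
  using finite_roots_unity[of g] by (metis Suc_leI One_nat_def finite_Diff)

lemma card_nontrivial_roots:
  assumes "g > 0"
  shows "card (nontrivial_roots g) = g - 1"
  using card_roots_unity_eq[OF assms] assms by (subst card_Diff_subset) auto

lemma sum_nontrivial_roots_inverse:
  "(\<Sum>w\<in>nontrivial_roots g. f (inverse w)) = (\<Sum>w\<in>nontrivial_roots g. f w :: complex)"
  if "g > 0" for f
proof -
  have "inverse w \<in> nontrivial_roots g" if w: "w \<in> nontrivial_roots g" for w
  proof -
    have "w \<noteq> 0" using w \<open>g > 0\<close> by (auto simp: zero_power)
    hence "inverse w ^ g * w ^ g = 1" by (simp flip: power_mult_distrib)
    thus ?thesis using w by simp
  qed
  thus ?thesis by (intro sum.reindex_bij_witness[where i = inverse and j = inverse]) auto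
qed

lemma nontrivial_root_nonzero: "g > 0 \<Longrightarrow> w \<in> nontrivial_roots g \<Longrightarrow> w \<noteq> 0"
  by (auto simp: zero_power)

text \<open>Pair w with its inverse: 1 / (1 - w) + 1 / (1 - 1/w) = 1.\<close>

lemma sum_roots_1:
  assumes "g > 0"
  shows "(\<Sum>w\<in>nontrivial_roots g. 1 / (1 - w)) = (of_nat g - 1) / 2"
proof -
  let ?S = "\<Sum>w\<in>nontrivial_roots g. 1 / (1 - w)"
  have "2 * ?S = ?S + (\<Sum>w\<in>nontrivial_roots g. 1 / (1 - inverse w))"
    using sum_nontrivial_roots_inverse[OF assms, of "\<lambda>w. 1 / (1 - w)"] by simp
  also have "\<dots> = (\<Sum>w\<in>nontrivial_roots g. 1)"
    unfolding sum.distrib[symmetric]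
  proof (rule sum.cong[OF refl])
    fix w assume w: "w \<in> nontrivial_roots g"
    hence "w \<noteq> 0" "1 - w \<noteq> 0" "w - 1 \<noteq> 0" using nontrivial_root_nonzero[OF assms w] by auto
    thus "1 / (1 - w) + 1 / (1 - inverse w) = 1" by (simp add: divide_simps) (simp add: algebra_simps)
  qed
  also have "\<dots> = of_nat (g - 1)" using card_nontrivial_roots[OF assms] by simp
  finally show ?thesis using assms by (simp add: of_nat_diff field_simps)
qed

text \<open>The summand changes sign under inversion of w, which permutes the nontrivial roots. This
  is why the quadratic Taylor terms of a single nontrivial index leave no trace in the
  formula.\<close>

lemma sum_roots_3:
  assumes "g > 0"
  shows "(\<Sum>w\<in>nontrivial_roots g. w * (1 + w) / (1 - w) ^ 3) = 0"
proof -
  let ?f = "\<lambda>w :: complex. w * (1 + w) / (1 - w) ^ 3"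
  let ?S = "\<Sum>w\<in>nontrivial_roots g. ?f w"
  have "?S = (\<Sum>w\<in>nontrivial_roots g. ?f (inverse w))"
    using sum_nontrivial_roots_inverse[OF assms, of ?f] by simp
  also have "\<dots> = (\<Sum>w\<in>nontrivial_roots g. - ?f w)"
  proof (rule sum.cong[OF refl])
    fix w assume w: "w \<in> nontrivial_roots g"
    hence w': "w \<noteq> 0" "1 - w \<noteq> 0" using nontrivial_root_nonzero[OF assms w] by auto
    have "1 - inverse w = - (1 - w) / w" using w' by (simp add: field_simps)
    hence "(1 - inverse w) ^ 3 = (- (1 - w)) ^ 3 / w ^ 3" by (simp only: power_divide)
    moreover have "(- (1 - w)) ^ 3 = - ((1 - w) ^ 3)" by (rule power_minus_odd) simp
    ultimately have "(1 - inverse w) ^ 3 = - ((1 - w) ^ 3) / w ^ 3" by (simp only:)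
    hence "?f (inverse w) = inverse w * (1 + inverse w) / (- ((1 - w) ^ 3) / w ^ 3)" by simp
    also have "\<dots> = - ((inverse w * (1 + inverse w) * w ^ 3) / (1 - w) ^ 3)" by simp
    also have "inverse w * (1 + inverse w) * w ^ 3 = w * (1 + w)"
      using w' by (simp add: field_simps power3_eq_cube)
    finally show "?f (inverse w) = - ?f w" .
  qed
  finally have "?S = - ?S" by (simp add: sum_negf)
  thus ?thesis by simp
qed

lemma sum_quadratic: "(\<Sum>m<g. of_nat m * (of_nat g - of_nat m)) = (of_nat g * (of_nat g ^ 2 - 1) / 6 :: complex)"
proof -
  \<comment> \<open>The constant c is decoupled from the summation bound N, since with g in both
    places the induction would not go through.\<close>
  have "(\<Sum>m<N. of_nat m * (c - of_nat m)) = c * of_nat N * (of_nat N - 1) / 2 - of_nat N * (of_nat N - 1) * (2 * of_nat N - 1) / (6 :: complex)" for N and c :: complex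
    by (induction N) (simp_all add: field_simps)
  from this[of "of_nat g" g] show ?thesis by (simp add: field_simps power2_eq_square)
qed

text \<open>Summation by parts gives the discrete Fourier expansion of \<open>w / (1 - w)\<^sup>2\<close>.\<close>

lemma root_fourier:
  assumes "g > 0" "w ^ g = 1" "w \<noteq> (1 :: complex)"
  shows "w / (1 - w) ^ 2 = (\<Sum>m<g. of_nat m * (of_nat g - of_nat m) * w ^ m) / (2 * of_nat g)"
proof -
  define S0 where "S0 = (\<Sum>m<g. w ^ m)"
  define S1 where "S1 = (\<Sum>m<g. of_nat m * w ^ m)"
  define S2 where "S2 = (\<Sum>m<g. of_nat m * (of_nat g - of_nat m) * w ^ m)"
  have w: "1 - w \<noteq> 0" using assms(3) by simp
  have "(1 - w) * (\<Sum>m<N. of_nat m * w ^ m) = (\<Sum>m<N. w ^ m) - 1 - (of_nat N - 1) * w ^ N" for N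
    by (induction N) (simp_all add: algebra_simps)
  hence 1: "(1 - w) * S1 = S0 - of_nat g" using assms(2) by (simp add: S0_def S1_def)
  have "(1 - w) * (\<Sum>m<N. of_nat m * (c - of_nat m) * w ^ m) =
     (\<Sum>m<N. (c + 1 - 2 * of_nat m) * w ^ m) - (c + 1) - (of_nat N - 1) * (c - of_nat N + 1) * w ^ N" for N c
    by (induction N) (simp_all add: algebra_simps)
  hence "(1 - w) * S2 = (\<Sum>m<g. (of_nat g + 1 - 2 * of_nat m) * w ^ m) - 2 * of_nat g"
    using assms(2) by (simp add: S2_def)
  also have "(\<Sum>m<g. (of_nat g + 1 - 2 * of_nat m) * w ^ m) = (of_nat g + 1) * S0 - 2 * S1"
    by (simp add: S0_def S1_def sum_distrib_left left_diff_distrib sum_subtractf mult.assoc)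
  finally have 2: "(1 - w) * S2 = (of_nat g + 1) * S0 - 2 * S1 - 2 * of_nat g" .
  have "(1 - w) * S0 = 0" unfolding S0_def using one_diff_power_eq[of w g] assms(2) by simp
  hence S0: "S0 = 0" using w by simp
  have "(1 - w) ^ 2 * S2 = (1 - w) * ((1 - w) * S2)" by (simp add: power2_eq_square)
  also have "\<dots> = - 2 * ((1 - w) * S1) - 2 * of_nat g * (1 - w)" unfolding 2 S0 by (simp add: algebra_simps)
  also have "\<dots> = 2 * of_nat g * w" unfolding 1 S0 by (simp add: algebra_simps)
  finally show ?thesis using w assms(1) by (simp add: S2_def field_simps)
qed

text \<open>Inserting the Fourier expansion and exchanging the sums, the inner sum of w^m over the
  nontrivial roots is -1 for 0 < m < g, and the coefficient for m = 0 vanishes.\<close>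

lemma sum_roots_2:
  assumes "g > 0"
  shows "(\<Sum>w\<in>nontrivial_roots g. w / (1 - w) ^ 2) = - (of_nat g ^ 2 - 1) / 12"
proof -
  have pow: "(\<Sum>w\<in>nontrivial_roots g. w ^ m) = -1" if "m < g" "m \<noteq> 0" for m
    using sum_unity_powers[of m g] that finite_roots_unity[of g] assms
    by (subst sum_diff1) auto
  have "(\<Sum>w\<in>nontrivial_roots g. w / (1 - w) ^ 2) =
      (\<Sum>w\<in>nontrivial_roots g. (\<Sum>m<g. of_nat m * (of_nat g - of_nat m) * w ^ m) / (2 * of_nat g))"
    using root_fourier[OF assms] by (intro sum.cong) auto
  also have "\<dots> = (\<Sum>m<g. of_nat m * (of_nat g - of_nat m) * (\<Sum>w\<in>nontrivial_roots g. w ^ m)) / (2 * of_nat g)"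
    unfolding sum_divide_distrib[symmetric] sum_distrib_left by (subst sum.swap) simp
  also have "(\<Sum>m<g. of_nat m * (of_nat g - of_nat m) * (\<Sum>w\<in>nontrivial_roots g. w ^ m)) =
      - (\<Sum>m<g. of_nat m * (of_nat g - of_nat m))"
    unfolding sum_negf[symmetric]
  proof (rule sum.cong[OF refl])
    fix m assume "m \<in> {..<g}"
    thus "of_nat m * (of_nat g - of_nat m) * (\<Sum>w\<in>nontrivial_roots g. w ^ m) = - (of_nat m * (of_nat g - of_nat m) :: complex)"
      using pow[of m] by (cases "m = 0") auto
  qed
  also have "\<dots> = - (of_nat g * (of_nat g ^ 2 - 1) / 6)" by (simp add: sum_quadratic)
  also have "\<dots> / (2 * of_nat g) = - (of_nat g ^ 2 - 1) / (12 :: complex)" using assms by (simp add: field_simps)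
  finally show ?thesis .
qed

subsection \<open>Polar integrals and \<open>S\<^sub>u\<close>\<close>

text \<open>The variant with complex entries: integer weights cannot be moved apart by small
  perturbations.\<close>

definition polar_integral_at :: "real \<Rightarrow> (nat \<Rightarrow> complex) \<Rightarrow> nat set \<Rightarrow> nat \<Rightarrow> complex" where
  "polar_integral_at R z I e = contour_integral (circlepath (-1) R) (\<lambda>y. y ^ e / (\<Prod>i\<in>I. 1 - z i * y)) / (2 * of_real pi * \<i>)"

text \<open>The sign comes from 1 - z_i y = - z_i (y - 1 / z_i). In the exponent of z_i, card I - 1
  comes from clearing the denominators of the other factors at y = 1 / z_i, one is lost to the
  factor z_i, and e to y^e. Simplicity is asked of the poles inside the circle, while entries whose
  poles lie outside may coincide.\<close>

lemma polar_integral_residues: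
  fixes z :: "nat \<Rightarrow> complex"
  assumes I: "finite I" and R: "R > 0" and nz: "\<And>i. i \<in> I \<Longrightarrow> z i \<noteq> 0"
    and off: "\<And>i. i \<in> I \<Longrightarrow> norm (1 / z i + 1) \<noteq> R"
    and K: "K = {i \<in> I. norm (1 / z i + 1) < R}"
    and simple: "\<And>i j. i \<in> K \<Longrightarrow> j \<in> I \<Longrightarrow> i \<noteq> j \<Longrightarrow> z i \<noteq> z j"
  shows "polar_integral_at R z I e =
    - (\<Sum>i\<in>K. z i powi (int (card I) - 2 - int e) / (\<Prod>q\<in>I - {i}. z i - z q))"
proof -
  define f where "f y = y ^ e / (\<Prod>i\<in>I. 1 - z i * y)" for y
  define pts where "pts = (\<lambda>i. 1 / z i) ` I"
  have dist: "dist (- 1) x = norm (x + 1)" for x :: complex by (simp add: dist_norm norm_minus_commute add.commute)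
  have zero_iff: "1 - z i * y = 0 \<longleftrightarrow> y = 1 / z i" if "i \<in> I" for i y using nz[OF that] by (auto simp: field_simps)
  have "contour_integral (circlepath (-1) R) f = of_real (2 * pi) * \<i> *
      (\<Sum>p\<in>pts. winding_number (circlepath (-1) R) p * residue f p)"
  proof (rule Residue_theorem[of UNIV])
    show "f holomorphic_on UNIV - pts" unfolding f_def
      by (intro holomorphic_intros) (use I zero_iff in \<open>auto simp: prod_zero_iff pts_def\<close>)
    show "path_image (circlepath (- 1) R) \<subseteq> UNIV - pts" using R off by (auto simp: pts_def dist)
  qed (use I in \<open>auto simp: pts_def\<close>)
  also have "(\<Sum>p\<in>pts. winding_number (circlepath (-1) R) p * residue f p) = (\<Sum>p\<in>(\<lambda>i. 1 / z i) ` K. residue f p)"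
  proof (rule sum.mono_neutral_cong_right)
    show "\<forall>p\<in>pts - (\<lambda>i. 1 / z i) ` K. winding_number (circlepath (-1) R) p * residue f p = 0"
    proof
      fix p assume "p \<in> pts - (\<lambda>i. 1 / z i) ` K"
      then obtain i where i: "i \<in> I" "p = 1 / z i" "i \<notin> K" by (auto simp: pts_def)
      hence "norm (p + 1) > R" using K off[OF i(1)] by auto
      hence "winding_number (circlepath (-1) R) p = 0"
        by (intro winding_number_zero_outside[of _ "cball (-1) R"]) (use R in \<open>auto simp: dist\<close>)
      thus "winding_number (circlepath (-1) R) p * residue f p = 0" by simp
    qed
    show "winding_number (circlepath (-1) R) p * residue f p = residue f p" if "p \<in> (\<lambda>i. 1 / z i) ` K" for p
      using that K by (subst winding_number_circlepath) (auto simp: dist_norm)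
  qed (use I K in \<open>auto simp: pts_def\<close>)
  also have "\<dots> = (\<Sum>i\<in>K. residue f (1 / z i))"
  proof (rule sum.reindex_cong[OF _ refl refl])
    show "inj_on (\<lambda>i. 1 / z i) K" using simple K by (intro inj_onI) (metis (no_types, lifting) divide_cancel_left mem_Collect_eq one_neq_zero)
  qed
  also have "\<dots> = (\<Sum>i\<in>K. - (z i powi (int (card I) - 2 - int e) / (\<Prod>q\<in>I - {i}. z i - z q)))"
  proof (rule sum.cong[OF refl])
    fix i assume i: "i \<in> K"
    hence iI: "i \<in> I" using K by simp
    define g where "g y = y ^ e / (- z i * (\<Prod>q\<in>I - {i}. 1 - z q * y))" for y
    define S where "S = UNIV - (\<lambda>q. 1 / z q) ` (I - {i})"
    have S: "open S" unfolding S_def using I by (intro open_Diff finite_imp_closed) auto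
    have iS: "1 / z i \<in> S"
    proof -
      have "1 / z i \<noteq> 1 / z q" if "q \<in> I - {i}" for q
      proof -
        have "z i \<noteq> z q" using simple[OF i, of q] that by auto
        thus ?thesis using nz[OF iI] by (metis divide_divide_eq_right mult_1 div_by_1)
      qed
      thus ?thesis unfolding S_def by blast
    qed
    have fg: "f y = g y / (y - 1 / z i)" for y
    proof -
      have "1 - z i * y = - z i * (y - 1 / z i)" using nz[OF iI] by (simp add: field_simps)
      hence "(\<Prod>i\<in>I. 1 - z i * y) = (- z i * (y - 1 / z i)) * (\<Prod>q\<in>I - {i}. 1 - z q * y)"
        using I iI by (simp add: prod.remove)
      thus ?thesis by (simp add: f_def g_def mult_ac)
    qed
    have "g holomorphic_on S" unfolding g_def
      by (intro holomorphic_intros) (use I nz iI zero_iff in \<open>auto simp: prod_zero_iff S_def\<close>)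
    hence "residue f (1 / z i) = g (1 / z i)"
      unfolding fg[abs_def] by (rule residue_simple[OF S iS])
    also have "g (1 / z i) = - (z i powi (int (card I) - 2 - int e) / (\<Prod>q\<in>I - {i}. z i - z q))"
    proof -
      have zi: "z i \<noteq> 0" using nz iI by simp
      have "(\<Prod>q\<in>I - {i}. 1 - z q * (1 / z i)) = (\<Prod>q\<in>I - {i}. (z i - z q) / z i)"
        using zi by (intro prod.cong) (auto simp: field_simps)
      also have "\<dots> = (\<Prod>q\<in>I - {i}. z i - z q) / z i powi (int (card I) - 1)"
      proof -
        have "card I > 0" using I iI card_gt_0_iff by blast
        hence "z i powi (int (card I) - 1) = z i ^ card (I - {i})"
          using I iI by (simp add: power_int_def nat_diff_distrib)
        thus ?thesis by (simp add: prod_dividef)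
      qed
      finally have "g (1 / z i) = (1 / z i) ^ e / (- z i * ((\<Prod>q\<in>I - {i}. z i - z q) / z i powi (int (card I) - 1)))"
        by (simp only: g_def)
      also have "\<dots> = - ((z i powi (int (card I) - 1) / (z i powi 1 * z i powi int e)) / (\<Prod>q\<in>I - {i}. z i - z q))"
        using zi by (simp add: power_divide divide_simps)
      also have "z i powi (int (card I) - 1) / (z i powi 1 * z i powi int e) = z i powi (int (card I) - 1 - (1 + int e))"
        using zi by (simp add: power_int_diff power_int_add power2_eq_square)
      also have "int (card I) - 1 - (1 + int e) = int (card I) - 2 - int e" by simp
      finally show ?thesis .
    qed
    finally show "residue f (1 / z i) = - (z i powi (int (card I) - 2 - int e) / (\<Prod>q\<in>I - {i}. z i - z q))" .
  qed
  finally show ?thesis by (simp add: polar_integral_at_def f_def[abs_def] sum_negf)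
qed

text \<open>No 1 / z_i lies on the circle, so for small perturbations the integrand is continuous on
  the compact circle and converges uniformly.\<close>

lemma tendsto_polar_integral_at:
  fixes z v :: "nat \<Rightarrow> complex"
  assumes I: "finite I" and R: "R > 0" and nz: "\<And>i. i \<in> I \<Longrightarrow> z i \<noteq> 0"
    and off: "\<And>i. i \<in> I \<Longrightarrow> norm (1 / z i + 1) \<noteq> R"
  shows "((\<lambda>\<epsilon>::real. polar_integral_at R (\<lambda>i. z i + of_real \<epsilon> * v i) I e) \<longlongrightarrow> polar_integral_at R z I e) (at_right 0)"
proof -
  define C where "C = sphere (-1 :: complex) R"
  define h where "h = (\<lambda>(\<epsilon>::real, y). y ^ e / (\<Prod>i\<in>I. 1 - (z i + of_real \<epsilon> * v i) * y))"
  define U where "U = {\<epsilon>::real. \<forall>i\<in>I. \<forall>y\<in>C. 1 - (z i + of_real \<epsilon> * v i) * y \<noteq> 0}"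
  have cont: "continuous_on (U \<times> C) h"
    unfolding h_def case_prod_unfold
    by (intro continuous_intros) (use I in \<open>auto simp: U_def prod_zero_iff\<close>)
  have nonzero: "1 - w * y \<noteq> 0" if "norm (1 / w + 1) \<noteq> R" "y \<in> C" for w y :: complex
  proof
    assume "1 - w * y = 0"
    hence "y = 1 / w" by (cases "w = 0") (auto simp: field_simps)
    moreover have "norm (y - (- 1)) = R" using that(2) unfolding C_def mem_sphere dist_norm by (metis norm_minus_commute)
    ultimately show False using that(1) by simp
  qed
  have lim: "((\<lambda>\<epsilon>. norm (1 / (z i + of_real \<epsilon> * v i) + 1)) \<longlongrightarrow> norm (1 / z i + 1)) (at_right 0)" if "i \<in> I" for i
    using nz[OF that] by (auto intro!: tendsto_eq_intros)
  have "\<forall>\<^sub>F \<epsilon> in at_right 0. \<forall>i\<in>I. norm (1 / (z i + of_real \<epsilon> * v i) + 1) \<noteq> R"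
    using I tendsto_imp_eventually_ne[OF lim off] by (simp add: eventually_ball_finite)
  hence evU: "\<forall>\<^sub>F \<epsilon> in at_right 0. \<epsilon> \<in> U"
    by eventually_elim (use nonzero in \<open>auto simp: U_def\<close>)
  have U0: "0 \<in> U" using nonzero off by (auto simp: U_def)
  have path: "path_image (circlepath (-1) R) = C" using R by (simp add: C_def)
  have unif: "uniform_limit C (\<lambda>\<epsilon> y. h (\<epsilon>, y)) (\<lambda>y. h (0, y)) (at_right 0)"
  proof (rule uniform_limitI)
    fix d :: real assume d: "d > 0"
    obtain X0 where X0: "0 \<in> X0" "open X0" "\<forall>x\<in>X0 \<inter> U. \<forall>t\<in>C. dist (h (x, t)) (h (0, t)) \<le> d / 2"
      using continuous_on_prod_compactE[OF cont _ U0, of "d / 2"] d by (auto simp: C_def)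
    have "\<forall>\<^sub>F \<epsilon> in at_right 0. \<epsilon> \<in> X0"
      using eventually_nhds_in_open[OF X0(2,1)] by (rule filter_leD[OF at_within_le_nhds])
    thus "\<forall>\<^sub>F \<epsilon> in at_right 0. \<forall>y\<in>C. dist (h (\<epsilon>, y)) (h (0, y)) < d"
      using evU by eventually_elim (use X0(3) d in force)
  qed
  have "((\<lambda>\<epsilon>. contour_integral (circlepath (-1) R) (\<lambda>y. h (\<epsilon>, y))) \<longlongrightarrow> contour_integral (circlepath (-1) R) (\<lambda>y. h (0, y))) (at_right 0)"
  proof (intro contour_integral_uniform_limit(2)[where B = "2 * pi * R"])
    show "\<forall>\<^sub>F \<epsilon> in at_right 0. (\<lambda>y. h (\<epsilon>, y)) contour_integrable_on circlepath (-1) R"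
      using evU
    proof eventually_elim
      case (elim \<epsilon>)
      show ?case unfolding h_def case_prod_conv
        by (intro contour_integrable_continuous_circlepath continuous_intros)
          (use elim I R in \<open>auto simp: path U_def prod_zero_iff C_def\<close>)
    qed
    show "norm (vector_derivative (circlepath (-1) R) (at t)) \<le> 2 * pi * R" for t
      using R by (simp add: vector_derivative_circlepath norm_mult)
    show "uniform_limit (path_image (circlepath (-1) R)) (\<lambda>\<epsilon> y. h (\<epsilon>, y)) (\<lambda>y. h (0, y)) (at_right 0)"
      unfolding path by (rule unif)
  qed auto
  thus ?thesis unfolding polar_integral_at_def h_def by (intro tendsto_divide) auto
qed

text \<open>For distinct entries both sides are the same sum of residues, by Lagrange interpolation; both sides are
  continuous in the entries, which removes the restriction.\<close>

lemma S_val_polar: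
  fixes b :: "int list" and A :: real
  assumes b: "\<And>x. x \<in> set b \<Longrightarrow> x \<noteq> 0" "\<And>x. x \<in> set b \<Longrightarrow> real_of_int \<bar>x\<bar> \<le> A" and A: "A \<ge> 1"
  shows "S_val (int (length b) - 2 - int e) b = - D_val b *
    (contour_integral (circlepath (-1) (cluster_radius A)) (\<lambda>y. y ^ e / (\<Prod>x\<leftarrow>b. 1 - of_int x * y)) / (2 * of_real pi * \<i>))"
proof -
  define R where "R = cluster_radius A"
  define k where "k = length (neg_entries b)"
  define m where "m = length (pos_entries b)"
  define N where "N = k + m"
  define c where "c = neg_entries b @ pos_entries b"
  \<comment> \<open>The value 1 beyond the list keeps the point free of zero coordinates.\<close>
  define z where "z i = (if i < N then of_int (c ! i) else 1 :: complex)" for i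
  have R: "R > 0" using cluster_radius_bounds[OF A] by (simp add: R_def)
  have len: "length c = N" by (simp add: c_def N_def k_def m_def)
  have filter: "filter (\<lambda>x. \<not> x < 0) b = filter (\<lambda>x. x > 0) b"
    by (rule filter_cong) (use b(1) in force)+
  have mset: "mset c = mset b"
    unfolding c_def neg_entries_def pos_entries_def filter[symmetric] mset_append mset_filter
    by (rule multiset_partition[symmetric])
  hence lenb: "length b = N" using len by (metis size_mset)
  have setc: "set c = set b" using mset by (metis set_mset_mset)
  have zN: "z i = of_int (c ! i)" "c ! i \<in> set b" if "i < N" for i
    using that len setc nth_mem[of i c] by (auto simp: z_def)
  have nz: "z i \<noteq> 0" for i using zN[of i] b(1)[of "c ! i"] by (auto simp: z_def)
  have cneg: "c ! i < 0 \<longleftrightarrow> i < k" if "i < N" for i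
  proof -
    have "c ! i \<in> set (neg_entries b)" if "i < k" using that by (auto simp: c_def nth_append k_def)
    moreover have "c ! i \<in> set (pos_entries b)" if "\<not> i < k" using that \<open>i < N\<close> by (auto simp: c_def nth_append k_def N_def m_def)
    ultimately show ?thesis by (cases "i < k") (auto simp: neg_entries_def pos_entries_def)
  qed
  have norm_eq: "norm (1 / z i + 1) = \<bar>1 / (c ! i) + 1\<bar>" if "i < N" for i
  proof -
    have "1 / z i + 1 = of_real (1 / (c ! i) + 1)" using zN[OF that] by simp
    thus ?thesis by (metis norm_of_real)
  qed
  have off: "norm (1 / z i + 1) \<noteq> R" and inside: "norm (1 / z i + 1) < R \<longleftrightarrow> i < k" if "i < N" for i
    using cluster_radius_separates[OF b(1)[OF zN(2)[OF that]] b(2)[OF zN(2)[OF that]]] cneg[OF that]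
    unfolding norm_eq[OF that] R_def by auto
  have "(\<Prod>x\<leftarrow>b. 1 - of_int x * y) = (\<Prod>i\<in>{0..<N}. 1 - z i * y)" for y
  proof -
    have "(\<Prod>x\<leftarrow>b. 1 - of_int x * y) = (\<Prod>x\<leftarrow>c. 1 - of_int x * y)"
      using mset by (metis mset_map prod_mset_prod_list)
    also have "\<dots> = (\<Prod>i\<in>{0..<N}. 1 - of_int (c ! i) * y)"
      using prod.list_conv_set_nth[of "map (\<lambda>x. 1 - of_int x * y) c"] len by simp
    finally show ?thesis by (simp add: z_def)
  qed
  hence integral: "contour_integral (circlepath (-1) (cluster_radius A)) (\<lambda>y. y ^ e / (\<Prod>x\<leftarrow>b. 1 - of_int x * y)) / (2 * of_real pi * \<i>)
     = polar_integral_at R z {0..<N} e" by (simp add: polar_integral_at_def R_def)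
  show ?thesis
  proof (cases "neg_entries b = []")
    \<comment> \<open>Without negative entries no pole lies inside the circle, so the integral is 0,
      in agreement with the convention in \<open>S_val\<close>.\<close>
    case True
    hence "k = 0" by (simp add: k_def)
    hence "polar_integral_at R z {0..<N} e = - (\<Sum>i\<in>{}. z i powi (int (card {0..<N}) - 2 - int e) / (\<Prod>q\<in>{0..<N} - {i}. z i - z q))"
      by (intro polar_integral_residues R) (use nz off inside in auto)
    thus ?thesis using True unfolding integral by (simp add: S_val_def)
  next
    case False
    define u where "u = int N - 2 - int e"
    \<comment> \<open>Distinct integers differ by at least 1, and equal ones are separated by their
      positions. So for \<epsilon> < 1 / (N + 1) the perturbed entries are distinct, and they stay
      nonzero because |z_i| \<ge> 1.\<close>
    define w where "w \<epsilon> i = z i + of_real \<epsilon> * of_nat i" for \<epsilon> :: real and i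
    have km: "k + m > 0" using False by (simp add: k_def)
    have z: "nonvanishing z" using nz by simp
    have S: "S_val u b = laurent_eval (S_laurent k m u) z"
    proof -
      have "monomial_at (\<lambda>i. of_int (c ! i)) j = monomial_at z j" if "j \<in> Poly_Mapping.keys (S_laurent k m u)" for j
        unfolding monomial_at_def
        by (rule prod.cong) (use S_laurent_vars[OF km that] in \<open>auto simp: z_def N_def\<close>)
      thus ?thesis using False by (simp add: S_val_def laurent_eval_monomial_at k_def m_def c_def)
    qed
    have wlim: "((\<lambda>\<epsilon>. w \<epsilon> i) \<longlongrightarrow> z i) (at_right 0)" for i
      unfolding w_def by (auto intro!: tendsto_eq_intros)
    have "\<forall>\<^sub>F \<epsilon>::real in at_right 0. \<epsilon> \<in> {0<..<1 / (real N + 1)}" by (rule eventually_at_right_real) simp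
    moreover have "\<forall>\<^sub>F \<epsilon> in at_right 0. \<forall>i\<in>{0..<N}. norm (1 / w \<epsilon> i + 1) \<noteq> R \<and> (norm (1 / w \<epsilon> i + 1) < R \<longleftrightarrow> i < k)"
    proof (rule eventually_ball_finite)
      show "\<forall>i\<in>{0..<N}. \<forall>\<^sub>F \<epsilon> in at_right 0. norm (1 / w \<epsilon> i + 1) \<noteq> R \<and> (norm (1 / w \<epsilon> i + 1) < R \<longleftrightarrow> i < k)"
      proof
        fix i assume "i \<in> {0..<N}"
        hence i: "i < N" by simp
        have lim: "((\<lambda>\<epsilon>. norm (1 / w \<epsilon> i + 1)) \<longlongrightarrow> norm (1 / z i + 1)) (at_right 0)"
          by (intro tendsto_intros wlim) (use nz in auto)
        show "\<forall>\<^sub>F \<epsilon> in at_right 0. norm (1 / w \<epsilon> i + 1) \<noteq> R \<and> (norm (1 / w \<epsilon> i + 1) < R \<longleftrightarrow> i < k)"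
        proof (cases "i < k")
          case True
          hence "\<forall>\<^sub>F \<epsilon> in at_right 0. norm (1 / w \<epsilon> i + 1) < R"
            using inside[OF i] by (intro order_tendstoD(2)[OF lim]) simp
          thus ?thesis by eventually_elim (use True in auto)
        next
          case False
          hence "\<forall>\<^sub>F \<epsilon> in at_right 0. norm (1 / w \<epsilon> i + 1) > R"
            using inside[OF i] off[OF i] by (intro order_tendstoD(1)[OF lim]) simp
          thus ?thesis by eventually_elim (use False in auto)
        qed
      qed
    qed simp
    ultimately have "\<forall>\<^sub>F \<epsilon> in at_right 0. laurent_eval (S_laurent k m u) (w \<epsilon>) =
       (\<Prod>i\<in>{0..<k}. \<Prod>j\<in>{k..<k + m}. w \<epsilon> i - w \<epsilon> j) * (- polar_integral_at R (w \<epsilon>) {0..<N} e)"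
    proof eventually_elim
      case (elim \<epsilon>)
      have small: "\<epsilon> * real i < 1" "\<epsilon> * real i \<ge> 0" if "i < N" for i
      proof -
        have "\<epsilon> * real i \<le> \<epsilon> * (real N + 1)" using elim(1) that by (intro mult_left_mono) auto
        also have "\<epsilon> * (real N + 1) < 1" using elim(1) by (simp add: field_simps)
        finally show "\<epsilon> * real i < 1" .
      qed (use elim(1) in auto)
      have wreal: "w \<epsilon> i = of_real (real_of_int (c ! i) + \<epsilon> * real i)" if "i < N" for i
        using that by (simp add: w_def zN)
      have wnz: "w \<epsilon> i \<noteq> 0" for i
      proof (cases "i < N")
        case True
        have "\<bar>c ! i\<bar> \<ge> 1" using b(1)[OF zN(2)[OF True]] by simp
        hence "\<bar>real_of_int (c ! i)\<bar> \<ge> 1" by linarith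
        hence "real_of_int (c ! i) + \<epsilon> * real i \<noteq> 0" using small[OF True] by linarith
        thus ?thesis unfolding wreal[OF True] by (metis of_real_eq_0_iff)
      next
        case False
        have "w \<epsilon> i = of_real (1 + \<epsilon> * real i)" using False by (simp add: w_def z_def)
        moreover have "1 + \<epsilon> * real i > 0" using elim(1) by (intro add_pos_nonneg) auto
        ultimately show ?thesis by (metis of_real_eq_0_iff less_numeral_extra(3))
      qed
      have winj: "inj_on (w \<epsilon>) {0..<N}"
      proof (rule inj_onI)
        fix i j assume ij: "i \<in> {0..<N}" "j \<in> {0..<N}" "w \<epsilon> i = w \<epsilon> j"
        hence ij': "i < N" "j < N" by auto
        have eq: "real_of_int (c ! i) + \<epsilon> * real i = real_of_int (c ! j) + \<epsilon> * real j"
          using ij(3) unfolding wreal[OF ij'(1)] wreal[OF ij'(2)] by (simp only: of_real_eq_iff)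
        hence "\<bar>real_of_int (c ! i - c ! j)\<bar> < 1" using small[OF ij'(1)] small[OF ij'(2)] by simp
        hence "c ! i = c ! j" by linarith
        hence "\<epsilon> * real i = \<epsilon> * real j" using eq by simp
        thus "i = j" using elim(1) by simp
      qed
      have "polar_integral_at R (w \<epsilon>) {0..<N} e =
         - (\<Sum>i\<in>{0..<k}. w \<epsilon> i powi (int (card {0..<N}) - 2 - int e) / (\<Prod>q\<in>{0..<N} - {i}. w \<epsilon> i - w \<epsilon> q))"
      proof (rule polar_integral_residues[OF _ R])
        show "{0..<k} = {i \<in> {0..<N}. norm (1 / w \<epsilon> i + 1) < R}" using elim(2) by (auto simp: N_def)
        show "w \<epsilon> i \<noteq> w \<epsilon> j" if "i \<in> {0..<k}" "j \<in> {0..<N}" "i \<noteq> j" for i j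
          using inj_onD[OF winj, of i j] that by (auto simp: N_def)
      qed (use wnz elim(2) in auto)
      thus ?case
        using laurent_eval_S_laurent[OF km _ winj[unfolded N_def], of u] wnz by (simp add: u_def N_def)
    qed
    moreover have "((\<lambda>\<epsilon>. (\<Prod>i\<in>{0..<k}. \<Prod>j\<in>{k..<k + m}. w \<epsilon> i - w \<epsilon> j) * (- polar_integral_at R (w \<epsilon>) {0..<N} e))
       \<longlongrightarrow> (\<Prod>i\<in>{0..<k}. \<Prod>j\<in>{k..<k + m}. z i - z j) * (- polar_integral_at R z {0..<N} e)) (at_right 0)"
    proof (intro tendsto_mult tendsto_minus tendsto_prod tendsto_diff wlim)
      show "((\<lambda>\<epsilon>. polar_integral_at R (w \<epsilon>) {0..<N} e) \<longlongrightarrow> polar_integral_at R z {0..<N} e) (at_right 0)"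
        unfolding w_def by (rule tendsto_polar_integral_at) (use R nz off in auto)
    qed
    ultimately have "((\<lambda>\<epsilon>. laurent_eval (S_laurent k m u) (w \<epsilon>))
       \<longlongrightarrow> (\<Prod>i\<in>{0..<k}. \<Prod>j\<in>{k..<k + m}. z i - z j) * (- polar_integral_at R z {0..<N} e)) (at_right 0)"
      by (subst tendsto_cong)
    moreover have "((\<lambda>\<epsilon>. laurent_eval (S_laurent k m u) (w \<epsilon>)) \<longlongrightarrow> laurent_eval (S_laurent k m u) z) (at_right 0)"
      unfolding laurent_eval_monomial_at monomial_at_def
      by (intro tendsto_sum tendsto_mult tendsto_const tendsto_prod tendsto_power_int wlim) (use nz in auto)
    ultimately have "laurent_eval (S_laurent k m u) z = (\<Prod>i\<in>{0..<k}. \<Prod>j\<in>{k..<k + m}. z i - z j) * (- polar_integral_at R z {0..<N} e)"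
      by (intro tendsto_unique[of "at_right (0::real)"]) auto
    also have "(\<Prod>i\<in>{0..<k}. \<Prod>j\<in>{k..<k + m}. z i - z j) = D_val b"
    proof -
      have "D_val b = (\<Prod>i\<in>{0..<k}. \<Prod>q\<leftarrow>pos_entries b. of_int (neg_entries b ! i - q))"
        using prod.list_conv_set_nth[of "map (\<lambda>p. \<Prod>q\<leftarrow>pos_entries b. of_int (p - q)) (neg_entries b)"]
        by (simp add: D_val_def k_def)
      also have "\<dots> = (\<Prod>i\<in>{0..<k}. \<Prod>j\<in>{k..<k + m}. z i - z j)"
      proof (rule prod.cong[OF refl])
        fix i assume i: "i \<in> {0..<k}"
        have "(\<Prod>q\<leftarrow>pos_entries b. of_int (neg_entries b ! i - q)) = (\<Prod>j\<in>{0..<m}. of_int (neg_entries b ! i - pos_entries b ! j) :: complex)"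
          using prod.list_conv_set_nth[of "map (\<lambda>q. of_int (neg_entries b ! i - q)) (pos_entries b)"] by (simp add: m_def)
        also have "\<dots> = (\<Prod>j\<in>{0 + k..<m + k}. z i - z j)"
          unfolding prod.shift_bounds_nat_ivl
          by (rule prod.cong) (use i in \<open>auto simp: z_def N_def c_def nth_append k_def m_def\<close>)
        finally show "(\<Prod>q\<leftarrow>pos_entries b. of_int (neg_entries b ! i - q)) = (\<Prod>j\<in>{k..<k + m}. z i - z j)"
          by (simp add: add.commute)
      qed
      finally show ?thesis by simp
    qed
    finally show ?thesis unfolding integral using S by (simp add: u_def lenb)
  qed
qed

lemma D_val_nonzero: "D_val b \<noteq> 0"
  unfolding D_val_def by (auto simp: prod_list_zero_iff neg_entries_def pos_entries_def)

subsection \<open>Sums over pairs and triples of indices\<close>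

text \<open>Newton's identity. The induction adds the largest index b, so that the new pairs are
  exactly the (j, b).\<close>

lemma sum_index_pairs:
  fixes x :: "nat \<Rightarrow> 'a :: field_char_0"
  assumes "finite I"
  shows "(\<Sum>(j, l)\<in>index_pairs I. x j * x l) = ((\<Sum>i\<in>I. x i) ^ 2 - (\<Sum>i\<in>I. x i ^ 2)) / 2"
  using assms
proof (induction I rule: finite_linorder_max_induct)
  case (insert b I)
  have eq: "index_pairs (insert b I) = index_pairs I \<union> (\<lambda>j. (j, b)) ` I"
    using insert.hyps(2) by (auto simp: index_pairs_def)
  have "b \<notin> I" using insert.hyps(2) by auto
  have "(\<Sum>(j, l)\<in>index_pairs (insert b I). x j * x l) = (\<Sum>(j, l)\<in>index_pairs I. x j * x l) + (\<Sum>j\<in>I. x j * x b)"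
    unfolding eq using insert.hyps(1) \<open>b \<notin> I\<close>
    by (subst sum.union_disjoint) (auto simp: finite_index_pairs sum.reindex inj_on_def, auto simp: index_pairs_def)
  also have "(\<Sum>j\<in>I. x j * x b) = (\<Sum>j\<in>I. x j) * x b" by (rule sum_distrib_right[symmetric])
  finally show ?case using insert \<open>b \<notin> I\<close> by (simp add: field_simps power2_eq_square)
qed (simp add: index_pairs_def)

lemma finite_index_triples: "finite I \<Longrightarrow> finite (index_triples I)"
  by (rule finite_subset[of _ "I \<times> I \<times> I"]) (auto simp: index_triples_def)

text \<open>Newton's identity in degree three; adding the largest index b reduces the new triples to
  pairs of smaller indices.\<close>

lemma sum_index_triples:
  fixes x :: "nat \<Rightarrow> 'a :: field_char_0"
  assumes "finite I"
  shows "(\<Sum>(j, l, p)\<in>index_triples I. x j * x l * x p)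
     = ((\<Sum>i\<in>I. x i) ^ 3 - 3 * (\<Sum>i\<in>I. x i) * (\<Sum>i\<in>I. x i ^ 2) + 2 * (\<Sum>i\<in>I. x i ^ 3)) / 6"
  using assms
proof (induction I rule: finite_linorder_max_induct)
  case (insert b I)
  have eq: "index_triples (insert b I) = index_triples I \<union> (\<lambda>(j, l). (j, l, b)) ` index_pairs I"
    using insert.hyps(2) by (auto simp: index_triples_def index_pairs_def)
  have "b \<notin> I" using insert.hyps(2) by auto
  have "(\<Sum>(j, l, p)\<in>index_triples (insert b I). x j * x l * x p)
     = (\<Sum>(j, l, p)\<in>index_triples I. x j * x l * x p) + (\<Sum>(j, l)\<in>index_pairs I. x j * x l * x b)"
  proof -
    have "(\<Sum>(j, l, p)\<in>(\<lambda>(j, l). (j, l, b)) ` index_pairs I. x j * x l * x p) = (\<Sum>(j, l)\<in>index_pairs I. x j * x l * x b)"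
      by (subst sum.reindex) (auto simp: inj_on_def intro!: sum.cong)
    thus ?thesis
      unfolding eq using insert.hyps(1) \<open>b \<notin> I\<close>
      by (subst sum.union_disjoint) (auto simp: finite_index_pairs finite_index_triples, auto simp: index_triples_def)
  qed
  also have "(\<Sum>(j, l)\<in>index_pairs I. x j * x l * x b) = (\<Sum>(j, l)\<in>index_pairs I. x j * x l) * x b"
    unfolding case_prod_unfold by (rule sum_distrib_right[symmetric])
  finally have "(\<Sum>(j, l, p)\<in>index_triples (insert b I). x j * x l * x p) =
      ((\<Sum>i\<in>I. x i) ^ 3 - 3 * (\<Sum>i\<in>I. x i) * (\<Sum>i\<in>I. x i ^ 2) + 2 * (\<Sum>i\<in>I. x i ^ 3)) / 6
      + ((\<Sum>i\<in>I. x i) ^ 2 - (\<Sum>i\<in>I. x i ^ 2)) / 2 * x b" (is "?lhs = _")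
    unfolding insert.IH sum_index_pairs[OF insert.hyps(1)] .
  hence lhs: "?lhs = ((\<Sum>i\<in>I. x i) ^ 3 - 3 * (\<Sum>i\<in>I. x i) * (\<Sum>i\<in>I. x i ^ 2) + 2 * (\<Sum>i\<in>I. x i ^ 3)
      + 3 * ((\<Sum>i\<in>I. x i) ^ 2 - (\<Sum>i\<in>I. x i ^ 2)) * x b) / 6" by (simp add: add_divide_distrib)
  show ?case unfolding lhs using insert.hyps(1) \<open>b \<notin> I\<close>
    by (simp add: field_simps power2_eq_square power3_eq_cube)
qed (auto simp: index_triples_def intro!: sum.neutral)

text \<open>By Bezout's identity. This turns conditions on \<zeta> stated with the numbers g_j,
  g_{j,l}, g_{j,l,p} into conditions on the individual powers \<zeta>^a_i.\<close>

lemma power_int_Gcd_eq_1_iff: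
  fixes \<zeta> :: complex and X :: "int set"
  assumes "finite X" "\<zeta> \<noteq> 0"
  shows "\<zeta> powi Gcd X = 1 \<longleftrightarrow> (\<forall>x\<in>X. \<zeta> powi x = 1)"
proof
  assume *: "\<zeta> powi Gcd X = 1"
  show "\<forall>x\<in>X. \<zeta> powi x = 1"
  proof
    fix x assume "x \<in> X"
    then obtain c where "x = Gcd X * c" by (meson Gcd_dvd dvdE)
    thus "\<zeta> powi x = 1" using * by (simp add: power_int_mult)
  qed
next
  assume "\<forall>x\<in>X. \<zeta> powi x = 1"
  with assms(1) show "\<zeta> powi Gcd X = 1"
  proof (induction X rule: finite_induct)
    case (insert x X)
    obtain u v where uv: "u * x + v * Gcd X = gcd x (Gcd X)" using bezout_int by blast
    have "\<zeta> powi Gcd (insert x X) = \<zeta> powi (x * u + Gcd X * v)" using uv by (simp add: mult.commute)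
    also have "\<dots> = (\<zeta> powi x) powi u * (\<zeta> powi Gcd X) powi v"
      using assms(2) by (simp add: power_int_add power_int_mult)
    finally show ?case using insert by simp
  qed simp
qed

text \<open>If x and y have the same image, then the quotient x / y is killed by the coprime
  exponents c and g, so it is 1; an injective self-map of a finite set is onto. This removes a_j
  from the sums over the roots of a single cluster type.\<close>

lemma bij_betw_root_powi:
  fixes g :: nat and c :: int
  assumes g: "g > 0" and coprime: "coprime c (int g)"
  shows "bij_betw (\<lambda>\<zeta>. \<zeta> powi c) (nontrivial_roots g) (nontrivial_roots g)"
proof -
  have one: "\<zeta> = 1" if "\<zeta> \<noteq> 0" "\<zeta> powi c = 1" "\<zeta> ^ g = 1" for \<zeta> :: complex
  proof -
    have "\<zeta> powi Gcd {c, int g} = 1"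
      using that by (subst power_int_Gcd_eq_1_iff) auto
    thus ?thesis using coprime by simp
  qed
  have inj: "inj_on (\<lambda>\<zeta>. \<zeta> powi c) (nontrivial_roots g)"
  proof (rule inj_onI)
    fix x y assume xy: "x \<in> nontrivial_roots g" "y \<in> nontrivial_roots g" "x powi c = y powi c"
    have nz: "x \<noteq> 0" "y \<noteq> 0" using xy nontrivial_root_nonzero[OF g] by blast+
    have "x / y = 1"
      by (rule one) (use nz xy in \<open>auto simp: power_int_divide_distrib power_divide\<close>)
    thus "x = y" using nz by simp
  qed
  moreover have "(\<lambda>\<zeta>. \<zeta> powi c) ` nontrivial_roots g \<subseteq> nontrivial_roots g"
  proof (rule image_subsetI)
    fix x assume x: "x \<in> nontrivial_roots g"
    hence nz: "x \<noteq> 0" using nontrivial_root_nonzero[OF g] by blast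
    have "(x powi c) ^ g = (x ^ g) powi c" by (simp add: power_int_power power_int_power' mult.commute)
    thus "x powi c \<in> nontrivial_roots g" using x one[OF nz] by auto
  qed
  ultimately show ?thesis
    unfolding bij_betw_def using endo_inj_surj[OF finite_nontrivial_roots[OF g]] by blast
qed

lemma ordered_triple_eq:
  fixes j l p :: nat
  assumes "j < l" "l < p" "j' < l'" "l' < p'" "{j, l, p} = {j', l', p'}"
  shows "j = j' \<and> l = l' \<and> p = p'"
proof -
  have "sorted_list_of_set (set [j, l, p]) = [j, l, p]" "sorted_list_of_set (set [j', l', p']) = [j', l', p']"
    by (rule sorted_list_of_set.idem_if_sorted_distinct; use assms in simp)+
  moreover have "set [j, l, p] = set [j', l', p']" using assms(5) by simp
  ultimately have "[j, l, p] = [j', l', p']" by metis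
  thus ?thesis by simp
qed

text \<open>Z is partitioned according to the value of T. Subsets with more than three elements
  contribute nothing, and the smaller ones correspond to increasing tuples of indices.\<close>

lemma sum_group_by_subset:
  fixes F :: "'z \<Rightarrow> complex" and T :: "'z \<Rightarrow> nat set"
  assumes Z: "finite Z" and I: "finite I" and T: "\<And>z. z \<in> Z \<Longrightarrow> T z \<subseteq> I"
    and F: "\<And>z. z \<in> Z \<Longrightarrow> card (T z) > 3 \<Longrightarrow> F z = 0"
  shows "(\<Sum>z\<in>Z. F z) = (\<Sum>z | z \<in> Z \<and> T z = {}. F z) + (\<Sum>j\<in>I. \<Sum>z | z \<in> Z \<and> T z = {j}. F z)
    + (\<Sum>(j, l)\<in>index_pairs I. \<Sum>z | z \<in> Z \<and> T z = {j, l}. F z)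
    + (\<Sum>(j, l, p)\<in>index_triples I. \<Sum>z | z \<in> Z \<and> T z = {j, l, p}. F z)"
proof -
  define G where "G U = (\<Sum>z | z \<in> Z \<and> T z = U. F z)" for U
  define P1 where "P1 = (\<lambda>j. {j}) ` I"
  define P2 where "P2 = (\<lambda>(j, l). {j, l}) ` index_pairs I"
  define P3 where "P3 = (\<lambda>(j, l, p). {j, l, p}) ` index_triples I"
  have card: "card U = 1" if "U \<in> P1" for U using that by (auto simp: P1_def)
  have card2: "card U = 2" if "U \<in> P2" for U using that by (auto simp: P2_def index_pairs_def)
  have card3: "card U = 3" if "U \<in> P3" for U using that by (auto simp: P3_def index_triples_def)
  have fin: "finite P1" "finite P2" "finite P3"
    using I by (auto simp: P1_def P2_def P3_def finite_index_pairs finite_index_triples)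
  have cover: "U \<in> {{}} \<union> (P1 \<union> (P2 \<union> P3))" if U: "U \<subseteq> I" "card U \<le> 3" for U
  proof -
    have finU: "finite U" using U(1) I finite_subset by blast
    have "card U = 0 \<or> card U = 1 \<or> card U = 2 \<or> card U = 3" using U(2) by linarith
    thus ?thesis
    proof (elim disjE)
      assume "card U = 2"
      then obtain x y where xy: "U = {x, y}" "x \<noteq> y" by (auto simp: card_2_iff)
      hence "(min x y, max x y) \<in> index_pairs I" "U = {min x y, max x y}"
        using U(1) by (auto simp: index_pairs_def min_def max_def)
      thus ?thesis unfolding P2_def by (metis (no_types, lifting) UnI1 UnI2 case_prod_conv imageI)
    next
      assume c3: "card U = 3"
      define s where "s = sorted_list_of_set U"
      have s: "set s = U" "length s = 3" "sorted_wrt (<) s" using finU c3 by (auto simp: s_def)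
      then obtain x y z where "s = [x, y, z]" by (auto simp: numeral_3_eq_3 length_Suc_conv)
      hence "U = {x, y, z}" "(x, y, z) \<in> index_triples I" using s U(1) by (auto simp: index_triples_def)
      hence "U \<in> P3" unfolding P3_def by (intro image_eqI[of _ _ "(x, y, z)"]) auto
      thus ?thesis by blast
    qed (use U finU in \<open>auto simp: card_1_singleton_iff P1_def\<close>)
  qed
  have "(\<Sum>z\<in>Z. F z) = (\<Sum>U\<in>Pow I. G U)"
    unfolding G_def by (rule sum.group[symmetric]) (use Z I T in auto)
  also have "\<dots> = (\<Sum>U\<in>{{}} \<union> (P1 \<union> (P2 \<union> P3)). G U)"
  proof (rule sum.mono_neutral_right)
    show "\<forall>U\<in>Pow I - ({{}} \<union> (P1 \<union> (P2 \<union> P3))). G U = 0"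
    proof
      fix U assume "U \<in> Pow I - ({{}} \<union> (P1 \<union> (P2 \<union> P3)))"
      hence "card U > 3" using cover[of U] by (meson DiffE PowD not_le)
      thus "G U = 0" unfolding G_def by (intro sum.neutral) (use F in auto)
    qed
    show "{{}} \<union> (P1 \<union> (P2 \<union> P3)) \<subseteq> Pow I"
      by (auto simp: P1_def P2_def P3_def index_pairs_def index_triples_def)
  qed (use I in simp)
  also have "\<dots> = G {} + (sum G P1 + (sum G P2 + sum G P3))"
  proof -
    have "{} \<notin> P1 \<union> (P2 \<union> P3)" using card card2 card3 by force
    moreover have "P1 \<inter> (P2 \<union> P3) = {}" "P2 \<inter> P3 = {}" using card card2 card3 by force+
    ultimately show ?thesis using fin by (simp add: sum.union_disjoint)
  qed
  also have "sum G P1 = (\<Sum>j\<in>I. G {j})" unfolding P1_def by (subst sum.reindex) (auto simp: inj_on_def)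
  also have "sum G P2 = (\<Sum>(j, l)\<in>index_pairs I. G {j, l})"
    unfolding P2_def by (subst sum.reindex) (auto simp: inj_on_def index_pairs_def doubleton_eq_iff case_prod_unfold)
  also have "sum G P3 = (\<Sum>(j, l, p)\<in>index_triples I. G {j, l, p})"
  proof -
    have inj: "inj_on (\<lambda>(j, l, p). {j, l, p}) (index_triples I)"
    proof (rule inj_onI)
      fix t t' assume t: "t \<in> index_triples I" "t' \<in> index_triples I"
        "(case t of (j, l, p) \<Rightarrow> {j, l, p}) = (case t' of (j, l, p) \<Rightarrow> {j, l, p})"
      obtain j l p j' l' p' where tt: "t = (j, l, p)" "t' = (j', l', p')" by (metis prod.exhaust)
      have "j = j' \<and> l = l' \<and> p = p'"
        by (rule ordered_triple_eq) (use t tt in \<open>simp_all add: index_triples_def\<close>)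
      thus "t = t'" by (simp add: tt)
    qed
    show ?thesis unfolding P3_def sum.reindex[OF inj] by (intro sum.cong) auto
  qed
  finally show ?thesis by (simp add: G_def add.assoc)
qed

lemma remove_entries_list:
  shows "length (remove_entries n a T) = card ({1..n} - T)"
    and "set (remove_entries n a T) = a ` ({1..n} - T)"
    and "(\<Sum>x\<leftarrow>remove_entries n a T. f x :: complex) = (\<Sum>i\<in>{1..n} - T. f (a i))"
    and "(\<Prod>x\<leftarrow>remove_entries n a T. f x :: complex) = (\<Prod>i\<in>{1..n} - T. f (a i))"
proof -
  define xs where "xs = filter (\<lambda>i. i \<notin> T) [1..<Suc n]"
  have xs: "distinct xs" "set xs = {1..n} - T" by (auto simp: xs_def)
  have r: "remove_entries n a T = map a xs" by (simp add: remove_entries_def xs_def)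
  show "length (remove_entries n a T) = card ({1..n} - T)" using distinct_card[OF xs(1)] xs(2) by (simp add: r)
  show "set (remove_entries n a T) = a ` ({1..n} - T)" by (simp add: r xs)
  show "(\<Sum>x\<leftarrow>remove_entries n a T. f x) = (\<Sum>i\<in>{1..n} - T. f (a i))"
    using sum_list_distinct_conv_sum_set[OF xs(1), of "\<lambda>i. f (a i)"] by (simp add: r xs(2) o_def)
  show "(\<Prod>x\<leftarrow>remove_entries n a T. f x) = (\<Prod>i\<in>{1..n} - T. f (a i))"
    using prod.distinct_set_conv_list[OF xs(1), of "\<lambda>i. f (a i)"] by (simp add: r xs(2) o_def)
qed

lemma E1_remove_entries: "E1 (remove_entries n a T) = esym1 a ({1..n} - T)"
  by (simp add: E1_def esym1_def remove_entries_list(3))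

lemma E2_remove_entries: "E2 (remove_entries n a T) = esym2 a ({1..n} - T)"
proof -
  let ?b = "remove_entries n a T"
  have nth: "(\<Sum>i\<in>{0..<length ?b}. f (?b ! i)) = (\<Sum>i\<in>{1..n} - T. f (a i))" for f :: "int \<Rightarrow> complex"
    using sum.list_conv_set_nth[of "map f ?b"] remove_entries_list(3)[of f n a T] by simp
  have "E2 ?b = (\<Sum>(i, j)\<in>index_pairs {0..<length ?b}. of_int (?b ! i) * of_int (?b ! j))" by (simp add: E2_def)
  also have "\<dots> = ((\<Sum>i\<in>{0..<length ?b}. of_int (?b ! i)) ^ 2 - (\<Sum>i\<in>{0..<length ?b}. of_int (?b ! i) ^ 2)) / 2"
    by (rule sum_index_pairs) simp
  finally show ?thesis
    unfolding esym2_def nth[of "\<lambda>x. of_int x"] nth[of "\<lambda>x. of_int x ^ 2"] .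
qed

lemma gcd_without_0: "gcd_without n a {} = Gcd (a ` {1..n})"
  by (simp add: gcd_without_def)

subsection \<open>Grouping the clusters\<close>

locale effective_weights = weights +
  assumes effective: "Gcd (a ` {1..n}) = 1" and n2: "n \<ge> 2" and neg: "\<exists>i\<in>{1..n}. a i < 0"
begin

text \<open>The dictionary between integrals and S_u: with r entries removed the exponent e
  corresponds to u = n - r - 2 - e, and the exponents e \<le> 3 - r that occur give the indices from
  n - 2 - r down to n - 5.\<close>

lemma S_val_eq:
  assumes "u = int (card ({1..n} - T)) - 2 - int e"
  shows "S_val u (remove_entries n a T) = - D_val (remove_entries n a T) * J ({1..n} - T) e"
proof -
  have "S_val (int (length (remove_entries n a T)) - 2 - int e) (remove_entries n a T) = - D_val (remove_entries n a T) *
    (contour_integral (circlepath (-1) (cluster_radius A)) (\<lambda>y. y ^ e / (\<Prod>x\<leftarrow>remove_entries n a T. 1 - of_int x * y)) / (2 * of_real pi * \<i>))"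
    by (rule S_val_polar) (use nz A in \<open>auto simp: remove_entries_list(2)\<close>)
  thus ?thesis unfolding remove_entries_list(1,4) polar_integral_def assms .
qed

definition L :: nat where "L = nat (\<Prod>i\<in>{1..n}. \<bar>a i\<bar>)"

lemma L: "L > 0" "\<And>i. i \<in> {1..n} \<Longrightarrow> a i dvd int L"
proof -
  have pos: "(\<Prod>i\<in>{1..n}. \<bar>a i\<bar>) > 0" by (rule prod_pos) (use nz in auto)
  thus "L > 0" by (simp add: L_def)
  fix i assume i: "i \<in> {1..n}"
  have "\<bar>a i\<bar> dvd (\<Prod>i\<in>{1..n}. \<bar>a i\<bar>)" using i by (intro dvd_prodI) auto
  thus "a i dvd int L" using pos by (simp add: L_def)
qed

lemma root_nonzero: "\<zeta> ^ L = 1 \<Longrightarrow> \<zeta> \<noteq> (0 :: complex)"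
  using L(1) by (auto simp: zero_power)

lemma gcd_without_nonzero:
  assumes "{1..n} - T \<noteq> {}"
  shows "gcd_without n a T \<noteq> 0"
  unfolding gcd_without_def using assms nz by (auto simp: Gcd_0_iff)

lemma powi_gcd_without:
  assumes "\<zeta> \<noteq> 0"
  shows "\<zeta> powi gcd_without n a T = 1 \<longleftrightarrow> nontrivial \<zeta> \<subseteq> T"
  unfolding gcd_without_def using assms
  by (subst power_int_Gcd_eq_1_iff) (auto simp: nontrivial_def)

text \<open>\<open>zetas2\<close> and \<open>zetas3\<close> do not mention L. A solution of their
  equations is an L-th root of unity as soon as one index i with \<zeta>^a_i = 1 remains, because
  a_i divides L.\<close>

lemma root_if_trivial_weight:
  assumes "\<zeta> \<noteq> 0" "nontrivial \<zeta> \<subseteq> T" "{1..n} - T \<noteq> {}"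
  shows "\<zeta> ^ L = 1"
proof -
  obtain i where "i \<in> {1..n}" "i \<notin> T" using assms(3) by blast
  hence i: "i \<in> {1..n}" "\<zeta> powi a i = 1" using assms(2) by (auto simp: nontrivial_def)
  obtain c where "int L = a i * c" using L(2)[OF i(1)] by (elim dvdE)
  hence "\<zeta> powi int L = 1" using i(2) by (simp add: power_int_mult)
  thus ?thesis by simp
qed

lemma nontrivial_subset: "nontrivial \<zeta> \<subseteq> {1..n}"
  by (auto simp: nontrivial_def)

text \<open>This is where effectiveness enters: since the gcd of all weights is 1, only the cluster
  of \<zeta> = 1 has the full pole order.\<close>

lemma nontrivial_empty: "{\<zeta>. \<zeta> ^ L = 1 \<and> nontrivial \<zeta> = {}} = {1}"
proof -
  have "\<zeta> = 1" if "\<zeta> ^ L = 1" "nontrivial \<zeta> = {}" for \<zeta>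
    using powi_gcd_without[OF root_nonzero[OF that(1)], of "{}"] that(2) effective
    by (simp add: gcd_without_0)
  thus ?thesis by (auto simp: nontrivial_def)
qed

lemma nontrivial_singleton:
  assumes j: "j \<in> {1..n}"
  shows "{\<zeta>. \<zeta> ^ L = 1 \<and> nontrivial \<zeta> = {j}} = nontrivial_roots (nat (gcd_without n a {j}))"
proof -
  have ne: "{1..n} - {j} \<noteq> {}"
  proof
    assume "{1..n} - {j} = {}"
    hence "{1..n} \<subseteq> {j}" by blast
    hence "card {1..n} \<le> card {j}" by (intro card_mono) auto
    thus False using n2 by simp
  qed
  define g where "g = nat (gcd_without n a {j})"
  have "gcd_without n a {j} \<ge> 0" by (simp add: gcd_without_def)
  hence g: "g > 0" "gcd_without n a {j} = int g"
    using gcd_without_nonzero[OF ne] by (auto simp: g_def)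
  have iff: "\<zeta> ^ g = 1 \<longleftrightarrow> nontrivial \<zeta> \<subseteq> {j}" if "\<zeta> \<noteq> 0" for \<zeta>
    using powi_gcd_without[OF that, of "{j}"] by (simp add: g(2))
  have one: "nontrivial \<zeta> = {} \<longleftrightarrow> \<zeta> = 1" if "\<zeta> ^ L = 1" for \<zeta>
    using nontrivial_empty that by blast
  show ?thesis unfolding g_def[symmetric]
  proof (intro equalityI subsetI)
    fix \<zeta> assume "\<zeta> \<in> {\<zeta>. \<zeta> ^ L = 1 \<and> nontrivial \<zeta> = {j}}"
    hence \<zeta>: "\<zeta> ^ L = 1" "nontrivial \<zeta> = {j}" by auto
    hence "\<zeta> \<noteq> 1" "\<zeta> ^ g = 1" using one[OF \<zeta>(1)] iff[OF root_nonzero[OF \<zeta>(1)]] by simp_all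
    thus "\<zeta> \<in> nontrivial_roots g" by simp
  next
    fix \<zeta> assume \<zeta>: "\<zeta> \<in> nontrivial_roots g"
    hence nz: "\<zeta> \<noteq> 0" using nontrivial_root_nonzero[OF g(1)] by blast
    hence sub: "nontrivial \<zeta> \<subseteq> {j}" using iff \<zeta> by auto
    hence root: "\<zeta> ^ L = 1" using root_if_trivial_weight[OF nz sub ne] by simp
    thus "\<zeta> \<in> {\<zeta>. \<zeta> ^ L = 1 \<and> nontrivial \<zeta> = {j}}" using sub one[OF root] \<zeta> by auto
  qed
qed

lemma coprime_gcd_without:
  assumes "j \<in> {1..n}"
  shows "coprime (a j) (gcd_without n a {j})"
proof -
  have "a ` {1..n} = insert (a j) (a ` ({1..n} - {j}))" using assms by auto
  hence "gcd (a j) (gcd_without n a {j}) = 1" using effective by (simp add: gcd_without_def)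
  thus ?thesis by (simp add: coprime_iff_gcd_eq_1)
qed

text \<open>The three gcd conditions say that the nontrivial indices lie in {j, l}, but neither in
  {j} nor in {l}. Some index outside {j, l} must exist, as otherwise the gcd is 0 and
  \<open>zetas2\<close> is infinite.\<close>

lemma zetas2_eq:
  assumes "j \<noteq> l" "{1..n} - {j, l} \<noteq> {}"
  shows "zetas2 n a j l = {\<zeta>. \<zeta> ^ L = 1 \<and> nontrivial \<zeta> = {j, l}}"
proof (intro equalityI subsetI)
  fix \<zeta> assume \<zeta>: "\<zeta> \<in> zetas2 n a j l"
  hence nz: "\<zeta> \<noteq> 0" using gcd_without_nonzero[OF assms(2)] by (auto simp: zetas2_def power_int_0_left_if)
  have sub: "nontrivial \<zeta> \<subseteq> {j, l}" "\<not> nontrivial \<zeta> \<subseteq> {j}" "\<not> nontrivial \<zeta> \<subseteq> {l}"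
    using \<zeta> powi_gcd_without[OF nz] by (auto simp: zetas2_def)
  hence "nontrivial \<zeta> = {j, l}" by blast
  thus "\<zeta> \<in> {\<zeta>. \<zeta> ^ L = 1 \<and> nontrivial \<zeta> = {j, l}}"
    using root_if_trivial_weight[OF nz sub(1) assms(2)] by simp
next
  fix \<zeta> assume \<zeta>: "\<zeta> \<in> {\<zeta>. \<zeta> ^ L = 1 \<and> nontrivial \<zeta> = {j, l}}"
  thus "\<zeta> \<in> zetas2 n a j l"
    using powi_gcd_without[OF root_nonzero] assms(1) by (simp add: zetas2_def)
qed

lemma zetas3_eq:
  assumes "j \<noteq> l" "j \<noteq> p" "l \<noteq> p" "{1..n} - {j, l, p} \<noteq> {}"
  shows "zetas3 n a j l p = {\<zeta>. \<zeta> ^ L = 1 \<and> nontrivial \<zeta> = {j, l, p}}"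
proof (intro equalityI subsetI)
  fix \<zeta> assume \<zeta>: "\<zeta> \<in> zetas3 n a j l p"
  hence nz: "\<zeta> \<noteq> 0" using gcd_without_nonzero[OF assms(4)] by (auto simp: zetas3_def power_int_0_left_if)
  have sub: "nontrivial \<zeta> \<subseteq> {j, l, p}" "\<not> nontrivial \<zeta> \<subseteq> {j, l}" "\<not> nontrivial \<zeta> \<subseteq> {j, p}" "\<not> nontrivial \<zeta> \<subseteq> {l, p}"
    using \<zeta> powi_gcd_without[OF nz] by (auto simp: zetas3_def)
  hence "nontrivial \<zeta> = {j, l, p}" by blast
  thus "\<zeta> \<in> {\<zeta>. \<zeta> ^ L = 1 \<and> nontrivial \<zeta> = {j, l, p}}"
    using root_if_trivial_weight[OF nz sub(1) assms(4)] by simp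
next
  fix \<zeta> assume \<zeta>: "\<zeta> \<in> {\<zeta>. \<zeta> ^ L = 1 \<and> nontrivial \<zeta> = {j, l, p}}"
  thus "\<zeta> \<in> zetas3 n a j l p"
    using powi_gcd_without[OF root_nonzero] assms(1-3) by (simp add: zetas3_def)
qed

text \<open>The integrand is a polynomial. This is the counterpart of the convention that summands
  with the empty vector are 0.\<close>

lemma polar_integral_empty: "J {} e = 0"
proof -
  have "polar_integral_at (cluster_radius A) (\<lambda>i. of_int (a i)) {} e = 0"
    using cluster_radius_bounds[OF A(2)] by (subst polar_integral_residues[where K = "{}"]) auto
  thus ?thesis by (simp add: polar_integral_at_def polar_integral_def)
qed

lemma card_greater_3_cluster_term:
  assumes "card (nontrivial \<zeta>) > 3"
  shows "cluster_term \<zeta> = 0"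
proof -
  have "nontrivial \<zeta> \<noteq> {}" using assms by auto
  thus ?thesis using assms by (simp add: cluster_term_def Let_def)
qed

lemma cluster_term_1: "cluster_term 1 = (let e1 = esym1 a {1..n}; e2 = esym2 a {1..n}; I = {1..n} in
   (6 * J I 0 - 8 * e1 * J I 1 + (3 * e2 + 2 * e1\<^sup>2) * J I 2 - e1 * e2 * J I 3) / 24)"
  by (simp add: cluster_term_def nontrivial_def Let_def)

definition single_term :: "nat \<Rightarrow> complex" where
  "single_term j = (let g = of_int (gcd_without n a {j}); I = {1..n} - {j}; e1 = esym1 a I; e2 = esym2 a I in
     (g - 1) / 24 * (4 * J I 0 - 5 * e1 * J I 1 + (e2 + e1\<^sup>2) * J I 2)
     + (g\<^sup>2 - 1) / 24 * (2 * J I 0 - (2 * of_int (a j) + e1) * J I 1 + of_int (a j) * e1 * J I 2))"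

text \<open>As a_j is prime to g_j, the map sending \<zeta> to \<zeta>^a_j permutes the nontrivial
  g_j-th roots of unity. The three resulting sums are (g - 1) / 2, - (g^2 - 1) / 12 and 0; the
  negative sign of the second cancels the one in \<open>cluster_term\<close>.\<close>

lemma sum_cluster_term_singleton:
  assumes j: "j \<in> {1..n}"
  shows "(\<Sum>\<zeta> | \<zeta> ^ L = 1 \<and> nontrivial \<zeta> = {j}. cluster_term \<zeta>) = single_term j"
proof -
  define I where "I = {1..n} - {j}"
  define g where "g = nat (gcd_without n a {j})"
  define e1 where "e1 = esym1 a I"
  define e2 where "e2 = esym2 a I"
  define X where "X = (4 * J I 0 - 5 * e1 * J I 1 + (e2 + e1\<^sup>2) * J I 2) / 12"
  define Y where "Y = (2 * J I 0 - (2 * of_int (a j) + e1) * J I 1 + of_int (a j) * e1 * J I 2) / 2"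
  define W where "W = (J I 0 - 2 * of_int (a j) * J I 1 + of_int (a j) ^ 2 * J I 2) / 2"
  define F where "F w = 1 / (1 - w) * X - w / (1 - w) ^ 2 * Y + w * (1 + w) / (1 - w) ^ 3 * W" for w :: complex
  have ne: "{1..n} - {j} \<noteq> {}"
  proof
    assume "{1..n} - {j} = {}"
    hence "{1..n} \<subseteq> {j}" by blast
    hence "card {1..n} \<le> card {j}" by (intro card_mono) auto
    thus False using n2 by simp
  qed
  have "gcd_without n a {j} \<ge> 0" by (simp add: gcd_without_def)
  hence g: "g > 0" "gcd_without n a {j} = int g"
    using gcd_without_nonzero[OF ne] by (auto simp: g_def)
  have "(\<Sum>\<zeta> | \<zeta> ^ L = 1 \<and> nontrivial \<zeta> = {j}. cluster_term \<zeta>) = (\<Sum>\<zeta> | \<zeta> ^ L = 1 \<and> nontrivial \<zeta> = {j}. F (\<zeta> powi a j))"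
    by (rule sum.cong) (auto simp: cluster_term_def Let_def F_def X_def Y_def W_def I_def e1_def e2_def)
  also have "\<dots> = (\<Sum>\<zeta>\<in>nontrivial_roots g. F (\<zeta> powi a j))"
    using nontrivial_singleton[OF j] by (simp add: g_def)
  also have "\<dots> = (\<Sum>w\<in>nontrivial_roots g. F w)"
    by (rule sum.reindex_bij_betw[OF bij_betw_root_powi[OF g(1)]]) (use coprime_gcd_without[OF j] g(2) in simp)
  also have "\<dots> = (\<Sum>w\<in>nontrivial_roots g. 1 / (1 - w)) * X - (\<Sum>w\<in>nontrivial_roots g. w / (1 - w) ^ 2) * Y
     + (\<Sum>w\<in>nontrivial_roots g. w * (1 + w) / (1 - w) ^ 3) * W"
    unfolding F_def sum.distrib sum_subtractf sum_distrib_right ..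
  also have "\<dots> = (of_nat g - 1) / 2 * X + (of_nat g ^ 2 - 1) / 12 * Y"
    unfolding sum_roots_1[OF g(1)] sum_roots_2[OF g(1)] sum_roots_3[OF g(1)] by (simp add: field_simps)
  also have "\<dots> = single_term j"
    unfolding single_term_def Let_def I_def[symmetric] e1_def[symmetric] e2_def[symmetric] g(2) X_def Y_def by simp
  finally show ?thesis .
qed

lemma cluster_term_2:
  assumes "nontrivial \<zeta> = {j, l}" "j \<noteq> l"
  defines "I \<equiv> {1..n} - {j, l}"
  shows "cluster_term \<zeta> = 1 / ((1 - \<zeta> powi a j) * (1 - \<zeta> powi a l)) * ((J I 0 - esym1 a I * J I 1) / 2)
    - (\<zeta> powi a j / ((1 - \<zeta> powi a j) ^ 2 * (1 - \<zeta> powi a l)) * (J I 0 - of_int (a j) * J I 1)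
     + \<zeta> powi a l / ((1 - \<zeta> powi a j) * (1 - \<zeta> powi a l) ^ 2) * (J I 0 - of_int (a l) * J I 1))"
proof -
  have "{j, l} - {j} = {l}" "{j, l} - {l} = {j}" using assms(2) by auto
  thus ?thesis using assms(1,2) by (simp add: cluster_term_def Let_def I_def mult.commute)
qed

lemma cluster_term_3:
  assumes "nontrivial \<zeta> = {j, l, p}" "j \<noteq> l" "j \<noteq> p" "l \<noteq> p"
  shows "cluster_term \<zeta> = 1 / ((1 - \<zeta> powi a j) * (1 - \<zeta> powi a l) * (1 - \<zeta> powi a p)) * J ({1..n} - {j, l, p}) 0"
  using assms by (simp add: cluster_term_def Let_def mult.assoc)

lemma gamma3_polar:
  "gamma_coeff 3 n a = cluster_term 1 + (\<Sum>j=1..n. single_term j)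
    + (\<Sum>(j, l)\<in>index_pairs {1..n}. \<Sum>\<zeta> | \<zeta> ^ L = 1 \<and> nontrivial \<zeta> = {j, l}. cluster_term \<zeta>)
    + (\<Sum>(j, l, p)\<in>index_triples {1..n}. \<Sum>\<zeta> | \<zeta> ^ L = 1 \<and> nontrivial \<zeta> = {j, l, p}. cluster_term \<zeta>)"
proof -
  have fin: "finite {\<zeta> :: complex. \<zeta> ^ L = 1}" using L(1) by (intro finite_roots_unity) auto
  have "gamma_coeff 3 n a = (\<Sum>\<zeta>\<in>{\<zeta>. \<zeta> ^ L = 1}. cluster_term \<zeta>)"
    by (rule gamma3_cluster_sum[OF neg L])
  also have "\<dots> = (\<Sum>\<zeta> | \<zeta> \<in> {\<zeta>. \<zeta> ^ L = 1} \<and> nontrivial \<zeta> = {}. cluster_term \<zeta>)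
    + (\<Sum>j\<in>{1..n}. \<Sum>\<zeta> | \<zeta> \<in> {\<zeta>. \<zeta> ^ L = 1} \<and> nontrivial \<zeta> = {j}. cluster_term \<zeta>)
    + (\<Sum>(j, l)\<in>index_pairs {1..n}. \<Sum>\<zeta> | \<zeta> \<in> {\<zeta>. \<zeta> ^ L = 1} \<and> nontrivial \<zeta> = {j, l}. cluster_term \<zeta>)
    + (\<Sum>(j, l, p)\<in>index_triples {1..n}. \<Sum>\<zeta> | \<zeta> \<in> {\<zeta>. \<zeta> ^ L = 1} \<and> nontrivial \<zeta> = {j, l, p}. cluster_term \<zeta>)"
    by (rule sum_group_by_subset[OF fin]) (use nontrivial_subset card_greater_3_cluster_term in auto)
  also have "(\<Sum>\<zeta> | \<zeta> \<in> {\<zeta>. \<zeta> ^ L = 1} \<and> nontrivial \<zeta> = {}. cluster_term \<zeta>) = cluster_term 1"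
    using nontrivial_empty by simp
  also have "(\<Sum>j\<in>{1..n}. \<Sum>\<zeta> | \<zeta> \<in> {\<zeta>. \<zeta> ^ L = 1} \<and> nontrivial \<zeta> = {j}. cluster_term \<zeta>) = (\<Sum>j\<in>{1..n}. single_term j)"
    unfolding mem_Collect_eq by (rule sum.cong[OF refl sum_cluster_term_singleton])
  finally show ?thesis unfolding mem_Collect_eq .
qed

lemma cluster_term_1_S:
  defines "b \<equiv> remove_entries n a {}"
  shows "cluster_term 1 = (- 6 * S_val (int n - 2) b + 8 * E1 b * S_val (int n - 3) b
          - (3 * E2 b + 2 * (E1 b)^2) * S_val (int n - 4) b
          + E1 b * E2 b * S_val (int n - 5) b) / (24 * D_val b)"
proof -
  define D where "D = D_val b"
  have D: "D \<noteq> 0" by (simp add: D_def D_val_nonzero)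
  have S: "S_val (int n - 2) b = - D * J {1..n} 0" "S_val (int n - 3) b = - D * J {1..n} 1"
    "S_val (int n - 4) b = - D * J {1..n} 2" "S_val (int n - 5) b = - D * J {1..n} 3"
    using S_val_eq[of "int n - 2" "{}" 0] S_val_eq[of "int n - 3" "{}" 1]
      S_val_eq[of "int n - 4" "{}" 2] S_val_eq[of "int n - 5" "{}" 3]
    by (simp_all add: b_def D_def)
  have E: "E1 b = esym1 a {1..n}" "E2 b = esym2 a {1..n}"
    by (simp_all add: b_def E1_remove_entries E2_remove_entries)
  show ?thesis unfolding S E D_def[symmetric] cluster_term_1 Let_def using D by (simp add: field_simps)
qed

lemma card_remove:
  assumes "T \<subseteq> {1..n}"
  shows "int (card ({1..n} - T)) = int n - int (card T)"
proof -
  have "finite T" using assms finite_subset by blast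
  moreover have "card T \<le> n" using card_mono[OF _ assms] by simp
  ultimately show ?thesis using assms by (simp add: card_Diff_subset of_nat_diff)
qed

lemma single_term_S:
  assumes j: "j \<in> {1..n}"
  defines "b \<equiv> remove_entries n a {j}" and "g \<equiv> of_int (gcd_without n a {j})"
  shows "single_term j = (1 - g) / 24 *
        ((4 * S_val (int n - 3) b - 5 * E1 b * S_val (int n - 4) b
          + (E2 b + (E1 b)^2) * S_val (int n - 5) b) / D_val b)
      + (g^2 - 1) / 24 *
        ((- 2 * S_val (int n - 3) b + (2 * of_int (a j) + E1 b) * S_val (int n - 4) b
          - of_int (a j) * E1 b * S_val (int n - 5) b) / D_val b)"
proof -
  define D where "D = D_val b"
  define I where "I = {1..n} - {j}"
  have D: "D \<noteq> 0" by (simp add: D_def D_val_nonzero)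
  have card: "int (card ({1..n} - {j})) = int n - 1" using card_remove[of "{j}"] j by simp
  have S: "S_val (int n - 3) b = - D * J I 0" "S_val (int n - 4) b = - D * J I 1" "S_val (int n - 5) b = - D * J I 2"
    unfolding b_def D_def I_def by (rule S_val_eq, unfold card, simp)+
  have E: "E1 b = esym1 a I" "E2 b = esym2 a I"
    by (simp_all add: b_def I_def E1_remove_entries E2_remove_entries)
  have 1: "(4 * (- D * J I 0) - 5 * esym1 a I * (- D * J I 1) + (esym2 a I + (esym1 a I)\<^sup>2) * (- D * J I 2)) / D
      = - (4 * J I 0 - 5 * esym1 a I * J I 1 + (esym2 a I + (esym1 a I)\<^sup>2) * J I 2)"
    using D by (simp add: field_simps)
  have 2: "(- 2 * (- D * J I 0) + (2 * of_int (a j) + esym1 a I) * (- D * J I 1) - of_int (a j) * esym1 a I * (- D * J I 2)) / D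
      = 2 * J I 0 - (2 * of_int (a j) + esym1 a I) * J I 1 + of_int (a j) * esym1 a I * J I 2"
    using D by (simp add: field_simps)
  have 3: "(1 - g) / 24 * (- x) = (g - 1) / 24 * x" for x by (simp add: field_simps)
  show ?thesis unfolding S E D_def[symmetric] single_term_def Let_def I_def[symmetric] g_def[symmetric] 1 2 3
    by (simp add: algebra_simps)
qed

lemma pair_term_S:
  assumes jl: "(j, l) \<in> index_pairs {1..n}"
  defines "b \<equiv> remove_entries n a {j, l}"
  shows "(\<Sum>\<zeta> | \<zeta> ^ L = 1 \<and> nontrivial \<zeta> = {j, l}. cluster_term \<zeta>) =
    (\<Sum>\<zeta>\<in>zetas2 n a j l. 1 / ((1 - \<zeta> powi a j) * (1 - \<zeta> powi a l)) *
        ((E1 b * S_val (int n - 5) b - S_val (int n - 4) b) / (2 * D_val b)))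
    + (\<Sum>\<zeta>\<in>zetas2 n a j l. \<zeta> powi a j / ((1 - \<zeta> powi a j)^2 * (1 - \<zeta> powi a l)) *
          ((S_val (int n - 4) b - of_int (a j) * S_val (int n - 5) b) / D_val b)
        + \<zeta> powi a l / ((1 - \<zeta> powi a j) * (1 - \<zeta> powi a l)^2) *
          ((S_val (int n - 4) b - of_int (a l) * S_val (int n - 5) b) / D_val b))"
proof -
  define D where "D = D_val b"
  define I where "I = {1..n} - {j, l}"
  have jl': "j \<noteq> l" "{j, l} \<subseteq> {1..n}" using jl by (auto simp: index_pairs_def)
  have D: "D \<noteq> 0" by (simp add: D_def D_val_nonzero)
  have card: "int (card ({1..n} - {j, l})) = int n - 2" using card_remove[OF jl'(2)] jl'(1) by simp
  have S: "S_val (int n - 4) b = - D * J I 0" "S_val (int n - 5) b = - D * J I 1"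
    unfolding b_def D_def I_def by (rule S_val_eq, unfold card, simp)+
  have E: "E1 b = esym1 a I" by (simp add: b_def I_def E1_remove_entries)
  have R: "(E1 b * S_val (int n - 5) b - S_val (int n - 4) b) / (2 * D_val b) = (J I 0 - esym1 a I * J I 1) / 2"
    "(S_val (int n - 4) b - of_int c * S_val (int n - 5) b) / D_val b = - (J I 0 - of_int c * J I 1)" for c
    unfolding S E D_def[symmetric] using D by (simp_all add: field_simps)
  show ?thesis
  proof (cases "I = {}")
    \<comment> \<open>Here n = 2: \<open>zetas2\<close> is infinite, but every integral over the
      empty index set is 0, so both sides vanish.\<close>
    case True
    have "cluster_term \<zeta> = 0" if "nontrivial \<zeta> = {j, l}" for \<zeta>
      using cluster_term_2[OF that jl'(1)] unfolding I_def[symmetric] True polar_integral_empty by simp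
    thus ?thesis unfolding R True by (simp add: polar_integral_empty)
  next
    case False
    have "(\<Sum>\<zeta> | \<zeta> ^ L = 1 \<and> nontrivial \<zeta> = {j, l}. cluster_term \<zeta>) = (\<Sum>\<zeta>\<in>zetas2 n a j l. cluster_term \<zeta>)"
      using zetas2_eq[OF jl'(1)] False by (simp add: I_def)
    also have "\<dots> = (\<Sum>\<zeta>\<in>zetas2 n a j l. 1 / ((1 - \<zeta> powi a j) * (1 - \<zeta> powi a l)) * ((J I 0 - esym1 a I * J I 1) / 2)
       + (\<zeta> powi a j / ((1 - \<zeta> powi a j)^2 * (1 - \<zeta> powi a l)) * (- (J I 0 - of_int (a j) * J I 1))
        + \<zeta> powi a l / ((1 - \<zeta> powi a j) * (1 - \<zeta> powi a l)^2) * (- (J I 0 - of_int (a l) * J I 1))))"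
    proof (rule sum.cong[OF refl])
      fix \<zeta> assume "\<zeta> \<in> zetas2 n a j l"
      hence "nontrivial \<zeta> = {j, l}" using zetas2_eq[OF jl'(1)] False by (auto simp: I_def)
      have *: "x - (y * u + z * v) = x + (y * - u + z * - v)" for x y z u v :: complex by simp
      show "cluster_term \<zeta> = 1 / ((1 - \<zeta> powi a j) * (1 - \<zeta> powi a l)) * ((J I 0 - esym1 a I * J I 1) / 2)
       + (\<zeta> powi a j / ((1 - \<zeta> powi a j)^2 * (1 - \<zeta> powi a l)) * (- (J I 0 - of_int (a j) * J I 1))
        + \<zeta> powi a l / ((1 - \<zeta> powi a j) * (1 - \<zeta> powi a l)^2) * (- (J I 0 - of_int (a l) * J I 1)))"
        unfolding cluster_term_2[OF \<open>nontrivial \<zeta> = {j, l}\<close> jl'(1)] I_def[symmetric] by (rule *)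
    qed
    finally show ?thesis unfolding R sum.distrib by simp
  qed
qed

lemma triple_term_S:
  assumes t: "(j, l, p) \<in> index_triples {1..n}"
  defines "b \<equiv> remove_entries n a {j, l, p}"
  shows "(\<Sum>\<zeta> | \<zeta> ^ L = 1 \<and> nontrivial \<zeta> = {j, l, p}. cluster_term \<zeta>) =
     - S_val (int n - 5) b / D_val b * (\<Sum>\<zeta>\<in>zetas3 n a j l p.
          1 / ((1 - \<zeta> powi a j) * (1 - \<zeta> powi a l) * (1 - \<zeta> powi a p)))"
proof -
  define I where "I = {1..n} - {j, l, p}"
  have t': "j \<noteq> l" "j \<noteq> p" "l \<noteq> p" "{j, l, p} \<subseteq> {1..n}" using t by (auto simp: index_triples_def)
  have card: "int (card ({1..n} - {j, l, p})) = int n - 3" using card_remove[OF t'(4)] t' by simp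
  have "S_val (int n - 5) b = - D_val b * J I 0"
    unfolding b_def I_def by (rule S_val_eq, unfold card, simp)
  hence R: "- S_val (int n - 5) b / D_val b = J I 0" by (simp add: D_val_nonzero)
  show ?thesis
  proof (cases "I = {}")
    case True
    have "cluster_term \<zeta> = 0" if "nontrivial \<zeta> = {j, l, p}" for \<zeta>
      using cluster_term_3[OF that t'(1-3)] unfolding I_def[symmetric] True polar_integral_empty by simp
    thus ?thesis unfolding R True by (simp add: polar_integral_empty)
  next
    case False
    have eq: "zetas3 n a j l p = {\<zeta>. \<zeta> ^ L = 1 \<and> nontrivial \<zeta> = {j, l, p}}"
      using zetas3_eq[OF t'(1-3)] False by (simp add: I_def)
    show ?thesis unfolding R eq sum_distrib_left
      by (rule sum.cong[OF refl]) (use cluster_term_3[OF _ t'(1-3)] in \<open>auto simp: I_def mult.commute\<close>)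
  qed
qed

end

subsection \<open>Distinct negative weights\<close>

text \<open>The full double sum minus its diagonal, expressed by the power sums of degree one to
  three.\<close>

lemma sum_products_distinct:
  fixes x :: "nat \<Rightarrow> 'a :: comm_ring_1"
  assumes "finite K"
  shows "(\<Sum>j\<in>K. \<Sum>l\<in>K - {j}. x j * x l * (x l - 2 * c)) =
    (\<Sum>j\<in>K. x j) * (\<Sum>j\<in>K. x j ^ 2) - (\<Sum>j\<in>K. x j ^ 3) - 2 * c * ((\<Sum>j\<in>K. x j) ^ 2 - (\<Sum>j\<in>K. x j ^ 2))"
proof -
  have "(\<Sum>l\<in>K - {j}. x j * x l * (x l - 2 * c)) =
      x j * (\<Sum>l\<in>K. x l ^ 2) - 2 * c * (x j * (\<Sum>l\<in>K. x l)) - (x j ^ 3 - 2 * c * x j ^ 2)" if "j \<in> K" for j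
  proof -
    have "(\<Sum>l\<in>K - {j}. x j * x l * (x l - 2 * c)) = (\<Sum>l\<in>K. x j * x l * (x l - 2 * c)) - x j * x j * (x j - 2 * c)"
      using assms that by (simp add: sum_diff1)
    also have "(\<Sum>l\<in>K. x j * x l * (x l - 2 * c)) = x j * (\<Sum>l\<in>K. x l ^ 2) - 2 * c * (x j * (\<Sum>l\<in>K. x l))"
      by (simp add: sum_distrib_left algebra_simps power2_eq_square sum_subtractf)
    finally show ?thesis by (simp add: algebra_simps power2_eq_square power3_eq_cube)
  qed
  hence "(\<Sum>j\<in>K. \<Sum>l\<in>K - {j}. x j * x l * (x l - 2 * c)) =
      (\<Sum>j\<in>K. x j * (\<Sum>l\<in>K. x l ^ 2) - 2 * c * (x j * (\<Sum>l\<in>K. x l)) - (x j ^ 3 - 2 * c * x j ^ 2))"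
    by (rule sum.cong[OF refl])
  also have "\<dots> = (\<Sum>j\<in>K. x j) * (\<Sum>j\<in>K. x j ^ 2) - 2 * c * ((\<Sum>j\<in>K. x j) * (\<Sum>j\<in>K. x j))
      - ((\<Sum>j\<in>K. x j ^ 3) - 2 * c * (\<Sum>j\<in>K. x j ^ 2))"
    by (simp only: sum_subtractf sum_distrib_left[symmetric] sum_distrib_right[symmetric])
  finally show ?thesis by (simp add: algebra_simps power2_eq_square)
qed

locale simple_negative_weights = effective_weights +
  fixes k :: nat
  assumes k: "k < n" and sign: "\<And>i. i \<in> {1..n} \<Longrightarrow> a i < 0 \<longleftrightarrow> i \<le> k"
    and simple: "\<And>i j. i \<in> {1..k} \<Longrightarrow> j \<in> {1..k} \<Longrightarrow> i \<noteq> j \<Longrightarrow> a i \<noteq> a j"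
begin

text \<open>The power of a_i shared by all residues; it is an integer power because n may be less
  than 5.\<close>

definition pole_power :: "nat \<Rightarrow> complex" where "pole_power i = of_int (a i) powi (int n - 5)"

definition pole_prod :: "nat \<Rightarrow> nat set \<Rightarrow> complex" where
  "pole_prod i T = of_int (\<Prod>q\<in>{1..n} - insert i T. a i - a q)"

text \<open>Inside the circle there are only the poles of negative weights, which are simple because
  these weights are distinct. The residue exponent n - card T - 2 - e is split as (n - 5) + (3 -
  card T - e), with a nonnegative second part.\<close>

lemma polar_integral_simple:
  assumes T: "T \<subseteq> {1..n}" and e: "card T + e \<le> 3"
  shows "J ({1..n} - T) e = - (\<Sum>i | i \<in> {1..k} \<and> i \<notin> T. pole_power i * of_int (a i) ^ (3 - card T - e) / pole_prod i T)"
proof -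
  let ?I = "{1..n} - T"
  let ?K = "{i. i \<in> {1..k} \<and> i \<notin> T}"
  have inside: "norm (1 / complex_of_int (a i) + 1) < cluster_radius A \<longleftrightarrow> a i < 0"
    "norm (1 / complex_of_int (a i) + 1) \<noteq> cluster_radius A" if i: "i \<in> {1..n}" for i
  proof -
    have "norm (1 / complex_of_int (a i) + 1) = norm (complex_of_real (1 / a i + 1))" by simp
    also have "\<dots> = \<bar>1 / a i + 1\<bar>" by (rule norm_of_real)
    finally show "norm (1 / complex_of_int (a i) + 1) < cluster_radius A \<longleftrightarrow> a i < 0"
      "norm (1 / complex_of_int (a i) + 1) \<noteq> cluster_radius A"
      using cluster_radius_separates[OF nz[OF i] A(1)[OF i]] by simp_all
  qed
  have K: "?K \<subseteq> ?I" using k by auto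
  have "polar_integral_at (cluster_radius A) (\<lambda>i. of_int (a i)) ?I e =
     - (\<Sum>i\<in>?K. complex_of_int (a i) powi (int (card ?I) - 2 - int e) / (\<Prod>q\<in>?I - {i}. of_int (a i) - of_int (a q)))"
  proof (rule polar_integral_residues)
    show "cluster_radius A > 0" using cluster_radius_bounds[OF A(2)] by simp
    show "complex_of_int (a i) \<noteq> 0" if "i \<in> ?I" for i using nz that by simp
    show "norm (1 / complex_of_int (a i) + 1) \<noteq> cluster_radius A" if "i \<in> ?I" for i using inside(2) that by simp
    have "i \<in> ?K \<longleftrightarrow> i \<in> ?I \<and> norm (1 / complex_of_int (a i) + 1) < cluster_radius A" for i
    proof (cases "i \<in> {1..n}")
      case True
      thus ?thesis using inside(1)[OF True] sign[OF True] by auto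
    qed (use k in auto)
    thus "?K = {i \<in> ?I. norm (1 / complex_of_int (a i) + 1) < cluster_radius A}" by blast
    fix i j assume i: "i \<in> ?K" and j: "j \<in> ?I" and ij: "i \<noteq> j"
    have "a i < 0" using sign[of i] i K by auto
    hence "a i \<noteq> a j" using simple[of i j] i j ij sign[of j] by (cases "a j < 0") auto
    thus "complex_of_int (a i) \<noteq> of_int (a j)" by simp
  qed simp
  also have "\<dots> = - (\<Sum>i\<in>?K. pole_power i * of_int (a i) ^ (3 - card T - e) / pole_prod i T)"
  proof (intro arg_cong[where f = uminus] sum.cong refl)
    fix i assume "i \<in> ?K"
    hence i: "a i \<noteq> 0" using nz K by blast
    have "int (card ?I) - 2 - int e = (int n - 5) + int (3 - card T - e)"
      unfolding card_remove[OF T] using e by (simp add: of_nat_diff)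
    hence "complex_of_int (a i) powi (int (card ?I) - 2 - int e) = pole_power i * of_int (a i) ^ (3 - card T - e)"
      using i by (simp only: pole_power_def power_int_add) (simp add: power_int_add)
    moreover have "?I - {i} = {1..n} - insert i T" by blast
    ultimately show "complex_of_int (a i) powi (int (card ?I) - 2 - int e) / (\<Prod>q\<in>?I - {i}. of_int (a i) - of_int (a q))
      = pole_power i * of_int (a i) ^ (3 - card T - e) / pole_prod i T" by (simp add: pole_prod_def)
  qed
  finally show ?thesis by (simp add: polar_integral_at_def polar_integral_def)
qed

abbreviation p1 where "p1 K \<equiv> \<Sum>j\<in>K. complex_of_int (a j)"
abbreviation p2 where "p2 K \<equiv> \<Sum>j\<in>K. complex_of_int (a j) ^ 2"

lemma esym_insert:
  assumes "i \<in> {1..n} - T"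
  defines "K \<equiv> {1..n} - insert i T"
  shows "esym1 a ({1..n} - T) = of_int (a i) + p1 K"
    and "esym2 a ({1..n} - T) = of_int (a i) * p1 K + ((p1 K)\<^sup>2 - p2 K) / 2"
proof -
  have "{1..n} - T = insert i K" using assms(1) unfolding K_def by blast
  moreover have "i \<notin> K" "finite K" by (simp_all add: K_def)
  moreover have "((x + s)\<^sup>2 - (x\<^sup>2 + q)) / 2 = x * s + (s\<^sup>2 - q) / 2" for x s q :: complex
  proof -
    have "(x + s)\<^sup>2 - (x\<^sup>2 + q) = 2 * (x * s) + (s\<^sup>2 - q)" by (simp add: power2_eq_square algebra_simps)
    thus ?thesis by (simp only: add_divide_distrib) simp
  qed
  ultimately show "esym1 a ({1..n} - T) = of_int (a i) + p1 K"
    and "esym2 a ({1..n} - T) = of_int (a i) * p1 K + ((p1 K)\<^sup>2 - p2 K) / 2"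
    by (simp_all only: esym1_def esym2_def sum.insert not_False_eq_True)
qed

text \<open>Taking a_i^(n-5) out of the residues leaves for each i a cubic expression in a_i, E1 and
  E2. It is compared with the numerator of the target through the power sums of the remaining
  weights, summand by summand in i.\<close>

lemma cluster_term_1_simple:
  "cluster_term 1 = (\<Sum>i=1..k. of_int (a i) powi (int n - 5) *
        of_int ((\<Sum>(j, l, p)\<in>index_triples ({1..n} - {i}). 3 * a j * a l * a p)
          + (\<Sum>j\<in>{1..n} - {i}. \<Sum>l\<in>{1..n} - {i, j}. a j * a l * (a l - 2 * a i))
          + (\<Sum>j\<in>{1..n} - {i}. a i * a j * (2 * a i - a j)))
        / (24 * of_int (\<Prod>q\<in>{1..n} - {i}. a i - a q)))"
proof -
  define e1 where "e1 = esym1 a {1..n}"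
  define e2 where "e2 = esym2 a {1..n}"
  define x where "x i = complex_of_int (a i)" for i
  have "{i. i \<in> {1..k} \<and> i \<notin> {}} = {1..k}" by auto
  hence "J {1..n} e = - (\<Sum>i\<in>{1..k}. pole_power i * x i ^ (3 - e) / pole_prod i {})" if "e \<le> 3" for e
    using polar_integral_simple[of "{}" e] that by (simp only: x_def Diff_empty) simp
  from this[of 0] this[of 1] this[of 2] this[of 3]
  have J: "J {1..n} 0 = - (\<Sum>i\<in>{1..k}. pole_power i * x i ^ 3 / pole_prod i {})" "J {1..n} 1 = - (\<Sum>i\<in>{1..k}. pole_power i * x i ^ 2 / pole_prod i {})"
    "J {1..n} 2 = - (\<Sum>i\<in>{1..k}. pole_power i * x i / pole_prod i {})" "J {1..n} 3 = - (\<Sum>i\<in>{1..k}. pole_power i / pole_prod i {})"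
    by simp_all
  have "cluster_term 1 = (\<Sum>i\<in>{1..k}. - (6 * (pole_power i * x i ^ 3 / pole_prod i {})) / 24 + 8 * e1 * (pole_power i * x i ^ 2 / pole_prod i {}) / 24
      - (3 * e2 + 2 * e1\<^sup>2) * (pole_power i * x i / pole_prod i {}) / 24 + e1 * e2 * (pole_power i / pole_prod i {}) / 24)"
    unfolding cluster_term_1 Let_def e1_def[symmetric] e2_def[symmetric]
    unfolding J sum.distrib sum_subtractf sum_negf sum_distrib_left[symmetric] sum_divide_distrib[symmetric]
    by (simp add: diff_divide_distrib add_divide_distrib)
  also have "\<dots> = (\<Sum>i\<in>{1..k}. pole_power i *
        of_int ((\<Sum>(j, l, p)\<in>index_triples ({1..n} - {i}). 3 * a j * a l * a p)
          + (\<Sum>j\<in>{1..n} - {i}. \<Sum>l\<in>{1..n} - {i, j}. a j * a l * (a l - 2 * a i))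
          + (\<Sum>j\<in>{1..n} - {i}. a i * a j * (2 * a i - a j)))
        / (24 * pole_prod i {}))"
  proof (rule sum.cong[OF refl])
    fix i assume "i \<in> {1..k}"
    hence i: "i \<in> {1..n} - {}" using k by auto
    define K where "K = {1..n} - {i}"
    define q1 where "q1 = p1 K"
    define q2 where "q2 = p2 K"
    define q3 where "q3 = (\<Sum>j\<in>K. complex_of_int (a j) ^ 3)"
    have e: "e1 = x i + q1" "e2 = x i * q1 + (q1\<^sup>2 - q2) / 2"
      using esym_insert[OF i] by (simp_all add: e1_def e2_def x_def q1_def q2_def K_def)
    have "{1..n} - {i, j} = K - {j}" for j by (auto simp: K_def)
    hence "complex_of_int ((\<Sum>(j, l, p)\<in>index_triples ({1..n} - {i}). 3 * a j * a l * a p)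
          + (\<Sum>j\<in>{1..n} - {i}. \<Sum>l\<in>{1..n} - {i, j}. a j * a l * (a l - 2 * a i))
          + (\<Sum>j\<in>{1..n} - {i}. a i * a j * (2 * a i - a j)))
      = 3 * (\<Sum>(j, l, p)\<in>index_triples K. x j * x l * x p) + (\<Sum>j\<in>K. \<Sum>l\<in>K - {j}. x j * x l * (x l - 2 * x i))
        + (\<Sum>j\<in>K. x i * x j * (2 * x i - x j))"
      by (simp add: K_def x_def case_prod_unfold sum_distrib_left mult.assoc)
    also have "(\<Sum>j\<in>K. x i * x j * (2 * x i - x j)) = 2 * x i ^ 2 * q1 - x i * q2"
      by (simp add: q1_def q2_def x_def sum_distrib_left sum_subtractf algebra_simps power2_eq_square)
    also have "(\<Sum>j\<in>K. \<Sum>l\<in>K - {j}. x j * x l * (x l - 2 * x i)) = q1 * q2 - q3 - 2 * x i * (q1\<^sup>2 - q2)"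
      by (subst sum_products_distinct) (simp_all add: K_def q1_def q2_def q3_def x_def)
    also have "(\<Sum>(j, l, p)\<in>index_triples K. x j * x l * x p) = (q1 ^ 3 - 3 * q1 * q2 + 2 * q3) / 6"
      by (subst sum_index_triples) (simp_all add: K_def q1_def q2_def q3_def x_def)
    finally have num: "complex_of_int ((\<Sum>(j, l, p)\<in>index_triples ({1..n} - {i}). 3 * a j * a l * a p)
          + (\<Sum>j\<in>{1..n} - {i}. \<Sum>l\<in>{1..n} - {i, j}. a j * a l * (a l - 2 * a i))
          + (\<Sum>j\<in>{1..n} - {i}. a i * a j * (2 * a i - a j))) =
       3 * ((q1 ^ 3 - 3 * q1 * q2 + 2 * q3) / 6) + (q1 * q2 - q3 - 2 * x i * (q1\<^sup>2 - q2)) + (2 * x i ^ 2 * q1 - x i * q2)" .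
    \<comment> \<open>The sum q3 of cubes cancels between the triple sum and the double sum on the
      right, as it must, since the left side contains only e1 and e2.\<close>
    have poly: "- 6 * x i ^ 3 + 8 * e1 * x i ^ 2 - (3 * e2 + 2 * e1\<^sup>2) * x i + e1 * e2 =
       3 * ((q1 ^ 3 - 3 * q1 * q2 + 2 * q3) / 6) + (q1 * q2 - q3 - 2 * x i * (q1\<^sup>2 - q2)) + (2 * x i ^ 2 * q1 - x i * q2)"
      unfolding e by (simp add: field_simps power2_eq_square power3_eq_cube)
    have "- (6 * (pole_power i * x i ^ 3 / pole_prod i {})) / 24 + 8 * e1 * (pole_power i * x i ^ 2 / pole_prod i {}) / 24
      - (3 * e2 + 2 * e1\<^sup>2) * (pole_power i * x i / pole_prod i {}) / 24 + e1 * e2 * (pole_power i / pole_prod i {}) / 24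
      = pole_power i * (- 6 * x i ^ 3 + 8 * e1 * x i ^ 2 - (3 * e2 + 2 * e1\<^sup>2) * x i + e1 * e2) / (24 * pole_prod i {})"
      by (simp add: algebra_simps add_divide_distrib diff_divide_distrib)
    thus "- (6 * (pole_power i * x i ^ 3 / pole_prod i {})) / 24 + 8 * e1 * (pole_power i * x i ^ 2 / pole_prod i {}) / 24
      - (3 * e2 + 2 * e1\<^sup>2) * (pole_power i * x i / pole_prod i {}) / 24 + e1 * e2 * (pole_power i / pole_prod i {}) / 24
      = pole_power i * of_int ((\<Sum>(j, l, p)\<in>index_triples ({1..n} - {i}). 3 * a j * a l * a p)
          + (\<Sum>j\<in>{1..n} - {i}. \<Sum>l\<in>{1..n} - {i, j}. a j * a l * (a l - 2 * a i))
          + (\<Sum>j\<in>{1..n} - {i}. a i * a j * (2 * a i - a j))) / (24 * pole_prod i {})"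
      unfolding poly num .
  qed
  finally show ?thesis by (simp only: pole_power_def pole_prod_def)
qed

text \<open>The vector without entry j has no pole of index j, so each single term is a sum over i
  \<noteq> j. Exchanging the two sums gives, for every i, a sum over j \<noteq> i.\<close>

lemma sum_single_term_simple:
  "(\<Sum>j=1..n. single_term j) = (\<Sum>i=1..k. \<Sum>j\<in>{1..n} - {i}. let g = of_int (gcd_without n a {j}) in
        (g - 1) / 2 *
          ((\<Sum>(l, p)\<in>index_pairs ({1..n} - {i, j}).
              - (of_int (a i) powi (int n - 5)) * of_int (a l * a p)
              / (4 * of_int (\<Prod>q\<in>{1..n} - {i, j}. a i - a q)))
          + (\<Sum>l\<in>{1..n} - {i, j}.
              - (of_int (a i) powi (int n - 5)) * of_int (a l * (a l - 2 * a i))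
              / (12 * of_int (\<Prod>p\<in>{1..n} - {i, j}. a i - a p))))
        + (g^2 - 1) / 24 *
          (of_int (a i) powi (int n - 5) *
           of_int ((a i - a j) * (- a i + (\<Sum>l\<in>{1..n} - {i, j}. a l)))
           / of_int (\<Prod>l\<in>{1..n} - {i, j}. a i - a l)))"
    (is "_ = (\<Sum>i=1..k. \<Sum>j\<in>_. ?F i j)")
proof -
  have "single_term j = (\<Sum>i | i \<in> {1..k} \<and> i \<noteq> j. ?F i j)" if j: "j \<in> {1..n}" for j
  proof -
    define g where "g = complex_of_int (gcd_without n a {j})"
    define e1 where "e1 = esym1 a ({1..n} - {j})"
    define e2 where "e2 = esym2 a ({1..n} - {j})"
    define x where "x i = complex_of_int (a i)" for i
    have "J ({1..n} - {j}) e = - (\<Sum>i | i \<in> {1..k} \<and> i \<noteq> j. pole_power i * x i ^ (2 - e) / pole_prod i {j})" if "e \<le> 2" for e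
      using polar_integral_simple[of "{j}" e] that j by (simp add: x_def)
    from this[of 0] this[of 1] this[of 2]
    have J: "J ({1..n} - {j}) 0 = - (\<Sum>i | i \<in> {1..k} \<and> i \<noteq> j. pole_power i * x i ^ 2 / pole_prod i {j})"
      "J ({1..n} - {j}) 1 = - (\<Sum>i | i \<in> {1..k} \<and> i \<noteq> j. pole_power i * x i / pole_prod i {j})"
      "J ({1..n} - {j}) 2 = - (\<Sum>i | i \<in> {1..k} \<and> i \<noteq> j. pole_power i / pole_prod i {j})"
      by simp_all
    have "single_term j = (\<Sum>i | i \<in> {1..k} \<and> i \<noteq> j.
        (g - 1) / 24 * (- (4 * (pole_power i * x i ^ 2 / pole_prod i {j})) + 5 * e1 * (pole_power i * x i / pole_prod i {j}) - (e2 + e1\<^sup>2) * (pole_power i / pole_prod i {j}))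
     + (g\<^sup>2 - 1) / 24 * (- (2 * (pole_power i * x i ^ 2 / pole_prod i {j})) + (2 * x j + e1) * (pole_power i * x i / pole_prod i {j}) - x j * e1 * (pole_power i / pole_prod i {j})))"
      unfolding single_term_def Let_def g_def[symmetric] e1_def[symmetric] e2_def[symmetric] x_def[symmetric]
      unfolding J sum.distrib sum_subtractf sum_negf sum_distrib_left[symmetric]
      by (simp add: algebra_simps)
    also have "\<dots> = (\<Sum>i | i \<in> {1..k} \<and> i \<noteq> j. ?F i j)"
    proof (rule sum.cong[OF refl])
      fix i assume "i \<in> {i. i \<in> {1..k} \<and> i \<noteq> j}"
      hence i: "i \<in> {1..n} - {j}" using k by auto
      define K where "K = {1..n} - {i, j}"
      define q1 where "q1 = p1 K"
      define q2 where "q2 = p2 K"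
      define c where "c = pole_power i / pole_prod i {j}"
      have e: "e1 = x i + q1" "e2 = x i * q1 + (q1\<^sup>2 - q2) / 2"
        using esym_insert[OF i] by (simp_all add: e1_def e2_def x_def q1_def q2_def K_def)
      have P: "complex_of_int (\<Prod>q\<in>K. a i - a q) = pole_prod i {j}" by (simp add: pole_prod_def K_def)
      have 1: "(\<Sum>(l, p)\<in>index_pairs K. - pole_power i * of_int (a l * a p) / (4 * pole_prod i {j})) = - c / 4 * ((q1\<^sup>2 - q2) / 2)"
      proof -
        have "(\<Sum>(l, p)\<in>index_pairs K. - pole_power i * of_int (a l * a p) / (4 * pole_prod i {j})) = (\<Sum>(l, p)\<in>index_pairs K. - c / 4 * (x l * x p))"
          by (intro sum.cong) (auto simp: c_def x_def)
        also have "\<dots> = - c / 4 * (\<Sum>(l, p)\<in>index_pairs K. x l * x p)" by (simp add: sum_distrib_left case_prod_unfold)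
        also have "(\<Sum>(l, p)\<in>index_pairs K. x l * x p) = (q1\<^sup>2 - q2) / 2"
          by (subst sum_index_pairs) (simp_all add: K_def q1_def q2_def x_def)
        finally show ?thesis .
      qed
      have 2: "(\<Sum>l\<in>K. - pole_power i * of_int (a l * (a l - 2 * a i)) / (12 * pole_prod i {j})) = - c / 12 * (q2 - 2 * x i * q1)"
      proof -
        have "(\<Sum>l\<in>K. - pole_power i * of_int (a l * (a l - 2 * a i)) / (12 * pole_prod i {j})) = (\<Sum>l\<in>K. - c / 12 * (x l ^ 2 - 2 * x i * x l))"
          by (intro sum.cong) (auto simp: c_def x_def right_diff_distrib diff_divide_distrib power2_eq_square)
        also have "\<dots> = - c / 12 * (q2 - 2 * x i * q1)"
          by (simp only: sum_distrib_left[symmetric] sum_subtractf q1_def q2_def x_def)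
        finally show ?thesis .
      qed
      have 3: "pole_power i * of_int ((a i - a j) * (- a i + (\<Sum>l\<in>K. a l))) / pole_prod i {j} = c * ((x i - x j) * (- x i + q1))"
        by (simp add: c_def x_def q1_def)
      have F: "?F i j = (g - 1) / 2 * (- c / 4 * ((q1\<^sup>2 - q2) / 2) + - c / 12 * (q2 - 2 * x i * q1))
         + (g\<^sup>2 - 1) / 24 * (c * ((x i - x j) * (- x i + q1)))"
        unfolding Let_def K_def[symmetric] P pole_power_def[symmetric] 1 2 3 g_def[symmetric] ..
      show "(g - 1) / 24 * (- (4 * (pole_power i * x i ^ 2 / pole_prod i {j})) + 5 * e1 * (pole_power i * x i / pole_prod i {j}) - (e2 + e1\<^sup>2) * (pole_power i / pole_prod i {j}))
     + (g\<^sup>2 - 1) / 24 * (- (2 * (pole_power i * x i ^ 2 / pole_prod i {j})) + (2 * x j + e1) * (pole_power i * x i / pole_prod i {j}) - x j * e1 * (pole_power i / pole_prod i {j})) = ?F i j"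
      proof -
        have c: "pole_power i * x i ^ 2 / pole_prod i {j} = c * x i ^ 2" "pole_power i * x i / pole_prod i {j} = c * x i" "pole_power i / pole_prod i {j} = c"
          by (simp_all add: c_def)
        \<comment> \<open>The factor 12 turns the prefactor (g - 1) / 24 into the (g - 1) / 2 of the
          target.\<close>
        have "- (4 * (c * x i ^ 2)) + 5 * e1 * (c * x i) - (e2 + e1\<^sup>2) * c = 12 * (- c / 4 * ((q1\<^sup>2 - q2) / 2) + - c / 12 * (q2 - 2 * x i * q1))"
          unfolding e by (simp add: field_simps power2_eq_square)
        moreover have "- (2 * (c * x i ^ 2)) + (2 * x j + e1) * (c * x i) - x j * e1 * c = c * ((x i - x j) * (- x i + q1))"
          unfolding e by (simp add: algebra_simps power2_eq_square)
        ultimately show ?thesis unfolding F c by simp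
      qed
    qed
    finally show ?thesis .
  qed
  hence "(\<Sum>j=1..n. single_term j) = (\<Sum>j\<in>{1..n}. \<Sum>i | i \<in> {1..k} \<and> i \<noteq> j. ?F i j)" by (rule sum.cong[OF refl])
  also have "\<dots> = (\<Sum>i\<in>{1..k}. \<Sum>j | j \<in> {1..n} \<and> i \<noteq> j. ?F i j)" by (rule sum.swap_restrict) auto
  also have "\<dots> = (\<Sum>i\<in>{1..k}. \<Sum>j\<in>{1..n} - {i}. ?F i j)" by (intro sum.cong) auto
  finally show ?thesis .
qed

text \<open>At the pole of index i the combination \<open>J I 0 - c * J I 1\<close> contributes a
  multiple of c - a_i. For c = E1 this is the sum of the weights with index outside {i, j, l}, which
  is the inner sum over p; for c = a_j or a_l it gives the differences a_i - a_j and a_i - a_l,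
  after a change of sign.\<close>

lemma sum_pair_terms_simple:
  "(\<Sum>(j, l)\<in>index_pairs {1..n}. \<Sum>\<zeta> | \<zeta> ^ L = 1 \<and> nontrivial \<zeta> = {j, l}. cluster_term \<zeta>) =
    (\<Sum>i=1..k. \<Sum>(j, l)\<in>index_pairs ({1..n} - {i}).
        (\<Sum>\<zeta>\<in>zetas2 n a j l.
          1 / ((1 - \<zeta> powi a j) * (1 - \<zeta> powi a l)) *
          (\<Sum>p\<in>{1..n} - {i, j, l}.
            of_int (a i) powi (int n - 5) * of_int (a p)
            / (2 * of_int (\<Prod>q\<in>{1..n} - {i, j, l}. a i - a q))))
        + of_int (a i) powi (int n - 5) / of_int (\<Prod>p\<in>{1..n} - {i, j, l}. a i - a p) *
          (\<Sum>\<zeta>\<in>zetas2 n a j l.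
            \<zeta> powi a j * of_int (a i - a j) / ((1 - \<zeta> powi a j)^2 * (1 - \<zeta> powi a l))
            + \<zeta> powi a l * of_int (a i - a l) / ((1 - \<zeta> powi a j) * (1 - \<zeta> powi a l)^2)))"
    (is "_ = (\<Sum>i=1..k. \<Sum>(j, l)\<in>_. ?F i j l)")
proof -
  have main: "(\<Sum>\<zeta> | \<zeta> ^ L = 1 \<and> nontrivial \<zeta> = {j, l}. cluster_term \<zeta>) = (\<Sum>i | i \<in> {1..k} \<and> i \<notin> {j, l}. ?F i j l)"
    if jl: "(j, l) \<in> index_pairs {1..n}" for j l
  proof -
    have jl': "j \<noteq> l" "{j, l} \<subseteq> {1..n}" "card {j, l} = 2" using jl by (auto simp: index_pairs_def)
    define I where "I = {1..n} - {j, l}"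
    define x where "x i = complex_of_int (a i)" for i
    define u where "u \<zeta> = 1 / ((1 - \<zeta> powi a j) * (1 - \<zeta> powi a l))" for \<zeta> :: complex
    define v where "v \<zeta> = \<zeta> powi a j / ((1 - \<zeta> powi a j)^2 * (1 - \<zeta> powi a l))" for \<zeta> :: complex
    define w where "w \<zeta> = \<zeta> powi a l / ((1 - \<zeta> powi a j) * (1 - \<zeta> powi a l)^2)" for \<zeta> :: complex
    have J0: "J I 0 = - (\<Sum>i | i \<in> {1..k} \<and> i \<notin> {j, l}. pole_power i * x i / pole_prod i {j, l})"
      and J1: "J I 1 = - (\<Sum>i | i \<in> {1..k} \<and> i \<notin> {j, l}. pole_power i / pole_prod i {j, l})"
      using polar_integral_simple[OF jl'(2), of 0] polar_integral_simple[OF jl'(2), of 1] jl'(3)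
      by (simp_all only: I_def x_def) simp_all
    have F: "?F i j l = (\<Sum>\<zeta>\<in>zetas2 n a j l. u \<zeta> * ((esym1 a I - x i) * (pole_power i / pole_prod i {j, l}) / 2)
        + (v \<zeta> * ((x i - x j) * (pole_power i / pole_prod i {j, l})) + w \<zeta> * ((x i - x l) * (pole_power i / pole_prod i {j, l}))))"
      if i: "i \<in> {1..k}" "i \<notin> {j, l}" for i
    proof -
      define K where "K = {1..n} - {i, j, l}"
      define c where "c = pole_power i / pole_prod i {j, l}"
      have e: "esym1 a I - x i = p1 K"
        using esym_insert(1)[of i "{j, l}"] i k by (simp add: I_def x_def K_def)
      have P: "complex_of_int (\<Prod>q\<in>K. a i - a q) = pole_prod i {j, l}" by (simp add: pole_prod_def K_def)
      have 1: "(\<Sum>p\<in>K. pole_power i * of_int (a p) / (2 * pole_prod i {j, l})) = p1 K * c / 2"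
      proof -
        have "(\<Sum>p\<in>K. pole_power i * of_int (a p) / (2 * pole_prod i {j, l})) = (\<Sum>p\<in>K. of_int (a p) * (c / 2))"
          by (intro sum.cong) (simp_all add: c_def mult_ac)
        thus ?thesis by (simp add: sum_distrib_right)
      qed
      have 2: "\<zeta> powi a j * of_int (a i - a j) / ((1 - \<zeta> powi a j)^2 * (1 - \<zeta> powi a l))
            + \<zeta> powi a l * of_int (a i - a l) / ((1 - \<zeta> powi a j) * (1 - \<zeta> powi a l)^2)
          = v \<zeta> * (x i - x j) + w \<zeta> * (x i - x l)" for \<zeta>
        by (simp add: v_def w_def x_def)
      have "?F i j l = (\<Sum>\<zeta>\<in>zetas2 n a j l. u \<zeta> * (p1 K * c / 2)) + c * (\<Sum>\<zeta>\<in>zetas2 n a j l. v \<zeta> * (x i - x j) + w \<zeta> * (x i - x l))"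
        unfolding K_def[symmetric] P pole_power_def[symmetric] u_def[symmetric] 1 2 c_def[symmetric] ..
      also have "\<dots> = (\<Sum>\<zeta>\<in>zetas2 n a j l. u \<zeta> * (p1 K * c / 2) + (v \<zeta> * ((x i - x j) * c) + w \<zeta> * ((x i - x l) * c)))"
        unfolding sum_distrib_left sum.distrib[symmetric] by (intro sum.cong refl) (simp add: algebra_simps)
      finally show ?thesis unfolding e c_def .
    qed
    show ?thesis
    proof (cases "I = {}")
      case True
      have "cluster_term \<zeta> = 0" if "nontrivial \<zeta> = {j, l}" for \<zeta>
        using cluster_term_2[OF that jl'(1)] unfolding I_def[symmetric] True polar_integral_empty by simp
      moreover have "{i. i \<in> {1..k} \<and> i \<notin> {j, l}} \<subseteq> I" using k by (auto simp: I_def)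
      ultimately show ?thesis using True by (simp only: subset_empty sum.empty) simp
    next
      case False
      have "(\<Sum>\<zeta> | \<zeta> ^ L = 1 \<and> nontrivial \<zeta> = {j, l}. cluster_term \<zeta>) = (\<Sum>\<zeta>\<in>zetas2 n a j l. cluster_term \<zeta>)"
        using zetas2_eq[OF jl'(1)] False by (simp add: I_def)
      also have "\<dots> = (\<Sum>\<zeta>\<in>zetas2 n a j l. \<Sum>i | i \<in> {1..k} \<and> i \<notin> {j, l}. u \<zeta> * ((esym1 a I - x i) * (pole_power i / pole_prod i {j, l}) / 2)
        + (v \<zeta> * ((x i - x j) * (pole_power i / pole_prod i {j, l})) + w \<zeta> * ((x i - x l) * (pole_power i / pole_prod i {j, l}))))"
      proof (rule sum.cong[OF refl])
        fix \<zeta> assume "\<zeta> \<in> zetas2 n a j l"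
        hence nt: "nontrivial \<zeta> = {j, l}" using zetas2_eq[OF jl'(1)] False by (auto simp: I_def)
        have 1: "J I 0 - c * J I 1 = (\<Sum>i | i \<in> {1..k} \<and> i \<notin> {j, l}. (c - x i) * (pole_power i / pole_prod i {j, l}))" for c
          unfolding J0 J1 by (simp add: left_diff_distrib sum_subtractf diff_divide_distrib sum_distrib_left mult.commute)
        have 2: "(c - x i) * d = - ((x i - c) * d)" for c d i by (simp add: algebra_simps)
        show "cluster_term \<zeta> = (\<Sum>i | i \<in> {1..k} \<and> i \<notin> {j, l}. u \<zeta> * ((esym1 a I - x i) * (pole_power i / pole_prod i {j, l}) / 2)
        + (v \<zeta> * ((x i - x j) * (pole_power i / pole_prod i {j, l})) + w \<zeta> * ((x i - x l) * (pole_power i / pole_prod i {j, l}))))"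
          unfolding cluster_term_2[OF nt jl'(1)] I_def[symmetric] u_def[symmetric] v_def[symmetric] w_def[symmetric]
            x_def[symmetric] 1 unfolding 2[of "x j"] 2[of "x l"] sum_negf sum.distrib
          by (simp add: sum_distrib_left sum_divide_distrib)
      qed
      also have "\<dots> = (\<Sum>i | i \<in> {1..k} \<and> i \<notin> {j, l}. ?F i j l)"
        by (subst sum.swap) (intro sum.cong refl, use F in simp)
      finally show ?thesis .
    qed
  qed
  have "(\<Sum>(j, l)\<in>index_pairs {1..n}. \<Sum>\<zeta> | \<zeta> ^ L = 1 \<and> nontrivial \<zeta> = {j, l}. cluster_term \<zeta>)
     = (\<Sum>(j, l)\<in>index_pairs {1..n}. \<Sum>i | i \<in> {1..k} \<and> i \<notin> {j, l}. ?F i j l)"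
    by (rule sum.cong[OF refl]) (use main in auto)
  also have "\<dots> = (\<Sum>x\<in>index_pairs {1..n}. \<Sum>i | i \<in> {1..k} \<and> i \<notin> {fst x, snd x}. ?F i (fst x) (snd x))"
    by (simp only: case_prod_unfold)
  also have "\<dots> = (\<Sum>i\<in>{1..k}. \<Sum>x | x \<in> index_pairs {1..n} \<and> i \<notin> {fst x, snd x}. ?F i (fst x) (snd x))"
    by (rule sum.swap_restrict) (auto simp: finite_index_pairs)
  also have "\<dots> = (\<Sum>i\<in>{1..k}. \<Sum>(j, l)\<in>index_pairs ({1..n} - {i}). ?F i j l)"
    by (intro sum.cong refl) (auto simp: index_pairs_def)
  finally show ?thesis .
qed

text \<open>With three nontrivial indices only the leading coefficient of every factor enters; the
  minus sign is that of the residue of 1 / (1 - a_i y).\<close>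

lemma sum_triple_terms_simple:
  "(\<Sum>(j, l, p)\<in>index_triples {1..n}. \<Sum>\<zeta> | \<zeta> ^ L = 1 \<and> nontrivial \<zeta> = {j, l, p}. cluster_term \<zeta>) =
    (\<Sum>i=1..k. \<Sum>(j, l, p)\<in>index_triples ({1..n} - {i}). \<Sum>\<zeta>\<in>zetas3 n a j l p.
        - (of_int (a i) powi (int n - 5))
        / ((1 - \<zeta> powi a j) * (1 - \<zeta> powi a l) * (1 - \<zeta> powi a p) *
           of_int (\<Prod>q\<in>{1..n} - {i, j, l, p}. a i - a q)))"
    (is "_ = (\<Sum>i=1..k. \<Sum>(j, l, p)\<in>_. ?F i j l p)")
proof -
  have main: "(\<Sum>\<zeta> | \<zeta> ^ L = 1 \<and> nontrivial \<zeta> = {j, l, p}. cluster_term \<zeta>) = (\<Sum>i | i \<in> {1..k} \<and> i \<notin> {j, l, p}. ?F i j l p)"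
    if jlp: "(j, l, p) \<in> index_triples {1..n}" for j l p
  proof -
    have d: "j \<noteq> l" "j \<noteq> p" "l \<noteq> p" "{j, l, p} \<subseteq> {1..n}" "card {j, l, p} = 3" using jlp by (auto simp: index_triples_def)
    define I where "I = {1..n} - {j, l, p}"
    have J0: "J I 0 = - (\<Sum>i | i \<in> {1..k} \<and> i \<notin> {j, l, p}. pole_power i / pole_prod i {j, l, p})"
      using polar_integral_simple[OF d(4), of 0] d(5) by (simp only: I_def) simp
    show ?thesis
    proof (cases "I = {}")
      case True
      have "cluster_term \<zeta> = 0" if "nontrivial \<zeta> = {j, l, p}" for \<zeta>
        using cluster_term_3[OF that d(1-3)] unfolding I_def[symmetric] True polar_integral_empty by simp
      moreover have "{i. i \<in> {1..k} \<and> i \<notin> {j, l, p}} \<subseteq> I" using k by (auto simp: I_def)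
      ultimately show ?thesis using True by (simp only: subset_empty sum.empty) simp
    next
      case False
      have eq: "zetas3 n a j l p = {\<zeta>. \<zeta> ^ L = 1 \<and> nontrivial \<zeta> = {j, l, p}}"
        using zetas3_eq[OF d(1-3)] False by (simp add: I_def)
      have "(\<Sum>\<zeta> | \<zeta> ^ L = 1 \<and> nontrivial \<zeta> = {j, l, p}. cluster_term \<zeta>) = (\<Sum>\<zeta>\<in>zetas3 n a j l p. \<Sum>i | i \<in> {1..k} \<and> i \<notin> {j, l, p}.
          - pole_power i / ((1 - \<zeta> powi a j) * (1 - \<zeta> powi a l) * (1 - \<zeta> powi a p) * pole_prod i {j, l, p}))"
        unfolding eq
      proof (rule sum.cong[OF refl])
        fix \<zeta> assume "\<zeta> \<in> {\<zeta>. \<zeta> ^ L = 1 \<and> nontrivial \<zeta> = {j, l, p}}"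
        hence nt: "nontrivial \<zeta> = {j, l, p}" by simp
        show "cluster_term \<zeta> = (\<Sum>i | i \<in> {1..k} \<and> i \<notin> {j, l, p}.
          - pole_power i / ((1 - \<zeta> powi a j) * (1 - \<zeta> powi a l) * (1 - \<zeta> powi a p) * pole_prod i {j, l, p}))"
          unfolding cluster_term_3[OF nt d(1-3)] I_def[symmetric] J0 sum_negf[symmetric] sum_distrib_left by (simp add: mult.assoc)
      qed
      also have "\<dots> = (\<Sum>i | i \<in> {1..k} \<and> i \<notin> {j, l, p}. ?F i j l p)"
        by (subst sum.swap) (simp only: pole_power_def pole_prod_def)
      finally show ?thesis .
    qed
  qed
  have "(\<Sum>(j, l, p)\<in>index_triples {1..n}. \<Sum>\<zeta> | \<zeta> ^ L = 1 \<and> nontrivial \<zeta> = {j, l, p}. cluster_term \<zeta>)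
     = (\<Sum>(j, l, p)\<in>index_triples {1..n}. \<Sum>i | i \<in> {1..k} \<and> i \<notin> {j, l, p}. ?F i j l p)"
    by (rule sum.cong[OF refl]) (use main in auto)
  also have "\<dots> = (\<Sum>x\<in>index_triples {1..n}. \<Sum>i | i \<in> {1..k} \<and> i \<notin> {fst x, fst (snd x), snd (snd x)}. ?F i (fst x) (fst (snd x)) (snd (snd x)))"
    by (simp only: case_prod_unfold)
  also have "\<dots> = (\<Sum>i\<in>{1..k}. \<Sum>x | x \<in> index_triples {1..n} \<and> i \<notin> {fst x, fst (snd x), snd (snd x)}. ?F i (fst x) (fst (snd x)) (snd (snd x)))"
    by (rule sum.swap_restrict) (auto simp: finite_index_triples)
  also have "\<dots> = (\<Sum>i\<in>{1..k}. \<Sum>(j, l, p)\<in>index_triples ({1..n} - {i}). ?F i j l p)"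
    by (intro sum.cong refl) (auto simp: index_triples_def)
  finally show ?thesis .
qed

end

section \<open>The two formulas for the third Laurent coefficient\<close>

theorem theorem6p5:
  fixes n k :: nat and a :: "nat \<Rightarrow> int"
  assumes effective: "Gcd (a ` {1..n}) = 1"
    and k: "0 < k" "k < n"
    and neg: "\<And>i. 1 \<le> i \<Longrightarrow> i \<le> k \<Longrightarrow> a i < 0"
    and pos: "\<And>i. k < i \<Longrightarrow> i \<le> n \<Longrightarrow> a i > 0"
  shows "(gamma_coeff 3 n a =
      (let b = remove_entries n a {} in
        (- 6 * S_val (int n - 2) b + 8 * E1 b * S_val (int n - 3) b
          - (3 * E2 b + 2 * (E1 b)^2) * S_val (int n - 4) b
          + E1 b * E2 b * S_val (int n - 5) b) / (24 * D_val b))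
    + (\<Sum>j=1..n. let g = of_int (gcd_without n a {j}); b = remove_entries n a {j} in
        (1 - g) / 24 *
        ((4 * S_val (int n - 3) b - 5 * E1 b * S_val (int n - 4) b
          + (E2 b + (E1 b)^2) * S_val (int n - 5) b) / D_val b))
    + (\<Sum>j=1..n. let g = of_int (gcd_without n a {j}); b = remove_entries n a {j} in
        (g^2 - 1) / 24 *
        ((- 2 * S_val (int n - 3) b + (2 * of_int (a j) + E1 b) * S_val (int n - 4) b
          - of_int (a j) * E1 b * S_val (int n - 5) b) / D_val b))
    + (\<Sum>(j, l)\<in>index_pairs {1..n}. \<Sum>\<zeta>\<in>zetas2 n a j l.
        let b = remove_entries n a {j, l} in
        1 / ((1 - \<zeta> powi a j) * (1 - \<zeta> powi a l)) *
        ((E1 b * S_val (int n - 5) b - S_val (int n - 4) b) / (2 * D_val b)))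
    + (\<Sum>(j, l)\<in>index_pairs {1..n}. \<Sum>\<zeta>\<in>zetas2 n a j l.
        let b = remove_entries n a {j, l} in
        \<zeta> powi a j / ((1 - \<zeta> powi a j)^2 * (1 - \<zeta> powi a l)) *
          ((S_val (int n - 4) b - of_int (a j) * S_val (int n - 5) b) / D_val b)
        + \<zeta> powi a l / ((1 - \<zeta> powi a j) * (1 - \<zeta> powi a l)^2) *
          ((S_val (int n - 4) b - of_int (a l) * S_val (int n - 5) b) / D_val b))
    + (\<Sum>(j, l, p)\<in>index_triples {1..n}.
        let b = remove_entries n a {j, l, p} in
        - S_val (int n - 5) b / D_val b *
        (\<Sum>\<zeta>\<in>zetas3 n a j l p.
          1 / ((1 - \<zeta> powi a j) * (1 - \<zeta> powi a l) * (1 - \<zeta> powi a p)))))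
  \<and>
    ((\<forall>i\<in>{1..k}. \<forall>j\<in>{1..k}. i \<noteq> j \<longrightarrow> a i \<noteq> a j) \<longrightarrow>
    gamma_coeff 3 n a =
      (\<Sum>i=1..k.
        of_int (a i) powi (int n - 5) *
        of_int ((\<Sum>(j, l, p)\<in>index_triples ({1..n} - {i}). 3 * a j * a l * a p)
          + (\<Sum>j\<in>{1..n} - {i}. \<Sum>l\<in>{1..n} - {i, j}. a j * a l * (a l - 2 * a i))
          + (\<Sum>j\<in>{1..n} - {i}. a i * a j * (2 * a i - a j)))
        / (24 * of_int (\<Prod>q\<in>{1..n} - {i}. a i - a q)))
    + (\<Sum>i=1..k. \<Sum>j\<in>{1..n} - {i}. let g = of_int (gcd_without n a {j}) in
        (g - 1) / 2 *
          ((\<Sum>(l, p)\<in>index_pairs ({1..n} - {i, j}).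
              - (of_int (a i) powi (int n - 5)) * of_int (a l * a p)
              / (4 * of_int (\<Prod>q\<in>{1..n} - {i, j}. a i - a q)))
          + (\<Sum>l\<in>{1..n} - {i, j}.
              - (of_int (a i) powi (int n - 5)) * of_int (a l * (a l - 2 * a i))
              / (12 * of_int (\<Prod>p\<in>{1..n} - {i, j}. a i - a p))))
        + (g^2 - 1) / 24 *
          (of_int (a i) powi (int n - 5) *
           of_int ((a i - a j) * (- a i + (\<Sum>l\<in>{1..n} - {i, j}. a l)))
           / of_int (\<Prod>l\<in>{1..n} - {i, j}. a i - a l)))
    + (\<Sum>i=1..k. \<Sum>(j, l)\<in>index_pairs ({1..n} - {i}).
        (\<Sum>\<zeta>\<in>zetas2 n a j l.
          1 / ((1 - \<zeta> powi a j) * (1 - \<zeta> powi a l)) *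
          (\<Sum>p\<in>{1..n} - {i, j, l}.
            of_int (a i) powi (int n - 5) * of_int (a p)
            / (2 * of_int (\<Prod>q\<in>{1..n} - {i, j, l}. a i - a q))))
        + of_int (a i) powi (int n - 5) / of_int (\<Prod>p\<in>{1..n} - {i, j, l}. a i - a p) *
          (\<Sum>\<zeta>\<in>zetas2 n a j l.
            \<zeta> powi a j * of_int (a i - a j) / ((1 - \<zeta> powi a j)^2 * (1 - \<zeta> powi a l))
            + \<zeta> powi a l * of_int (a i - a l) / ((1 - \<zeta> powi a j) * (1 - \<zeta> powi a l)^2)))
    + (\<Sum>i=1..k. \<Sum>(j, l, p)\<in>index_triples ({1..n} - {i}). \<Sum>\<zeta>\<in>zetas3 n a j l p.
        - (of_int (a i) powi (int n - 5))
        / ((1 - \<zeta> powi a j) * (1 - \<zeta> powi a l) * (1 - \<zeta> powi a p) *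
           of_int (\<Prod>q\<in>{1..n} - {i, j, l, p}. a i - a q))))"
proof -
  \<comment> \<open>The additional 1 ensures A \<ge> 1, as \<open>cluster_radius\<close> requires;
    the sum bounds every single weight.\<close>
  define A :: real where "A = 1 + (\<Sum>i\<in>{1..n}. \<bar>of_int (a i)\<bar>)"
  have nz: "a i \<noteq> 0" if "i \<in> {1..n}" for i using neg[of i] pos[of i] that by (cases "i \<le> k") auto
  have A: "\<bar>real_of_int (a i)\<bar> \<le> A" if "i \<in> {1..n}" for i
    using member_le_sum[of i "{1..n}" "\<lambda>i. \<bar>real_of_int (a i)\<bar>"] that by (simp add: A_def)
  have "A \<ge> 1" by (simp add: A_def sum_nonneg)
  have sign: "a i < 0 \<longleftrightarrow> i \<le> k" if "i \<in> {1..n}" for i using neg[of i] pos[of i] that by (cases "i \<le> k") auto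
  interpret effective_weights n a A
  proof
    show "a i \<noteq> 0" if "i \<in> {1..n}" for i using nz that .
    show "real_of_int \<bar>a i\<bar> \<le> A" if "i \<in> {1..n}" for i using A[OF that] by simp
    show "A \<ge> 1" "Gcd (a ` {1..n}) = 1" by fact+
    show "n \<ge> 2" using k by simp
    show "\<exists>i\<in>{1..n}. a i < 0" using k neg[of 1] by (intro bexI[of _ 1]) auto
  qed
  have case_prod_sum: "(\<Sum>(j, l)\<in>X. f j l) + (\<Sum>(j, l)\<in>X. g j l) = (\<Sum>(j, l)\<in>X. f j l + g j l :: complex)" for f g and X :: "(nat \<times> nat) set"
    by (simp add: sum.distrib case_prod_unfold)
  show ?thesis
  proof (intro conjI impI, goal_cases)
    case 1
    have single: "(\<Sum>j=1..n. single_term j) = (\<Sum>j=1..n. let g = of_int (gcd_without n a {j}); b = remove_entries n a {j} in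
        (1 - g) / 24 *
        ((4 * S_val (int n - 3) b - 5 * E1 b * S_val (int n - 4) b
          + (E2 b + (E1 b)^2) * S_val (int n - 5) b) / D_val b))
    + (\<Sum>j=1..n. let g = of_int (gcd_without n a {j}); b = remove_entries n a {j} in
        (g^2 - 1) / 24 *
        ((- 2 * S_val (int n - 3) b + (2 * of_int (a j) + E1 b) * S_val (int n - 4) b
          - of_int (a j) * E1 b * S_val (int n - 5) b) / D_val b))"
      unfolding Let_def sum.distrib[symmetric] by (rule sum.cong[OF refl single_term_S])
    have pair: "(\<Sum>(j, l)\<in>index_pairs {1..n}. \<Sum>\<zeta> | \<zeta> ^ L = 1 \<and> nontrivial \<zeta> = {j, l}. cluster_term \<zeta>) =
      (\<Sum>(j, l)\<in>index_pairs {1..n}. \<Sum>\<zeta>\<in>zetas2 n a j l.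
        let b = remove_entries n a {j, l} in
        1 / ((1 - \<zeta> powi a j) * (1 - \<zeta> powi a l)) *
        ((E1 b * S_val (int n - 5) b - S_val (int n - 4) b) / (2 * D_val b)))
    + (\<Sum>(j, l)\<in>index_pairs {1..n}. \<Sum>\<zeta>\<in>zetas2 n a j l.
        let b = remove_entries n a {j, l} in
        \<zeta> powi a j / ((1 - \<zeta> powi a j)^2 * (1 - \<zeta> powi a l)) *
          ((S_val (int n - 4) b - of_int (a j) * S_val (int n - 5) b) / D_val b)
        + \<zeta> powi a l / ((1 - \<zeta> powi a j) * (1 - \<zeta> powi a l)^2) *
          ((S_val (int n - 4) b - of_int (a l) * S_val (int n - 5) b) / D_val b))"
      unfolding case_prod_sum Let_def by (rule sum.cong[OF refl], clarify) (rule pair_term_S)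
    have triple: "(\<Sum>(j, l, p)\<in>index_triples {1..n}. \<Sum>\<zeta> | \<zeta> ^ L = 1 \<and> nontrivial \<zeta> = {j, l, p}. cluster_term \<zeta>) =
      (\<Sum>(j, l, p)\<in>index_triples {1..n}.
        let b = remove_entries n a {j, l, p} in
        - S_val (int n - 5) b / D_val b *
        (\<Sum>\<zeta>\<in>zetas3 n a j l p.
          1 / ((1 - \<zeta> powi a j) * (1 - \<zeta> powi a l) * (1 - \<zeta> powi a p))))"
      unfolding Let_def by (rule sum.cong[OF refl], clarify) (rule triple_term_S)
    show ?case
      unfolding gamma3_polar cluster_term_1_S single pair triple by (simp only: Let_def add.assoc)
  next
    case 2
    interpret simple_negative_weights n a A k
      by unfold_locales (use k sign 2 in auto)
    show ?case
      unfolding gamma3_polar cluster_term_1_simple sum_single_term_simple sum_pair_terms_simple sum_triple_terms_simple ..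
  qed
qed

end
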